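(* Let $X$ be a $0$-definable (in a structure $M$) approximate subring of a ring and let $\bar R:=\langle \bar X\rangle$. If $\bar R$ is definable, then for an arbitrary small $A\subseteq\mathfrak C$, $$(\bar R,+)^{00}_A+\bar R\cdot(\bar R,+)^{00}_A=\bar R^{000}_A=\bar R^{00}_A.$$
   Context: Rings need not be commutative or unital. For subsets $B,C$ of a ring, $B+C=\{b+c\}$ and $B\cdot C=BC=\{bc\}$ (the set of products, not of sums of products). A subset $X$ of a ring is additively symmetric if $0\in X$ and $-X=X$. $\langle X\rangle$ is the subring generated by $X$. An approximate subring is an additively symmetric subset $X$ of a ring such that $XX\cup(X+X)\subseteq F+X$ for some finite $F\subseteq\langle X\rangle$. Put $X_0:=X$ and $X_{n+1}:=X_nX_n+(X_n+X_n)$; then $\langle X\rangle=\bigcup_n X_n$. $X$ is $0$-definable in a first-order structure $M$ (in a language $\mathcal L$) if all $X_n$, and the restrictions of $+$ and $\cdot$ to each $X_n\times X_n$, are definable in $M$ without parameters. $\mathfrak C\succ M$ is a monster model: $\kappa$-saturated and strongly $\kappa$-homogeneous for a strong limit cardinal $\kappa>|\mathcal L|+|M|$, where $|\mathcal L|$ is the cardinality of the set of formulas. "Small" and "bounded" mean of cardinality $<\kappa$. $\bar X$, $\bar X_n$ are the interpretations of $X$, $X_n$ in $\mathfrak C$, and $\bar R:=\langle\bar X\rangle=\bigcup_n\bar X_n$ is the ring generated by $\bar X$ (with operations interpreted in $\mathfrak C$). By saturation, $\bar R$ is definable in $\mathfrak C$ if and only if $\bar R=\bar X_m$ for some $m$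 (in particular, taking $X=R$, this covers every $0$-definable ring). A set is $A$-type-definable if it is the set of realizations in $\mathfrak C$ of a set of formulas over $A$; it is $A$-invariant if it is invariant under $\mathrm{Aut}(\mathfrak C/A)$. $(\bar R,+)^{00}_A$ is the smallest $A$-type-definable subgroup of $(\bar R,+)$ of bounded index (it is known to exist). $\bar R^{00}_A$ is the smallest $A$-type-definable two-sided ideal of $\bar R$ of bounded index. $\bar R^{000}_A$ is the smallest $A$-invariant two-sided ideal of $\bar R$ of bounded index. *)

theory Defs
  imports "HOL-Algebra.AbelCoset"
begin

unbundle cardinal_syntax

text \<open>The symbols of a language are sets inside the types \<open>'f\<close> and \<open>'r\<close>, so that languages
  without function symbols or without relation symbols are covered. Constants are function symbols
  of arity 0.\<close>

record ('f, 'r) lang =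
  funs :: "'f set"
  rels :: "'r set"
  farity :: "'f \<Rightarrow> nat"
  rarity :: "'r \<Rightarrow> nat"

datatype 'f tm = Var nat | Fn 'f "'f tm list"

datatype ('f, 'r) fm =
    FEq "'f tm" "'f tm"
  | FRel 'r "'f tm list"
  | FNeg "('f, 'r) fm"
  | FAnd "('f, 'r) fm" "('f, 'r) fm"
  | FEx nat "('f, 'r) fm"

fun wf_tm :: "('f, 'r) lang \<Rightarrow> 'f tm \<Rightarrow> bool" where
  "wf_tm L (Var i) \<longleftrightarrow> True"
| "wf_tm L (Fn f ts) \<longleftrightarrow> f \<in> funs L \<and> length ts = farity L f \<and> (\<forall>t\<in>set ts. wf_tm L t)"

fun wf_fm :: "('f, 'r) lang \<Rightarrow> ('f, 'r) fm \<Rightarrow> bool" where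
  "wf_fm L (FEq t u) \<longleftrightarrow> wf_tm L t \<and> wf_tm L u"
| "wf_fm L (FRel r ts) \<longleftrightarrow> r \<in> rels L \<and> length ts = rarity L r \<and> (\<forall>t\<in>set ts. wf_tm L t)"
| "wf_fm L (FNeg \<phi>) \<longleftrightarrow> wf_fm L \<phi>"
| "wf_fm L (FAnd \<phi> \<psi>) \<longleftrightarrow> wf_fm L \<phi> \<and> wf_fm L \<psi>"
| "wf_fm L (FEx i \<phi>) \<longleftrightarrow> wf_fm L \<phi>"

fun fv_tm :: "'f tm \<Rightarrow> nat set" where
  "fv_tm (Var i) = {i}"
| "fv_tm (Fn f ts) = (\<Union>t\<in>set ts. fv_tm t)"

fun fv_fm :: "('f, 'r) fm \<Rightarrow> nat set" where
  "fv_fm (FEq t u) = fv_tm t \<union> fv_tm u"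
| "fv_fm (FRel r ts) = (\<Union>t\<in>set ts. fv_tm t)"
| "fv_fm (FNeg \<phi>) = fv_fm \<phi>"
| "fv_fm (FAnd \<phi> \<psi>) = fv_fm \<phi> \<union> fv_fm \<psi>"
| "fv_fm (FEx i \<phi>) = fv_fm \<phi> - {i}"

definition formulas :: "('f, 'r) lang \<Rightarrow> ('f, 'r) fm set" where
  "formulas L = {\<phi>. wf_fm L \<phi>}"

definition formulas_in :: "('f, 'r) lang \<Rightarrow> nat \<Rightarrow> ('f, 'r) fm set" where
  "formulas_in L n = {\<phi> \<in> formulas L. fv_fm \<phi> \<subseteq> {..<n}}"

record ('a, 'f, 'r) struct =
  univ :: "'a set"
  fint :: "'f \<Rightarrow> 'a list \<Rightarrow> 'a"
  rint :: "'r \<Rightarrow> 'a list \<Rightarrow> bool"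

definition tuples :: "nat \<Rightarrow> 'a set \<Rightarrow> 'a list set" where
  "tuples n U = {xs. length xs = n \<and> set xs \<subseteq> U}"

definition is_struct :: "('f, 'r) lang \<Rightarrow> ('a, 'f, 'r) struct \<Rightarrow> bool" where
  "is_struct L M \<longleftrightarrow> univ M \<noteq> {} \<and>
     (\<forall>f\<in>funs L. \<forall>xs\<in>tuples (farity L f) (univ M). fint M f xs \<in> univ M)"

fun eval_tm :: "('a, 'f, 'r) struct \<Rightarrow> (nat \<Rightarrow> 'a) \<Rightarrow> 'f tm \<Rightarrow> 'a" where
  "eval_tm M s (Var i) = s i"
| "eval_tm M s (Fn f ts) = fint M f (map (eval_tm M s) ts)"

fun sat :: "('a, 'f, 'r) struct \<Rightarrow> (nat \<Rightarrow> 'a) \<Rightarrow> ('f, 'r) fm \<Rightarrow> bool" where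
  "sat M s (FEq t u) \<longleftrightarrow> eval_tm M s t = eval_tm M s u"
| "sat M s (FRel r ts) \<longleftrightarrow> rint M r (map (eval_tm M s) ts)"
| "sat M s (FNeg \<phi>) \<longleftrightarrow> \<not> sat M s \<phi>"
| "sat M s (FAnd \<phi> \<psi>) \<longleftrightarrow> sat M s \<phi> \<and> sat M s \<psi>"
| "sat M s (FEx i \<phi>) \<longleftrightarrow> (\<exists>a\<in>univ M. sat M (s(i := a)) \<phi>)"

text \<open>The tuple \<open>xs\<close> is assigned to the variables \<open>0, \<dots>, length xs - 1\<close>; this is only used for
  formulas with no other free variables, so the values of \<open>xs ! i\<close> for larger \<open>i\<close> are
  irrelevant.\<close>

definition holds :: "('a, 'f, 'r) struct \<Rightarrow> ('f, 'r) fm \<Rightarrow> 'a list \<Rightarrow> bool" where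
  "holds M \<phi> xs \<longleftrightarrow> sat M (\<lambda>i. xs ! i) \<phi>"

definition elementary_ext ::
  "('f, 'r) lang \<Rightarrow> ('a, 'f, 'r) struct \<Rightarrow> ('a, 'f, 'r) struct \<Rightarrow> bool" where
  "elementary_ext L M C \<longleftrightarrow> is_struct L M \<and> is_struct L C \<and> univ M \<subseteq> univ C \<and>
     (\<forall>n. \<forall>\<phi>\<in>formulas_in L n. \<forall>xs\<in>tuples n (univ M). holds M \<phi> xs \<longleftrightarrow> holds C \<phi> xs)"

text \<open>A formula over \<open>A\<close> in \<open>n\<close> variables is a pair \<open>(\<phi>, bs)\<close>, where \<open>bs\<close> is a list of parameters
  from \<open>A\<close> to be substituted for the variables \<open>n, \<dots>, n + length bs - 1\<close> of \<open>\<phi>\<close>.\<close>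

definition formulas_over :: "('f, 'r) lang \<Rightarrow> 'a set \<Rightarrow> nat \<Rightarrow> (('f, 'r) fm \<times> 'a list) set" where
  "formulas_over L A n = {(\<phi>, bs). set bs \<subseteq> A \<and> \<phi> \<in> formulas_in L (n + length bs)}"

definition realizations ::
  "('a, 'f, 'r) struct \<Rightarrow> nat \<Rightarrow> (('f, 'r) fm \<times> 'a list) set \<Rightarrow> 'a list set" where
  "realizations C n p = {xs \<in> tuples n (univ C). \<forall>(\<phi>, bs)\<in>p. holds C \<phi> (xs @ bs)}"

definition type_definable ::
  "('f, 'r) lang \<Rightarrow> ('a, 'f, 'r) struct \<Rightarrow> 'a set \<Rightarrow> nat \<Rightarrow> 'a list set \<Rightarrow> bool" where
  "type_definable L C A n D \<longleftrightarrow> (\<exists>p \<subseteq> formulas_over L A n. D = realizations C n p)"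

definition definable ::
  "('f, 'r) lang \<Rightarrow> ('a, 'f, 'r) struct \<Rightarrow> 'a set \<Rightarrow> nat \<Rightarrow> 'a list set \<Rightarrow> bool" where
  "definable L C A n D \<longleftrightarrow> (\<exists>\<theta> \<in> formulas_over L A n. D = realizations C n {\<theta>})"

definition automorphism :: "('f, 'r) lang \<Rightarrow> ('a, 'f, 'r) struct \<Rightarrow> ('a \<Rightarrow> 'a) \<Rightarrow> bool" where
  "automorphism L C \<sigma> \<longleftrightarrow> bij_betw \<sigma> (univ C) (univ C) \<and>
     (\<forall>f\<in>funs L. \<forall>xs\<in>tuples (farity L f) (univ C). \<sigma> (fint C f xs) = fint C f (map \<sigma> xs)) \<and>
     (\<forall>r\<in>rels L. \<forall>xs\<in>tuples (rarity L r) (univ C). rint C r xs \<longleftrightarrow> rint C r (map \<sigma> xs))"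

definition invariant ::
  "('f, 'r) lang \<Rightarrow> ('a, 'f, 'r) struct \<Rightarrow> 'a set \<Rightarrow> nat \<Rightarrow> 'a list set \<Rightarrow> bool" where
  "invariant L C A n D \<longleftrightarrow> D \<subseteq> tuples n (univ C) \<and>
     (\<forall>\<sigma>. automorphism L C \<sigma> \<and> (\<forall>a\<in>A. \<sigma> a = a) \<longrightarrow> map \<sigma> ` D = D)"

text \<open>Every cardinal below \<open>|Field \<kappa>|\<close> is the cardinality of a subset of \<open>Field \<kappa>\<close>.\<close>

definition strong_limit :: "'k rel \<Rightarrow> bool" where
  "strong_limit \<kappa> \<longleftrightarrow> Card_order \<kappa> \<and> infinite (Field \<kappa>) \<and>
     (\<forall>B \<subseteq> Field \<kappa>. |B| <o \<kappa> \<longrightarrow> |Pow B| <o \<kappa>)"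

definition saturated :: "('f, 'r) lang \<Rightarrow> 'k rel \<Rightarrow> ('a, 'f, 'r) struct \<Rightarrow> bool" where
  "saturated L \<kappa> C \<longleftrightarrow>
     (\<forall>A n p. A \<subseteq> univ C \<and> |A| <o \<kappa> \<and> p \<subseteq> formulas_over L A n \<and>
        (\<forall>q \<subseteq> p. finite q \<longrightarrow> realizations C n q \<noteq> {}) \<longrightarrow> realizations C n p \<noteq> {})"

definition elementary_map ::
  "('f, 'r) lang \<Rightarrow> ('a, 'f, 'r) struct \<Rightarrow> 'a set \<Rightarrow> ('a \<Rightarrow> 'a) \<Rightarrow> bool" where
  "elementary_map L C A f \<longleftrightarrow> f ` A \<subseteq> univ C \<and>
     (\<forall>n. \<forall>\<phi>\<in>formulas_in L n. \<forall>xs\<in>tuples n A. holds C \<phi> xs \<longleftrightarrow> holds C \<phi> (map f xs))"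

definition strongly_homogeneous :: "('f, 'r) lang \<Rightarrow> 'k rel \<Rightarrow> ('a, 'f, 'r) struct \<Rightarrow> bool" where
  "strongly_homogeneous L \<kappa> C \<longleftrightarrow>
     (\<forall>A f. A \<subseteq> univ C \<and> |A| <o \<kappa> \<and> elementary_map L C A f \<longrightarrow>
        (\<exists>\<sigma>. automorphism L C \<sigma> \<and> (\<forall>a\<in>A. \<sigma> a = f a)))"

definition monster_model ::
  "('f, 'r) lang \<Rightarrow> 'k rel \<Rightarrow> ('a, 'f, 'r) struct \<Rightarrow> ('a, 'f, 'r) struct \<Rightarrow> bool" where
  "monster_model L \<kappa> M C \<longleftrightarrow> elementary_ext L M C \<and>
     strong_limit \<kappa> \<and> |formulas L| +c |univ M| <o \<kappa> \<and>
     saturated L \<kappa> C \<and> strongly_homogeneous L \<kappa> C"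

text \<open>Rings that need not be commutative or unital. They are represented by the record type of
  HOL-Algebra, whose field \<open>one\<close> is ignored.\<close>

locale rng = abelian_group R for R (structure) +
  assumes rng_m_closed: "\<lbrakk>x \<in> carrier R; y \<in> carrier R\<rbrakk> \<Longrightarrow> x \<otimes> y \<in> carrier R"
    and rng_m_assoc: "\<lbrakk>x \<in> carrier R; y \<in> carrier R; z \<in> carrier R\<rbrakk>
      \<Longrightarrow> (x \<otimes> y) \<otimes> z = x \<otimes> (y \<otimes> z)"
    and rng_l_distr: "\<lbrakk>x \<in> carrier R; y \<in> carrier R; z \<in> carrier R\<rbrakk>
      \<Longrightarrow> (x \<oplus> y) \<otimes> z = x \<otimes> z \<oplus> y \<otimes> z"
    and rng_r_distr: "\<lbrakk>x \<in> carrier R; y \<in> carrier R; z \<in> carrier R\<rbrakk>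
      \<Longrightarrow> z \<otimes> (x \<oplus> y) = z \<otimes> x \<oplus> z \<otimes> y"

definition subrng :: "'b set \<Rightarrow> ('b, 'm) ring_scheme \<Rightarrow> bool" where
  "subrng B R \<longleftrightarrow> additive_subgroup B R \<and> B <#>\<^bsub>R\<^esub> B \<subseteq> B"

definition generated_subrng :: "('b, 'm) ring_scheme \<Rightarrow> 'b set \<Rightarrow> 'b set" where
  "generated_subrng R X = \<Inter>{B. subrng B R \<and> X \<subseteq> B}"

definition two_sided_ideal :: "'b set \<Rightarrow> ('b, 'm) ring_scheme \<Rightarrow> bool" where
  "two_sided_ideal I R \<longleftrightarrow> additive_subgroup I R \<and>
     carrier R <#>\<^bsub>R\<^esub> I \<subseteq> I \<and> I <#>\<^bsub>R\<^esub> carrier R \<subseteq> I"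

definition approximate_subring :: "('b, 'm) ring_scheme \<Rightarrow> 'b set \<Rightarrow> bool" where
  "approximate_subring R X \<longleftrightarrow> X \<subseteq> carrier R \<and> \<zero>\<^bsub>R\<^esub> \<in> X \<and> (\<lambda>x. \<ominus>\<^bsub>R\<^esub> x) ` X = X \<and>
     (\<exists>F. finite F \<and> F \<subseteq> generated_subrng R X \<and>
        (X <#>\<^bsub>R\<^esub> X) \<union> (X <+>\<^bsub>R\<^esub> X) \<subseteq> F <+>\<^bsub>R\<^esub> X)"

primrec stage :: "('b, 'm) ring_scheme \<Rightarrow> 'b set \<Rightarrow> nat \<Rightarrow> 'b set" where
  "stage R X 0 = X"
| "stage R X (Suc n) =
     (stage R X n <#>\<^bsub>R\<^esub> stage R X n) <+>\<^bsub>R\<^esub> (stage R X n <+>\<^bsub>R\<^esub> stage R X n)"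

text \<open>As for every definable set, the elements of \<open>X\<close> (and of all \<open>stage R X n\<close>) are \<open>k\<close>-tuples of
  elements of \<open>M\<close> for some \<open>k\<close>. A triple of \<open>k\<close>-tuples is the \<open>3 * k\<close>-tuple obtained by
  concatenation, and an operation is identified with its graph.\<close>

definition graph_on :: "('b list \<Rightarrow> 'b list \<Rightarrow> 'b list) \<Rightarrow> 'b list set \<Rightarrow> 'b list set" where
  "graph_on op Y = {x @ y @ op x y | x y. x \<in> Y \<and> y \<in> Y}"

definition zero_definable ::
  "('f, 'r) lang \<Rightarrow> ('a, 'f, 'r) struct \<Rightarrow> nat \<Rightarrow> 'a list ring \<Rightarrow> 'a list set \<Rightarrow> bool" where
  "zero_definable L M k R X \<longleftrightarrow> (\<forall>n.
     definable L M {} k (stage R X n) \<and>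
     definable L M {} (3 * k) (graph_on (add R) (stage R X n)) \<and>
     definable L M {} (3 * k) (graph_on (mult R) (stage R X n)))"

text \<open>The set \<open>\<phi>(C)\<close> for any parameter-free formula \<open>\<phi>\<close> with \<open>\<phi>(M) = D\<close>. If \<open>C\<close> is an elementary
  extension of \<open>M\<close> then it does not depend on \<open>\<phi>\<close>, so the existential quantifier is harmless.\<close>

definition interpretation_in :: "('f, 'r) lang \<Rightarrow> ('a, 'f, 'r) struct \<Rightarrow> ('a, 'f, 'r) struct
    \<Rightarrow> nat \<Rightarrow> 'a list set \<Rightarrow> 'a list set" where
  "interpretation_in L M C n D =
     {xs. \<exists>\<phi>\<in>formulas_in L n. realizations M n {(\<phi>, [])} = D \<and> xs \<in> realizations C n {(\<phi>, [])}}"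

text \<open>The union of the interpretations of the sets \<open>stage R X n\<close>, with the operations whose graphs
  are the unions of the interpretations of the graphs of the restricted operations. The zero of the
  given ring lies in \<open>X\<close>, hence in \<open>M\<close>, and by elementarity it is also the zero here.\<close>

definition Rbar :: "('f, 'r) lang \<Rightarrow> ('a, 'f, 'r) struct \<Rightarrow> ('a, 'f, 'r) struct
    \<Rightarrow> nat \<Rightarrow> 'a list ring \<Rightarrow> 'a list set \<Rightarrow> 'a list ring" where
  "Rbar L M C k R X =
     \<lparr>carrier = (\<Union>n. interpretation_in L M C k (stage R X n)),
      mult = (\<lambda>x y. THE z. \<exists>n. x @ y @ z \<in>
        interpretation_in L M C (3 * k) (graph_on (mult R) (stage R X n))),
      one = undefined,
      zero = \<zero>\<^bsub>R\<^esub>,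
      add = (\<lambda>x y. THE z. \<exists>n. x @ y @ z \<in>
        interpretation_in L M C (3 * k) (graph_on (add R) (stage R X n)))\<rparr>"

definition bounded_index :: "'k rel \<Rightarrow> ('b, 'm) ring_scheme \<Rightarrow> 'b set \<Rightarrow> bool" where
  "bounded_index \<kappa> R H \<longleftrightarrow> |a_rcosets\<^bsub>R\<^esub> H| <o \<kappa>"

definition smallest :: "('b set \<Rightarrow> bool) \<Rightarrow> 'b set \<Rightarrow> bool" where
  "smallest P H \<longleftrightarrow> P H \<and> (\<forall>K. P K \<longrightarrow> H \<subseteq> K)"

text \<open>\<open>is_add_00 L \<kappa> C k R A H\<close> reads \<open>H = (R, +)\<^sup>0\<^sup>0\<^sub>A\<close>, and similarly below. The components are
  given by predicates, so that using one of them always asserts that the smallest set exists.\<close>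

definition is_add_00 :: "('f, 'r) lang \<Rightarrow> 'k rel \<Rightarrow> ('a, 'f, 'r) struct \<Rightarrow> nat \<Rightarrow> 'a list ring
    \<Rightarrow> 'a set \<Rightarrow> 'a list set \<Rightarrow> bool" where
  "is_add_00 L \<kappa> C k R A = smallest (\<lambda>H. additive_subgroup H R \<and>
     type_definable L C A k H \<and> bounded_index \<kappa> R H)"

definition is_ring_00 :: "('f, 'r) lang \<Rightarrow> 'k rel \<Rightarrow> ('a, 'f, 'r) struct \<Rightarrow> nat \<Rightarrow> 'a list ring
    \<Rightarrow> 'a set \<Rightarrow> 'a list set \<Rightarrow> bool" where
  "is_ring_00 L \<kappa> C k R A = smallest (\<lambda>I. two_sided_ideal I R \<and>
     type_definable L C A k I \<and> bounded_index \<kappa> R I)"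

definition is_ring_000 :: "('f, 'r) lang \<Rightarrow> 'k rel \<Rightarrow> ('a, 'f, 'r) struct \<Rightarrow> nat \<Rightarrow> 'a list ring
    \<Rightarrow> 'a set \<Rightarrow> 'a list set \<Rightarrow> bool" where
  "is_ring_000 L \<kappa> C k R A = smallest (\<lambda>I. two_sided_ideal I R \<and>
     invariant L C A k I \<and> bounded_index \<kappa> R I)"

end

theory Submission
  imports Defs "HOL-Library.Ramsey" "HOL-Analysis.Function_Topology"
begin

text \<open>Write \<open>G\<close> for \<open>(R, +)\<^sup>0\<^sup>0\<^sub>A\<close>. Two facts carry the proof.

First, \<open>G\<close> is contained in every \<open>A\<close>-invariant subgroup \<open>I\<close> of bounded index, although such an \<open>I\<close>
need not be type-definable (\<open>G00_subset_invariant\<close>). Call a definable set thick if every finite set of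
some fixed size contains two distinct points whose differences lie in it; these are the definable sets
that cannot be avoided by the differences of an unboundedly long sequence. Every element outside \<open>I\<close>
is omitted by a thick set definable over \<open>A\<close>. Since \<open>(R, +)\<close> is abelian, it has an invariant mean, and
the argument of Sanders and of Massicot and Wagner puts inside \<open>4 D\<close>, for \<open>D\<close> thick, the first set of
a descending chain of thick sets, each of which contains the sum of the next one with itself. The
intersection of such a chain is a type-definable subgroup of bounded index. It is defined over
parameters outside \<open>A\<close>, and the remaining problem is to descend to \<open>A\<close>: a translate of the chain under
an automorphism is added to it so that the new chain has only boundedly many conjugates up to
refinement, and then its intersection contains \<open>G\<close>. The automorphism is found with saturation and a
form of Neumann's lemma on coverings of a group by cosets. Hence \<open>G \<subseteq> 8 D\<close> for all thick \<open>A\<close>-definable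
\<open>D\<close>, and saturation gives \<open>G \<subseteq> I\<close>.

Secondly, \<open>G + R \<cdot> G\<close>, where \<open>R \<cdot> G\<close> is only the set of products, is already a two-sided ideal
(\<open>J00_ideal\<close>). For a type-definable subgroup \<open>H \<supseteq> G\<close> the set of all \<open>g\<close> with \<open>R g \<subseteq> H\<close> is a subgroup; if it
has bounded index then it contains \<open>G\<close>. If it has unbounded index then it is avoided by most elements
of \<open>G\<close>, and by saturation and the covering lemma one \<open>g \<in> G\<close> avoids all these subgroups
simultaneously. For this \<open>g\<close> the subgroup \<open>H = G + R g\<close> satisfies \<open>R G \<subseteq> H\<close>, so that \<open>G + R \<cdot> G = G + R g\<close> is
a subgroup. It is type-definable over \<open>A\<close>, of bounded index, and an ideal. An \<open>A\<close>-invariant ideal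
of bounded index contains \<open>G\<close> by the first fact, hence contains \<open>G + R \<cdot> G\<close>. So this set is the smallest
ideal of both kinds.

Both facts are proved in an abstract locale, in which definability is a family of predicates closed
under the first-order operations and the monster model enters only through saturation, homogeneity
and a group of automorphisms. The last parts derive these axioms from the model theory: the ring axioms
are transferred from \<open>M\<close> to \<open>C\<close>, and saturation makes the carrier equal to one stage.\<close>

section \<open>Small sets\<close>

lemma card_less_Field_subset:
  assumes "Card_order \<kappa>" "|X| <o \<kappa>"
  obtains B where "B \<subseteq> Field \<kappa>" "|X| =o |B|"
proof -
  have "|X| \<le>o |Field \<kappa>|"
    using assms card_of_Field_ordIso ordIso_symmetric ordLess_imp_ordLeq ordLeq_ordIso_trans by metis
  then obtain f where "inj_on f X" "f ` X \<subseteq> Field \<kappa>"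
    using card_of_ordLeq by metis
  then show ?thesis using that[of "f ` X"]
    by (meson card_of_ordIso bij_betw_def)
qed

lemma small_Pow:
  assumes "strong_limit \<kappa>" "|X| <o \<kappa>"
  shows "|Pow X| <o \<kappa>"
proof -
  obtain B where B: "B \<subseteq> Field \<kappa>" "|X| =o |B|"
    using card_less_Field_subset assms strong_limit_def by metis
  then have "|B| <o \<kappa>" using assms(2) ordIso_symmetric ordIso_ordLess_trans by blast
  then have "|Pow B| <o \<kappa>" using B(1) assms(1) by (auto simp: strong_limit_def)
  moreover have "|Pow X| =o |Pow B|"
    using B(2) by (meson bij_betw_Pow card_of_ordIso)
  ultimately show ?thesis using ordIso_ordLess_trans by blast
qed

lemma small_subset: "|Y| <o \<kappa> \<Longrightarrow> X \<subseteq> Y \<Longrightarrow> |X| <o \<kappa>"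
  using card_of_mono1 ordLeq_ordLess_trans by blast

lemma small_image: "|X| <o \<kappa> \<Longrightarrow> |f ` X| <o \<kappa>"
  using card_of_image ordLeq_ordLess_trans by blast

lemma small_inj: "|Y| <o \<kappa> \<Longrightarrow> inj_on f X \<Longrightarrow> f ` X \<subseteq> Y \<Longrightarrow> |X| <o \<kappa>"
  using card_of_ordLeq ordLeq_ordLess_trans by metis

lemma small_Plus:
  assumes "strong_limit \<kappa>" "|X| <o \<kappa>" "|Y| <o \<kappa>"
  shows "|X <+> Y| <o \<kappa>"
  using assms card_of_Plus_ordLess_infinite_Field strong_limit_def by metis

lemma small_Un:
  assumes "strong_limit \<kappa>" "|X| <o \<kappa>" "|Y| <o \<kappa>"
  shows "|X \<union> Y| <o \<kappa>"
  using assms card_of_Un_ordLess_infinite_Field strong_limit_def by metis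

lemma small_Times:
  assumes "strong_limit \<kappa>" "|X| <o \<kappa>" "|Y| <o \<kappa>"
  shows "|X \<times> Y| <o \<kappa>"
proof (rule small_inj)
  show "|Pow (X <+> Y)| <o \<kappa>" using small_Pow small_Plus assms by metis
  show "inj_on (\<lambda>(x, y). {Inl x, Inr y}) (X \<times> Y)" by (auto simp: inj_on_def doubleton_eq_iff)
qed auto

lemma small_UNION_uniform:
  assumes "strong_limit \<kappa>" "|X| <o \<kappa>" "|Y| <o \<kappa>" "\<And>i. i \<in> X \<Longrightarrow> Z i \<subseteq> f i ` Y"
  shows "|\<Union>i\<in>X. Z i| <o \<kappa>"
proof (rule small_subset)
  show "|(\<lambda>(i, j). f i j) ` (X \<times> Y)| <o \<kappa>" using small_image small_Times assms by metis
qed (use assms(4) in force)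

lemma small_finite:
  assumes "strong_limit \<kappa>" "finite X"
  shows "|X| <o \<kappa>"
proof -
  have "natLeq \<le>o |Field \<kappa>|"
    using assms(1) infinite_iff_natLeq_ordLeq by (auto simp: strong_limit_def)
  moreover have "|Field \<kappa>| =o \<kappa>" using assms(1) card_of_Field_ordIso by (auto simp: strong_limit_def)
  ultimately have "natLeq \<le>o \<kappa>" by (rule ordLeq_ordIso_trans)
  moreover have "|X| <o natLeq" using assms(2) finite_iff_ordLess_natLeq by auto
  ultimately show ?thesis using ordLess_ordLeq_trans by blast
qed

lemma small_lists:
  assumes "strong_limit \<kappa>" "|UNIV :: nat set| <o \<kappa>" "|X| <o \<kappa>"
  shows "|lists X| <o \<kappa>"
proof (rule small_inj)
  show "|Pow ((UNIV :: nat set) \<times> X)| <o \<kappa>" using small_Pow small_Times assms by metis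
  show "inj_on (\<lambda>xs. set (List.enumerate 0 xs)) (lists X)"
  proof (rule inj_onI)
    fix xs ys assume *: "set (List.enumerate 0 xs) = set (List.enumerate 0 ys)"
    have "length xs = length ys"
      using arg_cong[OF *, of card] by (simp add: distinct_card)
    moreover have "xs ! i = ys ! i" if "i < length xs" for i
    proof -
      have "(i, xs ! i) \<in> set (List.enumerate 0 xs)" using that by (simp add: in_set_enumerate_eq)
      then have "(i, xs ! i) \<in> set (List.enumerate 0 ys)" by (simp add: *)
      then show ?thesis by (simp add: in_set_enumerate_eq)
    qed
    ultimately show "xs = ys" by (simp add: list_eq_iff_nth_eq)
  qed
qed (auto simp: in_set_enumerate_eq in_lists_conv_set)

section \<open>First-order definability over a ring\<close>

context rng
begin

lemma r_null_rng [simp]: assumes "x \<in> carrier R" shows "x \<otimes> \<zero> = \<zero>"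
proof -
  have "x \<otimes> \<zero> \<oplus> x \<otimes> \<zero> = x \<otimes> \<zero>"
    using rng_r_distr[OF zero_closed zero_closed assms] by simp
  then show ?thesis using assms rng_m_closed[OF assms zero_closed] add.l_cancel_one' by simp
qed

lemma l_null_rng [simp]: assumes "x \<in> carrier R" shows "\<zero> \<otimes> x = \<zero>"
proof -
  have "\<zero> \<otimes> x \<oplus> \<zero> \<otimes> x = \<zero> \<otimes> x"
    using rng_l_distr[OF zero_closed zero_closed assms] by simp
  then show ?thesis using assms rng_m_closed[OF zero_closed assms] add.l_cancel_one' by simp
qed

lemma l_minus_rng:
  assumes "x \<in> carrier R" "y \<in> carrier R" shows "(\<ominus> x) \<otimes> y = \<ominus> (x \<otimes> y)"
proof -
  have "(\<ominus> x) \<otimes> y \<oplus> x \<otimes> y = \<zero>"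
    using rng_l_distr[of "\<ominus> x" x y] assms by (simp add: l_neg)
  then show ?thesis using assms rng_m_closed minus_equality[of "(\<ominus> x) \<otimes> y" "x \<otimes> y"] by simp
qed

lemma r_minus_rng:
  assumes "x \<in> carrier R" "y \<in> carrier R" shows "x \<otimes> (\<ominus> y) = \<ominus> (x \<otimes> y)"
proof -
  have "x \<otimes> (\<ominus> y) \<oplus> x \<otimes> y = \<zero>"
    using rng_r_distr[of "\<ominus> y" y x] assms by (simp add: l_neg)
  then show ?thesis using assms rng_m_closed minus_equality[of "x \<otimes> (\<ominus> y)" "x \<otimes> y"] by simp
qed

end

text \<open>A predicate on assignments of ring elements to variables stands for a formula. The two instances of
interest are formulas with arbitrary parameters and formulas with parameters in \<open>A\<close>. The quantifier
binds variable 0 and shifts the other variables, as with de Bruijn indices.\<close>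

locale definability = rng R for R :: "('b, 'm) ring_scheme" (structure) +
  fixes fo :: "((nat \<Rightarrow> 'b) \<Rightarrow> bool) \<Rightarrow> bool"
  assumes fo_cong: "\<And>P Q. fo P \<Longrightarrow> (\<And>e. (\<And>i. e i \<in> carrier R) \<Longrightarrow> P e \<longleftrightarrow> Q e) \<Longrightarrow> fo Q"
    and fo_not: "\<And>P. fo P \<Longrightarrow> fo (\<lambda>e. \<not> P e)"
    and fo_conj: "\<And>P Q. fo P \<Longrightarrow> fo Q \<Longrightarrow> fo (\<lambda>e. P e \<and> Q e)"
    and fo_ex_case: "\<And>P. fo P \<Longrightarrow> fo (\<lambda>e. \<exists>y\<in>carrier R. P (case_nat y e))"
    and fo_subst: "\<And>P h. fo P \<Longrightarrow> fo (\<lambda>e. P (\<lambda>i. e (h i)))"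
    and fo_eq: "\<And>i j. fo (\<lambda>e. e i = e j)"
    and fo_add: "\<And>i j l. fo (\<lambda>e. e i \<oplus> e j = e l)"
    and fo_mult: "\<And>i j l. fo (\<lambda>e. e i \<otimes> e j = e l)"
begin

declare rng_m_closed [simp]

lemma cancel1: assumes "x \<in> carrier R" "a \<in> carrier R" shows "x \<oplus> (a \<oplus> \<ominus> x) = a"
  using assms a_lcomm[of x a "\<ominus> x"] by (simp add: r_neg)
lemma cancel2: assumes "x \<in> carrier R" "a \<in> carrier R" "b \<in> carrier R"
  shows "x \<oplus> (a \<oplus> (\<ominus> x \<oplus> b)) = a \<oplus> b"
  using assms a_lcomm[of x a "\<ominus> x \<oplus> b"] by (simp add: r_neg2)
lemma cancel3: "\<lbrakk>x \<in> carrier R; a \<in> carrier R; b \<in> carrier R\<rbrakk> \<Longrightarrow> x \<oplus> (a \<oplus> (b \<oplus> \<ominus> x)) = a \<oplus> b"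
  using cancel1[of x "a \<oplus> b"] by (simp add: a_assoc)
lemma cancel4: "\<lbrakk>x \<in> carrier R; a \<in> carrier R; b \<in> carrier R; c \<in> carrier R\<rbrakk>
    \<Longrightarrow> x \<oplus> (a \<oplus> (b \<oplus> (\<ominus> x \<oplus> c))) = a \<oplus> (b \<oplus> c)"
  using cancel2[of x "a \<oplus> b" c] by (simp add: a_assoc)
lemma cancel5: "\<lbrakk>x \<in> carrier R; a \<in> carrier R; b \<in> carrier R; c \<in> carrier R\<rbrakk>
    \<Longrightarrow> x \<oplus> (a \<oplus> (b \<oplus> (c \<oplus> \<ominus> x))) = a \<oplus> (b \<oplus> c)"
  using cancel3[of x "a \<oplus> b" c] by (simp add: a_assoc)
lemma cancel6: "\<lbrakk>x \<in> carrier R; a \<in> carrier R; b \<in> carrier R; c \<in> carrier R; d \<in> carrier R\<rbrakk>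
    \<Longrightarrow> x \<oplus> (a \<oplus> (b \<oplus> (c \<oplus> (\<ominus> x \<oplus> d)))) = a \<oplus> (b \<oplus> (c \<oplus> d))"
  using cancel4[of x "a \<oplus> b" c d] by (simp add: a_assoc)

lemmas group_simps = a_minus_def a_assoc a_comm a_lcomm minus_add r_neg l_neg r_neg1 r_neg2
  cancel1 cancel2 cancel3 cancel4 cancel5 cancel6

lemma minus_minus_eq: "\<lbrakk>x \<in> carrier R; y \<in> carrier R\<rbrakk> \<Longrightarrow> \<ominus> (x \<ominus> y) = y \<ominus> x"
  by (simp add: group_simps)

lemma add_eq_iff_eq_minus:
  assumes "x \<in> carrier R" "y \<in> carrier R" "z \<in> carrier R"
  shows "x \<oplus> y = z \<longleftrightarrow> x = z \<ominus> y"
proof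
  assume "x \<oplus> y = z"
  then have "z = x \<oplus> y" by simp
  then show "x = z \<ominus> y" using assms by (simp add: group_simps)
next
  assume "x = z \<ominus> y"
  then show "x \<oplus> y = z" using assms by (simp add: group_simps)
qed

lemma fo_cong': "fo P \<Longrightarrow> (\<And>e. (\<And>i. e i \<in> carrier R) \<Longrightarrow> P e = Q e) \<Longrightarrow> fo Q"
  using fo_cong by blast

lemma fo_bex:
  assumes "fo (\<lambda>e. Q (e 0) (\<lambda>i. e (Suc i)))"
  shows "fo (\<lambda>e. \<exists>y\<in>carrier R. Q y e)"
  using fo_ex_case[OF assms] by simp

lemma fo_ball:
  assumes "fo (\<lambda>e. Q (e 0) (\<lambda>i. e (Suc i)))"
  shows "fo (\<lambda>e. \<forall>y\<in>carrier R. Q y e)"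
  using fo_not[OF fo_bex[of "\<lambda>y e. \<not> Q y e", OF fo_not[OF assms]]] by simp

lemma fo_disj: "fo P \<Longrightarrow> fo Q \<Longrightarrow> fo (\<lambda>e. P e \<or> Q e)"
  using fo_not[OF fo_conj[OF fo_not[of P] fo_not[of Q]]] by simp

lemma fo_imp: "fo P \<Longrightarrow> fo Q \<Longrightarrow> fo (\<lambda>e. P e \<longrightarrow> Q e)"
  using fo_disj[OF fo_not[of P], of Q] by simp

lemma fo_True: "fo (\<lambda>e. True)"
  using fo_eq[of 0 0] by simp

definition dset :: "'b set \<Rightarrow> bool" where
  "dset D \<longleftrightarrow> D \<subseteq> carrier R \<and> fo (\<lambda>e. e 0 \<in> D)"

text \<open>Terms, characterized by the definability of their graph; variable 0 carries the value.\<close>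

definition fot :: "((nat \<Rightarrow> 'b) \<Rightarrow> 'b) \<Rightarrow> bool" where
  "fot t \<longleftrightarrow> (\<forall>e. (\<forall>i. e i \<in> carrier R) \<longrightarrow> t e \<in> carrier R) \<and> fo (\<lambda>e. e 0 = t (\<lambda>i. e (Suc i)))"

lemma fot_closed: "fot t \<Longrightarrow> (\<And>i. e i \<in> carrier R) \<Longrightarrow> t e \<in> carrier R"
  by (simp add: fot_def)

lemma fo_term:
  assumes "fot t" "fo (\<lambda>e. Q (e 0) (\<lambda>i. e (Suc i)))"
  shows "fo (\<lambda>e. Q (t e) e)"
proof -
  have "fo (\<lambda>e. e 0 = t (\<lambda>i. e (Suc i)))" using assms(1) by (simp add: fot_def)
  then have "fo (\<lambda>e. \<exists>y\<in>carrier R. y = t e \<and> Q y e)"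
    by (intro fo_bex fo_conj assms(2))
  then show ?thesis
    by (rule fo_cong') (use fot_closed[OF assms(1)] in auto)
qed

lemma fot_shift:
  assumes "fot t" shows "fot (\<lambda>e. t (\<lambda>i. e (h i)))"
proof -
  have "fo (\<lambda>e. e 0 = t (\<lambda>i. e (Suc i)))" using assms by (simp add: fot_def)
  from fo_subst[OF this, of "\<lambda>i. case i of 0 \<Rightarrow> 0 | Suc i \<Rightarrow> Suc (h i)"]
  have "fo (\<lambda>e. e 0 = t (\<lambda>i. e (Suc (h i))))" by simp
  then show ?thesis using assms by (simp add: fot_def)
qed

lemma fot_var: "fot (\<lambda>e. e i)"
  using fo_eq[of 0 "Suc i"] by (simp add: fot_def)

lemma fo_mem: "dset D \<Longrightarrow> fot t \<Longrightarrow> fo (\<lambda>e. t e \<in> D)"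
  by (rule fo_term[of t "\<lambda>y e. y \<in> D"]) (simp_all add: dset_def)

lemma fot_op:
  assumes "fot t" "fot u" "fo (\<lambda>e. e 2 = f (e 1) (e 0))"
    "\<And>x y. x \<in> carrier R \<Longrightarrow> y \<in> carrier R \<Longrightarrow> f x y \<in> carrier R"
  shows "fot (\<lambda>e. f (t e) (u e))"
proof -
  have 1: "fo (\<lambda>e. e (Suc (Suc 0)) = f (e (Suc 0)) (e 0))"
    using assms(3) by (simp add: numeral_2_eq_2)
  have 2: "fo (\<lambda>e. e (Suc 0) = f (e 0) (u (\<lambda>i. e (Suc (Suc i)))))"
    by (rule fo_term[of "\<lambda>e. u (\<lambda>i. e (Suc (Suc i)))" "\<lambda>y e. e (Suc 0) = f (e 0) y"])
      (use 1 fot_shift[OF assms(2)] in auto)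
  have "fo (\<lambda>e. e 0 = f (t (\<lambda>i. e (Suc i))) (u (\<lambda>i. e (Suc i))))"
    by (rule fo_term[of "\<lambda>e. t (\<lambda>i. e (Suc i))" "\<lambda>y e. e 0 = f y (u (\<lambda>i. e (Suc i)))"])
      (use 2 fot_shift[OF assms(1)] in auto)
  then show ?thesis using assms by (auto simp: fot_def)
qed

lemma fot_add: "fot t \<Longrightarrow> fot u \<Longrightarrow> fot (\<lambda>e. t e \<oplus> u e)"
  by (rule fot_op[of t u "\<lambda>x y. x \<oplus> y"]) (simp_all add: fo_cong'[OF fo_add[of 1 0 2]] eq_commute[of "_ \<oplus> _"])

lemma fot_mult: "fot t \<Longrightarrow> fot u \<Longrightarrow> fot (\<lambda>e. t e \<otimes> u e)"
  by (rule fot_op[of t u "\<lambda>x y. x \<otimes> y"]) (simp_all add: fo_cong'[OF fo_mult[of 1 0 2]] eq_commute[of "_ \<otimes> _"])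

lemma fot_diff:
  assumes "fot t" "fot u" shows "fot (\<lambda>e. t e \<ominus> u e)"
proof (rule fot_op[of t u "\<lambda>x y. x \<ominus> y"])
  show "fo (\<lambda>e. e 2 = e 1 \<ominus> e 0)"
  proof (rule fo_cong'[OF fo_add[of 2 0 1]])
    fix e :: "nat \<Rightarrow> 'b" assume "\<And>i. e i \<in> carrier R"
    then show "(e 2 \<oplus> e 0 = e 1) = (e 2 = e 1 \<ominus> e 0)"
      using add_eq_iff_eq_minus[of "e 2" "e 0" "e 1"] by simp
  qed
qed (use assms in auto)

lemma fot_zero: "fot (\<lambda>e. \<zero>)"
  unfolding fot_def by (intro conjI fo_cong'[OF fo_add[of 0 0 0]]) auto

lemma fot_cong:
  assumes "fot t" "\<And>e. (\<And>i. e i \<in> carrier R) \<Longrightarrow> t e = u e"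
  shows "fot u"
  unfolding fot_def
proof (intro conjI allI impI)
  show "fo (\<lambda>e. e 0 = u (\<lambda>i. e (Suc i)))"
    by (rule fo_cong'[of "\<lambda>e. e 0 = t (\<lambda>i. e (Suc i))"]) (use assms in \<open>auto simp: fot_def\<close>)
qed (use assms in \<open>auto simp: fot_def\<close>)

lemma fot_minus:
  assumes "fot t" shows "fot (\<lambda>e. \<ominus> t e)"
  by (rule fot_cong[OF fot_diff[OF fot_zero assms]]) (use fot_closed[OF assms] in \<open>simp add: a_minus_def\<close>)

lemma fo_eqt: "fot t \<Longrightarrow> fot u \<Longrightarrow> fo (\<lambda>e. t e = u e)"
  by (rule fo_term[of t "\<lambda>y e. y = u e"]) (auto simp: fot_def)

lemma fo_bex_dset:
  assumes "dset D" "fo (\<lambda>e. Q (e 0) (\<lambda>i. e (Suc i)))"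
  shows "fo (\<lambda>e. \<exists>y\<in>D. Q y e)"
proof -
  have "fo (\<lambda>e. \<exists>y\<in>carrier R. y \<in> D \<and> Q y e)"
    by (intro fo_bex fo_conj fo_mem fot_var assms)
  then show ?thesis by (rule fo_cong') (use assms(1) in \<open>auto simp: dset_def\<close>)
qed

lemma fo_finite_ball: "finite I \<Longrightarrow> (\<And>i. i \<in> I \<Longrightarrow> fo (P i)) \<Longrightarrow> fo (\<lambda>e. \<forall>i\<in>I. P i e)"
proof (induction I rule: finite_induct)
  case empty then show ?case by (simp add: fo_True)
next
  case (insert x F)
  then have "fo (\<lambda>e. P x e \<and> (\<forall>i\<in>F. P i e))" by (intro fo_conj) simp_all
  then show ?case by simp
qed

lemmas fo_intros = fo_not fo_conj fo_disj fo_imp fo_bex_dset fo_bex fo_ball fo_mem fo_eqt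
  fot_add fot_mult fot_diff fot_minus fot_zero fot_var

lemma dsetI: "D \<subseteq> carrier R \<Longrightarrow> fo (\<lambda>e. e 0 \<in> D) \<Longrightarrow> dset D"
  by (simp add: dset_def)

lemma dset_sub: "dset D \<Longrightarrow> D \<subseteq> carrier R"
  by (simp add: dset_def)

lemma dset_Collect:
  assumes "fo (\<lambda>e. P (e 0))" shows "dset {x\<in>carrier R. P x}"
proof (rule dsetI)
  show "fo (\<lambda>e. e 0 \<in> {x\<in>carrier R. P x})" by (rule fo_cong'[OF assms]) simp
qed auto

lemma dset_carrier: "dset (carrier R)"
  using dset_Collect[of "\<lambda>_. True"] fo_True by simp

lemma dset_zero: "dset {\<zero>}"
proof -
  have "dset {x\<in>carrier R. x = \<zero>}" by (intro dset_Collect fo_intros)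
  moreover have "{x\<in>carrier R. x = \<zero>} = {\<zero>}" by auto
  ultimately show ?thesis by simp
qed

lemma dset_Int: "dset D \<Longrightarrow> dset E \<Longrightarrow> dset (D \<inter> E)"
  by (auto simp: dset_def intro: fo_conj)

lemma dset_Diff: "dset D \<Longrightarrow> dset E \<Longrightarrow> dset (D - E)"
  by (auto simp: dset_def intro: fo_conj fo_not)

lemma dset_Un: "dset D \<Longrightarrow> dset E \<Longrightarrow> dset (D \<union> E)"
  by (auto simp: dset_def intro: fo_disj)

lemma dset_finite_Int: "finite F \<Longrightarrow> (\<And>D. D \<in> F \<Longrightarrow> dset D) \<Longrightarrow> dset (carrier R \<inter> \<Inter>F)"
proof (induction F rule: finite_induct)
  case empty then show ?case by (simp add: dset_carrier)
next
  case (insert D F)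
  have "dset D" "dset (carrier R \<inter> \<Inter>F)" using insert.prems insert.IH by blast+
  then have "dset (D \<inter> (carrier R \<inter> \<Inter>F))" by (rule dset_Int)
  moreover have "carrier R \<inter> \<Inter>(insert D F) = D \<inter> (carrier R \<inter> \<Inter>F)" by auto
  ultimately show ?case by simp
qed

definition neg :: "'b set \<Rightarrow> 'b set" where
  "neg D = {x\<in>carrier R. \<ominus> x \<in> D}"

lemma dset_neg: "dset D \<Longrightarrow> dset (neg D)"
  unfolding neg_def by (intro dset_Collect fo_intros)

definition sumset :: "'b set \<Rightarrow> 'b set \<Rightarrow> 'b set" (infixl "\<boxplus>" 65) where
  "D \<boxplus> E = {x \<oplus> y | x y. x \<in> D \<and> y \<in> E}"

lemma sumset_alt: "D \<subseteq> carrier R \<Longrightarrow> E \<subseteq> carrier R \<Longrightarrow>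
  D \<boxplus> E = {z\<in>carrier R. \<exists>x\<in>D. \<exists>y\<in>E. z = x \<oplus> y}"
  by (auto simp: sumset_def)

lemma dset_sumset: "dset D \<Longrightarrow> dset E \<Longrightarrow> dset (D \<boxplus> E)"
  using dset_sub[of D] dset_sub[of E]
  by (simp add: sumset_alt) (intro dset_Collect fo_intros; assumption)

end

section \<open>Thick sets\<close>

context definability
begin

text \<open>No two points of \<open>Y\<close> have both differences in \<open>D\<close>; both are required because \<open>D\<close> is not assumed to
be symmetric.\<close>

definition sep :: "'b set \<Rightarrow> 'b set \<Rightarrow> bool" where
  "sep D Y \<longleftrightarrow> (\<forall>x\<in>Y. \<forall>y\<in>Y. x \<noteq> y \<longrightarrow> \<not> (x \<ominus> y \<in> D \<and> y \<ominus> x \<in> D))"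

definition nthick :: "nat \<Rightarrow> 'b set \<Rightarrow> bool" where
  "nthick n D \<longleftrightarrow> (\<forall>Y. Y \<subseteq> carrier R \<and> finite Y \<and> card Y = n \<longrightarrow> \<not> sep D Y)"

definition thick :: "'b set \<Rightarrow> bool" where
  "thick D \<longleftrightarrow> (\<exists>n. nthick n D)"

lemma sep_insert:
  "sep D (insert x Y) \<longleftrightarrow> (\<forall>y\<in>Y. x \<noteq> y \<longrightarrow> \<not> (x \<ominus> y \<in> D \<and> y \<ominus> x \<in> D)) \<and> sep D Y"
proof -
  have "sep D Z \<longleftrightarrow> pairwise (\<lambda>x y. \<not> (x \<ominus> y \<in> D \<and> y \<ominus> x \<in> D)) Z" for Z
    by (simp add: sep_def pairwise_def)
  then show ?thesis by (simp only: pairwise_insert) metis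
qed

lemma sep_subset: "sep D Y \<Longrightarrow> Z \<subseteq> Y \<Longrightarrow> sep D Z"
  unfolding sep_def by blast

lemma sep_antimono: "sep E Y \<Longrightarrow> D \<subseteq> E \<Longrightarrow> sep D Y"
  unfolding sep_def by blast

lemma nthick_card_less:
  assumes "nthick n D" "Y \<subseteq> carrier R" "finite Y" "sep D Y"
  shows "card Y < n"
proof (rule ccontr)
  assume "\<not> card Y < n"
  then obtain Z where "Z \<subseteq> Y" "card Z = n" "finite Z"
    using obtain_subset_with_card_n by (metis leI)
  then show False using assms sep_subset[of D Y Z] unfolding nthick_def by blast
qed

lemma thick_mono:
  assumes "thick D" "D \<subseteq> E" shows "thick E"
proof -
  obtain n where "nthick n D" using assms(1) by (auto simp: thick_def)
  then have "nthick n E" unfolding nthick_def using sep_antimono[OF _ assms(2)] by blast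
  then show ?thesis by (auto simp: thick_def)
qed

lemma thick_carrier: "thick (carrier R)"
proof -
  have "\<not> sep (carrier R) Y" if Y: "Y \<subseteq> carrier R" "card Y = 2" for Y
  proof -
    obtain x y where "Y = {x, y}" "x \<noteq> y" using Y(2) by (auto simp: card_2_iff)
    then show ?thesis using Y(1) by (auto simp: sep_def)
  qed
  then have "nthick 2 (carrier R)" by (auto simp: nthick_def)
  then show ?thesis by (auto simp: thick_def)
qed

text \<open>Ramsey's theorem: colour the pairs of a long sequence by whether their differences lie in \<open>D\<close>. A
large set homogeneous for the wrong colour contradicts thickness of \<open>D\<close>, so there is a large set all of
whose differences are in \<open>D\<close>, and thickness of \<open>E\<close> applies to it.\<close>

lemma thick_Int:
  assumes "thick D" "thick E" shows "thick (D \<inter> E)"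
proof -
  obtain m n where mn: "nthick m D" "nthick n E" using assms by (auto simp: thick_def)
  obtain r :: nat where r: "\<forall>(V::'b set) (E::'b set set). finite V \<and> card V \<ge> r \<longrightarrow>
    (\<exists>R \<subseteq> V. card R = m \<and> clique R E \<or> card R = n \<and> Ramsey.indep R E)"
    using ramsey2[of m n] by blast
  have "\<not> sep (D \<inter> E) Y" if Y: "Y \<subseteq> carrier R" "finite Y" "card Y = r" for Y
  proof
    assume *: "sep (D \<inter> E) Y"
    define Ed where "Ed = {{x, y} | x y. \<not> (x \<ominus> y \<in> D \<and> y \<ominus> x \<in> D)}"
    obtain Z where Z: "Z \<subseteq> Y" "card Z = m \<and> clique Z Ed \<or> card Z = n \<and> Ramsey.indep Z Ed"
      using r[rule_format, of Y Ed] Y by auto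
    have fin: "finite Z" using Z Y finite_subset by blast
    from Z(2) show False
    proof
      assume Zm: "card Z = m \<and> clique Z Ed"
      have "sep D Z" unfolding sep_def
      proof (intro ballI impI)
        fix x y assume "x \<in> Z" "y \<in> Z" "x \<noteq> y"
        then have "{x, y} \<in> Ed" using Zm unfolding clique_def by blast
        then show "\<not> (x \<ominus> y \<in> D \<and> y \<ominus> x \<in> D)" unfolding Ed_def by (auto simp: doubleton_eq_iff)
      qed
      then show False using mn(1) Zm Z(1) Y(1) fin unfolding nthick_def by blast
    next
      assume Zn: "card Z = n \<and> Ramsey.indep Z Ed"
      have "x \<ominus> y \<in> D \<and> y \<ominus> x \<in> D" if "x \<in> Z" "y \<in> Z" "x \<noteq> y" for x y
        using Zn that unfolding indep_def Ed_def by blast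
      then have "sep E Z" using * Z(1) unfolding sep_def by blast
      then show False using mn(2) Zn Z(1) Y(1) fin unfolding nthick_def by blast
    qed
  qed
  then show ?thesis unfolding thick_def nthick_def by blast
qed

lemma thick_finite_Int: "finite F \<Longrightarrow> (\<And>D. D \<in> F \<Longrightarrow> thick D) \<Longrightarrow> thick (carrier R \<inter> \<Inter>F)"
proof (induction F rule: finite_induct)
  case empty then show ?case by (simp add: thick_carrier)
next
  case (insert D F)
  have "thick D" "thick (carrier R \<inter> \<Inter>F)" using insert.prems insert.IH by blast+
  then have "thick (D \<inter> (carrier R \<inter> \<Inter>F))" by (rule thick_Int)
  moreover have "carrier R \<inter> \<Inter>(insert D F) = D \<inter> (carrier R \<inter> \<Inter>F)" by auto
  ultimately show ?case by simp
qed

text \<open>A maximal finite separated set exists because separated sets have bounded size, and maximality says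
that its translates of \<open>D\<close> cover.\<close>

lemma thick_cover:
  assumes "thick D" "\<zero> \<in> D"
  obtains Y where "Y \<subseteq> carrier R" "finite Y" "\<And>x. x \<in> carrier R \<Longrightarrow> \<exists>y\<in>Y. x \<ominus> y \<in> D"
proof -
  obtain n where n: "nthick n D" using assms by (auto simp: thick_def)
  define P where "P Y \<longleftrightarrow> Y \<subseteq> carrier R \<and> finite Y \<and> sep D Y" for Y
  have "P {}" by (simp add: P_def sep_def)
  moreover have "\<And>Z. P Z \<Longrightarrow> card Z < n" using nthick_card_less[OF n] by (auto simp: P_def)
  ultimately have "\<exists>Y. P Y \<and> (\<forall>Z. P Z \<longrightarrow> card Z \<le> card Y)"
    using Lattices_Big.ex_has_greatest_nat[of P "{}" card n] by blast
  then obtain Y where Y: "P Y" "\<And>Z. P Z \<Longrightarrow> card Z \<le> card Y" by blast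
  have "\<exists>y\<in>Y. x \<ominus> y \<in> D" if x: "x \<in> carrier R" for x
  proof (cases "x \<in> Y")
    case True
    then show ?thesis using assms(2) x by (metis a_minus_def r_neg)
  next
    case False
    then have "\<not> P (insert x Y)" using Y by (metis P_def card_insert_disjoint not_less_eq_eq order_refl)
    then show ?thesis using Y(1) x unfolding P_def sep_def by auto
  qed
  then show ?thesis using that Y(1) P_def by blast
qed

text \<open>Quantifying over finite separated sets of a given size is first-order.\<close>

lemma fo_sep_list:
  assumes "fo (\<lambda>e. e 0 \<in> D (\<lambda>i. e (Suc i)))" "\<forall>t\<in>set ts. fot t"
  shows "fo (\<lambda>e. distinct (map (\<lambda>t. t e) ts) \<and> sep (D e) (set (map (\<lambda>t. t e) ts)))"
proof -
  have *: "fo (\<lambda>e. t e \<noteq> u e \<and> \<not> (t e \<ominus> u e \<in> D e \<and> u e \<ominus> t e \<in> D e))" if "fot t" "fot u" for t u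
  proof -
    have "fo (\<lambda>e. t e \<ominus> u e \<in> D e)"
      by (rule fo_term[of "\<lambda>e. t e \<ominus> u e" "\<lambda>y e. y \<in> D e", OF fot_diff assms(1)]) (use that in auto)
    moreover have "fo (\<lambda>e. u e \<ominus> t e \<in> D e)"
      by (rule fo_term[of "\<lambda>e. u e \<ominus> t e" "\<lambda>y e. y \<in> D e", OF fot_diff assms(1)]) (use that in auto)
    ultimately
    show ?thesis using that by (intro fo_conj fo_not fo_eqt)
  qed
  from assms(2) show ?thesis
  proof (induction ts)
    case Nil
    then show ?case by (simp add: sep_def fo_True)
  next
    case (Cons t ts)
    have "fo (\<lambda>e. (\<forall>u\<in>set ts. t e \<noteq> u e \<and> \<not> (t e \<ominus> u e \<in> D e \<and> u e \<ominus> t e \<in> D e)) \<and>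
       (distinct (map (\<lambda>t. t e) ts) \<and> sep (D e) (set (map (\<lambda>t. t e) ts))))"
    proof (rule fo_conj[OF fo_finite_ball])
      show "fo (\<lambda>e. t e \<noteq> u e \<and> \<not> (t e \<ominus> u e \<in> D e \<and> u e \<ominus> t e \<in> D e))" if "u \<in> set ts" for u
        by (rule *) (use that Cons.prems in auto)
      show "fo (\<lambda>e. distinct (map (\<lambda>t. t e) ts) \<and> sep (D e) (set (map (\<lambda>t. t e) ts)))"
        using Cons by simp
    qed simp
    moreover have "((\<forall>u\<in>set ts. t e \<noteq> u e \<and> \<not> (t e \<ominus> u e \<in> D e \<and> u e \<ominus> t e \<in> D e)) \<and>
       (distinct (map (\<lambda>t. t e) ts) \<and> sep (D e) (set (map (\<lambda>t. t e) ts)))) \<longleftrightarrow>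
       distinct (map (\<lambda>t. t e) (t # ts)) \<and> sep (D e) (set (map (\<lambda>t. t e) (t # ts)))" for e
      by (simp only: list.map distinct.simps list.set sep_insert set_map ball_simps) blast
    ultimately show ?case by (simp only:)
  qed
qed

lemma fo_sep_extend:
  assumes "fo (\<lambda>e. e 0 \<in> D (\<lambda>i. e (Suc i)))" "\<forall>t\<in>set ts. fot t"
  shows "fo (\<lambda>e. \<exists>ys. length ys = n \<and> set ys \<subseteq> carrier R \<and>
    distinct (ys @ map (\<lambda>t. t e) ts) \<and> sep (D e) (set (ys @ map (\<lambda>t. t e) ts)))"
  using assms
proof (induction n arbitrary: D ts)
  case 0
  have eq: "(\<exists>ys. length ys = 0 \<and> set ys \<subseteq> carrier R \<and>
    distinct (ys @ map (\<lambda>t. t e) ts) \<and> sep (D e) (set (ys @ map (\<lambda>t. t e) ts))) \<longleftrightarrow>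
    distinct (map (\<lambda>t. t e) ts) \<and> sep (D e) (set (map (\<lambda>t. t e) ts))" for e by auto
  show ?case unfolding eq by (rule fo_sep_list[OF 0])
next
  case (Suc n)
  let ?ts = "(\<lambda>e. e 0) # map (\<lambda>t e. t (\<lambda>i. e (Suc i))) ts"
  let ?P = "\<lambda>y e. \<exists>ys. length ys = n \<and> set ys \<subseteq> carrier R \<and>
    distinct (ys @ y # map (\<lambda>t. t e) ts) \<and> sep (D e) (set (ys @ y # map (\<lambda>t. t e) ts))"
  have "fo (\<lambda>e. e 0 \<in> D (\<lambda>i. e (Suc (Suc i))))"
    using fo_subst[OF Suc.prems(1), of "\<lambda>i. case i of 0 \<Rightarrow> 0 | Suc i \<Rightarrow> Suc (Suc i)"] by simp
  moreover have "\<forall>t\<in>set ?ts. fot t"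
    using Suc.prems(2) fot_shift[of _ Suc] fot_var by auto
  ultimately have "fo (\<lambda>e. \<exists>ys. length ys = n \<and> set ys \<subseteq> carrier R \<and>
    distinct (ys @ map (\<lambda>t. t e) ?ts) \<and> sep (D (\<lambda>i. e (Suc i))) (set (ys @ map (\<lambda>t. t e) ?ts)))"
    by (rule Suc.IH)
  then have "fo (\<lambda>e. ?P (e 0) (\<lambda>i. e (Suc i)))" by (simp add: comp_def)
  then have "fo (\<lambda>e. \<exists>y\<in>carrier R. ?P y e)" by (rule fo_bex)
  moreover have "(\<exists>y\<in>carrier R. ?P y e) \<longleftrightarrow> (\<exists>ys. length ys = Suc n \<and> set ys \<subseteq> carrier R \<and>
    distinct (ys @ map (\<lambda>t. t e) ts) \<and> sep (D e) (set (ys @ map (\<lambda>t. t e) ts)))" (is "?l \<longleftrightarrow> ?r") for e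
  proof
    assume ?l
    then obtain y ys where "y \<in> carrier R" "length ys = n" "set ys \<subseteq> carrier R"
       "distinct (ys @ y # map (\<lambda>t. t e) ts)" "sep (D e) (set (ys @ y # map (\<lambda>t. t e) ts))" by blast
    then show ?r by (intro exI[of _ "ys @ [y]"]) simp
  next
    assume ?r
    then obtain zs where zs: "length zs = Suc n" "set zs \<subseteq> carrier R"
       "distinct (zs @ map (\<lambda>t. t e) ts)" "sep (D e) (set (zs @ map (\<lambda>t. t e) ts))" by blast
    then obtain ys y where "zs = ys @ [y]" by (metis length_Suc_conv_rev)
    then show ?l using zs by (intro bexI[of _ y] exI[of _ ys]) auto
  qed
  ultimately show ?case by (simp only:)
qed

text \<open>Thickness with a fixed bound is an elementary property of the parameters of a definable family. This is
what keeps the sets built below from thick sets definable.\<close>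

lemma fo_nthick:
  assumes "fo (\<lambda>e. e 0 \<in> D (\<lambda>i. e (Suc i)))"
  shows "fo (\<lambda>e. nthick n (D e))"
proof -
  have "nthick n (D e) \<longleftrightarrow> \<not> (\<exists>ys. length ys = n \<and> set ys \<subseteq> carrier R \<and> distinct ys \<and> sep (D e) (set ys))" for e
  proof -
    have "(\<exists>Y. Y \<subseteq> carrier R \<and> finite Y \<and> card Y = n \<and> sep (D e) Y) \<longleftrightarrow>
       (\<exists>ys. length ys = n \<and> set ys \<subseteq> carrier R \<and> distinct ys \<and> sep (D e) (set ys))"
      by (metis List.finite_set distinct_card finite_distinct_list)
    then show ?thesis unfolding nthick_def by blast
  qed
  then show ?thesis using fo_not[OF fo_sep_extend[OF assms, of "[]" n]] by simp
qed

section \<open>Subgroups\<close>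

definition subgrp :: "'b set \<Rightarrow> bool" where
  "subgrp H \<longleftrightarrow> H \<subseteq> carrier R \<and> \<zero> \<in> H \<and> (\<forall>x\<in>H. \<forall>y\<in>H. x \<ominus> y \<in> H)"

lemma subgrp_sub: "subgrp H \<Longrightarrow> H \<subseteq> carrier R"
  by (simp add: subgrp_def)

lemma subgrp_zero: "subgrp H \<Longrightarrow> \<zero> \<in> H"
  by (simp add: subgrp_def)

lemma subgrp_diff: "subgrp H \<Longrightarrow> x \<in> H \<Longrightarrow> y \<in> H \<Longrightarrow> x \<ominus> y \<in> H"
  by (simp add: subgrp_def)

lemma subgrp_minus:
  assumes "subgrp H" "x \<in> H" shows "\<ominus> x \<in> H"
proof -
  have "\<zero> \<ominus> x = \<ominus> x" using assms subgrp_sub by (simp add: a_minus_def subset_iff)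
  then show ?thesis using subgrp_diff[OF assms(1) subgrp_zero[OF assms(1)] assms(2)] by simp
qed

lemma subgrp_add:
  assumes "subgrp H" "x \<in> H" "y \<in> H" shows "x \<oplus> y \<in> H"
proof -
  have "x \<ominus> (\<ominus> y) = x \<oplus> y" using assms subgrp_sub by (simp add: a_minus_def subset_iff)
  then show ?thesis using subgrp_diff[OF assms(1,2) subgrp_minus[OF assms(1,3)]] by simp
qed

lemma subgrp_eq_additive_subgroup: "subgrp H \<longleftrightarrow> additive_subgroup H R"
proof
  assume H: "subgrp H"
  show "additive_subgroup H R"
    unfolding additive_subgroup_def subgroup_def
    using H subgrp_sub[OF H] subgrp_zero[OF H] subgrp_add[OF H] subgrp_minus[OF H]
    by (auto simp: a_inv_def)
next
  assume H: "additive_subgroup H R"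
  interpret additive_subgroup H R by (rule H)
  show "subgrp H" unfolding subgrp_def
  proof (intro conjI ballI)
    fix x y assume "x \<in> H" "y \<in> H"
    moreover have "\<ominus> y \<in> H" using additive_subgroup.a_inv_closed[OF H] \<open>y \<in> H\<close> by simp
    ultimately show "x \<ominus> y \<in> H" unfolding a_minus_def using additive_subgroup.a_closed[OF H] by blast
  qed (use additive_subgroup.a_subset[OF H] additive_subgroup.zero_closed[OF H] in auto)
qed

lemma subgrp_Inter: "\<F> \<noteq> {} \<Longrightarrow> (\<And>H. H \<in> \<F> \<Longrightarrow> subgrp H) \<Longrightarrow> subgrp (\<Inter>\<F>)"
  unfolding subgrp_def by blast

definition cos :: "'b set \<Rightarrow> 'b \<Rightarrow> 'b set" where
  "cos H x = {y\<in>carrier R. y \<ominus> x \<in> H}"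

lemma cos_eq:
  assumes "subgrp H" "x \<in> carrier R" "y \<in> carrier R"
  shows "cos H x = cos H y \<longleftrightarrow> x \<ominus> y \<in> H"
proof
  assume "cos H x = cos H y"
  moreover have "x \<in> cos H x" using assms subgrp_zero by (simp add: cos_def a_minus_def r_neg)
  ultimately show "x \<ominus> y \<in> H" by (auto simp: cos_def)
next
  assume *: "x \<ominus> y \<in> H"
  have "z \<ominus> x \<in> H \<longleftrightarrow> z \<ominus> y \<in> H" if z: "z \<in> carrier R" for z
  proof -
    have "z \<ominus> y = (z \<ominus> x) \<oplus> (x \<ominus> y)" "z \<ominus> x = (z \<ominus> y) \<ominus> (x \<ominus> y)"
      using assms z by (simp_all add: group_simps)
    then show ?thesis using * subgrp_add[OF assms(1)] subgrp_diff[OF assms(1)] by metis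
  qed
  then show "cos H x = cos H y" by (auto simp: cos_def)
qed

lemma a_rcosets_eq:
  assumes "subgrp H" shows "a_rcosets H = cos H ` carrier R"
proof -
  have "H +> x = cos H x" if "x \<in> carrier R" for x
  proof -
    have 1: "y = (y \<ominus> x) \<oplus> x" if "y \<in> carrier R" for y
      using that \<open>x \<in> carrier R\<close> by (simp add: group_simps)
    have 2: "(h \<oplus> x) \<ominus> x = h" if "h \<in> carrier R" for h
      using that \<open>x \<in> carrier R\<close> by (simp add: group_simps)
    show ?thesis unfolding a_r_coset_def' cos_def
    proof (intro equalityI subsetI)
      fix y assume "y \<in> (\<Union>h\<in>H. {h \<oplus> x})"
      then obtain h where h: "h \<in> H" "y = h \<oplus> x" by blast
      then have "h \<in> carrier R" using subgrp_sub[OF assms] by blast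
      then show "y \<in> {y \<in> carrier R. y \<ominus> x \<in> H}" using h 2 \<open>x \<in> carrier R\<close> by simp
    next
      fix y assume "y \<in> {y \<in> carrier R. y \<ominus> x \<in> H}"
      then show "y \<in> (\<Union>h\<in>H. {h \<oplus> x})" using 1[of y] by blast
    qed
  qed
  then show ?thesis unfolding A_RCOSETS_def' by auto
qed

end

section \<open>Saturation and automorphisms\<close>

text \<open>The abstract form of a definable ring in a monster model. \<open>Aut\<close> plays the role of the automorphisms that
fix \<open>A\<close>, and \<open>Aut_saturation\<close> is a compactness principle for choosing one automorphism that meets
a small set of requirements, each of the form that a definable set is not moved into another.\<close>

locale definable_ring = definability R fo + A: definability R foA
  for R :: "('b, 'm) ring_scheme" (structure) and fo foA +
  fixes \<kappa> :: "'k rel" and Aut :: "('b \<Rightarrow> 'b) set"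
  assumes strong_limit: "strong_limit \<kappa>"
    and small_nat: "|UNIV :: nat set| <o \<kappa>"
    and foA_fo: "\<And>P. foA P \<Longrightarrow> fo P"
    and fo_const: "\<And>x i. x \<in> carrier R \<Longrightarrow> fo (\<lambda>e. e i = x)"
    and saturation: "\<And>\<S>. |\<S>| <o \<kappa> \<Longrightarrow> (\<And>S. S \<in> \<S> \<Longrightarrow> dset S) \<Longrightarrow>
      (\<And>F. finite F \<Longrightarrow> F \<subseteq> \<S> \<Longrightarrow> carrier R \<inter> \<Inter>F \<noteq> {}) \<Longrightarrow> carrier R \<inter> \<Inter>\<S> \<noteq> {}"
    and few_A: "|{D. A.dset D}| <o \<kappa>"
    and Aut_id: "id \<in> Aut"
    and Aut_comp: "\<And>\<sigma> \<tau>. \<sigma> \<in> Aut \<Longrightarrow> \<tau> \<in> Aut \<Longrightarrow> \<sigma> \<circ> \<tau> \<in> Aut"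
    and Aut_bij: "\<And>\<sigma>. \<sigma> \<in> Aut \<Longrightarrow> bij \<sigma>"
    and Aut_inv: "\<And>\<sigma>. \<sigma> \<in> Aut \<Longrightarrow> inv_into UNIV \<sigma> \<in> Aut"
    and Aut_carrier: "\<And>\<sigma>. \<sigma> \<in> Aut \<Longrightarrow> \<sigma> ` carrier R = carrier R"
    and Aut_add: "\<And>\<sigma> x y. \<sigma> \<in> Aut \<Longrightarrow> x \<in> carrier R \<Longrightarrow> y \<in> carrier R \<Longrightarrow> \<sigma> (x \<oplus> y) = \<sigma> x \<oplus> \<sigma> y"
    and Aut_mult: "\<And>\<sigma> x y. \<sigma> \<in> Aut \<Longrightarrow> x \<in> carrier R \<Longrightarrow> y \<in> carrier R \<Longrightarrow> \<sigma> (x \<otimes> y) = \<sigma> x \<otimes> \<sigma> y"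
    and Aut_dset: "\<And>\<sigma> D. \<sigma> \<in> Aut \<Longrightarrow> dset D \<Longrightarrow> dset (\<sigma> ` D)"
    and Aut_dset_A: "\<And>\<sigma> D. \<sigma> \<in> Aut \<Longrightarrow> A.dset D \<Longrightarrow> \<sigma> ` D = D"
    and homogeneity: "\<And>x y. x \<in> carrier R \<Longrightarrow> y \<in> carrier R \<Longrightarrow> (\<And>D. A.dset D \<Longrightarrow> x \<in> D \<longleftrightarrow> y \<in> D) \<Longrightarrow>
      \<exists>\<sigma>\<in>Aut. \<sigma> x = y"
    and Aut_saturation: "\<And>\<C>. |\<C>| <o \<kappa> \<Longrightarrow> (\<And>D E. (D, E) \<in> \<C> \<Longrightarrow> dset D \<and> dset E) \<Longrightarrow>
      (\<And>F. finite F \<Longrightarrow> F \<subseteq> \<C> \<Longrightarrow> \<exists>\<sigma>\<in>Aut. \<forall>(D, E)\<in>F. \<not> \<sigma> ` D \<subseteq> E) \<Longrightarrow>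
      \<exists>\<sigma>\<in>Aut. \<forall>(D, E)\<in>\<C>. \<not> \<sigma> ` D \<subseteq> E"
begin

declare a_closed [rule del] zero_closed [rule del] a_inv_closed [rule del] minus_closed [rule del]
  additive_subgroup.a_closed [rule del] additive_subgroup.a_inv_closed [rule del]

abbreviation small :: "'c set \<Rightarrow> bool" where "small X \<equiv> |X| <o \<kappa>"

lemmas small_Pow' = small_Pow[OF strong_limit]
  and small_Times' = small_Times[OF strong_limit]
  and small_finite' = small_finite[OF strong_limit]
  and small_Un' = small_Un[OF strong_limit]

lemma small_finite_subsets:
  assumes "small X" shows "small {F. finite F \<and> F \<subseteq> X}"
  by (rule small_subset[OF small_Pow'[OF assms]]) auto

lemma fot_const: "x \<in> carrier R \<Longrightarrow> fot (\<lambda>e. x)"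
  using fo_const by (simp add: fot_def)

lemma A_dset: "A.dset D \<Longrightarrow> dset D"
  unfolding dset_def A.dset_def using foA_fo by blast

text \<open>Directed form of saturation.\<close>

lemma saturation_family:
  assumes "small I" "\<And>i. i \<in> I \<Longrightarrow> dset (S i)"
    "\<And>J. finite J \<Longrightarrow> J \<subseteq> I \<Longrightarrow> \<exists>x\<in>carrier R. \<forall>i\<in>J. x \<in> S i"
  shows "\<exists>x\<in>carrier R. \<forall>i\<in>I. x \<in> S i"
proof -
  have "carrier R \<inter> \<Inter>(S ` I) \<noteq> {}"
  proof (rule saturation)
    fix F assume "finite F" "F \<subseteq> S ` I"
    then obtain J where "finite J" "J \<subseteq> I" "F = S ` J" by (meson finite_subset_image)
    then show "carrier R \<inter> \<Inter>F \<noteq> {}" using assms(3)[of J] by blast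
  qed (use assms small_image in auto)
  then show ?thesis by blast
qed

lemma compactness:
  assumes "small \<S>" "\<And>S. S \<in> \<S> \<Longrightarrow> dset S" "dset D" "carrier R \<inter> \<Inter>\<S> \<subseteq> D"
  obtains F where "finite F" "F \<subseteq> \<S>" "carrier R \<inter> \<Inter>F \<subseteq> D"
proof (rule ccontr)
  assume "\<not> thesis"
  then have *: "\<And>F. finite F \<Longrightarrow> F \<subseteq> \<S> \<Longrightarrow> \<not> carrier R \<inter> \<Inter>F \<subseteq> D" using that by blast
  have "carrier R \<inter> \<Inter>(insert (carrier R - D) \<S>) \<noteq> {}"
  proof (rule saturation)
    show "small (insert (carrier R - D) \<S>)" using small_Un'[OF small_finite'[of "{carrier R - D}"] assms(1)] by simp
    fix F assume "finite F" "F \<subseteq> insert (carrier R - D) \<S>"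
    then show "carrier R \<inter> \<Inter>F \<noteq> {}" using *[of "F - {carrier R - D}"] by blast
  qed (use assms dset_Diff dset_carrier in auto)
  then show False using assms(4) by blast
qed

section \<open>Long separated families\<close>

text \<open>Zorn's lemma and saturation: a maximal separated set that can be continued consistently cannot be
small, since the conditions on one further point form a small set of formulas, which is finitely
satisfiable because the sets are not thick.\<close>

lemma long_separated:
  assumes "\<E> \<noteq> {}" "small \<E>" "\<And>D. D \<in> \<E> \<Longrightarrow> dset D" "\<And>D. D \<in> \<E> \<Longrightarrow> \<not> thick D"
    and directed: "\<And>D E. D \<in> \<E> \<Longrightarrow> E \<in> \<E> \<Longrightarrow> \<exists>F\<in>\<E>. D \<union> E \<subseteq> F"
  obtains W where "W \<subseteq> carrier R" "\<not> small W" "\<And>D. D \<in> \<E> \<Longrightarrow> sep D W"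
proof -
  define ext where "ext D n V \<longleftrightarrow> (\<exists>Y. Y \<subseteq> carrier R \<and> finite Y \<and> card Y = n \<and> Y \<inter> V = {} \<and> sep D (Y \<union> V))"
    for D n V
  have ext_mono: "ext D n V" if m: "ext E n' V'" "D \<subseteq> E" "n \<le> n'" "V \<subseteq> V'" for D n V E n' V'
  proof -
    obtain Y where Y: "Y \<subseteq> carrier R" "finite Y" "card Y = n'" "Y \<inter> V' = {}" "sep E (Y \<union> V')"
      using m(1) unfolding ext_def by blast
    obtain Z where Z: "Z \<subseteq> Y" "card Z = n" "finite Z" using obtain_subset_with_card_n[of n Y] Y(3) m(3) by blast
    have "sep E (Z \<union> V)" using sep_subset[OF Y(5), of "Z \<union> V"] Z(1) m(4) by blast
    then have "sep D (Z \<union> V)" by (rule sep_antimono[OF _ m(2)])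
    then show ?thesis unfolding ext_def using Y Z m(4) by (intro exI[of _ Z]) auto
  qed
  define P where "P W \<longleftrightarrow> W \<subseteq> carrier R \<and> (\<forall>D\<in>\<E>. \<forall>n V. finite V \<and> V \<subseteq> W \<longrightarrow> ext D n V)" for W
  have "\<exists>M\<in>Collect P. \<forall>X\<in>Collect P. M \<subseteq> X \<longrightarrow> X = M"
  proof (rule subset_Zorn')
    fix C assume C: "subset.chain (Collect P) C"
    have "ext D n V" if "D \<in> \<E>" "finite V" "V \<subseteq> \<Union>C" for D n V
    proof (cases "V = {}")
      case True
      have "\<not> nthick n D" using assms(4) that(1) by (auto simp: thick_def)
      then show ?thesis unfolding True nthick_def ext_def by auto
    next
      case False
      then have "C \<noteq> {}" using that by blast
      then obtain B where "B \<in> C" "V \<subseteq> B"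
        using finite_subset_Union_chain[OF \<open>finite V\<close> \<open>V \<subseteq> \<Union>C\<close> _ C] by metis
      then have "P B" using C by (auto simp: subset.chain_def)
      then show ?thesis using that \<open>V \<subseteq> B\<close> by (auto simp: P_def)
    qed
    moreover have "C \<subseteq> Collect P" using C by (simp add: subset.chain_def)
    then have "\<Union>C \<subseteq> carrier R" unfolding P_def by blast
    ultimately show "\<Union>C \<in> Collect P" by (auto simp: P_def)
  qed
  then obtain W where W: "P W" "\<And>X. P X \<Longrightarrow> W \<subseteq> X \<Longrightarrow> X = W" by auto
  have "\<not> small W"
  proof
    assume "small W"
    define I where "I = \<E> \<times> {V. finite V \<and> V \<subseteq> W} \<times> (UNIV :: nat set)"
    define S where "S = (\<lambda>(D, V, n). {y\<in>carrier R. y \<notin> V \<and> ext D n (insert y V)})"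
    have "\<exists>x\<in>carrier R. \<forall>i\<in>I. x \<in> S i"
    proof (rule saturation_family)
      show "small I" unfolding I_def
        using \<open>small W\<close> assms(2) small_nat small_finite_subsets by (intro small_Times')
    next
      fix i assume "i \<in> I"
      then obtain D V n where i: "i = (D, V, n)" "D \<in> \<E>" "finite V" "V \<subseteq> W" by (auto simp: I_def)
      obtain vs where vs: "set vs = V" "distinct vs" using i finite_distinct_list by blast
      let ?ts = "(\<lambda>e::nat \<Rightarrow> 'b. e 0) # map (\<lambda>v e. v) vs"
      have "fo (\<lambda>e. \<exists>ys. length ys = n \<and> set ys \<subseteq> carrier R \<and>
        distinct (ys @ map (\<lambda>t. t e) ?ts) \<and> sep D (set (ys @ map (\<lambda>t. t e) ?ts)))"
      proof (rule fo_sep_extend)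
        show "fo (\<lambda>e. e 0 \<in> D)" using assms(3) i by (simp add: dset_def)
        show "\<forall>t\<in>set ?ts. fot t" using fot_var fot_const vs i W(1) by (auto simp: P_def)
      qed
      moreover have "(\<exists>ys. length ys = n \<and> set ys \<subseteq> carrier R \<and>
        distinct (ys @ y # vs) \<and> sep D (set (ys @ y # vs))) \<longleftrightarrow> y \<notin> V \<and> ext D n (insert y V)" (is "?l \<longleftrightarrow> ?r") for y
      proof
        assume ?l
        then obtain ys where "length ys = n" "set ys \<subseteq> carrier R"
          "distinct (ys @ y # vs)" "sep D (set (ys @ y # vs))" by blast
        then show ?r unfolding ext_def using vs
          by (intro conjI exI[of _ "set ys"]) (auto simp: distinct_card)
      next
        assume r: ?r
        then obtain Y where Y: "Y \<subseteq> carrier R" "finite Y" "card Y = n" "Y \<inter> insert y V = {}" "sep D (Y \<union> insert y V)"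
          by (auto simp: ext_def)
        then obtain ys where "set ys = Y" "distinct ys" using finite_distinct_list by blast
        then show ?l using Y r vs by (intro exI[of _ ys]) (auto simp: distinct_card)
      qed
      ultimately have "fo (\<lambda>e. e 0 \<notin> V \<and> ext D n (insert (e 0) V))" by (simp add: comp_def)
      then show "dset (S i)" by (simp add: i S_def dset_Collect)
    next
      fix J assume J: "finite J" "J \<subseteq> I"
      have "\<exists>D\<in>\<E>. \<forall>j\<in>J. fst j \<subseteq> D" using J
      proof (induction J rule: finite_induct)
        case empty then show ?case using assms(1) by auto
      next
        case (insert j J)
        then obtain D where D: "D \<in> \<E>" "\<forall>j\<in>J. fst j \<subseteq> D" by blast
        have j: "fst j \<in> \<E>" using insert.prems by (auto simp: I_def)
        then obtain D3 where "D3 \<in> \<E>" "D \<union> fst j \<subseteq> D3" using directed D by blast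
        then show ?case using D by (intro bexI[of _ D3]) auto
      qed
      then obtain D where D: "D \<in> \<E>" "\<forall>j\<in>J. fst j \<subseteq> D" by blast
      define V where "V = (\<Union>(D', V', n)\<in>J. V')"
      define N where "N = (\<Sum>(D', V', n)\<in>J. n)"
      have N: "n \<le> N" if "(D', V', n) \<in> J" for D' V' n
        unfolding N_def using member_le_sum[OF that, of "\<lambda>(D', V', n). n"] J(1) by simp
      have "finite V" "V \<subseteq> W" using J unfolding V_def I_def by (auto intro!: finite_UN_I)
      then have "ext D (Suc N) V" using W(1) D(1) by (auto simp: P_def)
      then obtain Y where Y: "Y \<subseteq> carrier R" "finite Y" "card Y = Suc N" "Y \<inter> V = {}" "sep D (Y \<union> V)"
        by (auto simp: ext_def)
      then obtain y where y: "y \<in> Y" by fastforce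
      have "ext D N (insert y V)" unfolding ext_def
        using Y y by (intro exI[of _ "Y - {y}"]) (auto elim: sep_subset)
      then have "y \<in> S j" if "j \<in> J" for j
      proof -
        obtain D' V' n where j: "j = (D', V', n)" by (cases j)
        then have "V' \<subseteq> V" "D' \<subseteq> D" "n \<le> N" using that N D(2) by (force simp: V_def)+
        then have "ext D' n (insert y V')" by (intro ext_mono[OF \<open>ext D N (insert y V)\<close>]) auto
        then show ?thesis using y Y \<open>V' \<subseteq> V\<close> unfolding j S_def by auto
      qed
      then show "\<exists>x\<in>carrier R. \<forall>i\<in>J. x \<in> S i" using y Y by blast
    qed
    then obtain y where y: "y \<in> carrier R" "\<And>i. i \<in> I \<Longrightarrow> y \<in> S i" by blast
    have yS: "y \<notin> V \<and> ext D n (insert y V)" if "D \<in> \<E>" "finite V" "V \<subseteq> W" for D V n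
      using y(2)[of "(D, V, n)"] that by (auto simp: I_def S_def)
    obtain D where "D \<in> \<E>" using assms(1) by blast
    then have "y \<notin> W" using yS[of D "{y}" 0] by auto
    moreover have "P (insert y W)" unfolding P_def
    proof (intro conjI ballI allI impI)
      fix D n V assume "D \<in> \<E>" "finite V \<and> V \<subseteq> insert y W"
      then show "ext D n V" using yS[of D "V - {y}" n] ext_mono[of D n "insert y (V - {y})" D n V] by auto
    qed (use W(1) y(1) P_def in auto)
    ultimately show False using W(2)[of "insert y W"] by blast
  qed
  have sepW: "sep D W" if "D \<in> \<E>" for D
    unfolding sep_def
  proof (intro ballI impI)
    fix x y assume "x \<in> W" "y \<in> W" "x \<noteq> y"
    then have "ext D 0 {x, y}" using W(1) that by (simp add: P_def)
    then show "\<not> (x \<ominus> y \<in> D \<and> y \<ominus> x \<in> D)" using \<open>x \<noteq> y\<close> by (auto simp: ext_def sep_def)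
  qed
  have "W \<subseteq> carrier R" using W(1) by (simp add: P_def)
  then show ?thesis using \<open>\<not> small W\<close> sepW by (rule that)
qed

section \<open>Subgroups of bounded index\<close>

definition bounded :: "'b set \<Rightarrow> bool" where
  "bounded H \<longleftrightarrow> small (cos H ` carrier R)"

lemma small_factor:
  assumes "small (f ` X)" "\<And>x y. x \<in> X \<Longrightarrow> y \<in> X \<Longrightarrow> f x = f y \<Longrightarrow> g x = g y"
  shows "small (g ` X)"
proof -
  have "g x = g (SOME y. y \<in> X \<and> f y = f x)" if "x \<in> X" for x
  proof -
    have "(SOME y. y \<in> X \<and> f y = f x) \<in> X \<and> f (SOME y. y \<in> X \<and> f y = f x) = f x"
      by (rule someI[of "\<lambda>y. y \<in> X \<and> f y = f x" x]) (simp add: that)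
    then show ?thesis using assms(2)[OF that] by metis
  qed
  then have "g ` X = (\<lambda>z. g (SOME y. y \<in> X \<and> f y = z)) ` f ` X" unfolding image_image by (rule image_cong[OF refl])
  then show ?thesis using small_image[OF assms(1), of "\<lambda>z. g (SOME y. y \<in> X \<and> f y = z)"] by simp
qed

lemma bounded_separated:
  assumes "subgrp H" "bounded H" "W \<subseteq> carrier R"
    "\<And>x y. x \<in> W \<Longrightarrow> y \<in> W \<Longrightarrow> x \<noteq> y \<Longrightarrow> x \<ominus> y \<notin> H"
  shows "small W"
proof (rule small_inj)
  show "small (cos H ` carrier R)" using assms(2) by (simp add: bounded_def)
  show "inj_on (cos H) W"
  proof (rule inj_onI)
    fix x y assume xy: "x \<in> W" "y \<in> W" "cos H x = cos H y"
    then have "x \<ominus> y \<in> H" using cos_eq[OF assms(1), of x y] assms(3) by blast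
    then show "x = y" using assms(4) xy by blast
  qed
  show "cos H ` W \<subseteq> cos H ` carrier R" using assms(3) by (rule image_mono)
qed

lemma bounded_mono:
  assumes "bounded H" "H \<subseteq> K" "subgrp H" "subgrp K" shows "bounded K"
  unfolding bounded_def
proof (rule small_factor[OF assms(1)[unfolded bounded_def]])
  fix x y assume "x \<in> carrier R" "y \<in> carrier R" "cos H x = cos H y"
  then show "cos K x = cos K y" using cos_eq[OF assms(3), of x y] cos_eq[OF assms(4), of x y] assms(2) by blast
qed

text \<open>Otherwise there is an unboundedly long sequence with no differences in \<open>D\<close>, in particular with none in \<open>H\<close>,
and its members lie in distinct cosets of \<open>H\<close>.\<close>

lemma thick_of_bounded:
  assumes "subgrp H" "bounded H" "H \<subseteq> D" "dset D" shows "thick D"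
proof (rule ccontr)
  assume nt: "\<not> thick D"
  obtain W where W: "W \<subseteq> carrier R" "\<not> small W" "\<And>D'. D' \<in> {D} \<Longrightarrow> sep D' W"
    by (rule long_separated[of "{D}"]) (use assms(4) nt in \<open>auto simp: small_finite'\<close>)
  have "x \<ominus> y \<notin> H" if "x \<in> W" "y \<in> W" "x \<noteq> y" for x y
  proof
    assume "x \<ominus> y \<in> H"
    moreover have "\<ominus> (x \<ominus> y) = y \<ominus> x" by (rule minus_minus_eq) (use that W(1) in blast)+
    ultimately have "x \<ominus> y \<in> D" "y \<ominus> x \<in> D" using assms(3) subgrp_minus[OF assms(1)] by (metis subsetD)+
    then show False using W(3)[of D] that unfolding sep_def by blast
  qed
  then show False using bounded_separated[OF assms(1,2) W(1)] W(2) by blast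
qed

definition tdef :: "'b set \<Rightarrow> bool" where
  "tdef H \<longleftrightarrow> (\<exists>\<S>. small \<S> \<and> (\<forall>S\<in>\<S>. dset S) \<and> H = carrier R \<inter> \<Inter>\<S>)"

definition tdefA :: "'b set \<Rightarrow> bool" where
  "tdefA H \<longleftrightarrow> (\<exists>\<S>. (\<forall>S\<in>\<S>. A.dset S) \<and> H = carrier R \<inter> \<Inter>\<S>)"

text \<open>Compactness applied to \<open>H + H \<subseteq> D\<close>, as for neighbourhoods of the identity in a topological group.\<close>

lemma nbhd_half:
  assumes "subgrp H" "tdef H" "H \<subseteq> D" "dset D"
  obtains T where "dset T" "H \<subseteq> T" "neg T = T" "\<And>x y. x \<in> T \<Longrightarrow> y \<in> T \<Longrightarrow> x \<oplus> y \<in> D"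
proof -
  obtain \<S> where S: "small \<S>" "\<And>S. S \<in> \<S> \<Longrightarrow> dset S" "H = carrier R \<inter> \<Inter>\<S>"
    using assms(2) by (auto simp: tdef_def)
  define I where "I = {F. finite F \<and> F \<subseteq> \<S>}"
  define N where "N F = carrier R \<inter> \<Inter>F" for F :: "'b set set"
  have smallI: "small I" unfolding I_def by (rule small_finite_subsets[OF S(1)])
  have dN: "dset (N F)" if F: "F \<in> I" for F
    unfolding N_def
  proof (rule dset_finite_Int)
    show "finite F" using F by (simp add: I_def)
    show "dset E" if "E \<in> F" for E using F that S(2) unfolding I_def by blast
  qed
  have N_Union: "\<Union>J \<in> I" "\<And>F. F \<in> J \<Longrightarrow> N (\<Union>J) \<subseteq> N F" if "finite J" "J \<subseteq> I" for J
    using that unfolding I_def N_def by auto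
  have inH: "x \<in> H" if x: "\<And>F. F \<in> I \<Longrightarrow> x \<in> N F" for x
  proof -
    have "x \<in> carrier R" using x[of "{}"] by (simp add: I_def N_def)
    moreover have "x \<in> E" if "E \<in> \<S>" for E using x[of "{E}"] that by (simp add: I_def N_def)
    ultimately show ?thesis using S(3) by simp
  qed
  have HN: "H \<subseteq> N F" if "F \<in> I" for F using that S(3) unfolding I_def N_def by auto
  have "\<exists>F\<in>I. \<forall>x\<in>N F. \<forall>y\<in>N F. x \<ominus> y \<in> D"
  proof (rule ccontr)
    assume "\<not> (\<exists>F\<in>I. \<forall>x\<in>N F. \<forall>y\<in>N F. x \<ominus> y \<in> D)"
    then have *: "\<And>F. F \<in> I \<Longrightarrow> \<exists>x\<in>N F. \<exists>y\<in>N F. x \<ominus> y \<notin> D" by blast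
    have "\<exists>x\<in>carrier R. \<forall>F\<in>I. x \<in> {x\<in>carrier R. x \<in> N F \<and> (\<exists>y\<in>N F. x \<ominus> y \<notin> D)}"
    proof (rule saturation_family[OF smallI])
      fix F assume F: "F \<in> I"
      show "dset {x\<in>carrier R. x \<in> N F \<and> (\<exists>y\<in>N F. x \<ominus> y \<notin> D)}"
        by (intro dset_Collect fo_intros dN[OF F] assms(4))
    next
      fix J assume J: "finite J" "J \<subseteq> I"
      obtain x y where xy: "x \<in> N (\<Union>J)" "y \<in> N (\<Union>J)" "x \<ominus> y \<notin> D" using *[OF N_Union(1)[OF J]] by blast
      then have "x \<in> carrier R" by (simp add: N_def)
      then show "\<exists>x\<in>carrier R. \<forall>F\<in>J. x \<in> {x\<in>carrier R. x \<in> N F \<and> (\<exists>y\<in>N F. x \<ominus> y \<notin> D)}"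
        using xy N_Union(2)[OF J] by blast
    qed
    then obtain x where x: "x \<in> carrier R" "\<And>F. F \<in> I \<Longrightarrow> x \<in> N F" "\<And>F. F \<in> I \<Longrightarrow> \<exists>y\<in>N F. x \<ominus> y \<notin> D" by blast
    have "\<exists>y\<in>carrier R. \<forall>F\<in>I. y \<in> {y\<in>carrier R. y \<in> N F \<and> x \<ominus> y \<notin> D}"
    proof (rule saturation_family[OF smallI])
      fix F assume F: "F \<in> I"
      show "dset {y\<in>carrier R. y \<in> N F \<and> x \<ominus> y \<notin> D}"
        by (intro dset_Collect fo_intros dN[OF F] assms(4) fot_const x)
    next
      fix J assume J: "finite J" "J \<subseteq> I"
      obtain y where y: "y \<in> N (\<Union>J)" "x \<ominus> y \<notin> D" using x(3)[OF N_Union(1)[OF J]] by blast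
      then have "y \<in> carrier R" by (simp add: N_def)
      then show "\<exists>y\<in>carrier R. \<forall>F\<in>J. y \<in> {y\<in>carrier R. y \<in> N F \<and> x \<ominus> y \<notin> D}"
        using y N_Union(2)[OF J] by blast
    qed
    then obtain y where y: "\<And>F. F \<in> I \<Longrightarrow> y \<in> N F \<and> x \<ominus> y \<notin> D" by blast
    have "x \<ominus> y \<in> H" using subgrp_diff[OF assms(1) inH[OF x(2)] inH] y by blast
    moreover have "x \<ominus> y \<notin> D" using y[of "{}"] by (simp add: I_def)
    ultimately show False using assms(3) by blast
  qed
  then obtain F where F: "F \<in> I" "\<And>x y. x \<in> N F \<Longrightarrow> y \<in> N F \<Longrightarrow> x \<ominus> y \<in> D" by blast
  have NR: "N F \<subseteq> carrier R" by (simp add: N_def)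
  let ?T = "N F \<inter> neg (N F)"
  show ?thesis
  proof (rule that[of ?T])
    show "dset ?T" using dN[OF F(1)] by (intro dset_Int dset_neg)
    show "H \<subseteq> ?T"
    proof
      fix x assume "x \<in> H"
      then have "x \<in> N F" "\<ominus> x \<in> N F" using HN[OF F(1)] subgrp_minus[OF assms(1)] by blast+
      then show "x \<in> ?T" using NR by (simp add: neg_def subset_iff)
    qed
    show "neg ?T = ?T" using NR by (auto simp: neg_def)
    fix x y assume "x \<in> ?T" "y \<in> ?T"
    then have "x \<ominus> (\<ominus> y) \<in> D" "x \<in> carrier R" "y \<in> carrier R" using F(2)[of x "\<ominus> y"] by (auto simp: neg_def N_def)
    then show "x \<oplus> y \<in> D" by (simp add: a_minus_def)
  qed
qed

text \<open>The converse of \<open>thick_of_bounded\<close>. Finitely many translates of each half-neighbourhood cover. A coset of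
\<open>H\<close> is determined by the translates that contain a representative, hence by a subset of a small set.\<close>

lemma bounded_of_thick:
  assumes "subgrp H" "tdef H" "\<And>D. dset D \<Longrightarrow> H \<subseteq> D \<Longrightarrow> thick D"
  shows "bounded H"
proof -
  obtain \<S> where S: "small \<S>" "\<And>S. S \<in> \<S> \<Longrightarrow> dset S" "H = carrier R \<inter> \<Inter>\<S>"
    using assms(2) by (auto simp: tdef_def)
  have "\<exists>T Y. T \<subseteq> carrier R \<and> neg T = T \<and> (\<forall>x\<in>T. \<forall>y\<in>T. x \<oplus> y \<in> S) \<and> Y \<subseteq> carrier R \<and> finite Y \<and>
    (\<forall>x\<in>carrier R. \<exists>y\<in>Y. x \<ominus> y \<in> T)" if SS: "S \<in> \<S>" for S
  proof -
    have "H \<subseteq> S" using S(3) SS by blast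
    then obtain T where T: "dset T" "H \<subseteq> T" "neg T = T" "\<And>x y. x \<in> T \<Longrightarrow> y \<in> T \<Longrightarrow> x \<oplus> y \<in> S"
      using nbhd_half[OF assms(1,2) _ S(2)[OF SS]] by blast
    obtain Y where "Y \<subseteq> carrier R" "finite Y" "\<And>x. x \<in> carrier R \<Longrightarrow> \<exists>y\<in>Y. x \<ominus> y \<in> T"
      using thick_cover[OF assms(3)[OF T(1,2)]] T(2) subgrp_zero[OF assms(1)] by blast
    then show ?thesis using T dset_sub by (intro exI[of _ T] exI[of _ Y]) auto
  qed
  then obtain T Y where TY: "\<And>S. S \<in> \<S> \<Longrightarrow> T S \<subseteq> carrier R \<and> neg (T S) = T S \<and> (\<forall>x\<in>T S. \<forall>y\<in>T S. x \<oplus> y \<in> S)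
    \<and> Y S \<subseteq> carrier R \<and> finite (Y S) \<and> (\<forall>x\<in>carrier R. \<exists>y\<in>Y S. x \<ominus> y \<in> T S)" by metis
  define Z where "Z = (\<Union>S\<in>\<S>. {S} \<times> Y S)"
  have "small Z" unfolding Z_def
  proof (rule small_UNION_uniform[OF strong_limit S(1) small_nat, of _ "\<lambda>S n. (S, from_nat_into (Y S) n)"])
    fix S assume "S \<in> \<S>"
    then have "countable (Y S)" using TY countable_finite by blast
    then have "y \<in> range (from_nat_into (Y S))" if "y \<in> Y S" for y
      using that by (metis from_nat_into_surj rangeI)
    then show "{S} \<times> Y S \<subseteq> (\<lambda>S n. (S, from_nat_into (Y S) n)) S ` UNIV" by auto
  qed
  define img where "img x = {(S, y). S \<in> \<S> \<and> y \<in> Y S \<and> x \<ominus> y \<in> T S}" for x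
  have "small (img ` carrier R)"
    by (rule small_subset[OF small_Pow'[OF \<open>small Z\<close>]]) (auto simp: img_def Z_def)
  then show ?thesis unfolding bounded_def
  proof (rule small_factor)
    fix x x' assume x: "x \<in> carrier R" "x' \<in> carrier R" "img x = img x'"
    have "x \<ominus> x' \<in> S" if "S \<in> \<S>" for S
    proof -
      obtain y where y: "y \<in> Y S" "x \<ominus> y \<in> T S" using TY[OF \<open>S \<in> \<S>\<close>] x by blast
      then have "(S, y) \<in> img x" using that by (simp add: img_def)
      then have "(S, y) \<in> img x'" using x(3) by simp
      then have x'y: "x' \<ominus> y \<in> T S" by (simp add: img_def)
      have "y \<in> carrier R" using y TY[OF that] by blast
      then have "\<ominus> (x' \<ominus> y) = y \<ominus> x'" by (intro minus_minus_eq x(2))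
      moreover have "x' \<ominus> y \<in> neg (T S)" using x'y TY[OF that] by simp
      ultimately have "y \<ominus> x' \<in> T S" by (simp add: neg_def)
      then have "(x \<ominus> y) \<oplus> (y \<ominus> x') \<in> S" using y TY[OF that] by blast
      moreover have "(x \<ominus> y) \<oplus> (y \<ominus> x') = x \<ominus> x'" using x \<open>y \<in> carrier R\<close> by (simp add: group_simps)
      ultimately show ?thesis by simp
    qed
    then have "x \<ominus> x' \<in> H" using S(3) x by auto
    then show "cos H x = cos H x'" using cos_eq[OF assms(1)] x by blast
  qed
qed

lemma bounded_Int_family:
  assumes "small \<S>" "\<And>S. S \<in> \<S> \<Longrightarrow> dset S" "\<And>S. S \<in> \<S> \<Longrightarrow> thick S" "subgrp (carrier R \<inter> \<Inter>\<S>)"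
  shows "bounded (carrier R \<inter> \<Inter>\<S>)"
proof (rule bounded_of_thick[OF assms(4)])
  show "tdef (carrier R \<inter> \<Inter>\<S>)" unfolding tdef_def using assms by blast
  fix D assume "dset D" "carrier R \<inter> \<Inter>\<S> \<subseteq> D"
  then obtain F where "finite F" "F \<subseteq> \<S>" "carrier R \<inter> \<Inter>F \<subseteq> D" using compactness assms(1,2) by metis
  then show "thick D" using thick_mono[OF thick_finite_Int[of F]] assms(3) by blast
qed

section \<open>The component \<open>(R, +)\<^sup>0\<^sup>0\<^sub>A\<close>\<close>

text \<open>The intersection with the carrier makes the definition meaningful for an empty family.\<close>

definition G00 :: "'b set" where
  "G00 = carrier R \<inter> \<Inter>{H. tdefA H \<and> subgrp H \<and> bounded H}"

lemma tdefA_canonical: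
  assumes "tdefA H" shows "H = carrier R \<inter> \<Inter>{S. A.dset S \<and> H \<subseteq> S}"
  using assms unfolding tdefA_def by blast

lemma G00_subset: "tdefA H \<Longrightarrow> subgrp H \<Longrightarrow> bounded H \<Longrightarrow> G00 \<subseteq> H"
  by (auto simp: G00_def)

lemma subgrp_carrier: "subgrp (carrier R)"
  by (auto simp: subgrp_def)

lemma G00_alt: "G00 = carrier R \<inter> \<Inter>{S. A.dset S \<and> (\<exists>H. tdefA H \<and> subgrp H \<and> bounded H \<and> H \<subseteq> S)}"
proof
  show "carrier R \<inter> \<Inter>{S. A.dset S \<and> (\<exists>H. tdefA H \<and> subgrp H \<and> bounded H \<and> H \<subseteq> S)} \<subseteq> G00"
    unfolding G00_def using tdefA_canonical by blast
qed (auto simp: G00_def)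

lemma G00_tdefA: "tdefA G00"
  unfolding tdefA_def
  by (rule exI[of _ "{S. A.dset S \<and> (\<exists>H. tdefA H \<and> subgrp H \<and> bounded H \<and> H \<subseteq> S)}"]) (simp add: G00_alt)

lemma G00_subgrp: "subgrp G00"
proof -
  have "subgrp (\<Inter>(insert (carrier R) {H. tdefA H \<and> subgrp H \<and> bounded H}))"
    by (rule subgrp_Inter) (auto intro: subgrp_carrier)
  then show ?thesis by (simp add: G00_def)
qed

lemma G00_bounded: "bounded G00"
  unfolding G00_alt
proof (rule bounded_Int_family)
  show "small {S. A.dset S \<and> (\<exists>H. tdefA H \<and> subgrp H \<and> bounded H \<and> H \<subseteq> S)}"
    by (rule small_subset[OF few_A]) auto
  show "subgrp (carrier R \<inter> \<Inter>{S. A.dset S \<and> (\<exists>H. tdefA H \<and> subgrp H \<and> bounded H \<and> H \<subseteq> S)})"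
    using G00_subgrp G00_alt by simp
qed (auto intro: A_dset thick_of_bounded)

section \<open>Automorphisms\<close>

lemma Aut_closed: "\<sigma> \<in> Aut \<Longrightarrow> x \<in> carrier R \<Longrightarrow> \<sigma> x \<in> carrier R"
  using Aut_carrier by blast

lemma Aut_inv_apply: "\<sigma> \<in> Aut \<Longrightarrow> inv_into UNIV \<sigma> (\<sigma> x) = x" "\<sigma> \<in> Aut \<Longrightarrow> \<sigma> (inv_into UNIV \<sigma> x) = x"
  using Aut_bij by (auto simp: bij_is_inj bij_is_surj surj_f_inv_f)

lemma Aut_zero: "\<sigma> \<in> Aut \<Longrightarrow> \<sigma> \<zero> = \<zero>"
  using Aut_add[of \<sigma> \<zero> \<zero>] Aut_closed[of \<sigma> \<zero>] add.l_cancel_one' by simp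

lemma Aut_minus: assumes "\<sigma> \<in> Aut" "x \<in> carrier R" shows "\<sigma> (\<ominus> x) = \<ominus> (\<sigma> x)"
proof -
  have "\<sigma> (\<ominus> x) \<oplus> \<sigma> x = \<zero>"
    using Aut_add[OF assms(1), of "\<ominus> x" x] assms by (simp add: l_neg Aut_zero)
  then show ?thesis using minus_equality Aut_closed assms by simp
qed

lemma Aut_diff: "\<sigma> \<in> Aut \<Longrightarrow> x \<in> carrier R \<Longrightarrow> y \<in> carrier R \<Longrightarrow> \<sigma> (x \<ominus> y) = \<sigma> x \<ominus> \<sigma> y"
  by (simp add: a_minus_def Aut_add Aut_minus)

lemma subgrp_Aut:
  assumes "\<sigma> \<in> Aut" "subgrp H" shows "subgrp (\<sigma> ` H)"
  unfolding subgrp_def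
proof (intro conjI ballI)
  show "\<sigma> ` H \<subseteq> carrier R" using assms Aut_closed subgrp_sub by blast
  show "\<zero> \<in> \<sigma> ` H" using Aut_zero[OF assms(1)] subgrp_zero[OF assms(2)] by (metis imageI)
  fix x y assume "x \<in> \<sigma> ` H" "y \<in> \<sigma> ` H"
  then obtain a b where ab: "x = \<sigma> a" "y = \<sigma> b" "a \<in> H" "b \<in> H" by blast
  then have "x \<ominus> y = \<sigma> (a \<ominus> b)" using Aut_diff[OF assms(1), of a b] subgrp_sub[OF assms(2)] by (simp add: subset_iff)
  then show "x \<ominus> y \<in> \<sigma> ` H" using ab subgrp_diff[OF assms(2)] by blast
qed

lemma Aut_Inter: assumes "\<sigma> \<in> Aut" shows "\<sigma> ` (carrier R \<inter> \<Inter>\<S>) = carrier R \<inter> \<Inter>((`) \<sigma> ` \<S>)"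
proof -
  have "inj \<sigma>" "\<sigma> ` carrier R = carrier R" using Aut_bij[OF assms] Aut_carrier[OF assms] by (simp_all add: bij_is_inj)
  moreover have "\<sigma> ` (\<Inter>S\<in>insert (carrier R) \<S>. S) = (\<Inter>S\<in>insert (carrier R) \<S>. \<sigma> ` S)"
    by (rule image_INT[OF \<open>inj \<sigma>\<close>, of _ _ "carrier R"]) auto
  ultimately show ?thesis by simp
qed

lemma thick_Aut:
  assumes "\<sigma> \<in> Aut" "thick D" shows "thick (\<sigma> ` D)"
proof -
  obtain n where n: "nthick n D" using assms by (auto simp: thick_def)
  have "\<not> sep (\<sigma> ` D) Y" if Y: "Y \<subseteq> carrier R" "finite Y" "card Y = n" for Y
  proof
    assume s: "sep (\<sigma> ` D) Y"
    let ?\<tau> = "inv_into UNIV \<sigma>" and ?Y = "inv_into UNIV \<sigma> ` Y"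
    have t: "?\<tau> \<in> Aut" by (rule Aut_inv[OF assms(1)])
    have "inj_on ?\<tau> Y" by (rule inj_on_subset[OF bij_is_inj[OF Aut_bij[OF t]]]) simp
    then have "card ?Y = n" using Y by (simp add: card_image)
    moreover have "?Y \<subseteq> carrier R" using Y(1) Aut_closed[OF t] by auto
    ultimately have cY: "card ?Y = n" "?Y \<subseteq> carrier R" by blast+
    have "sep D ?Y" unfolding sep_def
    proof (intro ballI impI)
      fix x y assume xy: "x \<in> ?Y" "y \<in> ?Y" "x \<noteq> y"
      then have m: "\<sigma> x \<in> Y" "\<sigma> y \<in> Y" using Aut_inv_apply(2)[OF assms(1)] by auto
      have "\<sigma> x \<noteq> \<sigma> y" using xy(3) Aut_inv_apply(1)[OF assms(1)] by metis
      moreover have c: "x \<in> carrier R" "y \<in> carrier R" using xy cY(2) by blast+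
      ultimately
      have "\<not> (\<sigma> x \<ominus> \<sigma> y \<in> \<sigma> ` D \<and> \<sigma> y \<ominus> \<sigma> x \<in> \<sigma> ` D)" using s m unfolding sep_def by blast
      then show "\<not> (x \<ominus> y \<in> D \<and> y \<ominus> x \<in> D)"
        using Aut_diff[OF assms(1) c] Aut_diff[OF assms(1) c(2,1)] by (metis imageI)
    qed
    moreover have "finite ?Y" using Y(2) by simp
    ultimately show False using n cY unfolding nthick_def by blast
  qed
  then have "nthick n (\<sigma> ` D)" by (simp add: nthick_def)
  then show ?thesis by (auto simp: thick_def)
qed

text \<open>By homogeneity, a set that is invariant under \<open>Aut\<close> and contains \<open>x\<close> contains all elements of the same type
over \<open>A\<close>. Compactness then separates a point outside \<open>H\<close> from \<open>H\<close> by sets definable over \<open>A\<close>.\<close>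

lemma invariant_tdefA:
  assumes "tdef H" "\<And>\<sigma>. \<sigma> \<in> Aut \<Longrightarrow> \<sigma> ` H \<subseteq> H"
  shows "tdefA H"
proof -
  obtain \<S> where S: "small \<S>" "\<And>S. S \<in> \<S> \<Longrightarrow> dset S" "H = carrier R \<inter> \<Inter>\<S>"
    using assms(1) by (auto simp: tdef_def)
  have "x \<in> H" if x: "x \<in> carrier R" "\<And>S. A.dset S \<Longrightarrow> H \<subseteq> S \<Longrightarrow> x \<in> S" for x
  proof -
    let ?q = "{S. A.dset S \<and> x \<in> S}"
    have "carrier R \<inter> \<Inter>(?q \<union> \<S>) \<noteq> {}"
    proof (rule saturation)
      have "small ?q" by (rule small_subset[OF few_A]) auto
      then show "small (?q \<union> \<S>)" using S(1) by (rule small_Un')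
      show "dset S" if "S \<in> ?q \<union> \<S>" for S using that S A_dset by blast
      fix F assume F: "finite F" "F \<subseteq> ?q \<union> \<S>"
      let ?E = "carrier R \<inter> \<Inter>(F \<inter> ?q)"
      have "A.dset ?E" by (rule A.dset_finite_Int) (use F in auto)
      then have "A.dset (carrier R - ?E)" using A.dset_Diff A.dset_carrier by blast
      moreover have "x \<notin> carrier R - ?E" using x by auto
      ultimately have "\<not> H \<subseteq> carrier R - ?E" using x(2) by blast
      then obtain z where "z \<in> H" "z \<in> ?E" using S(3) by blast
      have "z \<in> S" if "S \<in> F" for S
      proof (cases "S \<in> ?q")
        case True then show ?thesis using \<open>z \<in> ?E\<close> that by blast
      next
        case False
        then have "S \<in> \<S>" using F(2) that by blast
        then show ?thesis using \<open>z \<in> H\<close> S(3) by simp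
      qed
      then have "z \<in> carrier R \<inter> \<Inter>F" using \<open>z \<in> ?E\<close> by simp
      then show "carrier R \<inter> \<Inter>F \<noteq> {}" by (metis empty_iff)
    qed
    then obtain z where "z \<in> carrier R \<inter> \<Inter>(?q \<union> \<S>)" by (metis ex_in_conv)
    then have z: "z \<in> carrier R" "\<And>D. A.dset D \<Longrightarrow> x \<in> D \<Longrightarrow> z \<in> D" "z \<in> H" using S(3) by simp_all
    have "\<exists>\<sigma>\<in>Aut. \<sigma> z = x"
    proof (rule homogeneity[OF z(1) x(1)])
      fix D assume D: "A.dset D"
      then have "A.dset (carrier R - D)" using A.dset_Diff A.dset_carrier by blast
      then have "x \<in> carrier R - D \<Longrightarrow> z \<in> carrier R - D" "x \<in> D \<Longrightarrow> z \<in> D" using D z(2)[of "carrier R - D"] z(2)[of D] by simp_all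
      then show "z \<in> D \<longleftrightarrow> x \<in> D" using x(1) by blast
    qed
    then show ?thesis using assms(2) z(3) by blast
  qed
  then have "H = carrier R \<inter> \<Inter>{S. A.dset S \<and> H \<subseteq> S}" using S(3) by (intro equalityI subsetI) auto
  then show ?thesis unfolding tdefA_def by (intro exI[of _ "{S. A.dset S \<and> H \<subseteq> S}"]) simp
qed

lemma tdefA_invariant:
  assumes "tdefA H" "\<sigma> \<in> Aut" shows "\<sigma> ` H = H"
proof -
  obtain \<S> where S: "\<forall>S\<in>\<S>. A.dset S" "H = carrier R \<inter> \<Inter>\<S>" using assms(1) by (auto simp: tdefA_def)
  then have "(`) \<sigma> ` \<S> = \<S>" using Aut_dset_A[OF assms(2)] by (auto simp: image_iff)
  then show ?thesis using Aut_Inter[OF assms(2)] S(2) by metis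
qed

end

section \<open>Neumann's covering lemma\<close>

text \<open>A form of B. H. Neumann's theorem that a group is not covered by finitely many cosets of subgroups of
infinite index, with symmetric sets \<open>P i\<close> in place of subgroups. The condition on products says that
finitely many translates of \<open>P i \<cdot> P i\<close> do not cover, and the last that each piece of the cover has its
quotients in some \<open>P i\<close>.\<close>

lemma (in group) neumann_covering:
  assumes "finite J"
    and "\<And>i p. i \<in> J \<Longrightarrow> p \<in> P i \<Longrightarrow> p \<in> carrier G \<and> inv p \<in> P i"
    and "\<And>i F. i \<in> J \<Longrightarrow> finite F \<Longrightarrow> F \<subseteq> carrier G \<Longrightarrow>
      \<exists>y\<in>carrier G. \<forall>p\<in>P i. \<forall>q\<in>P i. \<forall>f\<in>F. y \<noteq> p \<otimes> q \<otimes> f"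
    and "finite \<C>" "\<And>C. C \<in> \<C> \<Longrightarrow> C \<subseteq> carrier G"
    and "\<And>C. C \<in> \<C> \<Longrightarrow> \<exists>i\<in>J. \<forall>c\<in>C. \<forall>c'\<in>C. c \<otimes> inv c' \<in> P i"
  shows "\<Union>\<C> \<noteq> carrier G"
  using assms
proof (induction J arbitrary: \<C> rule: finite_induct)
  case empty
  have "C \<notin> \<C>" for C using empty.prems(5)[of C] by auto
  then have "\<C> = {}" by auto
  then have "\<Union>\<C> = {}" by simp
  then show ?case using one_closed by (metis empty_iff)
next
  case (insert i J)
  define \<C>2 where "\<C>2 = {C\<in>\<C>. \<exists>j\<in>J. \<forall>c\<in>C. \<forall>c'\<in>C. c \<otimes> inv c' \<in> P j}"
  define \<C>1 where "\<C>1 = {C\<in>\<C> - \<C>2. C \<noteq> {}}"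
  define r where "r C = (SOME c. c \<in> C)" for C :: "'a set"
  have r: "r C \<in> C" if "C \<in> \<C>1" for C
    unfolding r_def by (rule someI_ex) (use that in \<open>auto simp: \<C>1_def\<close>)
  have sub: "C \<subseteq> carrier G" if "C \<in> \<C>" for C using insert.prems that by simp
  have C1: "C \<in> \<C>" "\<And>c c'. c \<in> C \<Longrightarrow> c' \<in> C \<Longrightarrow> c \<otimes> inv c' \<in> P i" if "C \<in> \<C>1" for C
  proof -
    show "C \<in> \<C>" using that by (simp add: \<C>1_def)
    then obtain j where "j \<in> insert i J" "\<forall>c\<in>C. \<forall>c'\<in>C. c \<otimes> inv c' \<in> P j" using insert.prems(5) by blast
    moreover have "j \<notin> J"
    proof
      assume "j \<in> J"
      then have "C \<in> \<C>2" using \<open>C \<in> \<C>\<close> calculation(2) by (auto simp: \<C>2_def)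
      then show False using that by (simp add: \<C>1_def)
    qed
    ultimately show "\<And>c c'. c \<in> C \<Longrightarrow> c' \<in> C \<Longrightarrow> c \<otimes> inv c' \<in> P i" by auto
  qed
  have fin: "finite \<C>1" "finite \<C>2" using insert.prems(3) by (auto simp: \<C>1_def \<C>2_def)
  have rc: "r C \<in> carrier G" if "C \<in> \<C>1" for C using r[OF that] C1(1)[OF that] sub by blast
  have "\<exists>y\<in>carrier G. \<forall>p\<in>P i. \<forall>q\<in>P i. \<forall>f\<in>r ` \<C>1. y \<noteq> p \<otimes> q \<otimes> f"
    by (rule insert.prems(2)) (use fin rc in auto)
  then obtain y where y0: "y \<in> carrier G" "\<forall>p\<in>P i. \<forall>q\<in>P i. \<forall>f\<in>r ` \<C>1. y \<noteq> p \<otimes> q \<otimes> f"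
    by (elim bexE)
  have y: "y \<in> carrier G" "\<And>p q f. p \<in> P i \<Longrightarrow> q \<in> P i \<Longrightarrow> f \<in> r ` \<C>1 \<Longrightarrow> y \<noteq> p \<otimes> q \<otimes> f"
    by (rule y0(1), rule y0(2)[rule_format])
  show ?case
  proof
    assume cov: "\<Union>\<C> = carrier G"
    have py: "\<exists>C\<in>\<C>2. p \<otimes> y \<in> C" if p: "p \<in> P i" for p
    proof -
      have pc: "p \<in> carrier G" "inv p \<in> P i" using insert.prems(1)[of i p] p by auto
      then have "p \<otimes> y \<in> carrier G" using y(1) by simp
      then obtain C where C: "C \<in> \<C>" "p \<otimes> y \<in> C" using cov by blast
      show ?thesis
      proof (cases "C \<in> \<C>2")
        case False
        then have CC: "C \<in> \<C>1" using C by (auto simp: \<C>1_def)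
        have q: "(p \<otimes> y) \<otimes> inv (r C) \<in> P i" by (rule C1(2)[OF CC C(2) r[OF CC]])
        have "inv p \<otimes> ((p \<otimes> y) \<otimes> inv (r C)) \<otimes> r C = y"
          using pc(1) y(1) rc[OF CC] by (simp add: m_assoc) (simp add: m_assoc[symmetric])
        then show ?thesis using y(2)[OF pc(2) q, of "r C"] CC by auto
      qed (use C in blast)
    qed
    define tr where "tr C' C = (\<lambda>x. x \<otimes> (inv y \<otimes> r C)) ` C'" for C' C
    define \<C>' where "\<C>' = \<C>2 \<union> (\<lambda>(C', C). tr C' C) ` (\<C>2 \<times> \<C>1)"
    have zc: "inv y \<otimes> r C \<in> carrier G" if "C \<in> \<C>1" for C using y(1) rc[OF that] by simp
    have "\<Union>\<C>' \<noteq> carrier G"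
    proof (rule insert.IH)
      show "finite \<C>'" using fin by (simp add: \<C>'_def)
      show "C \<subseteq> carrier G" if "C \<in> \<C>'" for C
        using that sub zc unfolding \<C>'_def tr_def \<C>2_def by auto
      show "\<exists>j\<in>J. \<forall>c\<in>C. \<forall>c'\<in>C. c \<otimes> inv c' \<in> P j" if CC: "C \<in> \<C>'" for C
      proof (cases "C \<in> \<C>2")
        case True then show ?thesis by (simp add: \<C>2_def)
      next
        case False
        then obtain C' D where D: "C' \<in> \<C>2" "D \<in> \<C>1" "C = tr C' D" using CC by (auto simp: \<C>'_def)
        then obtain j where j: "j \<in> J" "\<And>c c'. c \<in> C' \<Longrightarrow> c' \<in> C' \<Longrightarrow> c \<otimes> inv c' \<in> P j" by (auto simp: \<C>2_def)
        have C': "C' \<subseteq> carrier G" using D(1) sub by (simp add: \<C>2_def)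
        define z where "z = inv y \<otimes> r D"
        have z: "z \<in> carrier G" using zc[OF D(2)] by (simp add: z_def)
        have "(a \<otimes> z) \<otimes> inv (b \<otimes> z) = a \<otimes> inv b" if "a \<in> C'" "b \<in> C'" for a b
        proof -
          have "a \<in> carrier G" "b \<in> carrier G" using that C' by blast+
          then show ?thesis using z by (simp add: inv_mult_group m_assoc) (simp add: m_assoc[symmetric])
        qed
        then show ?thesis using j unfolding D(3) tr_def z_def[symmetric] by (intro bexI[of _ j]) auto
      qed
    qed (use insert.prems in auto)
    moreover have "c \<in> \<Union>\<C>'" if c: "c \<in> carrier G" for c
    proof -
      obtain C where C: "C \<in> \<C>" "c \<in> C" using cov c by blast
      show ?thesis
      proof (cases "C \<in> \<C>2")
        case True then show ?thesis using C by (auto simp: \<C>'_def)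
      next
        case False
        then have CC: "C \<in> \<C>1" using C by (auto simp: \<C>1_def)
        obtain C' where C': "C' \<in> \<C>2" "(c \<otimes> inv (r C)) \<otimes> y \<in> C'"
          using py[OF C1(2)[OF CC C(2) r[OF CC]]] by blast
        have "((c \<otimes> inv (r C)) \<otimes> y) \<otimes> (inv y \<otimes> r C) = c"
        proof -
          have "y \<otimes> (inv y \<otimes> r C) = r C"
            using m_assoc[of y "inv y" "r C"] y(1) rc[OF CC] by simp
          then show ?thesis using c y(1) rc[OF CC] by (simp add: m_assoc)
        qed
        then have "c \<in> tr C' C" using C'(2) unfolding tr_def by force
        then show ?thesis using C'(1) CC by (auto simp: \<C>'_def)
      qed
    qed
    moreover have "\<Union>\<C>' \<subseteq> carrier G"
      using sub zc unfolding \<C>'_def tr_def \<C>2_def by auto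
    ultimately show False by blast
  qed
qed

section \<open>Invariant means\<close>

context definability
begin

declare a_closed [rule del] zero_closed [rule del] a_inv_closed [rule del] minus_closed [rule del]
  additive_subgroup.a_closed [rule del] additive_subgroup.a_inv_closed [rule del]

definition trans :: "'b \<Rightarrow> 'b set \<Rightarrow> 'b set" where
  "trans x B = {a\<in>carrier R. a \<ominus> x \<in> B}"

lemma trans_trans:
  assumes "x \<in> carrier R" "y \<in> carrier R" shows "trans x (trans y B) = trans (x \<oplus> y) B"
proof -
  have "(a \<ominus> x) \<ominus> y = a \<ominus> (x \<oplus> y)" if "a \<in> carrier R" for a
    using assms that by (simp add: group_simps)
  then show ?thesis using assms by (auto simp: trans_def)
qed

lemma trans_Int: "trans x (B \<inter> C) = trans x B \<inter> trans x C"
  by (auto simp: trans_def)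

lemma trans_Diff: "trans x (B - C) = trans x B - trans x C"
  by (auto simp: trans_def)

lemma trans_zero:
  assumes "B \<subseteq> carrier R" shows "trans \<zero> B = B"
proof -
  have "a \<ominus> \<zero> = a" if "a \<in> carrier R" for a
    using that add_eq_iff_eq_minus[of a \<zero> a] by simp
  then show ?thesis using assms by (auto simp: trans_def)
qed

definition additive_prob :: "('b set \<Rightarrow> real) \<Rightarrow> bool" where
  "additive_prob m \<longleftrightarrow> (\<forall>B. 0 \<le> m B \<and> m B \<le> 1) \<and> m (carrier R) = 1 \<and>
     (\<forall>B C. B \<inter> C = {} \<longrightarrow> m (B \<union> C) = m B + m C)"

definition approx_invariant :: "real \<Rightarrow> 'b \<Rightarrow> ('b set \<Rightarrow> real) \<Rightarrow> bool" where
  "approx_invariant \<epsilon> x m \<longleftrightarrow> (\<forall>B. \<bar>m (trans x B) - m B\<bar> \<le> \<epsilon>)"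

lemma ex_approx_invariant:
  assumes "finite X" "X \<subseteq> carrier R" "\<epsilon> > 0"
  shows "\<exists>m. additive_prob m \<and> (\<forall>x\<in>X. approx_invariant \<epsilon> x m)"
  using assms
proof (induction X rule: finite_induct)
  case empty
  have "additive_prob (\<lambda>B. if \<zero> \<in> B then 1 else 0)"
    unfolding additive_prob_def by auto
  then show ?case by blast
next
  case (insert x X)
  then obtain m where m: "additive_prob m" "\<And>y. y \<in> X \<Longrightarrow> approx_invariant \<epsilon> y m" by auto
  have x: "x \<in> carrier R" "X \<subseteq> carrier R" using insert.prems by auto
  define s where "s i = ((\<lambda>z. x \<oplus> z) ^^ i) \<zero>" for i :: nat
  have s: "s i \<in> carrier R" for i by (induction i) (use x in \<open>auto simp: s_def\<close>)
  have s_Suc: "s (Suc i) = x \<oplus> s i" for i by (simp add: s_def)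
  obtain N :: nat where N: "N > 0" "1 / real N \<le> \<epsilon>"
    using \<open>\<epsilon> > 0\<close> by (metis inverse_eq_divide less_imp_le neq0_conv of_nat_0_less_iff real_arch_inverse)
  define m' where "m' B = (\<Sum>i<N. m (trans (s i) B)) / real N" for B
  have mb: "0 \<le> m B" "m B \<le> 1" "m (carrier R) = 1" "B \<inter> C = {} \<Longrightarrow> m (B \<union> C) = m B + m C" for B C
    using m(1) by (auto simp: additive_prob_def)
  have "additive_prob m'"
    unfolding additive_prob_def
  proof (intro conjI allI impI)
    fix B
    show "0 \<le> m' B" unfolding m'_def by (intro divide_nonneg_nonneg sum_nonneg mb) simp
    have "(\<Sum>i<N. m (trans (s i) B)) \<le> (\<Sum>i<N. 1)" by (intro sum_mono mb)
    then show "m' B \<le> 1" using N(1) by (simp add: m'_def)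
    have "trans (s i) (carrier R) = carrier R" for i using s by (auto simp: trans_def)
    then show "m' (carrier R) = 1" using N(1) by (simp add: m'_def mb)
    fix C assume "B \<inter> C = {}"
    then have "trans z B \<inter> trans z C = {}" for z by (auto simp: trans_def)
    moreover have "trans z (B \<union> C) = trans z B \<union> trans z C" for z by (auto simp: trans_def)
    ultimately have "m (trans z (B \<union> C)) = m (trans z B) + m (trans z C)" for z using mb(4) by simp
    then show "m' (B \<union> C) = m' B + m' C"
      by (simp add: m'_def sum.distrib add_divide_distrib)
  qed
  moreover have "approx_invariant \<epsilon> y m'" if "y \<in> insert x X" for y
    unfolding approx_invariant_def
  proof
    fix B
    have y: "y \<in> carrier R" using that x by blast
    have comm: "trans (s i) (trans y B) = trans y (trans (s i) B)" for i
      using s y by (simp add: trans_trans a_comm)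
    have diff: "m' (trans y B) - m' B = (\<Sum>i<N. m (trans y (trans (s i) B)) - m (trans (s i) B)) / real N"
      by (simp add: m'_def comm sum_subtractf diff_divide_distrib)
    show "\<bar>m' (trans y B) - m' B\<bar> \<le> \<epsilon>"
    proof (cases "y \<in> X")
      case True
      have "\<bar>\<Sum>i<N. m (trans y (trans (s i) B)) - m (trans (s i) B)\<bar> \<le> (\<Sum>i<N. \<epsilon>)"
        by (rule order_trans[OF sum_abs sum_mono]) (use m(2)[OF True] in \<open>simp add: approx_invariant_def\<close>)
      then have "\<bar>\<Sum>i<N. m (trans y (trans (s i) B)) - m (trans (s i) B)\<bar> / real N \<le> \<epsilon>"
        using N(1) by (simp add: field_simps)
      then show ?thesis using diff N(1) by simp
    next
      case False
      then have "y = x" using that by simp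
      then have "trans y (trans (s i) B) = trans (s (Suc i)) B" for i
        using s x by (simp add: trans_trans s_Suc)
      then have "(\<Sum>i<N. m (trans y (trans (s i) B)) - m (trans (s i) B)) = m (trans (s N) B) - m (trans (s 0) B)"
        by (simp only: sum_lessThan_telescope[of "\<lambda>i. m (trans (s i) B)"])
      then have "\<bar>\<Sum>i<N. m (trans y (trans (s i) B)) - m (trans (s i) B)\<bar> \<le> 1"
        using mb(1,2)[of "trans (s N) B"] mb(1,2)[of "trans (s 0) B"] by linarith
      then have "\<bar>\<Sum>i<N. m (trans y (trans (s i) B)) - m (trans (s i) B)\<bar> / real N \<le> 1 / real N"
        by (intro divide_right_mono) simp_all
      then show ?thesis using diff N by simp
    qed
  qed
  ultimately show ?case by blast
qed

text \<open>Abelian groups are amenable. The means that are approximately invariant under finitely many translations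
are given by averaging over a long box; compactness of the product of unit intervals yields an
invariant one.\<close>

lemma invariant_mean:
  obtains \<mu> :: "'b set \<Rightarrow> real" where "additive_prob \<mu>"
    "\<And>x B. x \<in> carrier R \<Longrightarrow> \<mu> (trans x B) = \<mu> B"
proof -
  define U where "U = (PiE UNIV (\<lambda>_::'b set. {0..1::real}))"
  define S where "S = (\<lambda>(x, n::nat). {m. additive_prob m \<and> approx_invariant (1 / real (Suc n)) x m})"
  have cont: "continuous_on UNIV (\<lambda>m::'b set \<Rightarrow> real. m B)" for B
    by (rule continuous_on_product_coordinates)
  have "U \<inter> \<Inter>(S ` (carrier R \<times> UNIV)) \<noteq> {}"
  proof (rule compact_imp_fip)
    have "compactin (product_topology (\<lambda>_::'b set. euclidean) UNIV) U"
      unfolding U_def by (subst compactin_PiE) auto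
    then show "compact U" by (simp add: euclidean_product_topology)
  next
    fix T assume "T \<in> S ` (carrier R \<times> UNIV)"
    then obtain x n where T: "T = {m. additive_prob m \<and> approx_invariant (1 / real (Suc n)) x m}"
      by (auto simp: S_def)
    have T': "T = (\<Inter>B. {m. 0 \<le> m B}) \<inter> (\<Inter>B. {m. m B \<le> 1}) \<inter> {m. m (carrier R) = 1} \<inter>
      (\<Inter>(B, C)\<in>{(B, C). B \<inter> C = {}}. {m. m (B \<union> C) = m B + m C}) \<inter>
      (\<Inter>B. {m. \<bar>m (trans x B) - m B\<bar> \<le> 1 / real (Suc n)})"
      unfolding T additive_prob_def approx_invariant_def by auto
    show "closed T" unfolding T'
      by (intro closed_Int closed_INT ballI closed_Collect_le closed_Collect_eq continuous_on_const cont
         | (auto intro!: closed_Collect_le closed_Collect_eq continuous_intros cont))+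
  next
    fix F assume F: "finite F" "F \<subseteq> S ` (carrier R \<times> UNIV)"
    then obtain Z where Z: "finite Z" "Z \<subseteq> carrier R \<times> UNIV" "F = S ` Z" by (meson finite_subset_image)
    define n where "n = Max (insert 0 (snd ` Z))"
    have n: "snd z \<le> n" if "z \<in> Z" for z unfolding n_def using Z(1) that by (intro Max_ge) auto
    have "finite (fst ` Z)" "fst ` Z \<subseteq> carrier R" "1 / real (Suc n) > 0" using Z by auto
    then obtain m where m: "additive_prob m" "\<And>x. x \<in> fst ` Z \<Longrightarrow> approx_invariant (1 / real (Suc n)) x m"
      using ex_approx_invariant by meson
    have "m \<in> S z" if "z \<in> Z" for z
    proof -
      have "1 / real (Suc n) \<le> 1 / real (Suc (snd z))" using n[OF that] by (simp add: frac_le)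
      moreover have "approx_invariant (1 / real (Suc n)) (fst z) m" using m(2) that by blast
      ultimately have "approx_invariant (1 / real (Suc (snd z))) (fst z) m"
        unfolding approx_invariant_def by (meson order_trans)
      then show ?thesis using m(1) by (simp add: S_def case_prod_beta)
    qed
    moreover have "m \<in> U" using m(1) by (auto simp: U_def additive_prob_def)
    ultimately have "m \<in> U \<inter> \<Inter>F" using Z(3) by blast
    then show "U \<inter> \<Inter>F \<noteq> {}" by blast
  qed
  then obtain \<mu> where "\<mu> \<in> U \<inter> \<Inter>(S ` (carrier R \<times> UNIV))" by blast
  then have mu: "additive_prob \<mu> \<and> approx_invariant (1 / real (Suc n)) x \<mu>" if "x \<in> carrier R" for x n
    using that by (auto simp: S_def)
  have "\<mu> (trans x B) = \<mu> B" if "x \<in> carrier R" for x B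
  proof (rule ccontr)
    assume "\<mu> (trans x B) \<noteq> \<mu> B"
    then obtain n where "inverse (real (Suc n)) < \<bar>\<mu> (trans x B) - \<mu> B\<bar>"
      using reals_Archimedean[of "\<bar>\<mu> (trans x B) - \<mu> B\<bar>"] by auto
    moreover have "\<bar>\<mu> (trans x B) - \<mu> B\<bar> \<le> 1 / real (Suc n)"
      using mu[OF that, of n] by (simp add: approx_invariant_def)
    ultimately show False by (simp add: inverse_eq_divide)
  qed
  moreover have "additive_prob \<mu>" using mu[OF zero_closed] by simp
  ultimately show ?thesis by (intro that[of \<mu>])
qed

end

section \<open>Thick sets contain approximate subgroups\<close>

context definability
begin

primrec msum :: "nat \<Rightarrow> 'b set \<Rightarrow> 'b set" where
  "msum 0 D = {\<zero>}"
| "msum (Suc k) D = D \<boxplus> msum k D"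

lemma sumsetI: "x \<in> D \<Longrightarrow> y \<in> E \<Longrightarrow> x \<oplus> y \<in> D \<boxplus> E"
  by (auto simp: sumset_def)

lemma sumset_sub: "D \<subseteq> carrier R \<Longrightarrow> E \<subseteq> carrier R \<Longrightarrow> D \<boxplus> E \<subseteq> carrier R"
  by (auto simp: sumset_def subset_iff)

lemma sumset_mono: "D \<subseteq> D' \<Longrightarrow> E \<subseteq> E' \<Longrightarrow> D \<boxplus> E \<subseteq> D' \<boxplus> E'"
  by (auto simp: sumset_def)

lemma msum_sub: "D \<subseteq> carrier R \<Longrightarrow> msum k D \<subseteq> carrier R"
  by (induction k) (simp_all add: sumset_sub)

lemma msum_mono: "D \<subseteq> E \<Longrightarrow> msum k D \<subseteq> msum k E"
  by (induction k) (simp_all add: sumset_mono)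

lemma dset_msum: "dset D \<Longrightarrow> dset (msum k D)"
  by (induction k) (simp_all add: dset_zero dset_sumset)

lemma sumset_assoc:
  assumes "D \<subseteq> carrier R" "E \<subseteq> carrier R" "F \<subseteq> carrier R"
  shows "(D \<boxplus> E) \<boxplus> F = D \<boxplus> (E \<boxplus> F)"
proof -
  have eq: "(x \<oplus> y) \<oplus> z = x \<oplus> (y \<oplus> z)" if "x \<in> D" "y \<in> E" "z \<in> F" for x y z
    by (rule a_assoc) (use that assms in blast)+
  show ?thesis
  proof (intro equalityI subsetI)
    fix w assume "w \<in> (D \<boxplus> E) \<boxplus> F"
    then obtain x y z where "w = (x \<oplus> y) \<oplus> z" "x \<in> D" "y \<in> E" "z \<in> F" by (auto simp: sumset_def)
    then show "w \<in> D \<boxplus> (E \<boxplus> F)" using eq by (simp add: sumsetI)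
  next
    fix w assume "w \<in> D \<boxplus> (E \<boxplus> F)"
    then obtain x y z where w: "w = x \<oplus> (y \<oplus> z)" "x \<in> D" "y \<in> E" "z \<in> F" by (auto simp: sumset_def)
    then have "w = (x \<oplus> y) \<oplus> z" using eq by simp
    then show "w \<in> (D \<boxplus> E) \<boxplus> F" using w by (simp add: sumsetI)
  qed
qed

lemma zero_sumset:
  assumes "E \<subseteq> carrier R" shows "{\<zero>} \<boxplus> E = E"
proof -
  have "\<zero> \<oplus> x = x" if "x \<in> E" for x by (rule l_zero) (use that assms in blast)
  then show ?thesis by (auto simp: sumset_def) metis
qed

lemma msum_add:
  assumes "D \<subseteq> carrier R" shows "msum j D \<boxplus> msum k D = msum (j + k) D"
proof (induction j)
  case 0
  then show ?case by (simp add: zero_sumset msum_sub assms)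
next
  case (Suc j)
  then show ?case by (simp add: sumset_assoc msum_sub assms)
qed

lemma msum_superset:
  assumes "D \<subseteq> carrier R" "\<zero> \<in> D" "k > 0" shows "D \<subseteq> msum k D"
proof -
  have z: "\<zero> \<in> msum j D" for j
    by (induction j) (use assms sumsetI[of \<zero> D \<zero>] in auto)
  obtain j where "k = Suc j" using assms(3) gr0_implies_Suc by blast
  moreover have "x \<in> D \<boxplus> msum j D" if "x \<in> D" for x
  proof -
    have "x \<in> carrier R" using that assms by blast
    then show ?thesis using sumsetI[OF that z[of j]] by simp
  qed
  ultimately show ?thesis by auto
qed

lemma neg_eqD: "neg D = D \<Longrightarrow> x \<in> D \<Longrightarrow> \<ominus> x \<in> D"
  by (metis (mono_tags, lifting) mem_Collect_eq neg_def)

lemma neg_eqI: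
  assumes "D \<subseteq> carrier R" "\<And>x. x \<in> D \<Longrightarrow> \<ominus> x \<in> D" shows "neg D = D"
proof (intro equalityI subsetI)
  fix x assume "x \<in> neg D"
  then have "x \<in> carrier R" "\<ominus> x \<in> D" by (auto simp: neg_def)
  then show "x \<in> D" using assms(2)[of "\<ominus> x"] by simp
qed (use assms in \<open>auto simp: neg_def\<close>)

lemma msum_minus:
  assumes "D \<subseteq> carrier R" "neg D = D" "x \<in> msum k D" shows "\<ominus> x \<in> msum k D"
  using assms(3)
proof (induction k arbitrary: x)
  case (Suc k)
  then obtain y z where x: "x = y \<oplus> z" "y \<in> D" "z \<in> msum k D" by (auto simp: sumset_def)
  then have "y \<in> carrier R" "z \<in> carrier R" using assms(1) msum_sub[OF assms(1)] by blast+
  then have "\<ominus> x = \<ominus> y \<oplus> \<ominus> z" using x(1) by (simp add: minus_add)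
  then show ?case using sumsetI[OF neg_eqD[OF assms(2) x(2)] Suc.IH[OF x(3)]] by simp
qed simp

lemma neg_msum: "D \<subseteq> carrier R \<Longrightarrow> neg D = D \<Longrightarrow> neg (msum k D) = msum k D"
  by (rule neg_eqI[OF msum_sub]) (simp_all add: msum_minus)

lemma thick_Int_neg:
  assumes "thick D" shows "thick (D \<inter> neg D)"
proof -
  obtain n where n: "nthick n D" using assms by (auto simp: thick_def)
  have "nthick n (D \<inter> neg D)" unfolding nthick_def
  proof (intro allI impI notI)
    fix Y assume Y: "Y \<subseteq> carrier R \<and> finite Y \<and> card Y = n" and s: "sep (D \<inter> neg D) Y"
    have "sep D Y" unfolding sep_def
    proof (intro ballI impI notI)
      fix x y assume xy: "x \<in> Y" "y \<in> Y" "x \<noteq> y" "x \<ominus> y \<in> D \<and> y \<ominus> x \<in> D"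
      then have c: "x \<in> carrier R" "y \<in> carrier R" using Y by auto
      then have "x \<ominus> y \<in> neg D" "y \<ominus> x \<in> neg D"
        using xy(4) by (simp_all add: neg_def minus_minus_eq)
      then show False using s xy unfolding sep_def by blast
    qed
    then show False using n Y unfolding nthick_def by blast
  qed
  then show ?thesis by (auto simp: thick_def)
qed

text \<open>A definable substitute for a lower bound on a mean, which need not be definable itself: \<open>B\<close> is large
if for a thick set of \<open>z\<close> the intersection of \<open>B\<close> with its translate by \<open>z\<close> is large one level lower.\<close>

primrec large :: "nat list \<Rightarrow> 'b set \<Rightarrow> bool" where
  "large [] B \<longleftrightarrow> (\<exists>b\<in>carrier R. b \<in> B)"
| "large (n # ns) B \<longleftrightarrow> (\<exists>b\<in>carrier R. b \<in> B) \<and> nthick n {z\<in>carrier R. large ns (B \<inter> trans z B)}"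

lemma fo_large:
  assumes "fo (\<lambda>e. e 0 \<in> B (\<lambda>i. e (Suc i)))"
  shows "fo (\<lambda>e. large ns (B e))"
  using assms
proof (induction ns arbitrary: B)
  case Nil
  then have "fo (\<lambda>e. \<exists>b\<in>carrier R. b \<in> B e)" by (rule fo_bex)
  then show ?case by simp
next
  case (Cons n ns)
  have s: "fo (\<lambda>e. e 0 \<in> B (\<lambda>i. e (Suc (Suc i))))"
    using fo_subst[OF Cons.prems, of "\<lambda>i. case i of 0 \<Rightarrow> 0 | Suc i \<Rightarrow> Suc (Suc i)"] by simp
  have d: "fot (\<lambda>e. e 0 \<ominus> e (Suc 0))" by (intro fot_diff fot_var)
  have s3: "fo (\<lambda>e. e 0 \<in> B (\<lambda>i. e (Suc (Suc (Suc i)))))"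
    using fo_subst[OF Cons.prems, of "\<lambda>i. case i of 0 \<Rightarrow> 0 | Suc i \<Rightarrow> Suc (Suc (Suc i))"] by simp
  have "fo (\<lambda>e. e 0 \<ominus> e (Suc 0) \<in> B (\<lambda>i. e (Suc (Suc i))))"
    by (rule fo_term[OF d, of "\<lambda>y e. y \<in> B (\<lambda>i. e (Suc (Suc i)))"]) (rule s3)
  with s have "fo (\<lambda>e. e 0 \<in> B (\<lambda>i. e (Suc (Suc i))) \<and> e 0 \<ominus> e (Suc 0) \<in> B (\<lambda>i. e (Suc (Suc i))))"
    by (rule fo_conj)
  then have "fo (\<lambda>e. e 0 \<in> B (\<lambda>i. e (Suc (Suc i))) \<inter> trans (e (Suc 0)) (B (\<lambda>i. e (Suc (Suc i)))))"
    by (rule fo_cong') (simp add: trans_def)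
  then have "fo (\<lambda>e. large ns (B (\<lambda>i. e (Suc i)) \<inter> trans (e 0) (B (\<lambda>i. e (Suc i)))))"
    by (rule Cons.IH[of "\<lambda>e. B (\<lambda>i. e (Suc i)) \<inter> trans (e 0) (B (\<lambda>i. e (Suc i)))"])
  then have "fo (\<lambda>e. e 0 \<in> {z\<in>carrier R. large ns (B (\<lambda>i. e (Suc i)) \<inter> trans z (B (\<lambda>i. e (Suc i))))})"
    by (rule fo_cong') simp
  then have "fo (\<lambda>e. nthick n {z\<in>carrier R. large ns (B e \<inter> trans z (B e))})"
    by (rule fo_nthick)
  then show ?case using fo_bex[OF Cons.prems] by (simp add: fo_conj)
qed

end

context definability
begin

context
  fixes \<mu> :: "'b set \<Rightarrow> real"
  assumes mu: "additive_prob \<mu>" and mu_trans: "\<And>x B. x \<in> carrier R \<Longrightarrow> \<mu> (trans x B) = \<mu> B"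
begin

lemma mu_basic: "0 \<le> \<mu> B" "\<mu> B \<le> 1" "\<mu> (carrier R) = 1" "B \<inter> C = {} \<Longrightarrow> \<mu> (B \<union> C) = \<mu> B + \<mu> C"
  using mu by (auto simp: additive_prob_def)

lemma mu_split: "\<mu> B = \<mu> (B \<inter> C) + \<mu> (B - C)"
  using mu_basic(4)[of "B \<inter> C" "B - C"] by (simp add: Int_Diff_Un Int_Diff_disjoint)

lemma mu_mono: "B \<subseteq> C \<Longrightarrow> \<mu> B \<le> \<mu> C"
  using mu_split[of C B] mu_basic(1)[of "C - B"] by (simp add: Int_absorb1)

lemma mu_empty: "\<mu> {} = 0"
  using mu_basic(4)[of "{}" "{}"] by simp

lemma mu_Un: "\<mu> (B \<union> C) = \<mu> B + \<mu> C - \<mu> (B \<inter> C)"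
  using mu_basic(4)[of B "C - B"] mu_split[of C B] by (simp add: Int_commute)

lemma mu_Un_le: "\<mu> (B \<union> C) \<le> \<mu> B + \<mu> C"
  using mu_Un[of B C] mu_basic(1)[of "B \<inter> C"] by simp

lemma mu_UN_le: "finite I \<Longrightarrow> \<mu> (\<Union>i\<in>I. B i) \<le> (\<Sum>i\<in>I. \<mu> (B i))"
proof (induction I rule: finite_induct)
  case (insert i I)
  then show ?case using mu_Un_le[of "B i" "\<Union>i\<in>I. B i"] by simp
qed (simp add: mu_empty)

text \<open>If many translates of a set of measure at least \<open>t\<close> had pairwise small intersections, their
  union would have measure greater than 1.\<close>

lemma mu_union_translates:
  assumes "finite Y" "Y \<subseteq> carrier R" "t \<le> \<mu> B" "0 \<le> s"
    "\<And>x y. x \<in> Y \<Longrightarrow> y \<in> Y \<Longrightarrow> x \<noteq> y \<Longrightarrow> \<mu> (trans x B \<inter> trans y B) \<le> s"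
  shows "real (card Y) * t - real (card Y) ^ 2 * s \<le> \<mu> (\<Union>y\<in>Y. trans y B)"
  using assms
proof (induction Y rule: finite_induct)
  case empty
  then show ?case by (simp add: mu_empty)
next
  case (insert y Y)
  have IH: "real (card Y) * t - real (card Y) ^ 2 * s \<le> \<mu> (\<Union>y\<in>Y. trans y B)"
    by (rule insert.IH) (use insert.prems in auto)
  have "trans y B \<inter> (\<Union>z\<in>Y. trans z B) = (\<Union>z\<in>Y. trans y B \<inter> trans z B)"
    by (rule Int_UN_distrib)
  then have "\<mu> (trans y B \<inter> (\<Union>z\<in>Y. trans z B)) \<le> (\<Sum>z\<in>Y. \<mu> (trans y B \<inter> trans z B))"
    using mu_UN_le[OF insert.hyps(1), of "\<lambda>z. trans y B \<inter> trans z B"] by (simp only:)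
  also have "\<dots> \<le> (\<Sum>z\<in>Y. s)"
    by (rule sum_mono, rule insert.prems(4)) (use insert.hyps in auto)
  finally have "\<mu> (trans y B \<inter> (\<Union>z\<in>Y. trans z B)) \<le> real (card Y) * s" by simp
  moreover have "\<mu> (trans y B) \<ge> t" using mu_trans insert.prems by simp
  ultimately have "\<mu> (\<Union>z\<in>insert y Y. trans z B) \<ge> t + (real (card Y) * t - real (card Y) ^ 2 * s) - real (card Y) * s"
    using IH mu_Un[of "trans y B" "\<Union>z\<in>Y. trans z B"] by simp
  moreover have "(real (card Y) + 1) ^ 2 * s \<ge> real (card Y) ^ 2 * s + real (card Y) * s"
  proof -
    have "(real (card Y) + 1) ^ 2 * s - (real (card Y) ^ 2 * s + real (card Y) * s) = (real (card Y) + 1) * s"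
      by (simp add: power2_eq_square algebra_simps)
    moreover have "0 \<le> (real (card Y) + 1) * s" using insert.prems(3) by simp
    ultimately show ?thesis by linarith
  qed
  moreover have "real (card (insert y Y)) = real (card Y) + 1" using insert.hyps by simp
  ultimately show ?case by (simp add: algebra_simps)
qed

text \<open>If too many translates of \<open>B\<close> had pairwise small intersections then their union would have mean
greater than 1. The recursion for \<open>t\<close> is the loss of this estimate, and \<open>2 / t i\<close> translates suffice
for the contradiction.\<close>

lemma large_of_measure:
  assumes t: "\<And>i. 0 < t i" "\<And>i. t i \<le> (1::real)" "\<And>i. t (Suc i) = (t i)\<^sup>2 / 18"
    and n: "\<And>i. n i = nat \<lceil>2 / t i\<rceil>"
    and B: "t i \<le> \<mu> B" "B \<subseteq> carrier R"
  shows "large (map n [i..<i + l]) B"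
  using B
proof (induction l arbitrary: i B)
  case 0
  then have "\<mu> B > 0" using t(1)[of i] by linarith
  then have "B \<noteq> {}" using mu_empty by auto
  then show ?case using 0 by auto
next
  case (Suc l)
  let ?ns = "map n [Suc i..<Suc i + l]"
  let ?Z = "{z\<in>carrier R. large ?ns (B \<inter> trans z B)}"
  have "\<not> sep ?Z Y" if Y: "Y \<subseteq> carrier R" "finite Y" "card Y = n i" for Y
  proof
    assume s: "sep ?Z Y"
    have "\<mu> (trans x B \<inter> trans y B) \<le> t (Suc i)" if xy: "x \<in> Y" "y \<in> Y" "x \<noteq> y" for x y
    proof (rule ccontr)
      assume a: "\<not> \<mu> (trans x B \<inter> trans y B) \<le> t (Suc i)"
      have c: "x \<in> carrier R" "y \<in> carrier R" using xy Y by blast+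
      have in_Z: "u \<ominus> v \<in> ?Z" if uv: "u \<in> carrier R" "v \<in> carrier R" "\<mu> (trans u B \<inter> trans v B) = \<mu> (trans x B \<inter> trans y B)" for u v
      proof -
        have "trans v (trans (u \<ominus> v) B \<inter> B) = trans u B \<inter> trans v B"
          using uv by (simp add: trans_Int trans_trans group_simps)
        then have "\<mu> (trans (u \<ominus> v) B \<inter> B) = \<mu> (trans u B \<inter> trans v B)" using mu_trans[OF uv(2)] by metis
        then have "t (Suc i) \<le> \<mu> (B \<inter> trans (u \<ominus> v) B)" using a uv(3) by (simp add: Int_commute)
        then have "large ?ns (B \<inter> trans (u \<ominus> v) B)" by (rule Suc.IH) (use Suc.prems in auto)
        then show ?thesis using uv by simp
      qed
      have "x \<ominus> y \<in> ?Z" "y \<ominus> x \<in> ?Z" using in_Z[OF c] in_Z[OF c(2,1)] by (simp_all add: Int_commute)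
      then show False using s xy unfolding sep_def by blast
    qed
    then have "real (n i) * t i - real (n i) ^ 2 * t (Suc i) \<le> \<mu> (\<Union>y\<in>Y. trans y B)"
      using mu_union_translates[OF Y(2,1) Suc.prems(1) less_imp_le[OF t(1)[of "Suc i"]]] Y(3) by simp
    also have "\<dots> \<le> 1" by (rule mu_basic)
    finally have le: "real (n i) * t i - real (n i) ^ 2 * t (Suc i) \<le> 1" .
    have pos: "2 / t i > 0" using t(1) by simp
    have n1: "2 / t i \<le> real (n i)" unfolding n by linarith
    have "real (n i) \<le> 2 / t i + 1" unfolding n using pos by linarith
    also have "\<dots> \<le> 3 / t i" using t(1)[of i] t(2)[of i] by (simp add: field_simps)
    finally have n2: "real (n i) * t i \<le> 3" using t(1)[of i] by (simp add: field_simps)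
    have n3: "real (n i) * t i \<ge> 2" using n1 t(1)[of i] by (simp add: field_simps)
    have "real (n i) ^ 2 * t (Suc i) = (real (n i) * t i)\<^sup>2 / 18" by (simp add: t(3) power_mult_distrib)
    also have "\<dots> \<le> 3\<^sup>2 / 18" using n2 n3 by (intro divide_right_mono power_mono) auto
    finally show False using le n3 by simp
  qed
  then have "nthick (n i) ?Z" by (simp add: nthick_def)
  moreover have "map n [i..<i + Suc l] = n i # ?ns"
    by (subst upt_conv_Cons) auto
  moreover have "\<exists>b\<in>carrier R. b \<in> B"
  proof -
    have "\<mu> B > 0" using t(1)[of i] Suc.prems(1) by linarith
    then have "B \<noteq> {}" using mu_empty by auto
    then show ?thesis using Suc.prems(2) by auto
  qed
  ultimately show ?case by simp
qed

lemma mu_thick_pos: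
  assumes "thick D" "\<zero> \<in> D" "D \<subseteq> carrier R" shows "\<mu> D > 0"
proof -
  obtain Y where Y: "Y \<subseteq> carrier R" "finite Y" "\<And>x. x \<in> carrier R \<Longrightarrow> \<exists>y\<in>Y. x \<ominus> y \<in> D"
    using thick_cover[OF assms(1,2)] by blast
  have "carrier R \<subseteq> (\<Union>y\<in>Y. trans y D)" using Y(3) unfolding trans_def by auto
  then have "1 \<le> \<mu> (\<Union>y\<in>Y. trans y D)" using mu_mono mu_basic(3) by metis
  also have "\<dots> \<le> (\<Sum>y\<in>Y. \<mu> (trans y D))" by (rule mu_UN_le[OF Y(2)])
  also have "\<dots> = (\<Sum>y\<in>Y. \<mu> D)" by (rule sum.cong[OF refl], rule mu_trans) (use Y(1) in blast)
  finally have "1 \<le> real (card Y) * \<mu> D" by simp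
  moreover have "\<mu> D \<noteq> 0" using calculation by auto
  ultimately show ?thesis using mu_basic(1)[of D] by simp
qed

lemma mu_Diff_trans_sum:
  assumes "\<And>x. x \<in> E \<Longrightarrow> \<mu> (U - trans x U) \<le> \<delta>" "E \<subseteq> carrier R" "U \<subseteq> carrier R" "z \<in> msum k E"
  shows "\<mu> (U - trans z U) \<le> real k * \<delta>"
  using assms(4)
proof (induction k arbitrary: z)
  case 0
  then show ?case using assms(3) by (simp add: trans_zero mu_empty)
next
  case (Suc k)
  then obtain x y where z: "z = x \<oplus> y" "x \<in> E" "y \<in> msum k E" by (auto simp: sumset_def)
  then have c: "x \<in> carrier R" "y \<in> carrier R" using assms(2) msum_sub[OF assms(2)] by blast+
  have "U - trans z U \<subseteq> (U - trans x U) \<union> trans x (U - trans y U)"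
    using c unfolding z(1) trans_Diff trans_trans[OF c] by blast
  then have "\<mu> (U - trans z U) \<le> \<mu> ((U - trans x U) \<union> trans x (U - trans y U))" by (rule mu_mono)
  also have "\<dots> \<le> \<mu> (U - trans x U) + \<mu> (trans x (U - trans y U))" by (rule mu_Un_le)
  also have "\<dots> \<le> \<delta> + real k * \<delta>" using assms(1)[OF z(2)] Suc.IH[OF z(3)] mu_trans[OF c(1)] by simp
  finally show ?case by (simp add: algebra_simps)
qed

text \<open>The core of the argument: pigeonhole on the scale \<open>i\<close>.\<close>

text \<open>Among the large sets \<open>B \<subseteq> D\<close> of level \<open>i\<close> consider the infimum of the mean of \<open>B + D\<close>. For some level this
infimum hardly changes at the next level. If \<open>B\<close> is nearly minimal there, and \<open>E\<close> is the set of \<open>x\<close> for which the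
intersection of \<open>B\<close> with its translate is large at the next level, then \<open>B + D\<close> is nearly invariant under \<open>E\<close>.
Eight steps still leave an intersection, which puts \<open>8 E\<close> inside differences of \<open>B + D\<close>, hence in \<open>4 D\<close>.\<close>

lemma massicot_wagner_mean:
  assumes const: "\<And>x. x \<in> carrier R \<Longrightarrow> fot (\<lambda>e. x)"
    and D: "dset D" "thick D" "neg D = D" "\<zero> \<in> D"
  shows "\<exists>E. dset E \<and> thick E \<and> neg E = E \<and> \<zero> \<in> E \<and> msum 8 E \<subseteq> msum 4 D"
proof -
  have DR: "D \<subseteq> carrier R" by (rule dset_sub[OF D(1)])
  define d where "d = \<mu> D"
  have d: "0 < d" "d \<le> 1" using mu_thick_pos[OF D(2,4) DR] mu_basic(2) by (auto simp: d_def)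
  define t where "t = rec_nat d (\<lambda>_ x. x\<^sup>2 / 18)"
  have tS: "t (Suc i) = (t i)\<^sup>2 / 18" "t 0 = d" for i by (simp_all add: t_def)
  have t: "0 < t i \<and> t i \<le> d" for i
  proof (induction i)
    case (Suc i)
    then have "(t i)\<^sup>2 / 18 \<le> t i" using d(2) by (simp add: power2_eq_square mult_le_cancel_right1)
    moreover have "0 < (t i)\<^sup>2 / 18" using Suc by simp
    ultimately show ?case using Suc tS(1)[of i] by linarith
  qed (use d tS in auto)
  define n where "n i = nat \<lceil>2 / t i\<rceil>" for i
  obtain r :: nat where r: "(31/32::real) ^ r < d" using real_arch_pow_inv[OF d(1), of "31/32"] by auto
  define ns where "ns i = map n [i..<r]" for i
  define \<B> where "\<B> i = {B. dset B \<and> B \<subseteq> D \<and> large (ns i) B}" for i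
  define f where "f i = Inf ((\<lambda>B. \<mu> (B \<boxplus> D)) ` \<B> i)" for i
  have D_in: "D \<in> \<B> i" if "i \<le> r" for i
  proof -
    have "large (map n [i..<i + (r - i)]) D"
      by (rule large_of_measure[of t]) (use t d tS DR n_def in \<open>auto simp: d_def[symmetric] intro: order_trans\<close>)
    then show ?thesis using that D(1) by (simp add: \<B>_def ns_def)
  qed
  have ge_d: "d \<le> \<mu> (B \<boxplus> D)" if B: "B \<in> \<B> i" for i B
  proof -
    have "large (ns i) B" using B by (simp add: \<B>_def)
    then obtain b where b: "b \<in> carrier R" "b \<in> B" by (cases "ns i") auto
    have "trans b D \<subseteq> B \<boxplus> D"
    proof
      fix a assume "a \<in> trans b D"
      then have a: "a \<in> carrier R" "a \<ominus> b \<in> D" by (auto simp: trans_def)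
      then have "a = b \<oplus> (a \<ominus> b)" using b by (simp add: group_simps)
      then show "a \<in> B \<boxplus> D" using sumsetI[OF b(2) a(2)] by simp
    qed
    then have "\<mu> (trans b D) \<le> \<mu> (B \<boxplus> D)" by (rule mu_mono)
    then show ?thesis using mu_trans[OF b(1), of D] by (simp add: d_def)
  qed
  have bdd: "bdd_below ((\<lambda>B. \<mu> (B \<boxplus> D)) ` \<B> i)" for i
    using mu_basic(1) by (intro bdd_belowI[of _ 0]) auto
  have f_le: "f i \<le> \<mu> (B \<boxplus> D)" if "B \<in> \<B> i" for i B
    unfolding f_def by (rule cInf_lower[OF _ bdd]) (use that in simp)
  have f_ge: "d \<le> f i" if "i \<le> r" for i
    unfolding f_def by (rule cInf_greatest) (use D_in[OF that] ge_d in auto)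
  have "\<exists>i<r. (31/32) * f i \<le> f (Suc i)"
  proof (rule ccontr)
    assume a: "\<not> (\<exists>i<r. (31/32) * f i \<le> f (Suc i))"
    have "f i \<le> (31/32) ^ i" if "i \<le> r" for i
      using that
    proof (induction i)
      case 0
      then show ?case using f_le[OF D_in[of 0]] mu_basic(2)[of "D \<boxplus> D"] by simp
    next
      case (Suc i)
      then have "\<not> (31/32) * f i \<le> f (Suc i)" using a by auto
      then show ?case using Suc by simp
    qed
    then show False using f_ge[of r] r by (metis linorder_not_less order_refl order_trans)
  qed
  then obtain i where i: "i < r" "(31/32) * f i \<le> f (Suc i)" by blast
  have fpos: "0 < f i" using f_ge[of i] i(1) d(1) by simp
  have "\<exists>u\<in>(\<lambda>B. \<mu> (B \<boxplus> D)) ` \<B> i. u < (33/32) * f i"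
    by (rule cInf_lessD) (use D_in[of i] i(1) fpos in \<open>auto simp: f_def[symmetric]\<close>)
  then obtain B where B: "B \<in> \<B> i" "\<mu> (B \<boxplus> D) < (33/32) * f i" by blast
  have Bd: "dset B" "B \<subseteq> D" "large (ns i) B" using B(1) by (auto simp: \<B>_def)
  have BR: "B \<subseteq> carrier R" using Bd(2) DR by blast
  define U where "U = B \<boxplus> D"
  have UR: "U \<subseteq> carrier R" unfolding U_def by (rule sumset_sub[OF BR DR])
  have upos: "0 < \<mu> U" using ge_d[OF B(1)] d(1) by (simp add: U_def)
  define E0 where "E0 = {z\<in>carrier R. large (ns (Suc i)) (B \<inter> trans z B)}"
  have ns_i: "ns i = n i # ns (Suc i)" using i(1) by (simp add: ns_def upt_conv_Cons)
  have tE0: "thick E0" using Bd(3) unfolding ns_i thick_def E0_def by auto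
  have dtr: "fo (\<lambda>e. e 0 \<in> B \<inter> trans (e (Suc 0)) B)"
  proof -
    have "fo (\<lambda>e. e 0 \<in> B \<and> e 0 \<ominus> e (Suc 0) \<in> B)" by (intro fo_intros Bd(1))
    then show ?thesis by (rule fo_cong') (simp add: trans_def)
  qed
  then have "fo (\<lambda>e. large (ns (Suc i)) (B \<inter> trans (e 0) B))" by (rule fo_large[of "\<lambda>e. B \<inter> trans (e 0) B"])
  then have dE0: "dset E0" unfolding E0_def by (rule dset_Collect)
  have dtr': "dset (B \<inter> trans z B)" if z: "z \<in> E0" for z
  proof -
    have zc: "z \<in> carrier R" using z by (simp add: E0_def)
    have "fo (\<lambda>e. \<forall>y\<in>carrier R. y = z \<longrightarrow> e 0 \<in> B \<and> e 0 \<ominus> y \<in> B)"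
      by (intro fo_intros Bd(1) const zc)
    then have "dset {x\<in>carrier R. \<forall>y\<in>carrier R. y = z \<longrightarrow> x \<in> B \<and> x \<ominus> y \<in> B}" by (rule dset_Collect)
    moreover have "{x\<in>carrier R. \<forall>y\<in>carrier R. y = z \<longrightarrow> x \<in> B \<and> x \<ominus> y \<in> B} = B \<inter> trans z B"
      using zc by (auto simp: trans_def)
    ultimately show ?thesis by simp
  qed
  have diff: "\<mu> (U - trans x U) \<le> (2/33) * \<mu> U" if x: "x \<in> E0" for x
  proof -
    have xc: "x \<in> carrier R" using x by (simp add: E0_def)
    have "B \<inter> trans x B \<in> \<B> (Suc i)"
      using x dtr'[OF x] Bd(2) by (auto simp: \<B>_def E0_def)
    then have "f (Suc i) \<le> \<mu> ((B \<inter> trans x B) \<boxplus> D)" by (rule f_le)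
    also have "\<dots> \<le> \<mu> (U \<inter> trans x U)"
    proof (rule mu_mono, rule subsetI)
      fix w assume "w \<in> (B \<inter> trans x B) \<boxplus> D"
      then obtain b a where w: "w = b \<oplus> a" "b \<in> B" "b \<ominus> x \<in> B" "a \<in> D" by (auto simp: sumset_def trans_def)
      then have c: "b \<in> carrier R" "a \<in> carrier R" using BR DR by blast+
      then have "w \<ominus> x = (b \<ominus> x) \<oplus> a" using w(1) xc by (simp add: group_simps)
      then show "w \<in> U \<inter> trans x U"
        using w c by (simp add: U_def trans_def sumsetI)
    qed
    finally have "f (Suc i) \<le> \<mu> (U \<inter> trans x U)" .
    then show ?thesis using mu_split[of U "trans x U"] i(2) B(2) unfolding U_def[symmetric] by linarith
  qed
  define E where "E = insert \<zero> (E0 \<inter> neg E0)"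
  have E0R: "E0 \<subseteq> carrier R" by (auto simp: E0_def)
  have ER: "E \<subseteq> carrier R" using E0R by (auto simp: E_def)
  have diffE: "\<mu> (U - trans x U) \<le> (2/33) * \<mu> U" if "x \<in> E" for x
    using that diff trans_zero[OF UR] upos by (auto simp: E_def mu_empty)
  have "msum 8 E \<subseteq> msum 4 D"
  proof
    fix z assume z: "z \<in> msum 8 E"
    then have zc: "z \<in> carrier R" using msum_sub[OF ER] by blast
    have "\<mu> (U - trans z U) \<le> real 8 * ((2/33) * \<mu> U)"
      by (rule mu_Diff_trans_sum[OF diffE ER UR z])
    also have "\<dots> < \<mu> U" using upos by simp
    finally have "U \<inter> trans z U \<noteq> {}" by (auto simp: Diff_triv)
    then obtain a where a: "a \<in> U" "a \<ominus> z \<in> U" by (auto simp: trans_def)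
    have U2: "U \<subseteq> msum 2 D"
    proof
      fix w assume "w \<in> U"
      then obtain b c where w: "w = b \<oplus> c" "b \<in> B" "c \<in> D" by (auto simp: U_def sumset_def)
      moreover have "c \<in> carrier R" using w DR by blast
      ultimately have "w = b \<oplus> (c \<oplus> \<zero>)" by simp
      moreover have "b \<oplus> (c \<oplus> \<zero>) \<in> D \<boxplus> (D \<boxplus> {\<zero>})" using w Bd(2) by (intro sumsetI) auto
      ultimately show "w \<in> msum 2 D" by (simp add: numeral_2_eq_2)
    qed
    have c: "a \<in> carrier R" "a \<ominus> z \<in> carrier R" using a UR by blast+
    have "z = a \<oplus> (\<ominus> (a \<ominus> z))" using c zc by (simp add: group_simps)
    moreover have "a \<oplus> (\<ominus> (a \<ominus> z)) \<in> msum 2 D \<boxplus> msum 2 D"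
      using a U2 by (intro sumsetI msum_minus[OF DR D(3)]) auto
    ultimately show "z \<in> msum 4 D" using msum_add[OF DR, of 2 2] by simp
  qed
  moreover have "dset E"
    using dset_Un[OF dset_zero dset_Int[OF dE0 dset_neg[OF dE0]]] by (simp add: E_def)
  moreover have "thick E" by (rule thick_mono[OF thick_Int_neg[OF tE0]]) (auto simp: E_def)
  moreover have "neg E = E"
    by (rule neg_eqI[OF ER]) (use E0R in \<open>auto simp: E_def neg_def\<close>)
  moreover have "\<zero> \<in> E" by (simp add: E_def)
  ultimately show ?thesis by blast
qed

end

lemma massicot_wagner:
  assumes const: "\<And>x. x \<in> carrier R \<Longrightarrow> fot (\<lambda>e. x)"
    and "dset D" "thick D" "neg D = D" "\<zero> \<in> D"
  obtains E where "dset E" "thick E" "neg E = E" "\<zero> \<in> E" "msum 8 E \<subseteq> msum 4 D"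
proof -
  obtain \<mu> where "additive_prob \<mu>" "\<And>x B. x \<in> carrier R \<Longrightarrow> \<mu> (trans x B) = \<mu> B"
    using invariant_mean by metis
  from massicot_wagner_mean[OF this const assms(2-5)] show ?thesis using that by blast
qed

end

section \<open>Invariant subgroups of bounded index\<close>

context definable_ring
begin

no_notation A.sumset (infixl "\<boxplus>" 65)

text \<open>Otherwise, for every \<open>A\<close>-definable neighbourhood \<open>\<phi>\<close> of \<open>x\<close> without zero, the complement of \<open>\<phi> \<union> - \<phi>\<close> is not
thick, and \<open>long_separated\<close> provides an unbounded set whose differences avoid all these complements. Up to
sign, its differences then have the type of \<open>x\<close> over \<open>A\<close>, so by homogeneity they lie outside \<open>I\<close>, and \<open>I\<close> has
unbounded index.\<close>

lemma bounded_invariant_omits: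
  assumes I: "subgrp I" "bounded I" "\<And>\<sigma>. \<sigma> \<in> Aut \<Longrightarrow> \<sigma> ` I \<subseteq> I" and x: "x \<in> carrier R" "x \<notin> I"
  obtains D where "A.dset D" "thick D" "neg D = D" "\<zero> \<in> D" "x \<notin> D"
proof (rule ccontr)
  assume "\<not> thesis"
  then have contr: "\<And>D. A.dset D \<Longrightarrow> thick D \<Longrightarrow> neg D = D \<Longrightarrow> \<zero> \<in> D \<Longrightarrow> x \<in> D" using that by blast
  define q where "q = {\<phi>. A.dset \<phi> \<and> x \<in> \<phi> \<and> \<zero> \<notin> \<phi>}"
  define dd where "dd \<phi> = carrier R - (\<phi> \<union> neg \<phi>)" for \<phi>
  have x0: "x \<noteq> \<zero>" using x subgrp_zero[OF I(1)] by auto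
  have dA: "A.dset (dd \<phi>)" if "\<phi> \<in> q" for \<phi>
    unfolding dd_def by (intro A.dset_Diff A.dset_carrier A.dset_Un A.dset_neg) (use that in \<open>simp_all add: q_def\<close>)
  have dd_sym: "\<ominus> z \<in> dd \<phi>" if "z \<in> dd \<phi>" for z \<phi>
    using that by (auto simp: dd_def neg_def)
  have nt: "\<not> thick (dd \<phi>)" if \<phi>: "\<phi> \<in> q" for \<phi>
  proof
    assume t: "thick (dd \<phi>)"
    have "neg (dd \<phi>) = dd \<phi>" by (rule neg_eqI) (use dd_sym in \<open>auto simp: dd_def\<close>)
    moreover have "\<zero> \<in> dd \<phi>" "x \<notin> dd \<phi>" using \<phi> by (auto simp: dd_def neg_def q_def add.inv_one[folded a_inv_def])
    ultimately show False using contr[of "dd \<phi>"] dA[OF \<phi>] t by blast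
  qed
  have q_Int: "\<phi> \<inter> \<psi> \<in> q" if "\<phi> \<in> q" "\<psi> \<in> q" for \<phi> \<psi>
    using that A.dset_Int by (auto simp: q_def)
  have q_Diff: "D - {\<zero>} \<in> q" if "A.dset D" "x \<in> D" for D
    using that A.dset_Diff A.dset_zero x0 by (auto simp: q_def)
  have "carrier R - {\<zero>} \<in> q" by (rule q_Diff[OF A.dset_carrier x(1)])
  then have a1: "dd ` q \<noteq> {}" by auto
  have "small q" by (rule small_subset[OF few_A]) (auto simp: q_def)
  then have a2: "small (dd ` q)" by (rule small_image)
  have a3: "dset D" "\<not> thick D" if "D \<in> dd ` q" for D
    using that dA A_dset nt by auto
  have a4: "\<exists>F\<in>dd ` q. D \<union> E \<subseteq> F" if DE: "D \<in> dd ` q" "E \<in> dd ` q" for D E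
  proof -
    obtain \<phi> \<psi> where p: "D = dd \<phi>" "E = dd \<psi>" "\<phi> \<in> q" "\<psi> \<in> q" using DE by blast
    have "dd \<phi> \<union> dd \<psi> \<subseteq> dd (\<phi> \<inter> \<psi>)" by (auto simp: dd_def neg_def)
    then show ?thesis using p q_Int by blast
  qed
  obtain W where W: "W \<subseteq> carrier R" "\<not> small W" "\<And>D. D \<in> dd ` q \<Longrightarrow> sep D W"
    using long_separated[OF a1 a2 a3 a4] by blast
  have "y \<ominus> z \<notin> I" if yz: "y \<in> W" "z \<in> W" "y \<noteq> z" for y z
  proof
    assume inI: "y \<ominus> z \<in> I"
    have c: "y \<in> carrier R" "z \<in> carrier R" using yz W(1) by blast+
    define w where "w = y \<ominus> z"
    have wc: "w \<in> carrier R" using c by (simp add: w_def)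
    have zy: "z \<ominus> y = \<ominus> w" using c by (simp add: w_def minus_minus_eq)
    have or: "w \<in> \<phi> \<or> \<ominus> w \<in> \<phi>" if \<phi>: "\<phi> \<in> q" for \<phi>
    proof -
      have "sep (dd \<phi>) W" using W(3) \<phi> by simp
      then have "\<not> (y \<ominus> z \<in> dd \<phi> \<and> z \<ominus> y \<in> dd \<phi>)" using yz unfolding sep_def by metis
      then have "\<not> (w \<in> dd \<phi> \<and> \<ominus> w \<in> dd \<phi>)" by (simp add: zy flip: w_def)
      then have "w \<notin> dd \<phi>" using dd_sym by metis
      then show ?thesis using wc by (auto simp: dd_def neg_def)
    qed
    have "(\<forall>\<phi>\<in>q. w \<in> \<phi>) \<or> (\<forall>\<phi>\<in>q. \<ominus> w \<in> \<phi>)"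
    proof (rule ccontr)
      assume "\<not> ?thesis"
      then obtain \<phi> \<psi> where "\<phi> \<in> q" "\<psi> \<in> q" "w \<notin> \<phi>" "\<ominus> w \<notin> \<psi>" by blast
      then show False using or[OF q_Int[of \<phi> \<psi>]] by blast
    qed
    then obtain v where v: "v = w \<or> v = \<ominus> w" "\<And>\<phi>. \<phi> \<in> q \<Longrightarrow> v \<in> \<phi>" by blast
    have vI: "v \<in> I" using v(1) inI subgrp_minus[OF I(1)] by (auto simp: w_def)
    have vc: "v \<in> carrier R" using vI subgrp_sub[OF I(1)] by blast
    have vD: "v \<in> D" if "A.dset D" "x \<in> D" for D using v(2)[OF q_Diff[OF that]] by simp
    have "\<exists>\<sigma>\<in>Aut. \<sigma> v = x"
    proof (rule homogeneity[OF vc x(1)])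
      fix D assume D: "A.dset D"
      then have "A.dset (carrier R - D)" using A.dset_Diff A.dset_carrier by blast
      then show "v \<in> D \<longleftrightarrow> x \<in> D" using D vD[of D] vD[of "carrier R - D"] x(1) by auto
    qed
    then show False using I(3) vI x(2) by blast
  qed
  then show False using bounded_separated[OF I(1,2) W(1)] W(2) by blast
qed

subsection \<open>Chains of thick sets\<close>

text \<open>The intersection of such a chain, its core, is a type-definable subgroup of bounded index.\<close>

definition chain :: "(nat \<Rightarrow> 'b set) \<Rightarrow> bool" where
  "chain D \<longleftrightarrow> (\<forall>k. dset (D k) \<and> thick (D k) \<and> neg (D k) = D k \<and> \<zero> \<in> D k \<and> D (Suc k) \<boxplus> D (Suc k) \<subseteq> D k)"

definition core :: "(nat \<Rightarrow> 'b set) \<Rightarrow> 'b set" where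
  "core D = carrier R \<inter> \<Inter>(range D)"

lemma chainD:
  assumes "chain D"
  shows "dset (D k)" "thick (D k)" "neg (D k) = D k" "\<zero> \<in> D k" "D k \<subseteq> carrier R"
    "x \<in> D (Suc k) \<Longrightarrow> y \<in> D (Suc k) \<Longrightarrow> x \<oplus> y \<in> D k"
  using assms dset_sub sumsetI[of x "D (Suc k)" y "D (Suc k)"] unfolding chain_def by blast+

lemma chain_Suc: assumes "chain D" shows "D (Suc k) \<subseteq> D k"
proof
  fix x assume x: "x \<in> D (Suc k)"
  then have "x \<in> carrier R" using chainD(5)[OF assms] by blast
  then show "x \<in> D k" using chainD(6)[OF assms x chainD(4)[OF assms]] by simp
qed

lemma chain_mono: "chain D \<Longrightarrow> j \<le> k \<Longrightarrow> D k \<subseteq> D j"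
  using lift_Suc_antimono_le[of D j k] chain_Suc by blast

lemma core_sub: "core D \<subseteq> D k"
  by (auto simp: core_def)

lemma core_subgrp: assumes "chain D" shows "subgrp (core D)"
  unfolding subgrp_def
proof (intro conjI ballI)
  show "core D \<subseteq> carrier R" by (auto simp: core_def)
  show "\<zero> \<in> core D" using chainD(4)[OF assms] by (auto simp: core_def)
  fix x y assume xy: "x \<in> core D" "y \<in> core D"
  then have c: "x \<in> carrier R" "y \<in> carrier R" by (auto simp: core_def)
  have "x \<ominus> y \<in> D k" for k
  proof -
    have "x \<in> D (Suc k)" "y \<in> D (Suc k)" using xy core_sub by blast+
    then have "x \<oplus> \<ominus> y \<in> D k" using chainD(6)[OF assms] neg_eqD[OF chainD(3)[OF assms]] by blast
    then show ?thesis by (simp add: a_minus_def)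
  qed
  then show "x \<ominus> y \<in> core D" using c by (auto simp: core_def)
qed

lemma core_bounded: assumes "chain D" shows "bounded (core D)"
  unfolding core_def
proof (rule bounded_Int_family)
  show "small (range D)" using small_image[OF small_nat] by blast
  show "subgrp (carrier R \<inter> \<Inter>(range D))" using core_subgrp[OF assms] by (simp add: core_def)
qed (use chainD[OF assms] in auto)

text \<open>Iterates the passage from \<open>D\<close> to \<open>E\<close> with \<open>8 E \<subseteq> 4 D\<close>; the sets of the chain are the fourfold sums.\<close>

lemma ex_chain:
  assumes "dset D" "thick D" "neg D = D" "\<zero> \<in> D"
  obtains E where "chain E" "E 0 \<subseteq> msum 4 D"
proof -
  define P where "P X \<longleftrightarrow> dset X \<and> thick X \<and> neg X = X \<and> \<zero> \<in> X" for X
  have "\<exists>X. \<forall>n. P (X n) \<and> (n = 0 \<longrightarrow> X n = D) \<and> msum 8 (X (Suc n)) \<subseteq> msum 4 (X n)"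
  proof (rule dependent_nat_choice[of "\<lambda>n Y. P Y \<and> (n = 0 \<longrightarrow> Y = D)" "\<lambda>n Y Z. msum 8 Z \<subseteq> msum 4 Y", simplified conj_assoc])
    show "\<exists>x. P x \<and> (0 = 0 \<longrightarrow> x = D)" using assms by (auto simp: P_def)
  next
    fix Y and n :: nat assume "P Y \<and> (n = 0 \<longrightarrow> Y = D)"
    then have Y: "dset Y" "thick Y" "neg Y = Y" "\<zero> \<in> Y" by (auto simp: P_def)
    obtain Z where "dset Z" "thick Z" "neg Z = Z" "\<zero> \<in> Z" "msum 8 Z \<subseteq> msum 4 Y"
      using massicot_wagner[OF fot_const Y] by blast
    then show "\<exists>Z. P Z \<and> (Suc n = 0 \<longrightarrow> Z = D) \<and> msum 8 Z \<subseteq> msum 4 Y" by (auto simp: P_def)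
  qed
  then obtain X where X: "\<And>n. P (X n)" "X 0 = D" "\<And>n. msum 8 (X (Suc n)) \<subseteq> msum 4 (X n)" by blast
  have XR: "X n \<subseteq> carrier R" for n using X(1)[of n] dset_sub by (auto simp: P_def)
  have "chain (\<lambda>n. msum 4 (X n))"
    unfolding chain_def
  proof (intro allI conjI)
    fix k
    show "dset (msum 4 (X k))" using X(1)[of k] dset_msum by (simp add: P_def)
    have sup: "X k \<subseteq> msum 4 (X k)" by (rule msum_superset[OF XR]) (use X(1)[of k] in \<open>simp_all add: P_def\<close>)
    then show "thick (msum 4 (X k))" using thick_mono X(1)[of k] unfolding P_def by blast
    show "\<zero> \<in> msum 4 (X k)" using sup X(1)[of k] by (auto simp: P_def)
    show "neg (msum 4 (X k)) = msum 4 (X k)" using neg_msum[OF XR] X(1)[of k] by (simp add: P_def)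
    have "msum 4 (X (Suc k)) \<boxplus> msum 4 (X (Suc k)) = msum 8 (X (Suc k))"
      using msum_add[OF XR[of "Suc k"], of 4 4] by simp
    then show "msum 4 (X (Suc k)) \<boxplus> msum 4 (X (Suc k)) \<subseteq> msum 4 (X k)" using X(3) by simp
  qed
  then show ?thesis using that[of "\<lambda>n. msum 4 (X n)"] X(2) by simp
qed

subsection \<open>Chains whose orbit is bounded\<close>

text \<open>Automorphisms that move the chain only by a bounded number of levels, in both directions.\<close>

definition shifts :: "(nat \<Rightarrow> 'b set) \<Rightarrow> nat \<Rightarrow> ('b \<Rightarrow> 'b) set" where
  "shifts D l = {\<rho>\<in>Aut. \<rho> ` D (Suc (Suc l)) \<subseteq> D l \<and> inv_into UNIV \<rho> ` D (Suc (Suc l)) \<subseteq> D l}"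

text \<open>Up to automorphisms that move the chain little, it has only finitely many conjugates at level \<open>l\<close>.\<close>

definition few_shifts :: "(nat \<Rightarrow> 'b set) \<Rightarrow> nat \<Rightarrow> bool" where
  "few_shifts D l \<longleftrightarrow> (\<exists>F. finite F \<and> F \<subseteq> Aut \<and> (\<forall>\<sigma>\<in>Aut. \<exists>\<rho>\<in>shifts D l. \<exists>f\<in>F. \<sigma> = \<rho> \<circ> f))"

lemma Aut_mem_image: assumes "\<sigma> \<in> Aut" shows "x \<in> \<sigma> ` D \<longleftrightarrow> inv_into UNIV \<sigma> x \<in> D"
proof
  assume "x \<in> \<sigma> ` D"
  then show "inv_into UNIV \<sigma> x \<in> D" using Aut_inv_apply(1)[OF assms] by auto
next
  assume "inv_into UNIV \<sigma> x \<in> D"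
  then have "\<sigma> (inv_into UNIV \<sigma> x) \<in> \<sigma> ` D" by (rule imageI)
  then show "x \<in> \<sigma> ` D" using Aut_inv_apply(2)[OF assms] by simp
qed

lemma inv_inv: "\<sigma> \<in> Aut \<Longrightarrow> inv_into UNIV (inv_into UNIV \<sigma>) = \<sigma>"
  by (rule inv_inv_eq[OF Aut_bij])

text \<open>Since finitely many automorphisms represent all of them at every level, the intersection of all
conjugates of the core is an intersection of a small number of definable sets. It has bounded index and is
invariant, hence type-definable over \<open>A\<close>, and therefore contains \<open>G00\<close>.\<close>

lemma core_of_few_shifts:
  assumes "chain D" "\<And>l. few_shifts D l" shows "G00 \<subseteq> core D"
proof -
  from assms(2) obtain F where F: "\<And>l. finite (F l)" "\<And>l. F l \<subseteq> Aut"
    "\<And>l \<sigma>. \<sigma> \<in> Aut \<Longrightarrow> \<exists>\<rho>\<in>shifts D l. \<exists>f\<in>F l. \<sigma> = \<rho> \<circ> f"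
    unfolding few_shifts_def by metis
  define \<S> where "\<S> = (\<Union>l. (\<lambda>f. inv_into UNIV f ` D (Suc (Suc l))) ` F l)"
  define K where "K = carrier R \<inter> \<Inter>((\<lambda>\<sigma>. \<sigma> ` core D) ` Aut)"
  have Sm: "\<exists>l f. f \<in> Aut \<and> f \<in> F l \<and> S = inv_into UNIV f ` D (Suc (Suc l))" if "S \<in> \<S>" for S
    using that F(2) unfolding \<S>_def by blast
  have smallS: "small \<S>" unfolding \<S>_def
  proof (rule small_UNION_uniform[OF strong_limit small_nat small_nat])
    fix l
    have "F l \<subseteq> range (from_nat_into (F l))"
      using countable_finite[OF F(1)] by (metis from_nat_into_surj rangeI subsetI)
    then show "(\<lambda>f. inv_into UNIV f ` D (Suc (Suc l))) ` F l \<subseteq>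
      (\<lambda>l n. inv_into UNIV (from_nat_into (F l) n) ` D (Suc (Suc l))) l ` UNIV" by auto
  qed
  have dS: "dset S" and tS: "thick S" if "S \<in> \<S>" for S
    using Sm[OF that] chainD(1,2)[OF assms(1)] Aut_dset[OF Aut_inv] thick_Aut[OF Aut_inv] by auto
  have sub: "subgrp K"
  proof -
    have "subgrp (\<Inter>(insert (carrier R) ((\<lambda>\<sigma>. \<sigma> ` core D) ` Aut)))"
      by (rule subgrp_Inter) (use subgrp_carrier subgrp_Aut core_subgrp[OF assms(1)] in auto)
    then show ?thesis by (simp add: K_def)
  qed
  have K_eq: "K = carrier R \<inter> \<Inter>\<S>"
  proof (intro equalityI subsetI)
    fix x assume x: "x \<in> K"
    have "x \<in> S" if S: "S \<in> \<S>" for S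
    proof -
      obtain l f where lf: "f \<in> Aut" "S = inv_into UNIV f ` D (Suc (Suc l))" using Sm[OF S] by blast
      have "x \<in> inv_into UNIV f ` core D" using x Aut_inv[OF lf(1)] by (simp add: K_def)
      then show ?thesis using lf(2) core_sub by blast
    qed
    then show "x \<in> carrier R \<inter> \<Inter>\<S>" using x by (simp add: K_def)
  next
    fix x assume x: "x \<in> carrier R \<inter> \<Inter>\<S>"
    have "inv_into UNIV \<sigma> x \<in> D k" if s: "\<sigma> \<in> Aut" for \<sigma> k
    proof -
      obtain \<rho> f where r: "\<rho> \<in> shifts D k" "f \<in> F k" "inv_into UNIV \<sigma> = \<rho> \<circ> f" using F(3)[OF Aut_inv[OF s]] by blast
      have fA: "f \<in> Aut" using r(2) F(2) by blast
      have "inv_into UNIV f ` D (Suc (Suc k)) \<in> \<S>" using r(2) by (auto simp: \<S>_def)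
      then have "x \<in> inv_into UNIV f ` D (Suc (Suc k))" using x by blast
      then have "f x \<in> D (Suc (Suc k))" using Aut_mem_image[OF Aut_inv[OF fA]] inv_inv[OF fA] by simp
      then show ?thesis using r(1,3) by (auto simp: shifts_def)
    qed
    moreover have "inv_into UNIV \<sigma> x \<in> carrier R" if s: "\<sigma> \<in> Aut" for \<sigma>
      using x Aut_closed[OF Aut_inv[OF s]] by simp
    ultimately have "x \<in> \<sigma> ` core D" if s: "\<sigma> \<in> Aut" for \<sigma>
      using s Aut_mem_image[OF s] by (simp add: core_def)
    then show "x \<in> K" using x by (simp add: K_def)
  qed
  have "tdef K" unfolding tdef_def using smallS dS K_eq by (intro exI[of _ \<S>]) simp
  moreover have "\<tau> ` K \<subseteq> K" if t: "\<tau> \<in> Aut" for \<tau>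
  proof
    fix y assume "y \<in> \<tau> ` K"
    then obtain x where x: "x \<in> K" "y = \<tau> x" by blast
    have "y \<in> \<sigma> ` core D" if s: "\<sigma> \<in> Aut" for \<sigma>
    proof -
      have "inv_into UNIV \<tau> \<circ> \<sigma> \<in> Aut" by (intro Aut_comp Aut_inv t s)
      then have "x \<in> (inv_into UNIV \<tau> \<circ> \<sigma>) ` core D" using x(1) unfolding K_def by blast
      then obtain z where "z \<in> core D" "x = inv_into UNIV \<tau> (\<sigma> z)" by auto
      then show ?thesis using x(2) Aut_inv_apply(2)[OF t] by simp
    qed
    moreover have "y \<in> carrier R" using x t Aut_closed by (simp add: K_def)
    ultimately show "y \<in> K" by (simp add: K_def)
  qed
  ultimately have "tdefA K" by (rule invariant_tdefA)
  moreover have "bounded K"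
    using bounded_Int_family[OF smallS dS tS] sub K_eq by simp
  ultimately have "G00 \<subseteq> K" using sub by (intro G00_subset)
  moreover have "K \<subseteq> id ` core D" using Aut_id unfolding K_def by blast
  ultimately show ?thesis by simp
qed

subsection \<open>Moving a chain away from unbounded orbits\<close>

definition Aut_group :: "('b \<Rightarrow> 'b) monoid" where
  "Aut_group = \<lparr>carrier = Aut, mult = (\<circ>), one = id\<rparr>"

lemma Aut_inv_comp: "\<sigma> \<in> Aut \<Longrightarrow> inv_into UNIV \<sigma> \<circ> \<sigma> = id" "\<sigma> \<in> Aut \<Longrightarrow> \<sigma> \<circ> inv_into UNIV \<sigma> = id"
  by (simp_all add: fun_eq_iff Aut_inv_apply)

lemma Aut_group: "group Aut_group"
  by (rule groupI) (auto simp: Aut_group_def Aut_comp Aut_id comp_assoc intro: bexI[OF _ Aut_inv] Aut_inv_comp)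

lemma Aut_group_inv: "\<sigma> \<in> Aut \<Longrightarrow> m_inv Aut_group \<sigma> = inv_into UNIV \<sigma>"
  by (rule group.inv_equality[OF Aut_group]) (simp_all add: Aut_group_def Aut_inv_comp Aut_inv)

text \<open>Automorphisms that violate the conclusion for a given \<open>i\<close> are divided into finitely many pieces according to
how finitely many translates of a set of the chain \<open>E\<close> that cover \<open>R\<close> are placed. Two automorphisms of one piece
differ by an element of \<open>shifts\<close>, so \<open>neumann_covering\<close> shows that these pieces do not exhaust \<open>Aut\<close>.\<close>

lemma avoid_finitely_many:
  assumes E: "chain E" and I: "finite I" "\<And>i. i \<in> I \<Longrightarrow> chain (D i)" "\<And>i. i \<in> I \<Longrightarrow> \<not> few_shifts (D i) (l i)"
  shows "\<exists>\<sigma>\<in>Aut. \<forall>i\<in>I. \<not> \<sigma> ` E j \<subseteq> D i (Suc (Suc (l i)))"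
proof (rule ccontr)
  assume contr: "\<not> ?thesis"
  obtain Y where Y: "Y \<subseteq> carrier R" "finite Y" "\<And>x. x \<in> carrier R \<Longrightarrow> \<exists>y\<in>Y. x \<ominus> y \<in> E (Suc j)"
    using thick_cover[OF chainD(2,4)[OF E]] by blast
  define Z where "Z i m \<sigma> = {y\<in>Y. \<exists>x\<in>carrier R. \<sigma> x \<in> D i m \<and> x \<ominus> y \<in> E (Suc j)}" for i m \<sigma>
  define T where "T i = {\<sigma>\<in>Aut. \<sigma> ` E j \<subseteq> D i (Suc (Suc (l i)))}" for i
  define step where "step i m \<rho> \<longleftrightarrow> \<rho> ` D i (Suc m) \<subseteq> D i m \<and> inv_into UNIV \<rho> ` D i (Suc m) \<subseteq> D i m" for i m \<rho>
  define P where "P i = {\<rho>\<in>Aut. step i (l i) \<rho> \<and> step i (Suc (l i)) \<rho>}" for i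
  define C where "C i Z1 Z2 = {\<sigma>\<in>T i. Z i (Suc (l i)) \<sigma> = Z1 \<and> Z i (Suc (Suc (l i))) \<sigma> = Z2}" for i Z1 Z2
  have move: "(\<tau> \<circ> inv_into UNIV \<sigma>) ` D i (Suc m) \<subseteq> D i m"
    if i: "i \<in> I" "\<sigma> \<in> T i" "\<tau> \<in> T i" "Z i (Suc m) \<sigma> = Z i (Suc m) \<tau>" "m \<le> Suc (l i)" for i m \<sigma> \<tau>
  proof
    fix u assume "u \<in> (\<tau> \<circ> inv_into UNIV \<sigma>) ` D i (Suc m)"
    then obtain w where w: "w \<in> D i (Suc m)" "u = \<tau> (inv_into UNIV \<sigma> w)" by auto
    have s: "\<sigma> \<in> Aut" and t: "\<tau> \<in> Aut" "\<tau> ` E j \<subseteq> D i (Suc (Suc (l i)))" using i by (auto simp: T_def)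
    define x where "x = inv_into UNIV \<sigma> w"
    have "w \<in> carrier R" using w(1) chainD(5)[OF I(2)[OF i(1)]] by blast
    then have xc: "x \<in> carrier R" using Aut_closed[OF Aut_inv[OF s]] by (simp add: x_def)
    have sx: "\<sigma> x = w" using Aut_inv_apply(2)[OF s] by (simp add: x_def)
    obtain y where y: "y \<in> Y" "x \<ominus> y \<in> E (Suc j)" using Y(3)[OF xc] by blast
    then have "y \<in> Z i (Suc m) \<sigma>" using xc sx w(1) by (auto simp: Z_def)
    then have "y \<in> Z i (Suc m) \<tau>" using i(4) by simp
    then obtain x' where x': "x' \<in> carrier R" "\<tau> x' \<in> D i (Suc m)" "x' \<ominus> y \<in> E (Suc j)" by (auto simp: Z_def)
    have yc: "y \<in> carrier R" using y(1) Y(1) by blast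
    define d where "d = (x \<ominus> y) \<oplus> \<ominus> (x' \<ominus> y)"
    have "d \<in> E j" unfolding d_def using chainD(6)[OF E y(2) neg_eqD[OF chainD(3)[OF E] x'(3)]] .
    then have "\<tau> d \<in> D i (Suc (Suc (l i)))" using t(2) by blast
    then have td: "\<tau> d \<in> D i (Suc m)" using chain_mono[OF I(2)[OF i(1)], of "Suc m" "Suc (Suc (l i))"] i(5) by auto
    have dc: "d \<in> carrier R" using xc x'(1) yc by (simp add: d_def)
    have "x = x' \<oplus> d" using xc x'(1) yc by (simp add: d_def group_simps)
    then have "\<tau> x = \<tau> x' \<oplus> \<tau> d" using Aut_add[OF t(1) x'(1) dc] by simp
    then show "u \<in> D i m" using chainD(6)[OF I(2)[OF i(1)] x'(2) td] w(2) by (simp add: x_def)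
  qed
  interpret Gp: group Aut_group by (rule Aut_group)
  have "\<Union>{C i Z1 Z2 | i Z1 Z2. i \<in> I \<and> Z1 \<subseteq> Y \<and> Z2 \<subseteq> Y} \<noteq> carrier Aut_group"
  proof (rule Gp.neumann_covering[OF I(1), of P])
    fix i p assume "i \<in> I" "p \<in> P i"
    then show "p \<in> carrier Aut_group \<and> m_inv Aut_group p \<in> P i"
      using Aut_inv by (auto simp: P_def step_def Aut_group_def Aut_group_inv[unfolded Aut_group_def] inv_inv)
  next
    fix i F assume i: "i \<in> I" and F: "finite F" "F \<subseteq> carrier Aut_group"
    show "\<exists>y\<in>carrier Aut_group. \<forall>p\<in>P i. \<forall>q\<in>P i. \<forall>f\<in>F. y \<noteq> p \<otimes>\<^bsub>Aut_group\<^esub> q \<otimes>\<^bsub>Aut_group\<^esub> f"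
    proof (rule ccontr)
      assume "\<not> ?thesis"
      then have *: "\<exists>p\<in>P i. \<exists>q\<in>P i. \<exists>f\<in>F. y = p \<circ> q \<circ> f" if "y \<in> Aut" for y
        using that by (auto simp: Aut_group_def)
      have pq: "p \<circ> q \<in> shifts (D i) (l i)" if p: "p \<in> P i" and q: "q \<in> P i" for p q
      proof -
        have pA: "p \<in> Aut" "q \<in> Aut" using p q by (auto simp: P_def)
        have "inv_into UNIV (p \<circ> q) = inv_into UNIV q \<circ> inv_into UNIV p"
          using pA Aut_bij by (intro o_inv_distrib)
        moreover have st: "step i (l i) p" "step i (Suc (l i)) p" "step i (l i) q" "step i (Suc (l i)) q"
          using p q by (simp_all add: P_def)
        have "p ` q ` D i (Suc (Suc (l i))) \<subseteq> D i (l i)"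
          by (rule order_trans[OF image_mono[of _ "D i (Suc (l i))"]]) (use st in \<open>simp_all add: step_def\<close>)
        moreover have "inv_into UNIV q ` inv_into UNIV p ` D i (Suc (Suc (l i))) \<subseteq> D i (l i)"
          by (rule order_trans[OF image_mono[of _ "D i (Suc (l i))"]]) (use st in \<open>simp_all add: step_def\<close>)
        ultimately show ?thesis using Aut_comp[OF pA] by (simp add: shifts_def image_comp)
      qed
      have "few_shifts (D i) (l i)" unfolding few_shifts_def
        by (rule exI[of _ F]) (use F * pq in \<open>auto simp: Aut_group_def, metis\<close>)
      then show False using I(3)[OF i] by simp
    qed
  next
    have "{C i Z1 Z2 | i Z1 Z2. i \<in> I \<and> Z1 \<subseteq> Y \<and> Z2 \<subseteq> Y} \<subseteq> (\<lambda>(i, Z1, Z2). C i Z1 Z2) ` (I \<times> Pow Y \<times> Pow Y)"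
      by force
    then show "finite {C i Z1 Z2 | i Z1 Z2. i \<in> I \<and> Z1 \<subseteq> Y \<and> Z2 \<subseteq> Y}"
      by (rule finite_subset) (use I(1) Y(2) in simp)
  next
    fix S assume "S \<in> {C i Z1 Z2 | i Z1 Z2. i \<in> I \<and> Z1 \<subseteq> Y \<and> Z2 \<subseteq> Y}"
    then obtain i Z1 Z2 where S: "S = C i Z1 Z2" "i \<in> I" by blast
    show "S \<subseteq> carrier Aut_group" by (auto simp: S(1) C_def T_def Aut_group_def)
    have "c \<circ> inv_into UNIV c' \<in> P i" if c: "c \<in> S" "c' \<in> S" for c c'
    proof -
      have T: "c \<in> T i" "c' \<in> T i" using c by (auto simp: S(1) C_def)
      have A: "c \<in> Aut" "c' \<in> Aut" using T by (auto simp: T_def)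
      have Zs: "Z i (Suc (l i)) c = Z i (Suc (l i)) c'" "Z i (Suc (Suc (l i))) c = Z i (Suc (Suc (l i))) c'"
        using c by (auto simp: S(1) C_def)
      have "inv_into UNIV (c \<circ> inv_into UNIV c') = c' \<circ> inv_into UNIV c"
        using o_inv_distrib[OF Aut_bij[OF A(1)] Aut_bij[OF Aut_inv[OF A(2)]]] inv_inv[OF A(2)] by simp
      moreover have "(c \<circ> inv_into UNIV c') ` D i (Suc m) \<subseteq> D i m" "(c' \<circ> inv_into UNIV c) ` D i (Suc m) \<subseteq> D i m"
        if m: "m = l i \<or> m = Suc (l i)" for m
      proof -
        have "Z i (Suc m) c = Z i (Suc m) c'" "m \<le> Suc (l i)" using m Zs by auto
        then show "(c \<circ> inv_into UNIV c') ` D i (Suc m) \<subseteq> D i m" "(c' \<circ> inv_into UNIV c) ` D i (Suc m) \<subseteq> D i m"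
          using move[OF S(2) T, of m] move[OF S(2) T(2,1), of m] by simp_all
      qed
      ultimately have "step i m (c \<circ> inv_into UNIV c')" if "m = l i \<or> m = Suc (l i)" for m
        unfolding step_def using that by simp
      then show ?thesis using Aut_comp[OF A(1) Aut_inv[OF A(2)]] by (simp add: P_def)
    qed
    moreover have "c \<otimes>\<^bsub>Aut_group\<^esub> m_inv Aut_group c' = c \<circ> inv_into UNIV c'" if "c' \<in> S" for c c'
      using that Aut_group_inv[of c'] by (simp add: Aut_group_def S(1) C_def T_def)
    ultimately show "\<exists>i\<in>I. \<forall>c\<in>S. \<forall>c'\<in>S. c \<otimes>\<^bsub>Aut_group\<^esub> m_inv Aut_group c' \<in> P i"
      using S(2) by (intro bexI[of _ i]) simp_all
  qed
  moreover have "\<Union>{C i Z1 Z2 | i Z1 Z2. i \<in> I \<and> Z1 \<subseteq> Y \<and> Z2 \<subseteq> Y} = carrier Aut_group"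
  proof (intro equalityI subsetI)
    fix \<sigma> assume "\<sigma> \<in> carrier Aut_group"
    then have s: "\<sigma> \<in> Aut" by (simp add: Aut_group_def)
    then obtain i where i: "i \<in> I" "\<sigma> ` E j \<subseteq> D i (Suc (Suc (l i)))" using contr by blast
    have "\<sigma> \<in> C i (Z i (Suc (l i)) \<sigma>) (Z i (Suc (Suc (l i))) \<sigma>)" using s i by (simp add: C_def T_def)
    moreover have "Z i m \<sigma> \<subseteq> Y" for m by (auto simp: Z_def)
    ultimately show "\<sigma> \<in> \<Union>{C i Z1 Z2 | i Z1 Z2. i \<in> I \<and> Z1 \<subseteq> Y \<and> Z2 \<subseteq> Y}" using i(1) by blast
  qed (auto simp: C_def T_def Aut_group_def)
  ultimately show False by simp
qed

text \<open>Such a subgroup is a union of cosets of \<open>N\<close>.\<close>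

lemma small_overgroups:
  assumes "subgrp N" "bounded N" shows "small {H. subgrp H \<and> N \<subseteq> H}"
proof (rule small_inj)
  show "small (Pow (cos N ` carrier R))" using small_Pow' assms(2) by (simp add: bounded_def)
  show "inj_on (\<lambda>H. cos N ` H) {H. subgrp H \<and> N \<subseteq> H}"
  proof (rule inj_onI)
    have *: "H \<subseteq> K" if H: "subgrp H" "subgrp K" "N \<subseteq> K" "cos N ` H = cos N ` K" for H K
    proof
      fix x assume x: "x \<in> H"
      then obtain y where y: "y \<in> K" "cos N x = cos N y" using H(4) by (metis imageE imageI)
      have c: "x \<in> carrier R" "y \<in> carrier R" using x y H subgrp_sub by blast+
      then have "x \<ominus> y \<in> K" using cos_eq[OF assms(1) c] y(2) H(3) by blast
      then have "(x \<ominus> y) \<oplus> y \<in> K" using subgrp_add[OF H(2)] y(1) by blast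
      then show "x \<in> K" using c by (simp add: group_simps)
    qed
    fix H K assume "H \<in> {H. subgrp H \<and> N \<subseteq> H}" "K \<in> {H. subgrp H \<and> N \<subseteq> H}" "cos N ` H = cos N ` K"
    then show "H = K" using *[of H K] *[of K H] by auto
  qed
  show "(\<lambda>H. cos N ` H) ` {H. subgrp H \<and> N \<subseteq> H} \<subseteq> Pow (cos N ` carrier R)"
    using subgrp_sub by blast
qed

text \<open>The cores that contain the core of \<open>E\<close> and come from chains with many shifts are small in number. By
\<open>Aut_saturation\<close> and \<open>avoid_finitely_many\<close> one \<open>\<sigma>\<close> moves \<open>E\<close> away from all of them. Then the chain with
members \<open>E k + \<sigma> (E k)\<close> has few shifts, since its core contains that of \<open>E\<close> and that of \<open>\<sigma> E\<close>.\<close>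

lemma G00_subset_chain_sum:
  assumes E: "chain E" shows "\<exists>\<sigma>\<in>Aut. G00 \<subseteq> E 0 \<boxplus> \<sigma> ` E 0"
proof -
  define \<U> where "\<U> = {H. core E \<subseteq> H \<and> (\<exists>D l. chain D \<and> \<not> few_shifts D l \<and> H = core D)}"
  have "\<forall>H\<in>\<U>. \<exists>D l. chain D \<and> \<not> few_shifts D l \<and> H = core D" by (auto simp: \<U>_def)
  then obtain D l where Dl: "\<And>H. H \<in> \<U> \<Longrightarrow> chain (D H) \<and> \<not> few_shifts (D H) (l H) \<and> H = core (D H)" by metis
  define B where "B H = D H (Suc (Suc (l H)))" for H
  have smallU: "small \<U>"
    by (rule small_subset[OF small_overgroups[OF core_subgrp[OF E] core_bounded[OF E]]])
      (auto simp: \<U>_def core_subgrp)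
  define \<C> where "\<C> = (\<lambda>(j, H). (E j, B H)) ` (UNIV \<times> \<U>)"
  have "\<exists>\<sigma>\<in>Aut. \<forall>(D, E)\<in>\<C>. \<not> \<sigma> ` D \<subseteq> E"
  proof (rule Aut_saturation)
    show "small \<C>" unfolding \<C>_def by (intro small_image small_Times' small_nat smallU)
    show "dset X \<and> dset X'" if "(X, X') \<in> \<C>" for X X'
      using that chainD(1)[OF E] Dl chainD(1) by (auto simp: \<C>_def B_def)
    fix F assume F: "finite F" "F \<subseteq> \<C>"
    then obtain Z where Z: "finite Z" "Z \<subseteq> UNIV \<times> \<U>" "F = (\<lambda>(j, H). (E j, B H)) ` Z"
      unfolding \<C>_def by (meson finite_subset_image)
    define j where "j = Max (insert 0 (fst ` Z))"
    have j: "fst z \<le> j" if "z \<in> Z" for z unfolding j_def using Z(1) that by (intro Max_ge) auto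
    have "\<exists>\<sigma>\<in>Aut. \<forall>H\<in>snd ` Z. \<not> \<sigma> ` E j \<subseteq> D H (Suc (Suc (l H)))"
      by (rule avoid_finitely_many[OF E]) (use Z Dl in auto)
    then obtain \<sigma> where s: "\<sigma> \<in> Aut" "\<And>H. H \<in> snd ` Z \<Longrightarrow> \<not> \<sigma> ` E j \<subseteq> B H" by (auto simp: B_def)
    have "\<not> \<sigma> ` E (fst z) \<subseteq> B (snd z)" if "z \<in> Z" for z
      using s(2)[of "snd z"] that chain_mono[OF E j[OF that]] by blast
    then show "\<exists>\<sigma>\<in>Aut. \<forall>(D, E)\<in>F. \<not> \<sigma> ` D \<subseteq> E" using s(1) Z(3) by (intro bexI[of _ \<sigma>]) (auto simp: case_prod_beta)
  qed
  then obtain \<sigma> where s: "\<sigma> \<in> Aut" "\<And>j H. H \<in> \<U> \<Longrightarrow> \<not> \<sigma> ` E j \<subseteq> B H" by (auto simp: \<C>_def)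
  have avoid: "\<not> \<sigma> ` core E \<subseteq> B H" if H: "H \<in> \<U>" for H
  proof -
    have "\<exists>x\<in>carrier R. \<forall>j\<in>UNIV. x \<in> E j \<inter> inv_into UNIV \<sigma> ` (carrier R - B H)"
    proof (rule saturation_family[OF small_nat])
      fix j
      show "dset (E j \<inter> inv_into UNIV \<sigma> ` (carrier R - B H))"
        using Dl[OF H] chainD(1) E unfolding B_def
        by (intro dset_Int Aut_dset Aut_inv s(1) dset_Diff dset_carrier) auto
    next
      fix J :: "nat set" assume J: "finite J"
      define j where "j = Max (insert 0 J)"
      have j: "i \<le> j" if "i \<in> J" for i unfolding j_def using J that by (intro Max_ge) auto
      obtain x where x: "x \<in> E j" "\<sigma> x \<notin> B H" using s(2)[OF H] by blast
      have xc: "x \<in> carrier R" using x(1) chainD(5)[OF E] by blast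
      have "x = inv_into UNIV \<sigma> (\<sigma> x)" by (simp add: Aut_inv_apply(1)[OF s(1)])
      then have "x \<in> inv_into UNIV \<sigma> ` (carrier R - B H)" using x(2) Aut_closed[OF s(1) xc] by blast
      then show "\<exists>x\<in>carrier R. \<forall>j\<in>J. x \<in> E j \<inter> inv_into UNIV \<sigma> ` (carrier R - B H)"
        using xc x(1) chain_mono[OF E j] by blast
    qed
    then obtain x where x: "x \<in> carrier R" "\<And>j. x \<in> E j" "x \<in> inv_into UNIV \<sigma> ` (carrier R - B H)" by auto
    then have "x \<in> core E" by (simp add: core_def)
    moreover have "\<sigma> x \<notin> B H" using x(3) Aut_inv_apply(2)[OF s(1)] by auto
    ultimately show ?thesis by blast
  qed
  define F where "F k = E k \<boxplus> \<sigma> ` E k" for k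
  have sE: "\<sigma> ` E k \<subseteq> carrier R" "\<zero> \<in> \<sigma> ` E k" for k
    using Aut_closed[OF s(1)] chainD(4,5)[OF E] Aut_zero[OF s(1)] by (auto simp: image_iff intro: bexI[of _ \<zero>])
  have E_F: "E k \<subseteq> F k" for k
  proof
    fix x assume "x \<in> E k"
    then have "x \<oplus> \<zero> \<in> F k" "x \<in> carrier R" using sE chainD(5)[OF E] unfolding F_def by (blast intro: sumsetI)+
    then show "x \<in> F k" by simp
  qed
  have sE_F: "\<sigma> ` E k \<subseteq> F k" for k
  proof
    fix x assume x: "x \<in> \<sigma> ` E k"
    then have "\<zero> \<oplus> x \<in> F k" using chainD(4)[OF E] unfolding F_def by (blast intro: sumsetI)
    then show "x \<in> F k" using x sE by (simp add: subset_iff)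
  qed
  have F: "chain F"
    unfolding chain_def
  proof (intro allI conjI)
    fix k
    show "dset (F k)" unfolding F_def by (intro dset_sumset Aut_dset s(1) chainD(1)[OF E])
    show "thick (F k)" by (rule thick_mono[OF chainD(2)[OF E] E_F])
    show "\<zero> \<in> F k" using E_F chainD(4)[OF E] by blast
    have FR: "F k \<subseteq> carrier R" unfolding F_def by (rule sumset_sub[OF chainD(5)[OF E] sE(1)])
    show "neg (F k) = F k"
    proof (rule neg_eqI[OF FR])
      fix x assume "x \<in> F k"
      then obtain a b where ab: "x = a \<oplus> \<sigma> b" "a \<in> E k" "b \<in> E k" by (auto simp: F_def sumset_def)
      then have c: "a \<in> carrier R" "b \<in> carrier R" using chainD(5)[OF E] by blast+
      have "\<ominus> x = \<ominus> a \<oplus> \<sigma> (\<ominus> b)" using c ab(1) Aut_closed[OF s(1)] by (simp add: minus_add Aut_minus[OF s(1)])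
      then show "\<ominus> x \<in> F k" using neg_eqD[OF chainD(3)[OF E]] ab unfolding F_def by (auto intro: sumsetI)
    qed
    show "F (Suc k) \<boxplus> F (Suc k) \<subseteq> F k"
    proof
      fix x assume "x \<in> F (Suc k) \<boxplus> F (Suc k)"
      then obtain a b a' b' where ab: "x = (a \<oplus> \<sigma> b) \<oplus> (a' \<oplus> \<sigma> b')" "a \<in> E (Suc k)" "b \<in> E (Suc k)" "a' \<in> E (Suc k)" "b' \<in> E (Suc k)"
        by (auto simp: F_def sumset_def)
      then have c: "a \<in> carrier R" "b \<in> carrier R" "a' \<in> carrier R" "b' \<in> carrier R" using chainD(5)[OF E] by blast+
      have "x = (a \<oplus> a') \<oplus> \<sigma> (b \<oplus> b')"
        using c ab(1) Aut_closed[OF s(1)] Aut_add[OF s(1)] by (simp add: a_assoc a_lcomm)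
      then show "x \<in> F k" using chainD(6)[OF E] ab unfolding F_def by (auto intro: sumsetI)
    qed
  qed
  have "few_shifts F m" for m
  proof (rule ccontr)
    assume "\<not> few_shifts F m"
    moreover have "core E \<subseteq> core F" using E_F by (auto simp: core_def)
    ultimately have H: "core F \<in> \<U>" using F by (auto simp: \<U>_def)
    have "\<sigma> ` core E \<subseteq> core F"
    proof
      fix y assume "y \<in> \<sigma> ` core E"
      then obtain x where x: "x \<in> core E" "y = \<sigma> x" by blast
      then have "y \<in> F k" for k using sE_F core_sub by blast
      moreover have "y \<in> carrier R" using x Aut_closed[OF s(1)] by (simp add: core_def)
      ultimately show "y \<in> core F" by (simp add: core_def)
    qed
    also have "core F = core (D (core F))" using Dl[OF H] by simp
    also have "\<dots> \<subseteq> B (core F)" unfolding B_def by (rule core_sub)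
    finally show False using avoid[OF H] by simp
  qed
  then have "G00 \<subseteq> core F" by (rule core_of_few_shifts[OF F])
  then have "G00 \<subseteq> F 0" using core_sub by blast
  then show ?thesis using s(1) by (auto simp: F_def)
qed

lemma G00_subset_msum:
  assumes D: "A.dset D" "thick D" "neg D = D" "\<zero> \<in> D" shows "G00 \<subseteq> msum 8 D"
proof -
  obtain E where E: "chain E" "E 0 \<subseteq> msum 4 D" using ex_chain[OF A_dset[OF D(1)] D(2-4)] by blast
  obtain \<sigma> where s: "\<sigma> \<in> Aut" "G00 \<subseteq> E 0 \<boxplus> \<sigma> ` E 0" using G00_subset_chain_sum[OF E(1)] by blast
  have "\<sigma> ` E 0 \<subseteq> \<sigma> ` msum 4 D" using E(2) by blast
  also have "\<sigma> ` msum 4 D = msum 4 D" by (rule Aut_dset_A[OF s(1) A.dset_msum[OF D(1)]])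
  finally have "E 0 \<boxplus> \<sigma> ` E 0 \<subseteq> msum 4 D \<boxplus> msum 4 D" using E(2) by (intro sumset_mono)
  then show ?thesis using s(2) msum_add[OF dset_sub[OF A_dset[OF D(1)]], of 4 4] by simp
qed

text \<open>By \<open>bounded_invariant_omits\<close>, the points that lie in all symmetric thick \<open>A\<close>-definable sets around zero belong
to \<open>I\<close>. Saturation and \<open>G00_subset_msum\<close> write every point of \<open>G00\<close> as a sum of eight of them.\<close>

theorem G00_subset_invariant:
  assumes I: "subgrp I" "bounded I" "\<And>\<sigma>. \<sigma> \<in> Aut \<Longrightarrow> \<sigma> ` I \<subseteq> I"
  shows "G00 \<subseteq> I"
proof -
  define T where "T = {D. A.dset D \<and> thick D \<and> neg D = D \<and> \<zero> \<in> D}"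
  have TR: "carrier R \<in> T" using A.dset_carrier thick_carrier by (auto simp: T_def neg_def)
  have T_Int: "D \<inter> E \<in> T" if "D \<in> T" "E \<in> T" for D E
  proof -
    have "neg (D \<inter> E) = neg D \<inter> neg E" by (auto simp: neg_def)
    then show ?thesis using that A.dset_Int thick_Int by (auto simp: T_def)
  qed
  have T_Inter: "carrier R \<inter> \<Inter>J \<in> T" if "finite J" "J \<subseteq> T" for J
    using that
  proof (induction J rule: finite_induct)
    case empty then show ?case using TR by simp
  next
    case (insert D J)
    then have "carrier R \<inter> \<Inter>J \<in> T" "D \<in> T" by auto
    then have "D \<inter> (carrier R \<inter> \<Inter>J) \<in> T" by (rule T_Int[rotated])
    moreover have "carrier R \<inter> \<Inter>(insert D J) = D \<inter> (carrier R \<inter> \<Inter>J)" by auto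
    ultimately show ?case by simp
  qed
  have smallT: "small T" by (rule small_subset[OF few_A]) (auto simp: T_def)
  have main: "x \<in> I" if "x \<in> carrier R" "\<And>D. D \<in> T \<Longrightarrow> x \<in> msum k D" for x k
    using that
  proof (induction k arbitrary: x)
    case 0
    then show ?case using TR subgrp_zero[OF I(1)] by auto
  next
    case (Suc k)
    have "\<exists>y\<in>carrier R. \<forall>D\<in>T. y \<in> {y\<in>carrier R. y \<in> D \<and> x \<ominus> y \<in> msum k D}"
    proof (rule saturation_family[OF smallT])
      fix D assume "D \<in> T"
      then have "dset D" using A_dset by (simp add: T_def)
      then show "dset {y\<in>carrier R. y \<in> D \<and> x \<ominus> y \<in> msum k D}"
        by (intro dset_Collect fo_intros dset_msum fot_const Suc.prems(1))
    next
      fix J assume J: "finite J" "J \<subseteq> T"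
      let ?D = "carrier R \<inter> \<Inter>J"
      have "x \<in> ?D \<boxplus> msum k ?D" using Suc.prems(2)[OF T_Inter[OF J]] by simp
      then obtain y z where yz: "x = y \<oplus> z" "y \<in> ?D" "z \<in> msum k ?D" by (auto simp: sumset_def)
      have c: "y \<in> carrier R" "z \<in> carrier R" using yz msum_sub[of ?D k] by blast+
      have "x \<ominus> y = z" using c yz(1) by (simp add: group_simps)
      moreover have "z \<in> msum k D" "y \<in> D" if "D \<in> J" for D
        using yz that msum_mono[of ?D D k] by blast+
      ultimately show "\<exists>y\<in>carrier R. \<forall>D\<in>J. y \<in> {y\<in>carrier R. y \<in> D \<and> x \<ominus> y \<in> msum k D}"
        using c by (intro bexI[of _ y]) auto
    qed
    then obtain y where y: "y \<in> carrier R" "\<And>D. D \<in> T \<Longrightarrow> y \<in> D" "\<And>D. D \<in> T \<Longrightarrow> x \<ominus> y \<in> msum k D" by blast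
    have "x \<ominus> y \<in> I" by (rule Suc.IH) (use Suc.prems(1) y in auto)
    moreover have "y \<in> I"
    proof (rule ccontr)
      assume "y \<notin> I"
      then obtain D where "A.dset D" "thick D" "neg D = D" "\<zero> \<in> D" "y \<notin> D"
        using bounded_invariant_omits[OF I y(1)] by blast
      then show False using y(2)[of D] by (simp add: T_def)
    qed
    ultimately have "(x \<ominus> y) \<oplus> y \<in> I" by (rule subgrp_add[OF I(1)])
    then show ?case using Suc.prems(1) y(1) by (simp add: group_simps)
  qed
  show ?thesis
  proof
    fix x assume x: "x \<in> G00"
    show "x \<in> I"
    proof (rule main[of x 8])
      show "x \<in> carrier R" using x by (simp add: G00_def)
      show "x \<in> msum 8 D" if "D \<in> T" for D using that x G00_subset_msum[of D] by (auto simp: T_def)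
    qed
  qed
qed

end

section \<open>The ideal generated by the additive component\<close>

context definable_ring
begin

text \<open>The elements \<open>g\<close> with \<open>R g \<subseteq> H\<close>. This is an annihilator, that of \<open>R / H\<close> when \<open>H\<close> is an ideal.\<close>

definition ann :: "'b set \<Rightarrow> 'b set" where
  "ann H = {g\<in>carrier R. \<forall>r\<in>carrier R. r \<otimes> g \<in> H}"

lemma ann_subgrp:
  assumes "subgrp H" shows "subgrp (ann H)"
  unfolding subgrp_def
proof (intro conjI ballI)
  show "ann H \<subseteq> carrier R" by (auto simp: ann_def)
  show "\<zero> \<in> ann H" using subgrp_zero[OF assms] by (simp add: ann_def)
  fix x y assume xy: "x \<in> ann H" "y \<in> ann H"
  have "r \<otimes> (x \<ominus> y) = r \<otimes> x \<ominus> r \<otimes> y" if "r \<in> carrier R" for r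
    using xy that by (simp add: ann_def a_minus_def rng_r_distr r_minus_rng)
  then show "x \<ominus> y \<in> ann H" using xy subgrp_diff[OF assms] by (simp add: ann_def)
qed

lemma ann_tdef:
  assumes "tdef H" shows "tdef (ann H)"
proof -
  obtain \<S> where S: "small \<S>" "\<And>S. S \<in> \<S> \<Longrightarrow> dset S" "H = carrier R \<inter> \<Inter>\<S>"
    using assms by (auto simp: tdef_def)
  have "ann H = carrier R \<inter> \<Inter>(ann ` \<S>)" unfolding S(3) by (auto simp: ann_def)
  moreover have "dset (ann S)" if "S \<in> \<S>" for S
    unfolding ann_def by (intro dset_Collect fo_intros S(2) that)
  ultimately show ?thesis unfolding tdef_def using small_image[OF S(1)] by (intro exI[of _ "ann ` \<S>"]) auto
qed

lemma ann_Aut: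
  assumes s: "\<sigma> \<in> Aut" shows "\<sigma> ` ann H = ann (\<sigma> ` H)"
proof (intro equalityI subsetI)
  fix y assume "y \<in> \<sigma> ` ann H"
  then obtain x where x: "y = \<sigma> x" "x \<in> carrier R" "\<And>r. r \<in> carrier R \<Longrightarrow> r \<otimes> x \<in> H" by (auto simp: ann_def)
  have "r \<otimes> y \<in> \<sigma> ` H" if r: "r \<in> carrier R" for r
  proof -
    have r': "inv_into UNIV \<sigma> r \<in> carrier R" by (rule Aut_closed[OF Aut_inv[OF s] r])
    have "\<sigma> (inv_into UNIV \<sigma> r \<otimes> x) = r \<otimes> y" using Aut_mult[OF s r' x(2)] Aut_inv_apply(2)[OF s] x(1) by simp
    then show ?thesis using x(3)[OF r'] by (metis imageI)
  qed
  then show "y \<in> ann (\<sigma> ` H)" using x Aut_closed[OF s] by (simp add: ann_def)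
next
  fix y assume y: "y \<in> ann (\<sigma> ` H)"
  then have yc: "y \<in> carrier R" by (simp add: ann_def)
  define x where "x = inv_into UNIV \<sigma> y"
  have xc: "x \<in> carrier R" unfolding x_def by (rule Aut_closed[OF Aut_inv[OF s] yc])
  have yx: "y = \<sigma> x" using Aut_inv_apply(2)[OF s] by (simp add: x_def)
  have "r \<otimes> x \<in> H" if r: "r \<in> carrier R" for r
  proof -
    have "\<sigma> r \<otimes> y \<in> \<sigma> ` H" using y Aut_closed[OF s r] by (simp add: ann_def)
    then have "\<sigma> (r \<otimes> x) \<in> \<sigma> ` H" using Aut_mult[OF s r xc] yx by simp
    then show ?thesis using Aut_inv_apply(1)[OF s] by (metis imageE)
  qed
  then show "y \<in> \<sigma> ` ann H" using xc yx by (simp add: ann_def)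
qed

text \<open>The conjugates of \<open>ann H\<close> are the sets \<open>ann (\<sigma> H)\<close>, and the \<open>\<sigma> H\<close> are among the small number of
subgroups that contain \<open>G00\<close>. So the intersection of the conjugates is type-definable, invariant and of bounded
index.\<close>

lemma G00_subset_ann:
  assumes H: "subgrp H" "tdef H" "G00 \<subseteq> H" "bounded (ann H)"
  shows "G00 \<subseteq> ann H"
proof -
  define \<O> where "\<O> = (\<lambda>\<sigma>. \<sigma> ` ann H) ` Aut"
  define K where "K = carrier R \<inter> \<Inter>\<O>"
  obtain \<S> where S: "small \<S>" "\<And>S. S \<in> \<S> \<Longrightarrow> dset S" "ann H = carrier R \<inter> \<Inter>\<S>"
    using ann_tdef[OF H(2)] by (auto simp: tdef_def)
  have tS: "thick S" if "S \<in> \<S>" for S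
  proof (rule thick_of_bounded[OF ann_subgrp[OF H(1)] H(4)])
    show "ann H \<subseteq> S" unfolding S(3) using that by auto
  qed (rule S(2)[OF that])
  have "\<O> \<subseteq> ann ` {H. subgrp H \<and> G00 \<subseteq> H}"
  proof
    fix X assume "X \<in> \<O>"
    then obtain \<sigma> where s: "\<sigma> \<in> Aut" "X = ann (\<sigma> ` H)" by (auto simp: \<O>_def ann_Aut)
    have "\<sigma> ` G00 \<subseteq> \<sigma> ` H" using H(3) by blast
    then have "G00 \<subseteq> \<sigma> ` H" using tdefA_invariant[OF G00_tdefA s(1)] by simp
    then show "X \<in> ann ` {H. subgrp H \<and> G00 \<subseteq> H}" using s subgrp_Aut[OF s(1) H(1)] by blast
  qed
  then have smallO: "small \<O>"
    by (rule small_subset[OF small_image[OF small_overgroups[OF G00_subgrp G00_bounded]]])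
  have "\<forall>X\<in>\<O>. \<exists>\<sigma>\<in>Aut. X = \<sigma> ` ann H" by (auto simp: \<O>_def)
  then obtain c where c: "\<And>X. X \<in> \<O> \<Longrightarrow> c X \<in> Aut \<and> X = c X ` ann H" by metis
  define \<T> where "\<T> = (\<lambda>(X, S). c X ` S) ` (\<O> \<times> \<S>)"
  have Tm: "\<exists>X S. X \<in> \<O> \<and> S \<in> \<S> \<and> T = c X ` S" if "T \<in> \<T>" for T using that by (auto simp: \<T>_def)
  have smallT: "small \<T>" unfolding \<T>_def by (intro small_image small_Times' smallO S(1))
  have dT: "dset T" and tT: "thick T" if T: "T \<in> \<T>" for T
  proof -
    obtain X S where XS: "X \<in> \<O>" "S \<in> \<S>" "T = c X ` S" using Tm[OF T] by blast
    have cX: "c X \<in> Aut" using c[OF XS(1)] by simp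
    show "dset T" unfolding XS(3) by (rule Aut_dset[OF cX S(2)[OF XS(2)]])
    show "thick T" unfolding XS(3) by (rule thick_Aut[OF cX tS[OF XS(2)]])
  qed
  have K_eq: "K = carrier R \<inter> \<Inter>\<T>"
  proof -
    have X: "X = carrier R \<inter> \<Inter>((`) (c X) ` \<S>)" if "X \<in> \<O>" for X
      using c[OF that] Aut_Inter[of "c X" \<S>] S(3) by metis
    have "x \<in> X \<longleftrightarrow> (\<forall>S\<in>\<S>. x \<in> c X ` S)" if "X \<in> \<O>" "x \<in> carrier R" for x X
      using that(2) by (subst X[OF that(1)]) simp
    then show ?thesis unfolding K_def \<T>_def by auto
  qed
  have sub: "subgrp K"
  proof -
    have "subgrp (\<Inter>(insert (carrier R) \<O>))"
      by (rule subgrp_Inter) (use subgrp_carrier subgrp_Aut ann_subgrp[OF H(1)] in \<open>auto simp: \<O>_def\<close>)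
    then show ?thesis by (simp add: K_def)
  qed
  have "tdef K" unfolding tdef_def using smallT dT K_eq by (intro exI[of _ \<T>]) simp
  moreover have "\<tau> ` K \<subseteq> K" if t: "\<tau> \<in> Aut" for \<tau>
  proof
    fix y assume "y \<in> \<tau> ` K"
    then obtain x where x: "x \<in> K" "y = \<tau> x" by blast
    have "y \<in> \<sigma> ` ann H" if s: "\<sigma> \<in> Aut" for \<sigma>
    proof -
      have "inv_into UNIV \<tau> \<circ> \<sigma> \<in> Aut" by (intro Aut_comp Aut_inv t s)
      then have "x \<in> (inv_into UNIV \<tau> \<circ> \<sigma>) ` ann H" using x(1) unfolding K_def \<O>_def by blast
      then obtain z where "z \<in> ann H" "x = inv_into UNIV \<tau> (\<sigma> z)" by auto
      then show ?thesis using x(2) Aut_inv_apply(2)[OF t] by simp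
    qed
    moreover have "y \<in> carrier R" using x t Aut_closed by (simp add: K_def)
    ultimately show "y \<in> K" by (simp add: K_def \<O>_def)
  qed
  ultimately have "tdefA K" by (rule invariant_tdefA)
  moreover have "bounded K"
    using bounded_Int_family[OF smallT dT tT] sub K_eq by simp
  ultimately have "G00 \<subseteq> K" using sub by (intro G00_subset)
  moreover have "K \<subseteq> id ` ann H" using Aut_id unfolding K_def \<O>_def by blast
  ultimately show ?thesis by simp
qed

lemma thick_of_cover:
  assumes "finite F" "F \<subseteq> carrier R" "\<And>x. x \<in> carrier R \<Longrightarrow> \<exists>f\<in>F. x \<ominus> f \<in> B"
    "\<And>a b. a \<in> B \<Longrightarrow> b \<in> B \<Longrightarrow> a \<ominus> b \<in> D"
  shows "thick D"
proof -
  have "nthick (Suc (card F)) D" unfolding nthick_def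
  proof (intro allI impI notI)
    fix Y assume Y: "Y \<subseteq> carrier R \<and> finite Y \<and> card Y = Suc (card F)" and s: "sep D Y"
    have "\<forall>y\<in>Y. \<exists>f\<in>F. y \<ominus> f \<in> B" using Y assms(3) by blast
    then obtain h where h: "\<And>y. y \<in> Y \<Longrightarrow> h y \<in> F \<and> y \<ominus> h y \<in> B" by metis
    have "\<not> inj_on h Y"
      using card_inj_on_le[of h Y F] h Y assms(1) by auto
    then obtain y z where yz: "y \<in> Y" "z \<in> Y" "y \<noteq> z" "h y = h z" by (auto simp: inj_on_def)
    have c: "y \<in> carrier R" "z \<in> carrier R" "h y \<in> carrier R" using yz Y h assms(2) by blast+
    have "y \<ominus> z = (y \<ominus> h y) \<ominus> (z \<ominus> h z)" "z \<ominus> y = (z \<ominus> h z) \<ominus> (y \<ominus> h y)"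
      using c yz(4)[symmetric] by (simp_all add: group_simps)
    then have "y \<ominus> z \<in> D \<and> z \<ominus> y \<in> D" using h[OF yz(1)] h[OF yz(2)] assms(4) by metis
    then show False using s yz unfolding sep_def by metis
  qed
  then show ?thesis by (auto simp: thick_def)
qed

text \<open>A thick set is not covered by finitely many sets each of which is far from thick.\<close>

text \<open>A thick set has finitely many translates that cover \<open>R\<close>. If it were covered by the \<open>T i\<close> then finitely many
translates of the \<open>T i\<close> would cover \<open>R\<close>, and the covering lemma would make one of the \<open>D i\<close> thick.\<close>

lemma thick_not_covered:
  assumes S: "thick S" "\<zero> \<in> S" "S \<subseteq> carrier R" and I: "finite I"
    and T: "\<And>i. i \<in> I \<Longrightarrow> T i \<subseteq> carrier R \<and> neg (T i) = T i \<and> \<not> thick (D i) \<and>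
      (\<forall>a\<in>msum 4 (T i). \<forall>b\<in>msum 4 (T i). a \<ominus> b \<in> D i)"
  shows "\<exists>x\<in>S. \<forall>i\<in>I. x \<notin> T i"
proof (rule ccontr)
  assume contr: "\<not> ?thesis"
  obtain Y where Y: "Y \<subseteq> carrier R" "finite Y" "\<And>x. x \<in> carrier R \<Longrightarrow> \<exists>y\<in>Y. x \<ominus> y \<in> S"
    using thick_cover[OF S(1,2)] by blast
  define P where "P i = T i \<boxplus> T i" for i
  define C where "C = (\<lambda>(y, i). {x\<in>carrier R. x \<ominus> y \<in> T i})"
  have TR: "T i \<subseteq> carrier R" "neg (T i) = T i" if "i \<in> I" for i using T[OF that] by auto
  have PR: "P i \<subseteq> carrier R" if "i \<in> I" for i unfolding P_def by (rule sumset_sub[OF TR(1) TR(1)]) fact+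
  have P2: "P i = msum 2 (T i)" if "i \<in> I" for i
  proof -
    have "T i \<boxplus> {\<zero>} = T i"
    proof -
      have "x \<oplus> \<zero> = x" if "x \<in> T i" for x using that TR(1)[OF \<open>i \<in> I\<close>] by (simp add: subset_iff)
      then show ?thesis by (auto simp: sumset_def) metis
    qed
    then show ?thesis by (simp add: P_def numeral_2_eq_2)
  qed
  have invp: "m_inv (add_monoid R) x = \<ominus> x" for x by (simp add: a_inv_def)
  have "\<Union>(C ` (Y \<times> I)) \<noteq> carrier (add_monoid R)"
  proof (rule group.neumann_covering[OF a_group I, of P])
    fix i p assume i: "i \<in> I" and p: "p \<in> P i"
    have "\<ominus> p \<in> P i" using msum_minus[OF TR(1,2)[OF i], of p 2] p P2[OF i] by simp
    then show "p \<in> carrier (add_monoid R) \<and> m_inv (add_monoid R) p \<in> P i"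
      using PR[OF i] p by (auto simp: invp)
  next
    fix i F assume i: "i \<in> I" and F: "finite F" "F \<subseteq> carrier (add_monoid R)"
    show "\<exists>y\<in>carrier (add_monoid R). \<forall>p\<in>P i. \<forall>q\<in>P i. \<forall>f\<in>F. y \<noteq> p \<otimes>\<^bsub>add_monoid R\<^esub> q \<otimes>\<^bsub>add_monoid R\<^esub> f"
    proof (rule ccontr)
      assume "\<not> ?thesis"
      then have *: "\<exists>p\<in>P i. \<exists>q\<in>P i. \<exists>f\<in>F. y = p \<oplus> q \<oplus> f" if "y \<in> carrier R" for y
        using that by simp
      have "thick (D i)"
      proof (rule thick_of_cover[OF F(1), of "msum 4 (T i)"])
        show "F \<subseteq> carrier R" using F by simp
        fix y assume y: "y \<in> carrier R"
        obtain p q f where pqf: "p \<in> P i" "q \<in> P i" "f \<in> F" "y = p \<oplus> q \<oplus> f" using *[OF y] by blast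
        have c: "p \<in> carrier R" "q \<in> carrier R" "f \<in> carrier R" using pqf PR[OF i] F by auto
        have "y \<ominus> f = p \<oplus> q" using pqf(4) c by (simp add: group_simps)
        moreover have "p \<oplus> q \<in> msum 4 (T i)"
          using sumsetI[OF pqf(1,2)] msum_add[OF TR(1)[OF i], of 2 2] P2[OF i] by simp
        ultimately have "y \<ominus> f \<in> msum 4 (T i)" by (simp only:)
        then show "\<exists>f\<in>F. y \<ominus> f \<in> msum 4 (T i)" using pqf(3) by (rule_tac bexI)
      qed (use T[OF i] in blast)
      then show False using T[OF i] by blast
    qed
  next
    show "finite (C ` (Y \<times> I))" using Y(2) I by simp
  next
    fix X assume "X \<in> C ` (Y \<times> I)"
    then obtain y i where X: "X = {x\<in>carrier R. x \<ominus> y \<in> T i}" "y \<in> Y" "i \<in> I" by (auto simp: C_def)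
    show "X \<subseteq> carrier (add_monoid R)" by (auto simp: X(1))
    have yc: "y \<in> carrier R" using X(2) Y(1) by blast
    have "c \<oplus> \<ominus> c' \<in> P i" if cc: "c \<in> X" "c' \<in> X" for c c'
    proof -
      have c: "c \<in> carrier R" "c' \<in> carrier R" "c \<ominus> y \<in> T i" "c' \<ominus> y \<in> T i" using cc by (auto simp: X(1))
      have "c \<oplus> \<ominus> c' = (c \<ominus> y) \<oplus> \<ominus> (c' \<ominus> y)" using c yc by (simp add: group_simps)
      then show ?thesis using sumsetI[OF c(3) neg_eqD[OF TR(2)[OF X(3)] c(4)]] by (simp add: P_def)
    qed
    then show "\<exists>i\<in>I. \<forall>c\<in>X. \<forall>c'\<in>X. c \<otimes>\<^bsub>add_monoid R\<^esub> m_inv (add_monoid R) c' \<in> P i"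
      using X(3) by (intro bexI[of _ i]) (simp_all add: invp)
  qed
  moreover have "\<Union>(C ` (Y \<times> I)) = carrier (add_monoid R)"
  proof (intro equalityI subsetI)
    fix x assume "x \<in> carrier (add_monoid R)"
    then have x: "x \<in> carrier R" by simp
    obtain y where y: "y \<in> Y" "x \<ominus> y \<in> S" using Y(3)[OF x] by blast
    then obtain i where "i \<in> I" "x \<ominus> y \<in> T i" using contr by blast
    then have "x \<in> C (y, i)" "(y, i) \<in> Y \<times> I" using x y by (auto simp: C_def)
    then show "x \<in> \<Union>(C ` (Y \<times> I))" by blast
  qed (auto simp: C_def)
  ultimately show False by simp
qed

lemma nbhd_eighth:
  assumes H: "subgrp H" "tdef H" "H \<subseteq> D" "dset D"
  obtains T where "dset T" "H \<subseteq> T" "neg T = T" "\<And>a b. a \<in> msum 4 T \<Longrightarrow> b \<in> msum 4 T \<Longrightarrow> a \<ominus> b \<in> D"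
proof -
  obtain T1 where T1: "dset T1" "H \<subseteq> T1" "neg T1 = T1" "\<And>x y. x \<in> T1 \<Longrightarrow> y \<in> T1 \<Longrightarrow> x \<oplus> y \<in> D"
    using nbhd_half[OF H] by blast
  obtain T2 where T2: "dset T2" "H \<subseteq> T2" "neg T2 = T2" "\<And>x y. x \<in> T2 \<Longrightarrow> y \<in> T2 \<Longrightarrow> x \<oplus> y \<in> T1"
    using nbhd_half[OF H(1,2) T1(2,1)] by blast
  obtain T3 where T3: "dset T3" "H \<subseteq> T3" "neg T3 = T3" "\<And>x y. x \<in> T3 \<Longrightarrow> y \<in> T3 \<Longrightarrow> x \<oplus> y \<in> T2"
    using nbhd_half[OF H(1,2) T2(2,1)] by blast
  have R3: "T3 \<subseteq> carrier R" by (rule dset_sub[OF T3(1)])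
  have "msum 4 T3 \<subseteq> T1"
  proof
    fix a assume a: "a \<in> msum 4 T3"
    have "msum 4 T3 = msum 2 T3 \<boxplus> msum 2 T3" using msum_add[OF R3, of 2 2] by simp
    then obtain u v where uv: "a = u \<oplus> v" "u \<in> msum 2 T3" "v \<in> msum 2 T3" using a by (auto simp: sumset_def)
    have "w \<in> T2" if "w \<in> msum 2 T3" for w
    proof -
      obtain x y where xy: "x \<in> T3" "y \<in> T3" "w = x \<oplus> (y \<oplus> \<zero>)"
        using \<open>w \<in> msum 2 T3\<close> by (auto simp: numeral_2_eq_2 sumset_def)
      then have "y \<in> carrier R" using R3 by blast
      then show ?thesis using xy T3(4) by simp
    qed
    then show "a \<in> T1" using uv T2(4) by simp
  qed
  then have "a \<ominus> b \<in> D" if "a \<in> msum 4 T3" "b \<in> msum 4 T3" for a b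
    unfolding a_minus_def using that neg_eqD[OF T1(3), of b] by (intro T1(4)) auto
  then show ?thesis using that[of T3] T3(1-3) by blast
qed

text \<open>The conditions on \<open>g\<close> are finitely satisfiable by \<open>thick_not_covered\<close>, and their number is small
because \<open>G00\<close> has few overgroups.\<close>

lemma ex_generic_element:
  obtains g where "g \<in> G00" "\<And>H. subgrp H \<Longrightarrow> tdef H \<Longrightarrow> G00 \<subseteq> H \<Longrightarrow> g \<in> ann H \<Longrightarrow> G00 \<subseteq> ann H"
proof -
  define \<F> where "\<F> = {H. subgrp H \<and> tdef H \<and> G00 \<subseteq> H \<and> \<not> G00 \<subseteq> ann H}"
  have smallF: "small \<F>"
    by (rule small_subset[OF small_overgroups[OF G00_subgrp G00_bounded]]) (auto simp: \<F>_def)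
  have "\<exists>T D. dset T \<and> ann H \<subseteq> T \<and> neg T = T \<and> \<not> thick D \<and>
    (\<forall>a\<in>msum 4 T. \<forall>b\<in>msum 4 T. a \<ominus> b \<in> D)" if H: "H \<in> \<F>" for H
  proof -
    have h: "subgrp H" "tdef H" "G00 \<subseteq> H" "\<not> G00 \<subseteq> ann H" using H by (auto simp: \<F>_def)
    then have "\<not> bounded (ann H)" using G00_subset_ann by blast
    then obtain D where D: "dset D" "ann H \<subseteq> D" "\<not> thick D"
      using bounded_of_thick[OF ann_subgrp[OF h(1)] ann_tdef[OF h(2)]] by blast
    obtain T where "dset T" "ann H \<subseteq> T" "neg T = T" "\<And>a b. a \<in> msum 4 T \<Longrightarrow> b \<in> msum 4 T \<Longrightarrow> a \<ominus> b \<in> D"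
      using nbhd_eighth[OF ann_subgrp[OF h(1)] ann_tdef[OF h(2)] D(2,1)] by blast
    then show ?thesis using D(3) by blast
  qed
  then obtain T D where TD: "\<And>H. H \<in> \<F> \<Longrightarrow> dset (T H) \<and> ann H \<subseteq> T H \<and> neg (T H) = T H \<and> \<not> thick (D H) \<and>
    (\<forall>a\<in>msum 4 (T H). \<forall>b\<in>msum 4 (T H). a \<ominus> b \<in> D H)" by metis
  define N where "N = {S. A.dset S \<and> G00 \<subseteq> S}"
  have G_eq: "G00 = carrier R \<inter> \<Inter>N" unfolding N_def by (rule tdefA_canonical[OF G00_tdefA])
  have smallN: "small N" by (rule small_subset[OF few_A]) (auto simp: N_def)
  define St where "St = (\<lambda>s. case s of Inl S \<Rightarrow> S | Inr H \<Rightarrow> carrier R - T H)"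
  have "\<exists>x\<in>carrier R. \<forall>s\<in>Inl ` N \<union> Inr ` \<F>. x \<in> St s"
  proof (rule saturation_family)
    show "small (Inl ` N \<union> Inr ` \<F>)" by (intro small_Un' small_image smallN smallF)
    show "dset (St s)" if "s \<in> Inl ` N \<union> Inr ` \<F>" for s
      using that TD A_dset dset_Diff dset_carrier by (auto simp: St_def N_def)
    fix J assume J: "finite J" "J \<subseteq> Inl ` N \<union> Inr ` \<F>"
    define J1 where "J1 = {S. Inl S \<in> J}"
    define J2 where "J2 = {H. Inr H \<in> J}"
    have fin: "finite J1" "finite J2" unfolding J1_def J2_def
      using J(1) by (auto intro!: finite_vimageI[of J Inl, unfolded vimage_def] finite_vimageI[of J Inr, unfolded vimage_def])
    have sub: "J1 \<subseteq> N" "J2 \<subseteq> \<F>" using J(2) by (auto simp: J1_def J2_def)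
    define S0 where "S0 = carrier R \<inter> \<Inter>J1"
    have "G00 \<subseteq> S0" using G_eq sub(1) unfolding S0_def by auto
    moreover have "thick S0" unfolding S0_def
    proof (rule thick_finite_Int[OF fin(1)])
      fix S assume "S \<in> J1"
      then have "A.dset S" "G00 \<subseteq> S" using sub(1) by (auto simp: N_def)
      then show "thick S" using thick_of_bounded[OF G00_subgrp G00_bounded] A_dset by blast
    qed
    moreover have "\<zero> \<in> S0" using calculation(1) subgrp_zero[OF G00_subgrp] by blast
    moreover have "S0 \<subseteq> carrier R" by (simp add: S0_def)
    moreover have "T H \<subseteq> carrier R \<and> neg (T H) = T H \<and> \<not> thick (D H) \<and>
      (\<forall>a\<in>msum 4 (T H). \<forall>b\<in>msum 4 (T H). a \<ominus> b \<in> D H)" if "H \<in> J2" for H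
    proof -
      have "H \<in> \<F>" using that sub(2) by blast
      then show ?thesis using TD[of H] dset_sub[of "T H"] by blast
    qed
    ultimately have "\<exists>x\<in>S0. \<forall>H\<in>J2. x \<notin> T H"
      using fin(2) by (intro thick_not_covered[of S0 J2 T D]) blast+
    then obtain x where x: "x \<in> S0" "\<And>H. H \<in> J2 \<Longrightarrow> x \<notin> T H" by blast
    have "x \<in> St s" if s: "s \<in> J" for s
    proof (cases s)
      case (Inl S)
      then show ?thesis using x(1) s by (simp add: St_def S0_def J1_def)
    next
      case (Inr H)
      then show ?thesis using x s by (simp add: St_def S0_def J2_def)
    qed
    moreover have "x \<in> carrier R" using x(1) by (simp add: S0_def)
    ultimately show "\<exists>x\<in>carrier R. \<forall>s\<in>J. x \<in> St s" by blast
  qed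
  then obtain g where g: "g \<in> carrier R" "\<And>s. s \<in> Inl ` N \<union> Inr ` \<F> \<Longrightarrow> g \<in> St s" by blast
  have gN: "g \<in> S" if "S \<in> N" for S using g(2)[of "Inl S"] that by (simp add: St_def)
  have gT: "g \<notin> T H" if "H \<in> \<F>" for H using g(2)[of "Inr H"] that by (simp add: St_def)
  show ?thesis
  proof (rule that)
    show "g \<in> G00" using G_eq g(1) gN by simp
    fix H assume H: "subgrp H" "tdef H" "G00 \<subseteq> H" "g \<in> ann H"
    show "G00 \<subseteq> ann H"
    proof (rule ccontr)
      assume "\<not> G00 \<subseteq> ann H"
      then have HF: "H \<in> \<F>" using H by (simp add: \<F>_def)
      then show False using gT[OF HF] TD[OF HF] H(4) by blast
    qed
  qed
qed

lemma tdef_sum_principal: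
  assumes "tdefA H" "H \<subseteq> carrier R" "g \<in> carrier R"
  shows "tdef (H \<boxplus> (\<lambda>r. r \<otimes> g) ` carrier R)"
proof -
  define \<S> where "\<S> = {S. A.dset S \<and> H \<subseteq> S}"
  have H_eq: "H = carrier R \<inter> \<Inter>\<S>" unfolding \<S>_def by (rule tdefA_canonical[OF assms(1)])
  have smallS: "small \<S>" by (rule small_subset[OF few_A]) (auto simp: \<S>_def)
  define I where "I = {F. finite F \<and> F \<subseteq> \<S>}"
  define N where "N F = carrier R \<inter> \<Inter>F" for F :: "'b set set"
  have smallI: "small I" unfolding I_def by (rule small_finite_subsets[OF smallS])
  have dN: "dset (N F)" if F: "F \<in> I" for F
    unfolding N_def
  proof (rule dset_finite_Int)
    show "finite F" using F by (simp add: I_def)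
    show "dset E" if "E \<in> F" for E using F that A_dset unfolding I_def \<S>_def by blast
  qed
  define M where "M F = {x\<in>carrier R. \<exists>s\<in>N F. \<exists>r\<in>carrier R. x = s \<oplus> r \<otimes> g}" for F
  have dM: "dset (M F)" if F: "F \<in> I" for F
    unfolding M_def by (intro dset_Collect fo_intros dN[OF F] fot_const assms(3))
  have "H \<boxplus> (\<lambda>r. r \<otimes> g) ` carrier R = carrier R \<inter> \<Inter>(M ` I)"
  proof (intro equalityI subsetI)
    fix x assume "x \<in> H \<boxplus> (\<lambda>r. r \<otimes> g) ` carrier R"
    then obtain h r where h: "h \<in> H" "r \<in> carrier R" "x = h \<oplus> r \<otimes> g" by (auto simp: sumset_def)
    have hc: "h \<in> carrier R" using h(1) assms(2) by blast
    have xc: "x \<in> carrier R" using h hc assms(3) by simp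
    have "h \<in> N F" if "F \<in> I" for F using h(1) H_eq that unfolding N_def I_def by auto
    then show "x \<in> carrier R \<inter> \<Inter>(M ` I)" using h xc by (auto simp: M_def)
  next
    fix x assume x: "x \<in> carrier R \<inter> \<Inter>(M ` I)"
    then have xc: "x \<in> carrier R" by simp
    have "\<exists>r\<in>carrier R. \<forall>F\<in>I. r \<in> {r\<in>carrier R. x \<ominus> r \<otimes> g \<in> N F}"
    proof (rule saturation_family[OF smallI])
      fix F assume F: "F \<in> I"
      show "dset {r\<in>carrier R. x \<ominus> r \<otimes> g \<in> N F}"
        by (intro dset_Collect fo_intros dN[OF F] fot_const assms(3) xc)
    next
      fix J assume J: "finite J" "J \<subseteq> I"
      have "\<Union>J \<in> I" using J by (auto simp: I_def)
      then have "x \<in> M (\<Union>J)" using x by blast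
      then obtain s r where s: "s \<in> N (\<Union>J)" "r \<in> carrier R" "x = s \<oplus> r \<otimes> g" by (auto simp: M_def)
      have "s \<in> carrier R" using s(1) by (simp add: N_def)
      then have "x \<ominus> r \<otimes> g = s" using s assms(3) by (simp add: group_simps)
      moreover have "s \<in> N F" if "F \<in> J" for F using s(1) that by (auto simp: N_def)
      ultimately show "\<exists>r\<in>carrier R. \<forall>F\<in>J. r \<in> {r\<in>carrier R. x \<ominus> r \<otimes> g \<in> N F}"
        using s(2) by (intro bexI[of _ r]) simp_all
    qed
    then obtain r where r: "r \<in> carrier R" "\<And>F. F \<in> I \<Longrightarrow> x \<ominus> r \<otimes> g \<in> N F" by blast
    have "x \<ominus> r \<otimes> g \<in> S" if "S \<in> \<S>" for S using r(2)[of "{S}"] that by (simp add: I_def N_def)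
    then have "x \<ominus> r \<otimes> g \<in> H" using H_eq xc r(1) assms(3) by simp
    then have "(x \<ominus> r \<otimes> g) \<oplus> r \<otimes> g \<in> H \<boxplus> (\<lambda>r. r \<otimes> g) ` carrier R" using r(1) by (intro sumsetI) auto
    then show "x \<in> H \<boxplus> (\<lambda>r. r \<otimes> g) ` carrier R" using xc r(1) assms(3) by (simp add: group_simps)
  qed
  then show ?thesis unfolding tdef_def using dM smallI small_image by (intro exI[of _ "M ` I"]) auto
qed

text \<open>Because \<open>G00\<close> is a subgroup, this is the sum set of \<open>G00\<close> and the set of products \<open>R \<cdot> G00\<close>.\<close>

definition J00 :: "'b set" where
  "J00 = {h \<oplus> r \<otimes> h' | h h' r. h \<in> G00 \<and> h' \<in> G00 \<and> r \<in> carrier R}"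

text \<open>For a generic \<open>g\<close> the subgroup \<open>G00 + R g\<close> contains \<open>R g\<close>, so \<open>g\<close> lies in its annihilator and then so does all
of \<open>G00\<close>. Thus the set of products is absorbed by \<open>R g\<close>.\<close>

lemma J00_principal:
  obtains g where "g \<in> G00" "J00 = G00 \<boxplus> (\<lambda>r. r \<otimes> g) ` carrier R"
    "subgrp (G00 \<boxplus> (\<lambda>r. r \<otimes> g) ` carrier R)" "G00 \<subseteq> ann (G00 \<boxplus> (\<lambda>r. r \<otimes> g) ` carrier R)"
proof -
  obtain g where g: "g \<in> G00" "\<And>H. subgrp H \<Longrightarrow> tdef H \<Longrightarrow> G00 \<subseteq> H \<Longrightarrow> g \<in> ann H \<Longrightarrow> G00 \<subseteq> ann H"
    using ex_generic_element by blast
  have GR: "G00 \<subseteq> carrier R" by (rule subgrp_sub[OF G00_subgrp])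
  have gc: "g \<in> carrier R" using g(1) GR by blast
  define J where "J = G00 \<boxplus> (\<lambda>r. r \<otimes> g) ` carrier R"
  have Jm: "x \<in> J \<longleftrightarrow> (\<exists>h\<in>G00. \<exists>r\<in>carrier R. x = h \<oplus> r \<otimes> g)" for x
    by (auto simp: J_def sumset_def)
  have GJ: "G00 \<subseteq> J"
  proof
    fix h assume h: "h \<in> G00"
    then have "h = h \<oplus> \<zero> \<otimes> g" using gc GR by (simp add: subset_iff)
    then show "h \<in> J" using h zero_closed unfolding Jm by blast
  qed
  have Jsub: "subgrp J"
    unfolding subgrp_def
  proof (intro conjI ballI)
    show "J \<subseteq> carrier R"
    proof
      fix x assume "x \<in> J"
      then obtain h r where "x = h \<oplus> r \<otimes> g" "h \<in> carrier R" "r \<in> carrier R" using GR unfolding Jm by blast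
      then show "x \<in> carrier R" using gc by simp
    qed
    show "\<zero> \<in> J" using GJ subgrp_zero[OF G00_subgrp] by blast
    fix x y assume "x \<in> J" "y \<in> J"
    then obtain h r h' r' where e: "x = h \<oplus> r \<otimes> g" "y = h' \<oplus> r' \<otimes> g" "h \<in> G00" "h' \<in> G00" "r \<in> carrier R" "r' \<in> carrier R"
      unfolding Jm by blast
    have c: "h \<in> carrier R" "h' \<in> carrier R" using e GR by blast+
    have "(r \<ominus> r') \<otimes> g = r \<otimes> g \<ominus> r' \<otimes> g" using e gc by (simp add: a_minus_def rng_l_distr l_minus_rng)
    then have "x \<ominus> y = (h \<ominus> h') \<oplus> (r \<ominus> r') \<otimes> g" using e c gc by (simp add: group_simps)
    then show "x \<ominus> y \<in> J" unfolding Jm using subgrp_diff[OF G00_subgrp e(3,4)] minus_closed[OF e(5,6)] by blast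
  qed
  have "tdef J" unfolding J_def by (rule tdef_sum_principal[OF G00_tdefA GR gc])
  moreover have "g \<in> ann J"
  proof -
    have "r \<otimes> g \<in> J" if r: "r \<in> carrier R" for r
    proof -
      have "r \<otimes> g = \<zero> \<oplus> r \<otimes> g" using r gc by simp
      then show ?thesis unfolding Jm using r subgrp_zero[OF G00_subgrp] by blast
    qed
    then show ?thesis using gc by (simp add: ann_def)
  qed
  ultimately have ann: "G00 \<subseteq> ann J" using g(2)[OF Jsub] GJ by blast
  have "J00 = J"
  proof (intro equalityI subsetI)
    fix x assume "x \<in> J00"
    then obtain h h' r where x: "x = h \<oplus> r \<otimes> h'" "h \<in> G00" "h' \<in> G00" "r \<in> carrier R" by (auto simp: J00_def)
    have "r \<otimes> h' \<in> J" using ann x(3,4) by (auto simp: ann_def)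
    moreover have "h \<in> J" using GJ x(2) by blast
    ultimately show "x \<in> J" using x(1) subgrp_add[OF Jsub] by simp
  next
    fix x assume "x \<in> J"
    then show "x \<in> J00" unfolding Jm J00_def using g(1) by blast
  qed
  then show ?thesis using that[of g] g(1) Jsub ann by (simp add: J_def)
qed

text \<open>The set is a left ideal by \<open>J00_principal\<close>. Therefore an element \<open>r\<close> acts on the left on the bounded quotient
\<open>R / J00\<close>. There are few such actions, so the invariant subgroup of all \<open>r\<close> with \<open>r R \<subseteq> J00\<close> has bounded index
and contains \<open>G00\<close>, which makes the set also a right ideal.\<close>

lemma J00_ideal:
  "subgrp J00" "tdefA J00" "bounded J00" "G00 \<subseteq> J00"
  "\<And>r x. r \<in> carrier R \<Longrightarrow> x \<in> J00 \<Longrightarrow> r \<otimes> x \<in> J00"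
  "\<And>r x. r \<in> carrier R \<Longrightarrow> x \<in> J00 \<Longrightarrow> x \<otimes> r \<in> J00"
proof -
  obtain g where g: "g \<in> G00" "J00 = G00 \<boxplus> (\<lambda>r. r \<otimes> g) ` carrier R" "subgrp J00" "G00 \<subseteq> ann J00"
    using J00_principal by metis
  have GR: "G00 \<subseteq> carrier R" by (rule subgrp_sub[OF G00_subgrp])
  have gc: "g \<in> carrier R" using g(1) GR by blast
  show sub: "subgrp J00" by (rule g(3))
  have JR: "J00 \<subseteq> carrier R" by (rule subgrp_sub[OF sub])
  show GJ: "G00 \<subseteq> J00"
  proof
    fix h assume h: "h \<in> G00"
    then have "h = h \<oplus> \<zero> \<otimes> g" using gc GR by (simp add: subset_iff)
    then show "h \<in> J00" using h g(1) zero_closed unfolding J00_def by blast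
  qed
  have tJ: "tdef J00" unfolding g(2) by (rule tdef_sum_principal[OF G00_tdefA GR gc])
  have inv: "\<sigma> ` J00 \<subseteq> J00" if s: "\<sigma> \<in> Aut" for \<sigma>
  proof
    fix y assume "y \<in> \<sigma> ` J00"
    then obtain h h' r where y: "y = \<sigma> (h \<oplus> r \<otimes> h')" "h \<in> G00" "h' \<in> G00" "r \<in> carrier R" by (auto simp: J00_def)
    have c: "h \<in> carrier R" "h' \<in> carrier R" using y GR by blast+
    have "y = \<sigma> h \<oplus> \<sigma> r \<otimes> \<sigma> h'" using y(1,4) c Aut_add[OF s] Aut_mult[OF s] by simp
    moreover have "\<sigma> h \<in> G00" "\<sigma> h' \<in> G00" using y(2,3) tdefA_invariant[OF G00_tdefA s] by blast+
    ultimately show "y \<in> J00" unfolding J00_def using Aut_closed[OF s y(4)] by blast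
  qed
  show tA: "tdefA J00" by (rule invariant_tdefA[OF tJ inv])
  show bJ: "bounded J00" by (rule bounded_mono[OF G00_bounded GJ G00_subgrp sub])
  show left: "r \<otimes> x \<in> J00" if r: "r \<in> carrier R" and x: "x \<in> J00" for r x
  proof -
    obtain h h' r' where x: "x = h \<oplus> r' \<otimes> h'" "h \<in> G00" "h' \<in> G00" "r' \<in> carrier R" using x by (auto simp: J00_def)
    have c: "h \<in> carrier R" "h' \<in> carrier R" using x GR by blast+
    have "r \<otimes> x = r \<otimes> h \<oplus> (r \<otimes> r') \<otimes> h'" using x(1,4) c r by (simp add: rng_r_distr rng_m_assoc)
    moreover have "r \<otimes> h \<in> J00" using g(4) x(2) r by (auto simp: ann_def)
    moreover have "(r \<otimes> r') \<otimes> h' \<in> J00" using g(4) x(3,4) r by (auto simp: ann_def)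
    ultimately show ?thesis using subgrp_add[OF sub] by simp
  qed
  define N where "N = {r\<in>carrier R. \<forall>x\<in>carrier R. r \<otimes> x \<in> J00}"
  have Nsub: "subgrp N"
    unfolding subgrp_def
  proof (intro conjI ballI)
    show "N \<subseteq> carrier R" by (auto simp: N_def)
    show "\<zero> \<in> N" using subgrp_zero[OF sub] by (simp add: N_def)
    fix x y assume xy: "x \<in> N" "y \<in> N"
    have "(x \<ominus> y) \<otimes> r = x \<otimes> r \<ominus> y \<otimes> r" if "r \<in> carrier R" for r
      using xy that by (simp add: N_def a_minus_def rng_l_distr l_minus_rng)
    then show "x \<ominus> y \<in> N" using xy subgrp_diff[OF sub] by (simp add: N_def)
  qed
  have tN: "tdef N"
  proof -
    obtain \<S> where S: "small \<S>" "\<And>S. S \<in> \<S> \<Longrightarrow> dset S" "J00 = carrier R \<inter> \<Inter>\<S>"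
      using tJ by (auto simp: tdef_def)
    define NS where "NS S = {r\<in>carrier R. \<forall>x\<in>carrier R. r \<otimes> x \<in> S}" for S
    have "N = carrier R \<inter> \<Inter>(NS ` \<S>)" unfolding N_def NS_def S(3) by auto
    moreover have "dset (NS S)" if "S \<in> \<S>" for S
      unfolding NS_def by (intro dset_Collect fo_intros S(2) that)
    ultimately show ?thesis unfolding tdef_def using small_image[OF S(1)] by (intro exI[of _ "NS ` \<S>"]) auto
  qed
  have invN: "\<sigma> ` N \<subseteq> N" if s: "\<sigma> \<in> Aut" for \<sigma>
  proof
    fix y assume "y \<in> \<sigma> ` N"
    then obtain r where r: "y = \<sigma> r" "r \<in> carrier R" "\<And>x. x \<in> carrier R \<Longrightarrow> r \<otimes> x \<in> J00" by (auto simp: N_def)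
    have "y \<otimes> x \<in> J00" if x: "x \<in> carrier R" for x
    proof -
      have x': "inv_into UNIV \<sigma> x \<in> carrier R" by (rule Aut_closed[OF Aut_inv[OF s] x])
      have "y \<otimes> x = \<sigma> (r \<otimes> inv_into UNIV \<sigma> x)" using Aut_mult[OF s r(2) x'] Aut_inv_apply(2)[OF s] r(1) by simp
      then show ?thesis using r(3)[OF x'] inv[OF s] by blast
    qed
    then show "y \<in> N" using r Aut_closed[OF s] by (simp add: N_def)
  qed
  have "bounded N"
    unfolding bounded_def
  proof (rule small_factor)
    let ?f = "\<lambda>r. (\<lambda>x. (cos J00 x, cos J00 (r \<otimes> x))) ` carrier R"
    have "?f ` carrier R \<subseteq> Pow (cos J00 ` carrier R \<times> cos J00 ` carrier R)" by auto
    moreover have "small (Pow (cos J00 ` carrier R \<times> cos J00 ` carrier R))"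
      using bJ unfolding bounded_def by (intro small_Pow' small_Times')
    ultimately show "small (?f ` carrier R)" by (rule small_subset[rotated])
    fix r r' assume r: "r \<in> carrier R" "r' \<in> carrier R" "?f r = ?f r'"
    have "(r \<ominus> r') \<otimes> x \<in> J00" if x: "x \<in> carrier R" for x
    proof -
      have "(cos J00 x, cos J00 (r \<otimes> x)) \<in> ?f r'" using x unfolding r(3)[symmetric] by blast
      then obtain x' where x': "x' \<in> carrier R" "cos J00 x = cos J00 x'" "cos J00 (r \<otimes> x) = cos J00 (r' \<otimes> x')" by auto
      have 1: "x \<ominus> x' \<in> J00" using cos_eq[OF sub x x'(1)] x'(2) by simp
      have 2: "r \<otimes> x \<ominus> r' \<otimes> x' \<in> J00" using cos_eq[OF sub, of "r \<otimes> x" "r' \<otimes> x'"] x'(1,3) x r by simp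
      have "r' \<otimes> (x \<ominus> x') = r' \<otimes> x \<ominus> r' \<otimes> x'" using x x'(1) r by (simp add: a_minus_def rng_r_distr r_minus_rng)
      then have 3: "r' \<otimes> x \<ominus> r' \<otimes> x' \<in> J00" using left[OF r(2) 1] by simp
      have "(r \<ominus> r') \<otimes> x = (r \<otimes> x \<ominus> r' \<otimes> x') \<ominus> (r' \<otimes> x \<ominus> r' \<otimes> x')"
        using x x'(1) r by (simp add: rng_l_distr l_minus_rng group_simps)
      then show ?thesis using subgrp_diff[OF sub 2 3] by simp
    qed
    then have "r \<ominus> r' \<in> N" using r by (simp add: N_def)
    then show "cos N r = cos N r'" using cos_eq[OF Nsub r(1,2)] by simp
  qed
  then have GN: "G00 \<subseteq> N" by (intro G00_subset invariant_tdefA[OF tN invN] Nsub)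
  show "x \<otimes> r \<in> J00" if r: "r \<in> carrier R" and x: "x \<in> J00" for r x
  proof -
    obtain h h' r' where x: "x = h \<oplus> r' \<otimes> h'" "h \<in> G00" "h' \<in> G00" "r' \<in> carrier R" using x by (auto simp: J00_def)
    have c: "h \<in> carrier R" "h' \<in> carrier R" using x GR by blast+
    have "x \<otimes> r = h \<otimes> r \<oplus> r' \<otimes> (h' \<otimes> r)" using x(1,4) c r by (simp add: rng_l_distr rng_m_assoc)
    moreover have "h \<otimes> r \<in> J00" "h' \<otimes> r \<in> J00" using GN x(2,3) r by (auto simp: N_def)
    ultimately show ?thesis using subgrp_add[OF sub] left[OF x(4)] by simp
  qed
qed

theorem J00_least:
  assumes I: "subgrp I" "bounded I" "\<And>\<sigma>. \<sigma> \<in> Aut \<Longrightarrow> \<sigma> ` I \<subseteq> I"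
    "\<And>r x. r \<in> carrier R \<Longrightarrow> x \<in> I \<Longrightarrow> r \<otimes> x \<in> I"
  shows "J00 \<subseteq> I"
proof
  fix x assume "x \<in> J00"
  then obtain h h' r where x: "x = h \<oplus> r \<otimes> h'" "h \<in> G00" "h' \<in> G00" "r \<in> carrier R" by (auto simp: J00_def)
  then show "x \<in> I" using G00_subset_invariant[OF I(1-3)] I(4)[of r h'] subgrp_add[OF I(1)] by auto
qed

end

section \<open>Expressible predicates\<close>

lemma eval_tm_cong: "(\<And>i. i \<in> fv_tm t \<Longrightarrow> s i = s' i) \<Longrightarrow> eval_tm N s t = eval_tm N s' t"
proof (induction t)
  case (Fn f ts)
  then have "map (eval_tm N s) ts = map (eval_tm N s') ts" by (intro map_cong refl) auto
  then show ?case by (simp only: eval_tm.simps)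
qed simp

lemma sat_cong: "(\<And>i. i \<in> fv_fm \<phi> \<Longrightarrow> s i = s' i) \<Longrightarrow> sat N s \<phi> \<longleftrightarrow> sat N s' \<phi>"
proof (induction \<phi> arbitrary: s s')
  case (FEq t u)
  then have "eval_tm N s t = eval_tm N s' t" "eval_tm N s u = eval_tm N s' u" by (auto intro!: eval_tm_cong)
  then show ?case by simp
next
  case (FRel r ts)
  then have "map (eval_tm N s) ts = map (eval_tm N s') ts" by (intro map_cong refl eval_tm_cong) auto
  then show ?case by (simp only: sat.simps)
next
  case (FNeg \<phi>)
  then have "sat N s \<phi> \<longleftrightarrow> sat N s' \<phi>" by (metis fv_fm.simps(3))
  then show ?case by simp
next
  case (FAnd \<phi> \<psi>)
  have "sat N s \<phi> \<longleftrightarrow> sat N s' \<phi>" by (rule FAnd.IH) (use FAnd.prems in auto)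
  moreover have "sat N s \<psi> \<longleftrightarrow> sat N s' \<psi>" by (rule FAnd.IH) (use FAnd.prems in auto)
  ultimately show ?case by simp
next
  case (FEx i \<phi>)
  have "sat N (s(i := a)) \<phi> \<longleftrightarrow> sat N (s'(i := a)) \<phi>" for a
    by (rule FEx.IH) (use FEx.prems in auto)
  then show ?case by simp
qed

lemma finite_fv_tm: "finite (fv_tm t)"
  by (induction t) auto

lemma finite_fv: "finite (fv_fm \<phi>)"
  by (induction \<phi>) (auto simp: finite_fv_tm)

fun ren_tm :: "(nat \<Rightarrow> nat) \<Rightarrow> 'f tm \<Rightarrow> 'f tm" where
  "ren_tm h (Var i) = Var (h i)"
| "ren_tm h (Fn f ts) = Fn f (map (ren_tm h) ts)"

fun ren_fm :: "(nat \<Rightarrow> nat) \<Rightarrow> ('f, 'r) fm \<Rightarrow> ('f, 'r) fm" where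
  "ren_fm h (FEq t u) = FEq (ren_tm h t) (ren_tm h u)"
| "ren_fm h (FRel r ts) = FRel r (map (ren_tm h) ts)"
| "ren_fm h (FNeg \<phi>) = FNeg (ren_fm h \<phi>)"
| "ren_fm h (FAnd \<phi> \<psi>) = FAnd (ren_fm h \<phi>) (ren_fm h \<psi>)"
| "ren_fm h (FEx i \<phi>) = FEx (h i) (ren_fm h \<phi>)"

lemma eval_ren: "eval_tm N s (ren_tm h t) = eval_tm N (\<lambda>i. s (h i)) t"
proof (induction t)
  case (Fn f ts)
  then have "map (eval_tm N s) (map (ren_tm h) ts) = map (eval_tm N (\<lambda>i. s (h i))) ts" by simp
  then show ?case by (simp only: ren_tm.simps eval_tm.simps)
qed simp

lemma sat_ren: "inj h \<Longrightarrow> sat N s (ren_fm h \<phi>) \<longleftrightarrow> sat N (\<lambda>i. s (h i)) \<phi>"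
proof (induction \<phi> arbitrary: s)
  case (FRel r ts)
  have "map (eval_tm N s) (map (ren_tm h) ts) = map (eval_tm N (\<lambda>i. s (h i))) ts" by (simp add: eval_ren)
  then show ?case by (simp only: ren_fm.simps sat.simps)
next
  case (FEx i \<phi>)
  have "(\<lambda>j. (s(h i := a)) (h j)) = (\<lambda>j. s (h j))(i := a)" for a
    using FEx.prems by (auto simp: inj_eq)
  then show ?case using FEx by simp
qed (simp_all add: eval_ren)

lemma wf_ren_tm: "wf_tm L (ren_tm h t) \<longleftrightarrow> wf_tm L t"
  by (induction t) auto

lemma wf_ren: "wf_fm L (ren_fm h \<phi>) \<longleftrightarrow> wf_fm L \<phi>"
  by (induction \<phi>) (auto simp: wf_ren_tm)

lemma fv_ren_tm: "fv_tm (ren_tm h t) = h ` fv_tm t"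
  by (induction t) auto

lemma fv_ren: "inj h \<Longrightarrow> fv_fm (ren_fm h \<phi>) = h ` fv_fm \<phi>"
proof (induction \<phi>)
  case (FEx i \<phi>)
  then show ?case by (simp add: image_set_diff)
qed (auto simp: fv_ren_tm)

text \<open>Substitution of variables, without capture: a bound variable that is equated with the variable
  to be substituted.\<close>

text \<open>Substitution of variables by means of \<open>\<exists>x\<^sub>i. x\<^sub>i = x\<^sub>j \<and> \<dots>\<close>, which avoids any renaming of bound variables.\<close>

lemma identify_variables:
  fixes \<phi> :: "('f, 'r) fm"
  assumes "finite I" "\<phi> \<in> formulas L" "\<rho> ` I \<inter> I = {}"
  shows "\<exists>\<chi>\<in>formulas L. fv_fm \<chi> \<subseteq> (fv_fm \<phi> - I) \<union> \<rho> ` I \<and>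
    (\<forall>(N :: ('c, 'f, 'r) struct) t. range t \<subseteq> univ N \<longrightarrow> (sat N t \<chi> \<longleftrightarrow> sat N (\<lambda>l. if l \<in> I then t (\<rho> l) else t l) \<phi>))"
  using assms
proof (induction I rule: finite_induct)
  case empty
  then show ?case by auto
next
  case (insert i I)
  then have "\<rho> ` I \<inter> I = {}" by auto
  from insert.IH[OF insert.prems(1) this] obtain \<chi> where \<chi>0: "\<chi> \<in> formulas L" "fv_fm \<chi> \<subseteq> (fv_fm \<phi> - I) \<union> \<rho> ` I"
    "\<forall>(N :: ('c, 'f, 'r) struct) t. range t \<subseteq> univ N \<longrightarrow> (sat N t \<chi> \<longleftrightarrow> sat N (\<lambda>l. if l \<in> I then t (\<rho> l) else t l) \<phi>)"
    by (elim bexE conjE) (rule that)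
  note \<chi> = \<chi>0(1,2) \<chi>0(3)[rule_format]
  define \<psi> where "\<psi> = FEx i (FAnd (FEq (Var i) (Var (\<rho> i))) \<chi>)"
  have ri: "\<rho> i \<noteq> i" "\<And>l. l \<in> I \<Longrightarrow> \<rho> l \<noteq> i" "i \<notin> I" using insert.prems(2) insert.hyps by auto
  have "\<psi> \<in> formulas L" using \<chi>(1) by (simp add: \<psi>_def formulas_def)
  moreover have "fv_fm \<psi> \<subseteq> (fv_fm \<phi> - insert i I) \<union> \<rho> ` insert i I"
    using \<chi>(2) ri by (auto simp: \<psi>_def)
  moreover have "sat N t \<psi> \<longleftrightarrow> sat N (\<lambda>l. if l \<in> insert i I then t (\<rho> l) else t l) \<phi>" if t: "range t \<subseteq> univ N" for N :: "('c, 'f, 'r) struct" and t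
  proof -
    have "t (\<rho> i) \<in> univ N" using t by blast
    then have "sat N t \<psi> \<longleftrightarrow> sat N (t(i := t (\<rho> i))) \<chi>" using ri(1) by (auto simp: \<psi>_def)
    also have "\<dots> \<longleftrightarrow> sat N (\<lambda>l. if l \<in> I then (t(i := t (\<rho> i))) (\<rho> l) else (t(i := t (\<rho> i))) l) \<phi>"
      by (rule \<chi>(3)) (use t in auto)
    also have "(\<lambda>l. if l \<in> I then (t(i := t (\<rho> i))) (\<rho> l) else (t(i := t (\<rho> i))) l) =
      (\<lambda>l. if l \<in> insert i I then t (\<rho> l) else t l)" using ri by (auto simp: fun_eq_iff)
    finally show ?thesis .
  qed
  ultimately show ?case by (intro bexI[of _ \<psi>] conjI allI impI)
qed

lemma substitute_variables:
  fixes \<phi> :: "('f, 'r) fm" and r :: "nat \<Rightarrow> nat"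
  assumes "\<phi> \<in> formulas L"
  shows "\<exists>\<chi>\<in>formulas L. fv_fm \<chi> \<subseteq> r ` fv_fm \<phi> \<and>
    (\<forall>(N :: ('c, 'f, 'r) struct) t. range t \<subseteq> univ N \<longrightarrow> (sat N t \<chi> \<longleftrightarrow> sat N (\<lambda>i. t (r i)) \<phi>))"
proof -
  define K where "K = Suc (Max (insert 0 (r ` fv_fm \<phi>)))"
  have K: "r i < K" if "i \<in> fv_fm \<phi>" for i
    unfolding K_def using that finite_fv[of \<phi>] by (auto simp: less_Suc_eq_le intro!: Max_ge)
  define h where "h i = i + K" for i
  have inj: "inj h" by (auto simp: h_def inj_def)
  define \<rho> where "\<rho> l = r (l - K)" for l
  have f1: "ren_fm h \<phi> \<in> formulas L" using assms by (simp add: formulas_def wf_ren)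
  have "\<rho> ` (h ` fv_fm \<phi>) \<inter> h ` fv_fm \<phi> = {}" using K by (fastforce simp: \<rho>_def h_def)
  from identify_variables[OF finite_imageI[OF finite_fv[of \<phi>]] f1 this]
  obtain \<chi> where \<chi>0: "\<chi> \<in> formulas L" "fv_fm \<chi> \<subseteq> (fv_fm (ren_fm h \<phi>) - h ` fv_fm \<phi>) \<union> \<rho> ` h ` fv_fm \<phi>"
    "\<forall>(N :: ('c, 'f, 'r) struct) t. range t \<subseteq> univ N \<longrightarrow> (sat N t \<chi> \<longleftrightarrow> sat N (\<lambda>l. if l \<in> h ` fv_fm \<phi> then t (\<rho> l) else t l) (ren_fm h \<phi>))"
    by (elim bexE conjE) (rule that)
  note \<chi> = \<chi>0(1,2) \<chi>0(3)[rule_format]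
  show ?thesis
  proof (intro bexI[OF _ \<chi>(1)] conjI allI impI)
    show "fv_fm \<chi> \<subseteq> r ` fv_fm \<phi>" using \<chi>(2) by (auto simp: fv_ren[OF inj] \<rho>_def h_def)
    fix N :: "('c, 'f, 'r) struct" and t :: "nat \<Rightarrow> 'c" assume t: "range t \<subseteq> univ N"
    show "sat N t \<chi> \<longleftrightarrow> sat N (\<lambda>i. t (r i)) \<phi>"
      unfolding \<chi>(3)[OF t] sat_ren[OF inj] by (rule sat_cong) (simp add: \<rho>_def h_def)
  qed
qed

text \<open>A predicate of assignments is expressible if it is given by one formula with parameters,
  uniformly in all structures under consideration. The type of the variables is arbitrary, so that
  blocks of variables can be handled.\<close>

definition assign :: "(nat \<Rightarrow> 'v + 'a) \<Rightarrow> ('v \<Rightarrow> 'a) \<Rightarrow> nat \<Rightarrow> 'a" where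
  "assign g s i = (case g i of Inl v \<Rightarrow> s v | Inr a \<Rightarrow> a)"

definition expressible :: "('f, 'r) lang \<Rightarrow> ('a, 'f, 'r) struct set \<Rightarrow> 'a set \<Rightarrow>
    (('a, 'f, 'r) struct \<Rightarrow> ('v \<Rightarrow> 'a) \<Rightarrow> bool) \<Rightarrow> bool" where
  "expressible L \<N> A P \<longleftrightarrow> (\<exists>\<phi>\<in>formulas L. \<exists>g. range g \<subseteq> range Inl \<union> Inr ` A \<and>
    (\<forall>N\<in>\<N>. \<forall>s. range s \<subseteq> univ N \<longrightarrow> (P N s \<longleftrightarrow> sat N (assign g s) \<phi>)))"

lemma expressibleE:
  assumes "expressible L \<N> A P"
  obtains \<phi> g where "\<phi> \<in> formulas L" "range g \<subseteq> range Inl \<union> Inr ` A"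
    "\<And>N s. N \<in> \<N> \<Longrightarrow> range s \<subseteq> univ N \<Longrightarrow> P N s \<longleftrightarrow> sat N (assign g s) \<phi>"
proof -
  from assms obtain \<phi> g where *: "\<phi> \<in> formulas L" "range g \<subseteq> range Inl \<union> Inr ` A"
    "\<forall>N\<in>\<N>. \<forall>s. range s \<subseteq> univ N \<longrightarrow> (P N s \<longleftrightarrow> sat N (assign g s) \<phi>)"
    unfolding expressible_def by (elim bexE exE conjE) (rule that)
  show ?thesis by (rule that[OF *(1,2)]) (rule *(3)[rule_format])
qed

lemma expressibleI:
  assumes "\<phi> \<in> formulas L" "range g \<subseteq> range Inl \<union> Inr ` A"
    "\<And>N s. N \<in> \<N> \<Longrightarrow> range s \<subseteq> univ N \<Longrightarrow> P N s \<longleftrightarrow> sat N (assign g s) \<phi>"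
  shows "expressible L \<N> A P"
  unfolding expressible_def
  by (intro bexI[of _ \<phi>] exI[of _ g] conjI ballI allI impI assms)

lemma expressible_cong:
  assumes "expressible L \<N> A P" "\<And>N s. N \<in> \<N> \<Longrightarrow> range s \<subseteq> univ N \<Longrightarrow> P N s \<longleftrightarrow> Q N s"
  shows "expressible L \<N> A Q"
proof -
  obtain \<phi> g where "\<phi> \<in> formulas L" "range g \<subseteq> range Inl \<union> Inr ` A"
    "\<And>N s. N \<in> \<N> \<Longrightarrow> range s \<subseteq> univ N \<Longrightarrow> P N s \<longleftrightarrow> sat N (assign g s) \<phi>"
    using expressibleE[OF assms(1)] by blast
  then show ?thesis using assms(2) by (intro expressibleI[of \<phi> L g]) auto
qed

lemma expressible_mono:
  assumes "expressible L \<N> A P" "A \<subseteq> B" "\<N>' \<subseteq> \<N>" shows "expressible L \<N>' B P"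
proof -
  obtain \<phi> g where *: "\<phi> \<in> formulas L" "range g \<subseteq> range Inl \<union> Inr ` A"
    "\<And>N s. N \<in> \<N> \<Longrightarrow> range s \<subseteq> univ N \<Longrightarrow> P N s \<longleftrightarrow> sat N (assign g s) \<phi>"
    using expressibleE[OF assms(1)] by blast
  show ?thesis
  proof (rule expressibleI[OF *(1)])
    show "range g \<subseteq> range Inl \<union> Inr ` B" by (rule order_trans[OF *(2)]) (use assms(2) in auto)
  qed (use * assms(3) in auto)
qed

lemma expressible_not:
  assumes "expressible L \<N> A P" shows "expressible L \<N> A (\<lambda>N s. \<not> P N s)"
proof -
  obtain \<phi> g where "\<phi> \<in> formulas L" "range g \<subseteq> range Inl \<union> Inr ` A"
    "\<And>N s. N \<in> \<N> \<Longrightarrow> range s \<subseteq> univ N \<Longrightarrow> P N s \<longleftrightarrow> sat N (assign g s) \<phi>"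
    using expressibleE[OF assms(1)] by blast
  then show ?thesis by (intro expressibleI[of "FNeg \<phi>" L g]) (auto simp: formulas_def)
qed

lemma expressible_conj:
  assumes "expressible L \<N> A P" "expressible L \<N> A Q"
  shows "expressible L \<N> A (\<lambda>N s. P N s \<and> Q N s)"
proof -
  obtain \<phi> g where 1: "\<phi> \<in> formulas L" "range g \<subseteq> range Inl \<union> Inr ` A"
    "\<And>N s. N \<in> \<N> \<Longrightarrow> range s \<subseteq> univ N \<Longrightarrow> P N s \<longleftrightarrow> sat N (assign g s) \<phi>"
    using expressibleE[OF assms(1)] by blast
  obtain \<psi> h where 2: "\<psi> \<in> formulas L" "range h \<subseteq> range Inl \<union> Inr ` A"
    "\<And>N s. N \<in> \<N> \<Longrightarrow> range s \<subseteq> univ N \<Longrightarrow> Q N s \<longleftrightarrow> sat N (assign h s) \<psi>"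
    using expressibleE[OF assms(2)] by blast
  \<comment> \<open>Even and odd variables keep the two formulas apart.\<close>
  define f where "f i = (if even i then g (i div 2) else h (i div 2))" for i
  have inj: "inj (\<lambda>i::nat. 2 * i)" "inj (\<lambda>i::nat. Suc (2 * i))" by (auto simp: inj_def)
  have f: "(\<lambda>i. assign f s (2 * i)) = assign g s" "(\<lambda>i. assign f s (Suc (2 * i))) = assign h s" for s
    by (simp_all add: assign_def f_def fun_eq_iff)
  show ?thesis
  proof (rule expressibleI[of "FAnd (ren_fm (\<lambda>i. 2 * i) \<phi>) (ren_fm (\<lambda>i. Suc (2 * i)) \<psi>)" L f])
    show "FAnd (ren_fm (\<lambda>i. 2 * i) \<phi>) (ren_fm (\<lambda>i. Suc (2 * i)) \<psi>) \<in> formulas L"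
      using 1(1) 2(1) by (simp add: formulas_def wf_ren)
    have "f i \<in> range Inl \<union> Inr ` A" for i
    proof -
      have "g (i div 2) \<in> range Inl \<union> Inr ` A" "h (i div 2) \<in> range Inl \<union> Inr ` A" using 1(2) 2(2) by blast+
      then show ?thesis by (auto simp: f_def)
    qed
    then show "range f \<subseteq> range Inl \<union> Inr ` A" by blast
  qed (simp add: sat_ren[OF inj(1)] sat_ren[OF inj(2)] f 1(3) 2(3))
qed

lemma expressible_True: "expressible L \<N> A (\<lambda>N s. True)"
  by (rule expressibleI[of "FEq (Var 0) (Var 0)" L "\<lambda>_. Inl undefined"]) (auto simp: formulas_def)

lemma expressible_finite_conj:
  assumes "finite I" "\<And>i. i \<in> I \<Longrightarrow> expressible L \<N> A (P i)"
  shows "expressible L \<N> A (\<lambda>N s. \<forall>i\<in>I. P i N s)"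
  using assms
proof (induction I rule: finite_induct)
  case empty then show ?case by (simp add: expressible_True)
next
  case (insert i I)
  then have "expressible L \<N> A (P i)" "expressible L \<N> A (\<lambda>N s. \<forall>i\<in>I. P i N s)" by auto
  then have "expressible L \<N> A (\<lambda>N s. P i N s \<and> (\<forall>i\<in>I. P i N s))" by (rule expressible_conj)
  then show ?case by simp
qed

lemma assign_in: "range g \<subseteq> range Inl \<union> Inr ` A \<Longrightarrow> A \<subseteq> U \<Longrightarrow> range s \<subseteq> U \<Longrightarrow> range (assign g s) \<subseteq> U"
proof -
  assume *: "range g \<subseteq> range Inl \<union> Inr ` A" "A \<subseteq> U" "range s \<subseteq> U"
  have "assign g s i \<in> U" for i
  proof -
    have "g i \<in> range Inl \<union> Inr ` A" using *(1) by blast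
    then show ?thesis using *(2,3) by (auto simp: assign_def)
  qed
  then show ?thesis by blast
qed

lemma quantify_variables:
  fixes \<phi> :: "('f, 'r) fm"
  assumes "finite J" "\<phi> \<in> formulas L"
  shows "\<exists>\<psi>\<in>formulas L. fv_fm \<psi> \<subseteq> fv_fm \<phi> - J \<and> (\<forall>(N :: ('c, 'f, 'r) struct) t. range t \<subseteq> univ N \<longrightarrow>
    (sat N t \<psi> \<longleftrightarrow> (\<exists>a\<in>univ N. sat N (\<lambda>i. if i \<in> J then a else t i) \<phi>)))"
proof (cases "J = {}")
  case True
  have "sat N t \<phi> \<longleftrightarrow> (\<exists>a\<in>univ N. sat N (\<lambda>i. if i \<in> J then a else t i) \<phi>)" if "range t \<subseteq> univ N" for N :: "('c, 'f, 'r) struct" and t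
    using that True by auto
  then show ?thesis using assms(2) True by auto
next
  case False
  then obtain j where j: "j \<in> J" by blast
  let ?I = "J - {j}"
  have "(\<lambda>_. j) ` ?I \<inter> ?I = {}" by auto
  from identify_variables[OF finite_Diff[OF assms(1)] assms(2) this]
  obtain \<chi> where \<chi>0: "\<chi> \<in> formulas L" "fv_fm \<chi> \<subseteq> (fv_fm \<phi> - ?I) \<union> (\<lambda>_. j) ` ?I"
    "\<forall>(N :: ('c, 'f, 'r) struct) t. range t \<subseteq> univ N \<longrightarrow> (sat N t \<chi> \<longleftrightarrow> sat N (\<lambda>l. if l \<in> ?I then t j else t l) \<phi>)"
    by (elim bexE conjE) (rule that)
  note \<chi> = \<chi>0(1,2) \<chi>0(3)[rule_format]
  have "FEx j \<chi> \<in> formulas L" using \<chi>(1) by (simp add: formulas_def)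
  moreover have "fv_fm (FEx j \<chi>) \<subseteq> fv_fm \<phi> - J" using \<chi>(2) by auto
  moreover have "sat N t (FEx j \<chi>) \<longleftrightarrow> (\<exists>a\<in>univ N. sat N (\<lambda>i. if i \<in> J then a else t i) \<phi>)" if t: "range t \<subseteq> univ N" for N :: "('c, 'f, 'r) struct" and t
  proof -
    have "sat N (t(j := a)) \<chi> \<longleftrightarrow> sat N (\<lambda>i. if i \<in> J then a else t i) \<phi>" if a: "a \<in> univ N" for a
    proof -
      have "sat N (t(j := a)) \<chi> \<longleftrightarrow> sat N (\<lambda>l. if l \<in> ?I then (t(j := a)) j else (t(j := a)) l) \<phi>"
        by (rule \<chi>(3)) (use t a in auto)
      also have "(\<lambda>l. if l \<in> ?I then (t(j := a)) j else (t(j := a)) l) = (\<lambda>i. if i \<in> J then a else t i)"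
        using j by (auto simp: fun_eq_iff)
      finally show ?thesis .
    qed
    then show ?thesis by simp
  qed
  ultimately show ?thesis by (intro bexI[of _ "FEx j \<chi>"] conjI allI impI)
qed

lemma expressible_ex:
  fixes L :: "('f, 'r) lang" and P :: "('a, 'f, 'r) struct \<Rightarrow> ('v \<Rightarrow> 'a) \<Rightarrow> bool"
  assumes "expressible L \<N> A P" "\<And>N. N \<in> \<N> \<Longrightarrow> A \<subseteq> univ N"
  shows "expressible L \<N> A (\<lambda>N s. \<exists>a\<in>univ N. P N (s(v := a)))"
proof -
  obtain \<phi> g where 1: "\<phi> \<in> formulas L" "range g \<subseteq> range Inl \<union> Inr ` A"
    "\<And>N s. N \<in> \<N> \<Longrightarrow> range s \<subseteq> univ N \<Longrightarrow> P N s \<longleftrightarrow> sat N (assign g s) \<phi>"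
    using expressibleE[OF assms(1)] by blast
  define J where "J = {i\<in>fv_fm \<phi>. g i = Inl v}"
  have "finite J" using finite_fv[of \<phi>] by (simp add: J_def)
  from quantify_variables[OF this 1(1)] obtain \<psi> where \<psi>0: "\<psi> \<in> formulas L"
    "\<forall>(N :: ('a, 'f, 'r) struct) t. range t \<subseteq> univ N \<longrightarrow> (sat N t \<psi> \<longleftrightarrow> (\<exists>a\<in>univ N. sat N (\<lambda>i. if i \<in> J then a else t i) \<phi>))"
    by (elim bexE conjE) (rule that)
  note \<psi> = \<psi>0(1) \<psi>0(2)[rule_format]
  show ?thesis
  proof (rule expressibleI[OF \<psi>(1) 1(2)])
    fix N and s :: "'v \<Rightarrow> 'a" assume N: "N \<in> \<N>" and s: "range s \<subseteq> univ N"
    have "P N (s(v := a)) \<longleftrightarrow> sat N (\<lambda>i. if i \<in> J then a else assign g s i) \<phi>" if a: "a \<in> univ N" for a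
    proof -
      have "range (s(v := a)) \<subseteq> univ N" using s a by auto
      then have "P N (s(v := a)) \<longleftrightarrow> sat N (assign g (s(v := a))) \<phi>" by (rule 1(3)[OF N])
      also have "\<dots> \<longleftrightarrow> sat N (\<lambda>i. if i \<in> J then a else assign g s i) \<phi>"
        by (rule sat_cong) (auto simp: J_def assign_def split: sum.splits)
      finally show ?thesis .
    qed
    then show "(\<exists>a\<in>univ N. P N (s(v := a))) \<longleftrightarrow> sat N (assign g s) \<psi>"
      using \<psi>(2)[OF assign_in[OF 1(2) assms(2)[OF N] s]] by simp
  qed
qed

lemma expressible_rename:
  fixes P :: "('a, 'f, 'r) struct \<Rightarrow> ('v \<Rightarrow> 'a) \<Rightarrow> bool" and h :: "'v \<Rightarrow> 'w"
  assumes "expressible L \<N> A P"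
  shows "expressible L \<N> A (\<lambda>N s. P N (\<lambda>v. s (h v)))"
proof -
  obtain \<phi> g where 1: "\<phi> \<in> formulas L" "range g \<subseteq> range Inl \<union> Inr ` A"
    "\<And>N s. N \<in> \<N> \<Longrightarrow> range s \<subseteq> univ N \<Longrightarrow> P N s \<longleftrightarrow> sat N (assign g s) \<phi>"
    using expressibleE[OF assms(1)] by blast
  define f where "f i = map_sum h id (g i)" for i
  show ?thesis
  proof (rule expressibleI[OF 1(1), of f])
    have "f i \<in> range Inl \<union> Inr ` A" for i
    proof -
      have "g i \<in> range Inl \<union> Inr ` A" using 1(2) by blast
      then show ?thesis by (auto simp: f_def)
    qed
    then show "range f \<subseteq> range Inl \<union> Inr ` A" by blast
    fix N and s :: "'w \<Rightarrow> 'a" assume N: "N \<in> \<N>" and s: "range s \<subseteq> univ N"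
    then have "P N (\<lambda>v. s (h v)) \<longleftrightarrow> sat N (assign g (\<lambda>v. s (h v))) \<phi>" by (intro 1(3)) auto
    also have "assign g (\<lambda>v. s (h v)) = assign f s"
      by (auto simp: assign_def f_def fun_eq_iff split: sum.splits)
    finally show "P N (\<lambda>v. s (h v)) \<longleftrightarrow> sat N (assign f s) \<phi>" .
  qed
qed

lemma expressible_eq: "expressible L \<N> A (\<lambda>N s. s u = s v)"
  by (rule expressibleI[of "FEq (Var 0) (Var 1)" L "\<lambda>i. if i = 0 then Inl u else Inl v"])
    (auto simp: formulas_def assign_def)

lemma expressible_const:
  assumes "a \<in> A" shows "expressible L \<N> A (\<lambda>N s. s v = a)"
  by (rule expressibleI[of "FEq (Var 0) (Var 1)" L "\<lambda>i. if i = 0 then Inl v else Inr a"])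
    (use assms in \<open>auto simp: formulas_def assign_def\<close>)

lemma expressible_formula:
  assumes "\<phi> \<in> formulas L" shows "expressible L \<N> A (\<lambda>N s. sat N (\<lambda>i. s (h i)) \<phi>)"
  by (rule expressibleI[OF assms, of "\<lambda>i. Inl (h i)"]) (auto simp: assign_def[abs_def])

lemma definable_expressible:
  fixes L :: "('f, 'r) lang" and C :: "('a, 'f, 'r) struct"
  assumes "definable L C A n D"
  shows "expressible L {C} A (\<lambda>N s. map s [0..<n] \<in> D)"
proof -
  obtain \<phi> bs where p: "set bs \<subseteq> A" "\<phi> \<in> formulas L" "fv_fm \<phi> \<subseteq> {..<n + length bs}" "D = realizations C n {(\<phi>, bs)}"
    using assms by (auto simp: definable_def formulas_over_def formulas_in_def)
  define g where "g i = (if i < n then Inl i else if i < n + length bs then Inr (bs ! (i - n)) else Inl 0)" for i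
  show ?thesis
  proof (rule expressibleI[OF p(2), of g])
    show "range g \<subseteq> range Inl \<union> Inr ` A" using p(1) by (auto simp: g_def nth_mem subset_iff)
    fix N and s :: "nat \<Rightarrow> 'a" assume N: "N \<in> {C}" and s: "range s \<subseteq> univ N"
    have "sat C (\<lambda>i. (map s [0..<n] @ bs) ! i) \<phi> \<longleftrightarrow> sat C (assign g s) \<phi>"
      by (rule sat_cong) (use p(3) in \<open>auto simp: g_def assign_def nth_append\<close>)
    moreover have "map s [0..<n] \<in> tuples n (univ C)" using s N by (auto simp: tuples_def)
    ultimately show "map s [0..<n] \<in> D \<longleftrightarrow> sat N (assign g s) \<phi>"
      using N by (simp add: p(4) realizations_def holds_def)
  qed
qed

lemma expressible_definable:
  fixes L :: "('f, 'r) lang" and C :: "('a, 'f, 'r) struct"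
  assumes ex: "expressible L {C} A (\<lambda>N s. map s [0..<n] \<in> D)" and D: "D \<subseteq> tuples n (univ C)"
    and A: "A \<subseteq> univ C" and ne: "univ C \<noteq> {}"
  shows "definable L C A n D"
proof -
  obtain \<phi> g where 10: "\<phi> \<in> formulas L" "range g \<subseteq> range Inl \<union> Inr ` A"
    "\<And>N s. N \<in> {C} \<Longrightarrow> range s \<subseteq> univ N \<Longrightarrow> map s [0..<n] \<in> D \<longleftrightarrow> sat N (assign g s) \<phi>"
    using expressibleE[OF ex] by blast
  note 1 = 10(1,2) 10(3)[OF singletonI]
  define J where "J = {i\<in>fv_fm \<phi>. \<exists>j\<ge>n. g i = Inl j}"
  have "finite J" using finite_fv[of \<phi>] by (simp add: J_def)
  from quantify_variables[OF this 1(1)] obtain \<psi> where \<psi>0: "\<psi> \<in> formulas L" "fv_fm \<psi> \<subseteq> fv_fm \<phi> - J"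
    "\<forall>(N :: ('a, 'f, 'r) struct) t. range t \<subseteq> univ N \<longrightarrow> (sat N t \<psi> \<longleftrightarrow> (\<exists>a\<in>univ N. sat N (\<lambda>i. if i \<in> J then a else t i) \<phi>))"
    by (elim bexE conjE) (rule that)
  note \<psi> = \<psi>0(1,2) \<psi>0(3)[rule_format]
  define B where "B = {a. \<exists>i\<in>fv_fm \<psi>. g i = Inr a}"
  have "B \<subseteq> (\<lambda>i. projr (g i)) ` fv_fm \<psi>" by (force simp: B_def)
  then have "finite B" using finite_fv[of \<psi>] finite_surj by blast
  then obtain bs where bs: "set bs = B" using finite_list by blast
  define ix where "ix a = (SOME q. q < length bs \<and> bs ! q = a)" for a
  have ix: "ix a < length bs" "bs ! ix a = a" if "a \<in> B" for a
    using someI_ex[of "\<lambda>q. q < length bs \<and> bs ! q = a"] that bs by (auto simp: ix_def in_set_conv_nth)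
  define r where "r i = (case g i of Inl j \<Rightarrow> j | Inr a \<Rightarrow> n + ix a)" for i
  from substitute_variables[OF \<psi>(1), of r] obtain \<chi> where \<chi>0: "\<chi> \<in> formulas L" "fv_fm \<chi> \<subseteq> r ` fv_fm \<psi>"
    "\<forall>(N :: ('a, 'f, 'r) struct) t. range t \<subseteq> univ N \<longrightarrow> (sat N t \<chi> \<longleftrightarrow> sat N (\<lambda>i. t (r i)) \<psi>)"
    by (elim bexE conjE) (rule that)
  note \<chi> = \<chi>0(1,2) \<chi>0(3)[rule_format]
  have gi: "(\<exists>j<n. g i = Inl j) \<or> (\<exists>a\<in>B. g i = Inr a)" if i: "i \<in> fv_fm \<psi>" for i
  proof (cases "g i")
    case (Inl j)
    then show ?thesis using \<psi>(2) i by (auto simp: J_def not_le)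
  next
    case (Inr a)
    then show ?thesis using i by (auto simp: B_def)
  qed
  have fv: "fv_fm \<chi> \<subseteq> {..<n + length bs}"
    using \<chi>(2) gi ix by (fastforce simp: r_def)
  have BA: "B \<subseteq> A"
  proof
    fix a assume "a \<in> B"
    then obtain i where gi: "g i = Inr a" by (auto simp: B_def)
    have "g i \<in> range Inl \<union> Inr ` A" using 1(2) by blast
    then show "a \<in> A" using gi by auto
  qed
  obtain u where u: "u \<in> univ C" using ne by blast
  have main: "holds C \<chi> (xs @ bs) \<longleftrightarrow> xs \<in> D" if xs: "xs \<in> tuples n (univ C)" for xs
  proof -
    have lx: "length xs = n" "set xs \<subseteq> univ C" using xs by (auto simp: tuples_def)
    define t where "t i = (if i < n + length bs then (xs @ bs) ! i else u)" for i
    have "(xs @ bs) ! i \<in> univ C" if "i < n + length bs" for i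
    proof -
      have "(xs @ bs) ! i \<in> set (xs @ bs)" using that lx(1) by (intro nth_mem) simp
      then show ?thesis using lx(2) bs BA A by auto
    qed
    then have t: "range t \<subseteq> univ C" using u by (auto simp: t_def)
    define s where "s j = (if j < n then xs ! j else u)" for j
    have s: "range s \<subseteq> univ C" using lx u by (auto simp: s_def subset_iff)
    have "holds C \<chi> (xs @ bs) \<longleftrightarrow> sat C t \<chi>"
      unfolding holds_def by (rule sat_cong) (use fv in \<open>auto simp: t_def\<close>)
    also have "\<dots> \<longleftrightarrow> sat C (\<lambda>i. t (r i)) \<psi>" by (rule \<chi>(3)[OF t])
    also have "\<dots> \<longleftrightarrow> sat C (assign g s) \<psi>"
    proof (rule sat_cong)
      fix i assume "i \<in> fv_fm \<psi>"
      then show "t (r i) = assign g s i"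
        using gi[of i] ix lx(1) by (auto simp: r_def t_def s_def assign_def nth_append)
    qed
    also have "\<dots> \<longleftrightarrow> (\<exists>a\<in>univ C. sat C (\<lambda>i. if i \<in> J then a else assign g s i) \<phi>)"
      by (rule \<psi>(3)[OF assign_in[OF 1(2) A s]])
    also have "\<dots> \<longleftrightarrow> (\<exists>a\<in>univ C. xs \<in> D)"
    proof (rule bex_cong[OF refl])
      fix a assume a: "a \<in> univ C"
      define s' where "s' j = (if j < n then xs ! j else a)" for j
      have s': "range s' \<subseteq> univ C" using lx a by (auto simp: s'_def subset_iff)
      have "sat C (\<lambda>i. if i \<in> J then a else assign g s i) \<phi> \<longleftrightarrow> sat C (assign g s') \<phi>"
        by (rule sat_cong) (auto simp: J_def assign_def s_def s'_def not_less split: sum.splits)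
      also have "\<dots> \<longleftrightarrow> map s' [0..<n] \<in> D" using 1(3)[OF s'] by simp
      also have "map s' [0..<n] = xs" using lx(1) by (intro nth_equalityI) (simp_all add: s'_def)
      finally show "sat C (\<lambda>i. if i \<in> J then a else assign g s i) \<phi> \<longleftrightarrow> xs \<in> D" .
    qed
    finally show ?thesis using ne by auto
  qed
  have "(\<chi>, bs) \<in> formulas_over L A n"
    using \<chi>(1) fv bs BA by (simp add: formulas_over_def formulas_in_def)
  moreover have "D = realizations C n {(\<chi>, bs)}"
    using main D by (auto simp: realizations_def)
  ultimately show ?thesis unfolding definable_def by blast
qed

section \<open>Blocks of variables\<close>

definition block :: "nat \<Rightarrow> (nat \<times> nat \<Rightarrow> 'a) \<Rightarrow> nat \<Rightarrow> 'a list" where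
  "block k s w = map (\<lambda>j. s (w, j)) [0..<k]"

text \<open>Expressibility with \<open>k\<close>-tuples as values of the variables: the variable \<open>(w, j)\<close> holds entry \<open>j\<close> of the
tuple \<open>w\<close>.\<close>

definition bexpr :: "('f, 'r) lang \<Rightarrow> ('a, 'f, 'r) struct set \<Rightarrow> 'a set \<Rightarrow> nat \<Rightarrow>
    (('a, 'f, 'r) struct \<Rightarrow> (nat \<Rightarrow> 'a list) \<Rightarrow> bool) \<Rightarrow> bool" where
  "bexpr L \<N> A k Q \<longleftrightarrow> expressible L \<N> A (\<lambda>N s. Q N (block k s))"

lemma block_in: "range s \<subseteq> U \<Longrightarrow> block k s w \<in> tuples k U"
  by (auto simp: block_def tuples_def)

lemma bexpr_not: "bexpr L \<N> A k Q \<Longrightarrow> bexpr L \<N> A k (\<lambda>N e. \<not> Q N e)"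
  unfolding bexpr_def by (rule expressible_not)

lemma bexpr_conj: "bexpr L \<N> A k P \<Longrightarrow> bexpr L \<N> A k Q \<Longrightarrow> bexpr L \<N> A k (\<lambda>N e. P N e \<and> Q N e)"
  unfolding bexpr_def by (rule expressible_conj)

lemma bexpr_mono: "bexpr L \<N> A k P \<Longrightarrow> A \<subseteq> B \<Longrightarrow> \<N>' \<subseteq> \<N> \<Longrightarrow> bexpr L \<N>' B k P"
  unfolding bexpr_def by (rule expressible_mono)

lemma bexpr_cong:
  assumes "bexpr L \<N> A k P" "\<And>N e. N \<in> \<N> \<Longrightarrow> (\<And>w. e w \<in> tuples k (univ N)) \<Longrightarrow> P N e \<longleftrightarrow> Q N e"
  shows "bexpr L \<N> A k Q"
  using assms(1) unfolding bexpr_def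
  by (rule expressible_cong) (rule assms(2), auto intro: block_in)

lemma bexpr_subst: "bexpr L \<N> A k P \<Longrightarrow> bexpr L \<N> A k (\<lambda>N e. P N (\<lambda>w. e (h w)))"
  unfolding bexpr_def
  using expressible_rename[of L \<N> A "\<lambda>N s. P N (block k s)" "\<lambda>(w, j). (h w, j)"]
  by (simp add: block_def[abs_def])

lemma bexpr_eq: "bexpr L \<N> A k (\<lambda>N e. e u = e v)"
proof -
  have "expressible L \<N> A (\<lambda>N s. \<forall>j\<in>{..<k}. s (u, j) = s (v, j))"
    by (intro expressible_finite_conj expressible_eq) simp
  then show ?thesis unfolding bexpr_def by (rule expressible_cong) (auto simp: block_def)
qed

lemma bexpr_const:
  assumes "c \<in> tuples k A" shows "bexpr L \<N> A k (\<lambda>N e. e u = c)"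
proof -
  have c: "length c = k" "set c \<subseteq> A" using assms by (auto simp: tuples_def)
  have "expressible L \<N> A (\<lambda>N s. \<forall>j\<in>{..<k}. s (u, j) = c ! j)"
    by (intro expressible_finite_conj expressible_const) (use c in \<open>auto simp: subset_iff\<close>)
  then show ?thesis unfolding bexpr_def
    by (rule expressible_cong) (use c in \<open>auto simp: block_def list_eq_iff_nth_eq\<close>)
qed

lemma expressible_ex_list:
  fixes P :: "('a, 'f, 'r) struct \<Rightarrow> ('b \<times> nat \<Rightarrow> 'a) \<Rightarrow> bool"
  assumes "expressible L \<N> A P" "\<And>N. N \<in> \<N> \<Longrightarrow> A \<subseteq> univ N"
  shows "expressible L \<N> A (\<lambda>N s. \<exists>ys\<in>tuples m (univ N).
    P N (\<lambda>(w', j). if w' = w \<and> j < m then ys ! j else s (w', j)))"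
  using assms(1)
proof (induction m arbitrary: P)
  case 0
  have "tuples 0 U = {[]}" for U :: "'a set" by (auto simp: tuples_def)
  then show ?case by (intro expressible_cong[OF 0]) (simp add: case_prod_eta)
next
  case (Suc m)
  have "expressible L \<N> A (\<lambda>N s. \<exists>a\<in>univ N. P N (s((w, m) := a)))"
    by (rule expressible_ex[OF Suc.prems assms(2)])
  from Suc.IH[OF this] show ?case
  proof (rule expressible_cong)
    fix N and s :: "'b \<times> nat \<Rightarrow> 'a"
    have upd: "(\<lambda>(w', j). if w' = w \<and> j < m then ys ! j else s (w', j))((w, m) := a) =
      (\<lambda>(w', j). if w' = w \<and> j < Suc m then (ys @ [a]) ! j else s (w', j))" if "length ys = m" for ys a
      using that by (auto simp: fun_eq_iff nth_append less_Suc_eq)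
    show "(\<exists>ys\<in>tuples m (univ N). \<exists>a\<in>univ N. P N ((\<lambda>(w', j). if w' = w \<and> j < m then ys ! j else s (w', j))((w, m) := a))) =
      (\<exists>ys\<in>tuples (Suc m) (univ N). P N (\<lambda>(w', j). if w' = w \<and> j < Suc m then ys ! j else s (w', j)))" (is "?l = ?r")
    proof
      assume ?l
      then obtain ys a where ys: "ys \<in> tuples m (univ N)" "a \<in> univ N"
        "P N ((\<lambda>(w', j). if w' = w \<and> j < m then ys ! j else s (w', j))((w, m) := a))" by blast
      then have "length ys = m" by (simp add: tuples_def)
      then show ?r using ys upd by (intro bexI[of _ "ys @ [a]"]) (auto simp: tuples_def)
    next
      assume ?r
      then obtain zs where zs: "zs \<in> tuples (Suc m) (univ N)"
        "P N (\<lambda>(w', j). if w' = w \<and> j < Suc m then zs ! j else s (w', j))" by blast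
      have "length zs = Suc m" using zs(1) by (simp add: tuples_def)
      then obtain ys a where ya: "zs = ys @ [a]" "length ys = m" by (auto simp: length_Suc_conv_rev)
      have "P N ((\<lambda>(w', j). if w' = w \<and> j < m then ys ! j else s (w', j))((w, m) := a))"
        using zs(2) unfolding upd[OF ya(2)] ya(1) .
      moreover have "ys \<in> tuples m (univ N)" "a \<in> univ N" using zs(1) ya by (auto simp: tuples_def)
      ultimately show ?l by blast
    qed
  qed
qed

lemma bexpr_ex:
  fixes A :: "'a set"
  assumes "bexpr L \<N> A k P" "\<And>N. N \<in> \<N> \<Longrightarrow> A \<subseteq> univ N"
  shows "bexpr L \<N> A k (\<lambda>N e. \<exists>y\<in>tuples k (univ N). P N (e(w := y)))"
  unfolding bexpr_def
  using expressible_ex_list[OF assms(1)[unfolded bexpr_def] assms(2), of k w]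
proof (rule expressible_cong)
  fix N and s :: "nat \<times> nat \<Rightarrow> 'a"
  have "block k (\<lambda>(w', j). if w' = w \<and> j < k then ys ! j else s (w', j)) = (block k s)(w := ys)"
    if "length ys = k" for ys
    using that by (auto simp: block_def fun_eq_iff list_eq_iff_nth_eq)
  then show "(\<exists>ys\<in>tuples k (univ N). P N (block k (\<lambda>(w', j). if w' = w \<and> j < k then ys ! j else s (w', j)))) =
    (\<exists>y\<in>tuples k (univ N). P N ((block k s)(w := y)))"
    by (intro bex_cong refl) (auto simp: tuples_def)
qed

lemma bexpr_holds1:
  assumes "\<phi> \<in> formulas_in L k" shows "bexpr L \<N> A k (\<lambda>N e. holds N \<phi> (e w))"
proof -
  have "expressible L \<N> A (\<lambda>N s. sat N (\<lambda>i. s (w, i)) \<phi>)"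
    by (rule expressible_formula) (use assms in \<open>simp add: formulas_in_def\<close>)
  then show ?thesis unfolding bexpr_def holds_def
    by (rule expressible_cong) (rule sat_cong, use assms in \<open>auto simp: formulas_in_def block_def\<close>)
qed

lemma bexpr_holds3:
  fixes A :: "'a set"
  assumes "\<phi> \<in> formulas_in L (3 * k)" shows "bexpr L \<N> A k (\<lambda>N e. holds N \<phi> (e u @ e v @ e w))"
proof -
  let ?h = "\<lambda>i. if i < k then (u, i) else if i < 2 * k then (v, i - k) else (w, i - 2 * k)"
  have "expressible L \<N> A (\<lambda>N s. sat N (\<lambda>i. s (?h i)) \<phi>)"
    by (rule expressible_formula) (use assms in \<open>simp add: formulas_in_def\<close>)
  then show ?thesis unfolding bexpr_def holds_def
  proof (rule expressible_cong)
    fix N and s :: "nat \<times> nat \<Rightarrow> 'a"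
    show "sat N (\<lambda>i. s (?h i)) \<phi> \<longleftrightarrow> sat N (\<lambda>i. (block k s u @ block k s v @ block k s w) ! i) \<phi>"
    proof (rule sat_cong)
      fix i assume "i \<in> fv_fm \<phi>"
      then have "i < 3 * k" using assms by (auto simp: formulas_in_def)
      then have "i < k \<or> (\<not> i < k \<and> i < 2 * k) \<or> (\<not> i < k \<and> \<not> i < 2 * k \<and> i - 2 * k < k)" by auto
      moreover have "i - k - k = i - 2 * k" by simp
      ultimately show "s (?h i) = (block k s u @ block k s v @ block k s w) ! i"
        by (auto simp: nth_append block_def simp del: diff_diff_left)
    qed
  qed
qed

lemma bexpr_definable:
  assumes "definable L C A k D" shows "bexpr L {C} A k (\<lambda>N e. e w \<in> D)"
  using expressible_rename[OF definable_expressible[OF assms], of "\<lambda>j. (w, j)"]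
  by (simp add: bexpr_def block_def)

lemma definable_bexpr:
  assumes ex: "bexpr L {C} A k (\<lambda>N e. e w \<in> D)" and D: "D \<subseteq> tuples k (univ C)"
    and A: "A \<subseteq> univ C" and ne: "univ C \<noteq> {}"
  shows "definable L C A k D"
proof (rule expressible_definable[OF _ D A ne])
  show "expressible L {C} A (\<lambda>N s. map s [0..<k] \<in> D)"
    using expressible_rename[OF ex[unfolded bexpr_def], of "\<lambda>(w, j). j"] by (simp add: block_def)
qed

lemma transfer_elementary:
  fixes L :: "('f, 'r) lang" and M C :: "('a, 'f, 'r) struct"
  assumes el: "elementary_ext L M C" and Q: "bexpr L {M, C} {} k Q" and e: "\<And>w. e w \<in> tuples k (univ M)"
  shows "Q M e \<longleftrightarrow> Q C e"
proof -
  have MC: "univ M \<subseteq> univ C" "univ M \<noteq> {}" using el by (auto simp: elementary_ext_def is_struct_def)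
  then obtain u where u: "u \<in> univ M" by blast
  obtain \<phi> g where 1: "\<phi> \<in> formulas L" "range g \<subseteq> range Inl \<union> Inr ` {}"
    "\<And>N s. N \<in> {M, C} \<Longrightarrow> range s \<subseteq> univ N \<Longrightarrow> Q N (block k s) \<longleftrightarrow> sat N (assign g s) \<phi>"
    using expressibleE[OF Q[unfolded bexpr_def]] by blast
  define s where "s = (\<lambda>(w, j). if j < k then e w ! j else u)"
  have le: "length (e w) = k" "set (e w) \<subseteq> univ M" for w using e[of w] by (auto simp: tuples_def)
  have ew: "e w ! j \<in> univ M" if "j < k" for w j
    using le(2)[of w] nth_mem[of j "e w"] le(1)[of w] that by auto
  have s: "range s \<subseteq> univ M" using ew u by (auto simp: s_def)
  have be: "block k s = e" using le by (auto simp: block_def s_def list_eq_iff_nth_eq fun_eq_iff)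
  define n where "n = Suc (Max (insert 0 (fv_fm \<phi>)))"
  have n: "fv_fm \<phi> \<subseteq> {..<n}" unfolding n_def using finite_fv[of \<phi>] by (auto simp: less_Suc_eq_le intro!: Max_ge)
  let ?xs = "map (assign g s) [0..<n]"
  have "range (assign g s) \<subseteq> univ M" using assign_in[OF 1(2) _ s] by simp
  then have xs: "?xs \<in> tuples n (univ M)" by (auto simp: tuples_def)
  have h: "holds N \<phi> ?xs \<longleftrightarrow> sat N (assign g s) \<phi>" for N :: "('a, 'f, 'r) struct"
    unfolding holds_def by (rule sat_cong) (use n in auto)
  have "\<phi> \<in> formulas_in L n" using 1(1) n by (simp add: formulas_in_def)
  then have "holds M \<phi> ?xs \<longleftrightarrow> holds C \<phi> ?xs" using el xs unfolding elementary_ext_def by blast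
  then show ?thesis using 1(3)[of M s] 1(3)[of C s] s MC(1) h be by auto
qed

section \<open>The monster model\<close>

lemma expressible_ex_finite:
  fixes P :: "('a, 'f, 'r) struct \<Rightarrow> ('v \<Rightarrow> 'a) \<Rightarrow> bool"
  assumes "finite W" "expressible L \<N> A P" "\<And>N. N \<in> \<N> \<Longrightarrow> A \<subseteq> univ N"
  shows "expressible L \<N> A (\<lambda>N s. \<exists>t. range t \<subseteq> univ N \<and> (\<forall>w. w \<notin> W \<longrightarrow> t w = s w) \<and> P N t)"
  using assms(1,2)
proof (induction W arbitrary: P rule: finite_induct)
  case empty
  show ?case
  proof (rule expressible_cong[OF empty])
    fix N :: "('a, 'f, 'r) struct" and s :: "'v \<Rightarrow> 'a" assume s: "range s \<subseteq> univ N"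
    have "t = s" if "\<forall>w. w \<notin> {} \<longrightarrow> t w = s w" for t using that by (simp add: fun_eq_iff)
    then show "P N s \<longleftrightarrow> (\<exists>t. range t \<subseteq> univ N \<and> (\<forall>w. w \<notin> {} \<longrightarrow> t w = s w) \<and> P N t)" using s by auto
  qed
next
  case (insert w W)
  show ?case
  proof (rule expressible_cong[OF insert.IH[OF expressible_ex[OF insert.prems assms(3), of w]]])
    fix N :: "('a, 'f, 'r) struct" and s :: "'v \<Rightarrow> 'a" assume s: "range s \<subseteq> univ N"
    show "(\<exists>t. range t \<subseteq> univ N \<and> (\<forall>x. x \<notin> W \<longrightarrow> t x = s x) \<and> (\<exists>a\<in>univ N. P N (t(w := a)))) \<longleftrightarrow>
      (\<exists>t. range t \<subseteq> univ N \<and> (\<forall>x. x \<notin> insert w W \<longrightarrow> t x = s x) \<and> P N t)" (is "?l \<longleftrightarrow> ?r")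
    proof
      assume ?l
      then obtain t a where t: "range t \<subseteq> univ N" "\<And>x. x \<notin> W \<Longrightarrow> t x = s x" "a \<in> univ N" "P N (t(w := a))" by blast
      have "range (t(w := a)) \<subseteq> univ N" using t(1,3) by auto
      then show ?r using t by (intro exI[of _ "t(w := a)"]) auto
    next
      assume ?r
      then obtain t where t: "range t \<subseteq> univ N" "\<And>x. x \<notin> insert w W \<Longrightarrow> t x = s x" "P N t" by blast
      have "range (t(w := s w)) \<subseteq> univ N" using t(1) s by auto
      moreover have "(t(w := s w)) x = s x" if "x \<notin> W" for x using t(2) that by auto
      moreover have "P N ((t(w := s w))(w := t w))" "t w \<in> univ N" using t by auto
      ultimately show ?l by blast
    qed
  qed
qed

lemma eval_in_univ:
  assumes "is_struct L C" shows "wf_tm L t \<Longrightarrow> range s \<subseteq> univ C \<Longrightarrow> eval_tm C s t \<in> univ C"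
proof (induction t)
  case (Fn f ts)
  then have "map (eval_tm C s) ts \<in> tuples (farity L f) (univ C)" by (auto simp: tuples_def)
  moreover have "f \<in> funs L" using Fn.prems(1) by simp
  ultimately show ?case using assms by (simp add: is_struct_def)
qed auto

lemma eval_automorphism:
  assumes "is_struct L C" "automorphism L C \<sigma>"
  shows "wf_tm L t \<Longrightarrow> range s \<subseteq> univ C \<Longrightarrow> eval_tm C (\<lambda>i. \<sigma> (s i)) t = \<sigma> (eval_tm C s t)"
proof (induction t)
  case (Fn f ts)
  have m: "map (eval_tm C s) ts \<in> tuples (farity L f) (univ C)"
    using Fn.prems eval_in_univ[OF assms(1)] by (auto simp: tuples_def)
  have "map (eval_tm C (\<lambda>i. \<sigma> (s i))) ts = map \<sigma> (map (eval_tm C s) ts)" using Fn by auto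
  moreover have "\<sigma> (fint C f (map (eval_tm C s) ts)) = fint C f (map \<sigma> (map (eval_tm C s) ts))"
    using assms(2) m Fn.prems(1) unfolding automorphism_def by simp
  ultimately show ?case by (simp only: eval_tm.simps)
qed simp

lemma sat_automorphism:
  assumes "is_struct L C" "automorphism L C \<sigma>"
  shows "wf_fm L \<phi> \<Longrightarrow> range s \<subseteq> univ C \<Longrightarrow> sat C (\<lambda>i. \<sigma> (s i)) \<phi> \<longleftrightarrow> sat C s \<phi>"
proof (induction \<phi> arbitrary: s)
  case (FEq t u)
  have "inj_on \<sigma> (univ C)" using assms(2) by (auto simp: automorphism_def bij_betw_def)
  then show ?case using FEq eval_automorphism[OF assms] eval_in_univ[OF assms(1)] by (simp add: inj_on_eq_iff)
next
  case (FRel r ts)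
  have m: "map (eval_tm C s) ts \<in> tuples (rarity L r) (univ C)"
    using FRel.prems eval_in_univ[OF assms(1)] by (auto simp: tuples_def)
  have "map (eval_tm C (\<lambda>i. \<sigma> (s i))) ts = map \<sigma> (map (eval_tm C s) ts)"
    using FRel eval_automorphism[OF assms] by auto
  moreover have "rint C r (map (eval_tm C s) ts) \<longleftrightarrow> rint C r (map \<sigma> (map (eval_tm C s) ts))"
    using assms(2) m FRel.prems(1) unfolding automorphism_def by simp
  ultimately show ?case by (simp only: sat.simps)
next
  case (FEx i \<phi>)
  have bij: "\<sigma> ` univ C = univ C" using assms(2) by (auto simp: automorphism_def bij_betw_def)
  have "(\<lambda>j. \<sigma> ((s(i := a)) j)) = (\<lambda>j. \<sigma> (s j))(i := \<sigma> a)" for a by auto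
  moreover have "sat C (\<lambda>j. \<sigma> ((s(i := a)) j)) \<phi> \<longleftrightarrow> sat C (s(i := a)) \<phi>" if "a \<in> univ C" for a
    by (rule FEx.IH) (use FEx.prems that in auto)
  ultimately have *: "sat C ((\<lambda>j. \<sigma> (s j))(i := \<sigma> a)) \<phi> \<longleftrightarrow> sat C (s(i := a)) \<phi>" if "a \<in> univ C" for a
    using that by simp
  have "(\<exists>b\<in>univ C. sat C ((\<lambda>j. \<sigma> (s j))(i := b)) \<phi>) \<longleftrightarrow> (\<exists>b\<in>\<sigma> ` univ C. sat C ((\<lambda>j. \<sigma> (s j))(i := b)) \<phi>)"
    by (simp only: bij)
  also have "\<dots> \<longleftrightarrow> (\<exists>a\<in>univ C. sat C (s(i := a)) \<phi>)" using * by auto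
  finally show ?case by simp
qed auto

lemma holds_automorphism:
  assumes "is_struct L C" "automorphism L C \<sigma>" "\<phi> \<in> formulas_in L (length xs)" "set xs \<subseteq> univ C"
  shows "holds C \<phi> (map \<sigma> xs) \<longleftrightarrow> holds C \<phi> xs"
proof -
  obtain u where u: "u \<in> univ C" using assms(1) by (auto simp: is_struct_def)
  define s where "s i = (if i < length xs then xs ! i else u)" for i
  have s: "range s \<subseteq> univ C" using assms(4) u nth_mem[of _ xs] by (auto simp: s_def subset_iff)
  have "holds C \<phi> (map \<sigma> xs) \<longleftrightarrow> sat C (\<lambda>i. \<sigma> (s i)) \<phi>"
    unfolding holds_def by (rule sat_cong) (use assms(3) in \<open>auto simp: formulas_in_def s_def\<close>)
  also have "\<dots> \<longleftrightarrow> sat C s \<phi>"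
    by (rule sat_automorphism[OF assms(1,2) _ s]) (use assms(3) in \<open>simp add: formulas_in_def formulas_def\<close>)
  also have "\<dots> \<longleftrightarrow> holds C \<phi> xs"
    unfolding holds_def by (rule sat_cong) (use assms(3) in \<open>auto simp: formulas_in_def s_def\<close>)
  finally show ?thesis .
qed

lemma automorphism_univ: "automorphism L C \<sigma> \<Longrightarrow> \<sigma> ` univ C = univ C"
  by (auto simp: automorphism_def bij_betw_def)

lemma automorphism_id: "automorphism L C id"
  by (simp add: automorphism_def)

lemma map_tuples: "automorphism L C \<sigma> \<Longrightarrow> xs \<in> tuples n (univ C) \<Longrightarrow> map \<sigma> xs \<in> tuples n (univ C)"
  using automorphism_univ[of L C \<sigma>] by (auto simp: tuples_def)

lemma automorphism_comp:
  assumes "automorphism L C \<sigma>" "automorphism L C \<tau>" shows "automorphism L C (\<sigma> \<circ> \<tau>)"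
  unfolding automorphism_def
proof (intro conjI ballI)
  show "bij_betw (\<sigma> \<circ> \<tau>) (univ C) (univ C)" using assms by (auto simp: automorphism_def intro: bij_betw_trans)
  fix f xs assume f: "f \<in> funs L" "xs \<in> tuples (farity L f) (univ C)"
  have "\<tau> (fint C f xs) = fint C f (map \<tau> xs)" using assms(2) f by (simp add: automorphism_def)
  moreover have "\<sigma> (fint C f (map \<tau> xs)) = fint C f (map \<sigma> (map \<tau> xs))"
    using assms(1) f(1) map_tuples[OF assms(2) f(2)] by (simp add: automorphism_def)
  ultimately show "(\<sigma> \<circ> \<tau>) (fint C f xs) = fint C f (map (\<sigma> \<circ> \<tau>) xs)" by simp
next
  fix r xs assume r: "r \<in> rels L" "xs \<in> tuples (rarity L r) (univ C)"
  have "rint C r xs = rint C r (map \<tau> xs)" using assms(2) r by (simp add: automorphism_def)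
  moreover have "rint C r (map \<tau> xs) = rint C r (map \<sigma> (map \<tau> xs))"
    using assms(1) r(1) map_tuples[OF assms(2) r(2)] by (simp add: automorphism_def)
  ultimately show "rint C r xs = rint C r (map (\<sigma> \<circ> \<tau>) xs)" by simp
qed

lemma automorphism_inv:
  assumes C: "is_struct L C" and s: "automorphism L C \<sigma>"
  obtains \<tau> where "automorphism L C \<tau>" "\<And>x. x \<in> univ C \<Longrightarrow> \<tau> (\<sigma> x) = x" "\<And>x. x \<in> univ C \<Longrightarrow> \<sigma> (\<tau> x) = x"
proof -
  define \<tau> where "\<tau> = inv_into (univ C) \<sigma>"
  have b: "bij_betw \<sigma> (univ C) (univ C)" using s by (simp add: automorphism_def)
  then have bt: "bij_betw \<tau> (univ C) (univ C)" unfolding \<tau>_def by (rule bij_betw_inv_into)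
  have ts: "\<tau> (\<sigma> x) = x" if "x \<in> univ C" for x using b that by (simp add: \<tau>_def bij_betw_inv_into_left)
  have st: "\<sigma> (\<tau> x) = x" if "x \<in> univ C" for x using b that by (simp add: \<tau>_def bij_betw_inv_into_right)
  have tu: "\<tau> x \<in> univ C" if "x \<in> univ C" for x using bt that by (auto simp: bij_betw_def)
  have mt: "map \<tau> xs \<in> tuples n (univ C)" if "xs \<in> tuples n (univ C)" for xs n
    using that tu by (auto simp: tuples_def)
  have mst: "map \<sigma> (map \<tau> xs) = xs" if "xs \<in> tuples n (univ C)" for xs n
    using that st by (auto simp: tuples_def intro!: map_idI)
  have "automorphism L C \<tau>"
    unfolding automorphism_def
  proof (intro conjI ballI bt)
    fix f xs assume f: "f \<in> funs L" "xs \<in> tuples (farity L f) (univ C)"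
    have "\<sigma> (fint C f (map \<tau> xs)) = fint C f xs"
      using s f(1) mt[OF f(2)] mst[OF f(2)] by (simp add: automorphism_def)
    moreover have "fint C f (map \<tau> xs) \<in> univ C" using C f(1) mt[OF f(2)] by (simp add: is_struct_def)
    ultimately show "\<tau> (fint C f xs) = fint C f (map \<tau> xs)" using ts by metis
  next
    fix r xs assume r: "r \<in> rels L" "xs \<in> tuples (rarity L r) (univ C)"
    have "rint C r (map \<tau> xs) = rint C r (map \<sigma> (map \<tau> xs))"
      using s r(1) mt[OF r(2)] unfolding automorphism_def by blast
    then show "rint C r xs = rint C r (map \<tau> xs)" using mst[OF r(2)] by simp
  qed
  then show ?thesis using that ts st by blast
qed

lemma definable_sub: "definable L C A n D \<Longrightarrow> D \<subseteq> tuples n (univ C)"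
  by (auto simp: definable_def realizations_def)

lemma definable_mono: "definable L C A n D \<Longrightarrow> A \<subseteq> B \<Longrightarrow> definable L C B n D"
  unfolding definable_def formulas_over_def by fastforce

lemma definable_image:
  assumes C: "is_struct L C" and s: "automorphism L C \<sigma>" and A: "A \<subseteq> univ C" and D: "definable L C A n D"
  shows "definable L C (\<sigma> ` A) n (map \<sigma> ` D)" "(\<And>a. a \<in> A \<Longrightarrow> \<sigma> a = a) \<Longrightarrow> map \<sigma> ` D = D"
proof -
  obtain \<phi> bs where p: "set bs \<subseteq> A" "\<phi> \<in> formulas_in L (n + length bs)" "D = realizations C n {(\<phi>, bs)}"
    using D by (auto simp: definable_def formulas_over_def)
  obtain \<tau> where t: "automorphism L C \<tau>" "\<And>x. x \<in> univ C \<Longrightarrow> \<tau> (\<sigma> x) = x" "\<And>x. x \<in> univ C \<Longrightarrow> \<sigma> (\<tau> x) = x"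
    using automorphism_inv[OF C s] by blast
  have h: "holds C \<phi> (map \<sigma> xs @ map \<sigma> bs) \<longleftrightarrow> holds C \<phi> (xs @ bs)" if "xs \<in> tuples n (univ C)" for xs
    using holds_automorphism[OF C s, of \<phi> "xs @ bs"] p A that by (auto simp: tuples_def)
  have eq: "map \<sigma> ` D = realizations C n {(\<phi>, map \<sigma> bs)}"
  proof (intro equalityI subsetI)
    fix y assume "y \<in> map \<sigma> ` D"
    then obtain x where x: "y = map \<sigma> x" "x \<in> tuples n (univ C)" "holds C \<phi> (x @ bs)" by (auto simp: p(3) realizations_def)
    then show "y \<in> realizations C n {(\<phi>, map \<sigma> bs)}" using h[OF x(2)] map_tuples[OF s x(2)] by (simp add: realizations_def)
  next
    fix y assume "y \<in> realizations C n {(\<phi>, map \<sigma> bs)}"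
    then have y: "y \<in> tuples n (univ C)" "holds C \<phi> (y @ map \<sigma> bs)" by (auto simp: realizations_def)
    have ty: "map \<tau> y \<in> tuples n (univ C)" by (rule map_tuples[OF t(1) y(1)])
    have "map \<sigma> (map \<tau> y) = y" using y(1) t(3) by (auto simp: tuples_def intro!: map_idI)
    then show "y \<in> map \<sigma> ` D" using h[OF ty] y(2) ty by (intro image_eqI[of _ _ "map \<tau> y"]) (simp_all add: p(3) realizations_def)
  qed
  have "(\<phi>, map \<sigma> bs) \<in> formulas_over L (\<sigma> ` A) n" using p(1,2) by (auto simp: formulas_over_def)
  then show "definable L C (\<sigma> ` A) n (map \<sigma> ` D)" using eq unfolding definable_def by blast
  show "map \<sigma> ` D = D" if fix_A: "\<And>a. a \<in> A \<Longrightarrow> \<sigma> a = a"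
  proof -
    have "map \<sigma> bs = bs" using p(1) fix_A by (auto intro!: map_idI)
    then show ?thesis using eq p(3) by simp
  qed
qed

locale monster =
  fixes L :: "('f, 'r) lang" and \<kappa> :: "'k rel" and M C :: "('a, 'f, 'r) struct" and A :: "'a set"
  assumes monster: "monster_model L \<kappa> M C" and A_univ: "A \<subseteq> univ C" and small_A: "|A| <o \<kappa>"
begin

lemma elementary: "elementary_ext L M C"
  and strong_limit: "strong_limit \<kappa>"
  and saturated: "saturated L \<kappa> C"
  and homogeneous: "strongly_homogeneous L \<kappa> C"
  using monster by (auto simp: monster_model_def)

lemma struct: "is_struct L C" and univ_ne: "univ C \<noteq> {}" and univ_M: "univ M \<subseteq> univ C" and univ_M_ne: "univ M \<noteq> {}"
  using elementary by (auto simp: elementary_ext_def is_struct_def)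

lemma small_formulas: "|formulas L| <o \<kappa>"
proof -
  have "|formulas L| \<le>o |formulas L| +c |univ M|" by (rule ordLeq_csum1) (rule card_of_Card_order)
  moreover have "|formulas L| +c |univ M| <o \<kappa>" using monster by (simp add: monster_model_def)
  ultimately show ?thesis by (rule ordLeq_ordLess_trans)
qed

lemma small_nat: "|UNIV :: nat set| <o \<kappa>"
proof (rule small_inj[OF small_formulas])
  show "inj_on (\<lambda>n::nat. FEq (Var n) (Var n) :: ('f, 'r) fm) UNIV" by (auto simp: inj_on_def)
qed (auto simp: formulas_def)

lemma few_definable:
  assumes "|B| <o \<kappa>" shows "|{D. definable L C B n D}| <o \<kappa>"
proof (rule small_subset)
  have "|formulas L \<times> lists B| <o \<kappa>"
    by (intro small_Times small_lists strong_limit small_formulas small_nat assms)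
  then show "|(\<lambda>\<theta>. realizations C n {\<theta>}) ` (formulas L \<times> lists B)| <o \<kappa>" by (rule small_image)
  show "{D. definable L C B n D} \<subseteq> (\<lambda>\<theta>. realizations C n {\<theta>}) ` (formulas L \<times> lists B)"
    by (auto simp: definable_def formulas_over_def formulas_in_def)
qed

lemma small_params:
  assumes "|I| <o \<kappa>" shows "|\<Union>i\<in>I. set (bs i)| <o \<kappa>"
proof (rule small_UNION_uniform[OF strong_limit assms small_nat])
  show "set (bs i) \<subseteq> (\<lambda>i j. bs i ! j) i ` UNIV" for i by (auto simp: in_set_conv_nth)
qed

lemma definableE:
  assumes "definable L C B n D"
  obtains \<phi> bs where "set bs \<subseteq> B" "\<phi> \<in> formulas_in L (n + length bs)" "D = {xs\<in>tuples n (univ C). holds C \<phi> (xs @ bs)}"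
  using assms by (auto simp: definable_def formulas_over_def realizations_def)

lemma saturated_family:
  assumes "|I| <o \<kappa>" "\<And>i. i \<in> I \<Longrightarrow> definable L C (univ C) n (S i)"
    "\<And>J. finite J \<Longrightarrow> J \<subseteq> I \<Longrightarrow> \<exists>x\<in>tuples n (univ C). \<forall>i\<in>J. x \<in> S i"
  shows "\<exists>x\<in>tuples n (univ C). \<forall>i\<in>I. x \<in> S i"
proof -
  have "\<forall>i\<in>I. \<exists>\<theta>\<in>formulas_over L (univ C) n. S i = realizations C n {\<theta>}" using assms(2) by (simp add: definable_def)
  then obtain \<theta> where th: "\<And>i. i \<in> I \<Longrightarrow> \<theta> i \<in> formulas_over L (univ C) n" "\<And>i. i \<in> I \<Longrightarrow> S i = realizations C n {\<theta> i}" by metis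
  define B where "B = (\<Union>i\<in>I. set (snd (\<theta> i)))"
  have sB: "|B| <o \<kappa>" unfolding B_def by (rule small_params[OF assms(1)])
  have B: "B \<subseteq> univ C" using th(1) unfolding B_def formulas_over_def by fastforce
  have over: "\<theta> ` I \<subseteq> formulas_over L B n" using th(1) by (fastforce simp: B_def formulas_over_def)
  have real: "x \<in> realizations C n (\<theta> ` J) \<longleftrightarrow> x \<in> tuples n (univ C) \<and> (\<forall>i\<in>J. x \<in> S i)" if "J \<subseteq> I" for J x
  proof -
    have "x \<in> S i \<longleftrightarrow> x \<in> realizations C n {\<theta> i}" if "i \<in> J" for i using th(2)[of i] that \<open>J \<subseteq> I\<close> by auto
    then show ?thesis by (auto simp: realizations_def)
  qed
  have fin: "realizations C n q \<noteq> {}" if q: "q \<subseteq> \<theta> ` I" "finite q" for q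
  proof -
    obtain J where J: "finite J" "J \<subseteq> I" "q = \<theta> ` J" using q by (meson finite_subset_image)
    then show ?thesis using assms(3)[OF J(1,2)] real[OF J(2)] by blast
  qed
  have "B \<subseteq> univ C \<and> |B| <o \<kappa> \<and> \<theta> ` I \<subseteq> formulas_over L B n \<and>
      (\<forall>q\<subseteq>\<theta> ` I. finite q \<longrightarrow> realizations C n q \<noteq> {}) \<longrightarrow> realizations C n (\<theta> ` I) \<noteq> {}"
    using saturated unfolding saturated_def by (elim allE)
  then have "realizations C n (\<theta> ` I) \<noteq> {}" by (rule mp) (intro conjI B sB over allI impI fin)
  then obtain x where "x \<in> realizations C n (\<theta> ` I)" by blast
  then show ?thesis using real[of I x] by blast
qed

lemma elementary_map_extends:
  assumes "V \<subseteq> univ C" "|V| <o \<kappa>" "f ` V \<subseteq> univ C"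
    "\<And>n \<phi> xs. \<phi> \<in> formulas_in L n \<Longrightarrow> xs \<in> tuples n V \<Longrightarrow> holds C \<phi> xs \<Longrightarrow> holds C \<phi> (map f xs)"
  shows "\<exists>\<sigma>. automorphism L C \<sigma> \<and> (\<forall>a\<in>V. \<sigma> a = f a)"
proof -
  have "holds C \<phi> xs \<longleftrightarrow> holds C \<phi> (map f xs)" if "\<phi> \<in> formulas_in L n" "xs \<in> tuples n V" for n \<phi> xs
  proof
    assume "holds C \<phi> (map f xs)"
    show "holds C \<phi> xs"
    proof (rule ccontr)
      assume "\<not> holds C \<phi> xs"
      then have "holds C (FNeg \<phi>) xs" by (simp add: holds_def)
      moreover have "FNeg \<phi> \<in> formulas_in L n" using that(1) by (simp add: formulas_in_def formulas_def)
      ultimately have "holds C (FNeg \<phi>) (map f xs)" using assms(4)[OF _ that(2)] by simp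
      then show False using \<open>holds C \<phi> (map f xs)\<close> by (simp add: holds_def)
    qed
  qed (rule assms(4)[OF that])
  then have "elementary_map L C V f" using assms(3) by (simp add: elementary_map_def)
  with assms(1,2) have "V \<subseteq> univ C \<and> |V| <o \<kappa> \<and> elementary_map L C V f" by (intro conjI)
  moreover have "V \<subseteq> univ C \<and> |V| <o \<kappa> \<and> elementary_map L C V f \<longrightarrow> (\<exists>\<sigma>. automorphism L C \<sigma> \<and> (\<forall>a\<in>V. \<sigma> a = f a))"
    using homogeneous unfolding strongly_homogeneous_def by (elim allE)
  ultimately show ?thesis by (rule rev_mp)
qed

lemma automorphism_of_type:
  assumes x: "x \<in> tuples k (univ C)" and y: "y \<in> tuples k (univ C)"
    and type: "\<And>D. definable L C A k D \<Longrightarrow> x \<in> D \<longleftrightarrow> y \<in> D"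
  obtains \<sigma> where "automorphism L C \<sigma>" "\<And>a. a \<in> A \<Longrightarrow> \<sigma> a = a" "map \<sigma> x = y"
proof -
  have l: "length x = k" "length y = k" "set x \<subseteq> univ C" "set y \<subseteq> univ C" using x y by (auto simp: tuples_def)
  have type': "Q x \<Longrightarrow> Q y" if "expressible L {C} A (\<lambda>N s. Q (map s [0..<k]))" for Q
  proof -
    let ?D = "{u\<in>tuples k (univ C). Q u}"
    have "expressible L {C} A (\<lambda>N s. map s [0..<k] \<in> ?D)"
      by (rule expressible_cong[OF that]) (auto simp: tuples_def)
    then have "definable L C A k ?D" by (rule expressible_definable) (use A_univ univ_ne in auto)
    then show "Q x \<Longrightarrow> Q y" using type[of ?D] x y by simp
  qed
  define ix where "ix a = (SOME j. j < k \<and> x ! j = a)" for a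
  have ix: "ix a < k" "x ! ix a = a" if "a \<in> set x" for a
    using someI_ex[of "\<lambda>j. j < k \<and> x ! j = a"] that l(1) by (auto simp: ix_def in_set_conv_nth)
  define f where "f a = (if a \<in> A then a else y ! ix a)" for a
  have fx: "f (x ! j) = y ! j" if j: "j < k" for j
  proof (cases "x ! j \<in> A")
    case True
    have "expressible L {C} A (\<lambda>N s. map s [0..<k] ! j = x ! j)"
      by (rule expressible_cong[OF expressible_const[OF True, of L "{C}" j]]) (use j in simp)
    then have "y ! j = x ! j" using type'[of "\<lambda>u. u ! j = x ! j"] by simp
    then show ?thesis using True by (simp add: f_def)
  next
    case False
    have i: "ix (x ! j) < k" "x ! ix (x ! j) = x ! j" using ix[of "x ! j"] j l(1) by auto
    have "expressible L {C} A (\<lambda>N s. map s [0..<k] ! ix (x ! j) = map s [0..<k] ! j)"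
      by (rule expressible_cong[OF expressible_eq[of L "{C}" A "ix (x ! j)" j]]) (use i j in simp)
    then have "y ! ix (x ! j) = y ! j" using type'[of "\<lambda>u. u ! ix (x ! j) = u ! j"] i(2) by simp
    then show ?thesis using False by (simp add: f_def)
  qed
  have V: "A \<union> set x \<subseteq> univ C" "|A \<union> set x| <o \<kappa>"
    using A_univ l(3) small_Un[OF strong_limit small_A small_finite[OF strong_limit, of "set x"]] by auto
  have fV: "f ` (A \<union> set x) \<subseteq> univ C"
  proof (rule image_subsetI)
    fix a assume "a \<in> A \<union> set x"
    then show "f a \<in> univ C" using A_univ ix(1)[of a] l(2,4) nth_mem[of "ix a" y] by (auto simp: f_def)
  qed
  have el: "holds C \<phi> (map f zs)" if \<phi>: "\<phi> \<in> formulas_in L n" and zs: "zs \<in> tuples n (A \<union> set x)" and h: "holds C \<phi> zs" for n \<phi> zs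
  proof -
    have lz: "length zs = n" "set zs \<subseteq> A \<union> set x" using zs by (auto simp: tuples_def)
    let ?Q = "\<lambda>u. holds C \<phi> (map (\<lambda>z. if z \<in> A then z else u ! ix z) zs)"
    have ixn: "ix (zs ! i) < k" if "i < n" "zs ! i \<notin> A" for i
    proof -
      have "zs ! i \<in> set zs" using that(1) lz(1) by (intro nth_mem) simp
      then have "zs ! i \<in> set x" using lz(2) that(2) by blast
      then show ?thesis by (rule ix(1))
    qed
    have "expressible L {C} A (\<lambda>N s. ?Q (map s [0..<k]))"
    proof (rule expressibleI[of \<phi> L "\<lambda>i. if i < n \<and> zs ! i \<in> A then Inr (zs ! i) else Inl (ix (zs ! i))"])
      show "\<phi> \<in> formulas L" using \<phi> by (simp add: formulas_in_def)
      fix N :: "('a, 'f, 'r) struct" and s :: "nat \<Rightarrow> 'a" assume "N \<in> {C}"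
      then have N: "N = C" by simp
      show "?Q (map s [0..<k]) \<longleftrightarrow> sat N (assign (\<lambda>i. if i < n \<and> zs ! i \<in> A then Inr (zs ! i) else Inl (ix (zs ! i))) s) \<phi>"
        unfolding holds_def N
      proof (rule sat_cong)
        fix i assume "i \<in> fv_fm \<phi>"
        then have i: "i < n" using \<phi> by (auto simp: formulas_in_def)
        then show "map (\<lambda>z. if z \<in> A then z else map s [0..<k] ! ix z) zs ! i = assign (\<lambda>i. if i < n \<and> zs ! i \<in> A then Inr (zs ! i) else Inl (ix (zs ! i))) s i"
          using lz(1) ixn[OF i] by (simp add: assign_def)
      qed
    qed auto
    moreover have "map (\<lambda>z. if z \<in> A then z else x ! ix z) zs = zs" by (rule map_idI) (use lz(2) ix(2) in auto)
    ultimately have "?Q y" using type'[of ?Q] h by simp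
    moreover have "map (\<lambda>z. if z \<in> A then z else y ! ix z) zs = map f zs" by (simp add: f_def)
    ultimately show ?thesis by simp
  qed
  have "\<exists>\<sigma>. automorphism L C \<sigma> \<and> (\<forall>a\<in>A \<union> set x. \<sigma> a = f a)"
    by (rule elementary_map_extends[OF V fV]) (rule el)
  then obtain \<sigma> where s: "automorphism L C \<sigma>" "\<And>a. a \<in> A \<union> set x \<Longrightarrow> \<sigma> a = f a" by blast
  show ?thesis
  proof (rule that[OF s(1)])
    show "\<sigma> a = a" if "a \<in> A" for a using s(2)[of a] that by (simp add: f_def)
    show "map \<sigma> x = y" using l fx s(2) by (intro nth_equalityI) auto
  qed
qed

text \<open>Saturation for types in a small set \<open>V\<close> of variables. Zorn's lemma yields a maximal partial assignment
that is consistent with all finite parts of the conditions; saturation in one variable extends it.\<close>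

lemma saturation_infinite:
  assumes V: "|V| <o \<kappa>" and P: "P \<subseteq> univ C" and Phi: "|\<Phi>| <o \<kappa>"
    and def: "\<And>vs T. (vs, T) \<in> \<Phi> \<Longrightarrow> set vs \<subseteq> V \<and> definable L C P (length vs) T"
    and fin: "\<And>F. finite F \<Longrightarrow> F \<subseteq> \<Phi> \<Longrightarrow> \<exists>g. range g \<subseteq> univ C \<and> (\<forall>(vs, T)\<in>F. map g vs \<in> T)"
  shows "\<exists>g::'v \<Rightarrow> 'a. range g \<subseteq> univ C \<and> (\<forall>(vs, T)\<in>\<Phi>. map g vs \<in> T)"
proof -
  define good where "good F h g \<longleftrightarrow> range g \<subseteq> univ C \<and> (\<forall>(v, a)\<in>h. g v = a) \<and> (\<forall>(vs, T)\<in>F. map g vs \<in> T)"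
    for F :: "('v list \<times> 'a list set) set" and h :: "('v \<times> 'a) set" and g :: "'v \<Rightarrow> 'a"
  define Q where "Q h \<longleftrightarrow> h \<subseteq> V \<times> univ C \<and> (\<forall>F h0. finite F \<and> F \<subseteq> \<Phi> \<and> finite h0 \<and> h0 \<subseteq> h \<longrightarrow> (\<exists>g. good F h0 g))" for h
  have "\<exists>m\<in>Collect Q. \<forall>x\<in>Collect Q. m \<subseteq> x \<longrightarrow> x = m"
  proof (rule subset_Zorn')
    fix Ch assume Ch: "subset.chain (Collect Q) Ch"
    have "Ch \<subseteq> Collect Q" using Ch by (simp add: subset.chain_def)
    then have sub: "\<Union>Ch \<subseteq> V \<times> univ C" unfolding Q_def by blast
    have "\<exists>g. good F h0 g" if F: "finite F" "F \<subseteq> \<Phi>" and h0: "finite h0" "h0 \<subseteq> \<Union>Ch" for F h0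
    proof (cases "Ch = {}")
      case True
      then have "h0 = {}" using h0 by simp
      then show ?thesis using fin[OF F] by (simp add: good_def)
    next
      case False
      then obtain h where "h \<in> Ch" "h0 \<subseteq> h" using finite_subset_Union_chain[OF h0 False Ch] by blast
      then show ?thesis using \<open>Ch \<subseteq> Collect Q\<close> F h0(1) unfolding Q_def by blast
    qed
    then show "\<Union>Ch \<in> Collect Q" using sub by (simp add: Q_def)
  qed
  then obtain h where h: "Q h" "\<And>h'. Q h' \<Longrightarrow> h \<subseteq> h' \<Longrightarrow> h' = h" by auto
  have hsub: "h \<subseteq> V \<times> univ C" using h(1) by (simp add: Q_def)
  have hfin: "\<exists>g. good F h0 g" if "finite F" "F \<subseteq> \<Phi>" "finite h0" "h0 \<subseteq> h" for F h0
    using h(1) that unfolding Q_def by blast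
  have func: "a = b" if "(v, a) \<in> h" "(v, b) \<in> h" for v a b
    using hfin[of "{}" "{(v, a), (v, b)}"] that by (auto simp: good_def)
  have smallh: "|h| <o \<kappa>"
    by (rule small_inj[OF V, of fst]) (use func hsub in \<open>auto simp: inj_on_def\<close>)
  have total: "\<exists>a. (v, a) \<in> h" if v: "v \<in> V" for v
  proof (rule ccontr)
    assume nv: "\<nexists>a. (v, a) \<in> h"
    define I where "I = {F. finite F \<and> F \<subseteq> \<Phi>} \<times> {h0. finite h0 \<and> h0 \<subseteq> h}"
    define S where "S = (\<lambda>(F, h0). {[a] | a. \<exists>g. good F h0 g \<and> g v = a})"
    have "\<exists>x\<in>tuples 1 (univ C). \<forall>i\<in>I. x \<in> S i"
    proof (rule saturated_family)
      have "|{F. finite F \<and> F \<subseteq> \<Phi>}| <o \<kappa>" "|{h0. finite h0 \<and> h0 \<subseteq> h}| <o \<kappa>"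
        by (rule small_subset[OF small_Pow[OF strong_limit Phi]], auto)
          (rule small_subset[OF small_Pow[OF strong_limit smallh]], auto)
      then show "|I| <o \<kappa>" unfolding I_def by (rule small_Times[OF strong_limit])
    next
      fix i assume "i \<in> I"
      then obtain F h0 where i: "i = (F, h0)" "finite F" "F \<subseteq> \<Phi>" "finite h0" "h0 \<subseteq> h" by (auto simp: I_def)
      define W where "W = ((\<Union>(vs, T)\<in>F. set vs) \<union> fst ` h0) - {v}"
      have W: "finite W" using i(2,4) by (auto simp: W_def)
      let ?B = "P \<union> snd ` h"
      have B: "?B \<subseteq> univ C" using P hsub by auto
      have e1: "expressible L {C} ?B (\<lambda>N s. s (fst p) = snd p)" if p: "p \<in> h0" for p :: "'v \<times> 'a"
      proof (rule expressible_const)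
        show "snd p \<in> ?B" using i(5) p by blast
      qed
      have e2: "expressible L {C} ?B (\<lambda>N s. map s (fst p) \<in> snd p)" if p: "p \<in> F" for p
      proof -
        obtain vs T where vT: "p = (vs, T)" by (cases p)
        then have "(vs, T) \<in> \<Phi>" using p i(3) by (simp add: subset_iff)
        then have "definable L C P (length vs) T" using def by simp
        then have "definable L C ?B (length vs) T" by (rule definable_mono) simp
        from expressible_rename[OF definable_expressible[OF this], of "\<lambda>j. vs ! j"]
        have e: "expressible L {C} ?B (\<lambda>N s. map (\<lambda>j. s (vs ! j)) [0..<length vs] \<in> T)" .
        show "expressible L {C} ?B (\<lambda>N s. map s (fst p) \<in> snd p)"
        proof (rule expressible_cong[OF e])
          fix N :: "('a, 'f, 'r) struct" and s :: "'v \<Rightarrow> 'a"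
          have "map (\<lambda>j. s (vs ! j)) [0..<length vs] = map s vs" by (rule nth_equalityI) simp_all
          then show "map (\<lambda>j. s (vs ! j)) [0..<length vs] \<in> T \<longleftrightarrow> map s (fst p) \<in> snd p" unfolding vT fst_conv snd_conv by (rule arg_cong)
        qed
      qed
      have "expressible L {C} ?B (\<lambda>N s. (\<forall>p\<in>h0. s (fst p) = snd p) \<and> (\<forall>p\<in>F. map s (fst p) \<in> snd p))"
        by (rule expressible_conj[OF expressible_finite_conj[OF i(4) e1] expressible_finite_conj[OF i(2) e2]])
      from expressible_ex_finite[OF W this] B
      have "expressible L {C} ?B (\<lambda>N s. \<exists>t. range t \<subseteq> univ N \<and> (\<forall>w. w \<notin> W \<longrightarrow> t w = s w) \<and>
        (\<forall>p\<in>h0. t (fst p) = snd p) \<and> (\<forall>p\<in>F. map t (fst p) \<in> snd p))" by simp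
      from expressible_rename[OF this, of "\<lambda>_. 0::nat"]
      have "expressible L {C} ?B (\<lambda>N s. map s [0..<1] \<in> S i)"
      proof (rule expressible_cong)
        fix N :: "('a, 'f, 'r) struct" and s :: "nat \<Rightarrow> 'a" assume N: "N \<in> {C}" and s: "range s \<subseteq> univ N"
        show "(\<exists>t. range t \<subseteq> univ N \<and> (\<forall>w. w \<notin> W \<longrightarrow> t w = s 0) \<and>
          (\<forall>p\<in>h0. t (fst p) = snd p) \<and> (\<forall>p\<in>F. map t (fst p) \<in> snd p)) \<longleftrightarrow> map s [0..<1] \<in> S i" (is "?l \<longleftrightarrow> ?r")
        proof
          assume ?l
          then obtain t where t: "range t \<subseteq> univ C" "\<And>w. w \<notin> W \<Longrightarrow> t w = s 0"
            "\<forall>p\<in>h0. t (fst p) = snd p" "\<forall>p\<in>F. map t (fst p) \<in> snd p" using N by auto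
          have "good F h0 t" using t by (simp add: good_def case_prod_beta)
          moreover have "t v = s 0" by (rule t(2)) (simp add: W_def)
          ultimately show ?r by (auto simp: S_def i(1))
        next
          assume ?r
          then obtain g where g: "good F h0 g" "g v = s 0" by (auto simp: S_def i(1))
          define t where "t w = (if w \<in> W then g w else s 0)" for w
          have tg: "t w = g w" if "w \<in> (\<Union>(vs, T)\<in>F. set vs) \<union> fst ` h0" for w
            using that g(2) by (cases "w = v") (auto simp: t_def W_def)
          have "\<forall>p\<in>h0. t (fst p) = snd p" using g(1) tg by (auto simp: good_def)
          moreover have "map t (fst p) \<in> snd p" if p: "p \<in> F" for p
          proof -
            have "map t (fst p) = map g (fst p)" by (rule map_cong[OF refl], rule tg) (use p in force)
            moreover have "map g (fst p) \<in> snd p" using g(1) p by (simp add: good_def case_prod_beta)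
            ultimately show ?thesis by (simp only:)
          qed
          moreover have "range t \<subseteq> univ N" using g(1) s N by (auto simp: t_def good_def)
          ultimately show ?l by (intro exI[of _ t]) (auto simp: t_def)
        qed
      qed
      then have "definable L C ?B 1 (S i)"
        by (rule expressible_definable) (use B univ_ne in \<open>auto simp: S_def i(1) good_def tuples_def\<close>)
      then show "definable L C (univ C) 1 (S i)" by (rule definable_mono[OF _ B])
    next
      fix J assume J: "finite J" "J \<subseteq> I"
      let ?F = "\<Union>(fst ` J)" and ?h = "\<Union>(snd ` J)"
      have "finite ?F" "?F \<subseteq> \<Phi>" "finite ?h" "?h \<subseteq> h" using J by (force simp: I_def)+
      then obtain g where g: "good ?F ?h g" using hfin by blast
      have "good (fst i) (snd i) g" if "i \<in> J" for i
        using g that unfolding good_def by (force simp: case_prod_beta)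
      then have "[g v] \<in> S i" if "i \<in> J" for i using that unfolding S_def case_prod_beta by blast
      moreover have "[g v] \<in> tuples 1 (univ C)" using g by (auto simp: good_def tuples_def)
      ultimately show "\<exists>x\<in>tuples 1 (univ C). \<forall>i\<in>J. x \<in> S i" by blast
    qed
    then obtain a where a: "a \<in> univ C" "\<And>i. i \<in> I \<Longrightarrow> [a] \<in> S i" by (auto simp: tuples_def length_Suc_conv)
    have "Q (insert (v, a) h)" unfolding Q_def
    proof (intro conjI allI impI)
      show "insert (v, a) h \<subseteq> V \<times> univ C" using hsub v a(1) by simp
      fix F h0 assume F: "finite F \<and> F \<subseteq> \<Phi> \<and> finite h0 \<and> h0 \<subseteq> insert (v, a) h"
      then have "(F, h0 - {(v, a)}) \<in> I" by (auto simp: I_def)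
      then obtain g where "good F (h0 - {(v, a)}) g" "g v = a" using a(2) by (force simp: S_def)
      then have "good F h0 g" unfolding good_def by (auto split: prod.splits)
      then show "\<exists>g. good F h0 g" by blast
    qed
    then have "insert (v, a) h = h" by (rule h(2)) auto
    then show False using nv by blast
  qed
  obtain u where u: "u \<in> univ C" using univ_ne by blast
  define g where "g v = (if v \<in> V then SOME a. (v, a) \<in> h else u)" for v
  have g: "(v, g v) \<in> h" if "v \<in> V" for v using someI_ex[OF total[OF that]] that by (simp add: g_def)
  have "g v \<in> univ C" for v using g[of v] hsub u by (cases "v \<in> V") (auto simp: g_def)
  moreover have "map g vs \<in> T" if vT: "(vs, T) \<in> \<Phi>" for vs T
  proof -
    have vsV: "set vs \<subseteq> V" using def[OF vT] by simp
    have "(\<lambda>v. (v, g v)) ` set vs \<subseteq> h" using g vsV by auto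
    then obtain g' where g': "good {(vs, T)} ((\<lambda>v. (v, g v)) ` set vs) g'" using hfin[of "{(vs, T)}" "(\<lambda>v. (v, g v)) ` set vs"] vT by auto
    then have m: "map g vs = map g' vs" by (auto simp: good_def)
    have "map g' vs \<in> T" using g' by (simp add: good_def)
    then show ?thesis by (simp only: m)
  qed
  ultimately show ?thesis by (intro exI[of _ g]) auto
qed

text \<open>By homogeneity an automorphism can be prescribed on the parameters of the sets \<open>D\<close> by an elementary map. The
type of the images of these parameters, together with the requirements, is finitely satisfiable, so
\<open>saturation_infinite\<close> realizes it.\<close>

lemma automorphism_saturation:
  assumes small: "|\<C>| <o \<kappa>"
    and def: "\<And>D E. (D, E) \<in> \<C> \<Longrightarrow> definable L C (univ C) k D \<and> definable L C (univ C) k E"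
    and fin: "\<And>F. finite F \<Longrightarrow> F \<subseteq> \<C> \<Longrightarrow>
      \<exists>\<sigma>. automorphism L C \<sigma> \<and> (\<forall>a\<in>A. \<sigma> a = a) \<and> (\<forall>(D, E)\<in>F. \<not> map \<sigma> ` D \<subseteq> E)"
  shows "\<exists>\<sigma>. automorphism L C \<sigma> \<and> (\<forall>a\<in>A. \<sigma> a = a) \<and> (\<forall>(D, E)\<in>\<C>. \<not> map \<sigma> ` D \<subseteq> E)"
proof -
  have "\<forall>c\<in>\<C>. \<exists>q. set (snd q) \<subseteq> univ C \<and> fst q \<in> formulas_in L (k + length (snd q)) \<and>
    fst c = {xs\<in>tuples k (univ C). holds C (fst q) (xs @ snd q)}"
  proof
    fix c assume "c \<in> \<C>"
    then have "definable L C (univ C) k (fst c)" using def[of "fst c" "snd c"] by simp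
    then obtain \<phi> bs where "set bs \<subseteq> univ C" "\<phi> \<in> formulas_in L (k + length bs)"
      "fst c = {xs\<in>tuples k (univ C). holds C \<phi> (xs @ bs)}" by (rule definableE)
    then show "\<exists>q. set (snd q) \<subseteq> univ C \<and> fst q \<in> formulas_in L (k + length (snd q)) \<and>
      fst c = {xs\<in>tuples k (univ C). holds C (fst q) (xs @ snd q)}" by (intro exI[of _ "(\<phi>, bs)"]) simp
  qed
  from bchoice[OF this] obtain q where q: "\<forall>c\<in>\<C>. set (snd (q c)) \<subseteq> univ C \<and> fst (q c) \<in> formulas_in L (k + length (snd (q c))) \<and>
    fst c = {xs\<in>tuples k (univ C). holds C (fst (q c)) (xs @ snd (q c))}" by (elim exE)
  define \<phi> bs where "\<phi> c = fst (q c)" and "bs c = snd (q c)" for c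
  have ph: "set (bs c) \<subseteq> univ C \<and> \<phi> c \<in> formulas_in L (k + length (bs c)) \<and>
    fst c = {xs\<in>tuples k (univ C). holds C (\<phi> c) (xs @ bs c)}" if "c \<in> \<C>" for c
    using bspec[OF q that] unfolding \<phi>_def bs_def .
  have "\<forall>c\<in>\<C>. \<exists>cs. set cs \<subseteq> univ C \<and> definable L C (set cs) k (snd c)"
  proof
    fix c assume "c \<in> \<C>"
    then have "definable L C (univ C) k (snd c)" using def[of "fst c" "snd c"] by simp
    then obtain \<psi> ds where d: "(\<psi>, ds) \<in> formulas_over L (univ C) k" "snd c = realizations C k {(\<psi>, ds)}"
      by (auto simp: definable_def)
    have "(\<psi>, ds) \<in> formulas_over L (set ds) k" using d(1) by (simp add: formulas_over_def)
    then have "definable L C (set ds) k (snd c)" unfolding definable_def using d(2) by (rule rev_bexI)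
    then show "\<exists>cs. set cs \<subseteq> univ C \<and> definable L C (set cs) k (snd c)"
      using d(1) by (intro exI[of _ ds]) (simp add: formulas_over_def)
  qed
  from bchoice[OF this] obtain cs where "\<forall>c\<in>\<C>. set (cs c) \<subseteq> univ C \<and> definable L C (set (cs c)) k (snd c)" by (elim exE)
  then have cs: "set (cs c) \<subseteq> univ C \<and> definable L C (set (cs c)) k (snd c)" if "c \<in> \<C>" for c using that by (rule bspec)
  define V where "V = A \<union> (\<Union>c\<in>\<C>. set (bs c))"
  define P where "P = A \<union> (\<Union>c\<in>\<C>. set (cs c))"
  have bsC: "set (bs c) \<subseteq> univ C" if "c \<in> \<C>" for c using ph[OF that] by (rule conjunct1)
  have csC: "set (cs c) \<subseteq> univ C" if "c \<in> \<C>" for c using cs[OF that] by (rule conjunct1)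
  have V: "V \<subseteq> univ C" "|V| <o \<kappa>" unfolding V_def
    by (intro Un_least UN_least A_univ, erule bsC) (intro small_Un strong_limit small_A small_params small)
  have P: "P \<subseteq> univ C" unfolding P_def by (intro Un_least UN_least A_univ, erule csC)
  define T where "T c = {ys\<in>tuples (length (bs c)) (univ C). \<exists>x\<in>tuples k (univ C). holds C (\<phi> c) (x @ ys) \<and> x \<notin> snd c}" for c
  define \<Phi>1 where "\<Phi>1 = {(vs, {ys\<in>tuples (length vs) (univ C). holds C \<chi> ys}) | vs \<chi>.
    set vs \<subseteq> V \<and> \<chi> \<in> formulas_in L (length vs) \<and> holds C \<chi> vs}"
  define \<Phi>2 where "\<Phi>2 = (\<lambda>a. ([a], {[a]})) ` A"
  define \<Phi>3 where "\<Phi>3 = (\<lambda>c. (bs c, T c)) ` \<C>"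
  have T_def': "definable L C P (length (bs c)) (T c)" if c: "c \<in> \<C>" for c
  proof -
    define n where "n = length (bs c)"
    have phc: "\<phi> c \<in> formulas_in L (k + n)" using ph[OF c] by (simp add: n_def)
    have 1: "expressible L {C} P (\<lambda>N s. sat N (\<lambda>i. s (if i < k then n + i else i - k)) (\<phi> c))"
      by (rule expressible_formula) (use phc in \<open>simp add: formulas_in_def\<close>)
    have "definable L C P k (snd c)" by (rule definable_mono[of _ _ "set (cs c)"]) (use cs[OF c] c in \<open>auto simp: P_def\<close>)
    from expressible_not[OF expressible_rename[OF definable_expressible[OF this], of "\<lambda>j. n + j"]]
    have 2: "expressible L {C} P (\<lambda>N s. map (\<lambda>j. s (n + j)) [0..<k] \<notin> snd c)" .
    from expressible_ex_finite[OF finite_atLeastLessThan[of n "n + k"] expressible_conj[OF 1 2]] P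
    have "expressible L {C} P (\<lambda>N s. \<exists>t. range t \<subseteq> univ N \<and> (\<forall>w. w \<notin> {n..<n + k} \<longrightarrow> t w = s w) \<and>
      sat N (\<lambda>i. t (if i < k then n + i else i - k)) (\<phi> c) \<and> map (\<lambda>j. t (n + j)) [0..<k] \<notin> snd c)" by simp
    then have "expressible L {C} P (\<lambda>N s. map s [0..<n] \<in> T c)"
    proof (rule expressible_cong)
      fix N :: "('a, 'f, 'r) struct" and s :: "nat \<Rightarrow> 'a" assume N: "N \<in> {C}" and s: "range s \<subseteq> univ N"
      have st: "sat C (\<lambda>i. t (if i < k then n + i else i - k)) (\<phi> c) \<longleftrightarrow> holds C (\<phi> c) (map (\<lambda>j. t (n + j)) [0..<k] @ map s [0..<n])"
        if t: "\<And>w. w \<notin> {n..<n + k} \<Longrightarrow> t w = s w" for t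
        unfolding holds_def by (rule sat_cong) (use phc t in \<open>auto simp: formulas_in_def nth_append\<close>)
      show "(\<exists>t. range t \<subseteq> univ N \<and> (\<forall>w. w \<notin> {n..<n + k} \<longrightarrow> t w = s w) \<and>
        sat N (\<lambda>i. t (if i < k then n + i else i - k)) (\<phi> c) \<and> map (\<lambda>j. t (n + j)) [0..<k] \<notin> snd c) \<longleftrightarrow> map s [0..<n] \<in> T c" (is "?l \<longleftrightarrow> ?r")
      proof
        assume ?l
        then obtain t where t: "range t \<subseteq> univ C" "\<And>w. w \<notin> {n..<n + k} \<Longrightarrow> t w = s w"
          "sat C (\<lambda>i. t (if i < k then n + i else i - k)) (\<phi> c)" "map (\<lambda>j. t (n + j)) [0..<k] \<notin> snd c" using N by auto
        have "map (\<lambda>j. t (n + j)) [0..<k] \<in> tuples k (univ C)" using t(1) by (auto simp: tuples_def)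
        moreover have "map s [0..<n] \<in> tuples n (univ C)" using s N by (auto simp: tuples_def)
        ultimately show ?r using t(3,4) st[OF t(2)] by (auto simp: T_def n_def)
      next
        assume ?r
        then obtain x where x: "x \<in> tuples k (univ C)" "holds C (\<phi> c) (x @ map s [0..<n])" "x \<notin> snd c" by (auto simp: T_def)
        define t where "t w = (if w \<in> {n..<n + k} then x ! (w - n) else s w)" for w
        have xm: "map (\<lambda>j. t (n + j)) [0..<k] = x" using x(1) by (intro nth_equalityI) (auto simp: t_def tuples_def)
        have tw: "t w = s w" if "w \<notin> {n..<n + k}" for w using that by (simp only: t_def if_False)
        have "t w \<in> univ C" for w
        proof (cases "w \<in> {n..<n + k}")
          case True
          then have "x ! (w - n) \<in> set x" using x(1) by (intro nth_mem) (auto simp: tuples_def)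
          then show ?thesis using True x(1) by (auto simp: t_def tuples_def)
        qed (use s N tw in auto)
        then have "range t \<subseteq> univ C" by blast
        then show ?l using st[OF tw] x xm tw N by (intro exI[of _ t]) auto
      qed
    qed
    then show ?thesis unfolding n_def by (rule expressible_definable) (use P univ_ne in \<open>auto simp: T_def\<close>)
  qed
  have "\<exists>g. range g \<subseteq> univ C \<and> (\<forall>(vs, T)\<in>\<Phi>1 \<union> \<Phi>2 \<union> \<Phi>3. map g vs \<in> T)"
  proof (rule saturation_infinite[OF V(2) P])
    have "\<Phi>1 \<subseteq> (\<lambda>(vs, \<chi>). (vs, {ys\<in>tuples (length vs) (univ C). holds C \<chi> ys})) ` (lists V \<times> formulas L)"
      by (force simp: \<Phi>1_def formulas_in_def in_lists_conv_set)
    moreover have "|(\<lambda>(vs, \<chi>). (vs, {ys\<in>tuples (length vs) (univ C). holds C \<chi> ys})) ` (lists V \<times> formulas L)| <o \<kappa>"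
      by (intro small_image small_Times strong_limit small_lists small_nat V(2) small_formulas)
    ultimately have "|\<Phi>1| <o \<kappa>" by (rule small_subset[rotated])
    moreover have "|\<Phi>2| <o \<kappa>" "|\<Phi>3| <o \<kappa>" unfolding \<Phi>2_def \<Phi>3_def by (intro small_image small_A small)+
    ultimately show "|\<Phi>1 \<union> \<Phi>2 \<union> \<Phi>3| <o \<kappa>" by (intro small_Un strong_limit)
  next
    fix vs S assume "(vs, S) \<in> \<Phi>1 \<union> \<Phi>2 \<union> \<Phi>3"
    then consider (1) "(vs, S) \<in> \<Phi>1" | (2) "(vs, S) \<in> \<Phi>2" | (3) "(vs, S) \<in> \<Phi>3" by blast
    then show "set vs \<subseteq> V \<and> definable L C P (length vs) S"
    proof cases
      case 1
      then obtain \<chi> where c: "set vs \<subseteq> V" "\<chi> \<in> formulas_in L (length vs)" "S = {ys\<in>tuples (length vs) (univ C). holds C \<chi> ys}"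
        by (auto simp: \<Phi>1_def)
      have "(\<chi>, []) \<in> formulas_over L P (length vs)" using c(2) by (simp add: formulas_over_def)
      moreover have "S = realizations C (length vs) {(\<chi>, [])}" using c(3) by (auto simp: realizations_def)
      ultimately show ?thesis using c(1) unfolding definable_def by blast
    next
      case 2
      then obtain a where a: "a \<in> A" "vs = [a]" "S = {[a]}" by (auto simp: \<Phi>2_def)
      have "expressible L {C} P (\<lambda>N s. s (0::nat) = a)" by (rule expressible_const) (use a in \<open>simp add: P_def\<close>)
      then have "expressible L {C} P (\<lambda>N s. map s [0..<1] \<in> S)" by (rule expressible_cong) (simp add: a)
      then have "definable L C P 1 S"
        by (rule expressible_definable) (use a A_univ P univ_ne in \<open>auto simp: tuples_def\<close>)
      then show ?thesis using a by (simp add: V_def)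
    next
      case 3
      then obtain c where "c \<in> \<C>" "vs = bs c" "S = T c" by (auto simp: \<Phi>3_def)
      then show ?thesis using T_def' by (auto simp: V_def)
    qed
  next
    fix F assume F: "finite F" "F \<subseteq> \<Phi>1 \<union> \<Phi>2 \<union> \<Phi>3"
    have F3: "F \<inter> \<Phi>3 \<subseteq> (\<lambda>c. (bs c, T c)) ` \<C>" by (simp add: \<Phi>3_def)
    have "finite (F \<inter> \<Phi>3)" using F(1) by simp
    from finite_subset_image[OF this F3]
    obtain C' where C': "C' \<subseteq> \<C>" "finite C'" "F \<inter> \<Phi>3 = (\<lambda>c. (bs c, T c)) ` C'" by (elim exE conjE)
    from fin[OF C'(2,1)] obtain \<sigma> where s0: "automorphism L C \<sigma>" "\<forall>a\<in>A. \<sigma> a = a"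
      "\<forall>(D, E)\<in>C'. \<not> map \<sigma> ` D \<subseteq> E" by (elim exE conjE)
    have s: "automorphism L C \<sigma>" "\<And>a. a \<in> A \<Longrightarrow> \<sigma> a = a" "\<And>c. c \<in> C' \<Longrightarrow> \<not> map \<sigma> ` fst c \<subseteq> snd c"
    proof -
      show "\<not> map \<sigma> ` fst c \<subseteq> snd c" if "c \<in> C'" for c using bspec[OF s0(3) that] by (simp add: case_prod_beta)
    qed (use s0 in simp_all)
    obtain u where u: "u \<in> univ C" using univ_ne by blast
    define g where "g x = (if x \<in> univ C then \<sigma> x else u)" for x
    have gm: "map g vs = map \<sigma> vs" if "set vs \<subseteq> univ C" for vs using that by (auto simp: g_def)
    have "range g \<subseteq> univ C" using automorphism_univ[OF s(1)] u by (auto simp: g_def)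
    moreover have "map g vs \<in> S" if vS: "(vs, S) \<in> F" for vs S
    proof -
      consider (1) "(vs, S) \<in> \<Phi>1" | (2) "(vs, S) \<in> \<Phi>2" | (3) "(vs, S) \<in> F \<inter> \<Phi>3" using vS F(2) by blast
      then show ?thesis
      proof cases
        case 1
        then obtain \<chi> where c: "set vs \<subseteq> V" "\<chi> \<in> formulas_in L (length vs)" "holds C \<chi> vs" "S = {ys\<in>tuples (length vs) (univ C). holds C \<chi> ys}"
          by (auto simp: \<Phi>1_def)
        have vU: "set vs \<subseteq> univ C" using c(1) V(1) by blast
        then have "map \<sigma> vs \<in> tuples (length vs) (univ C)" using map_tuples[OF s(1)] by (simp add: tuples_def)
        then show ?thesis unfolding c(4) gm[OF vU] using holds_automorphism[OF struct s(1) c(2) vU] c(3) by simp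
      next
        case 2
        then show ?thesis using s(2) A_univ by (auto simp: \<Phi>2_def g_def)
      next
        case 3
        then obtain c where c: "c \<in> C'" "vs = bs c" "S = T c" using C'(3) by auto
        then have cC: "c \<in> \<C>" using C'(1) by blast
        note p = ph[OF cC]
        obtain x where x: "x \<in> fst c" "map \<sigma> x \<notin> snd c" using s(3)[OF c(1)] by blast
        have xt: "x \<in> tuples k (univ C)" "holds C (\<phi> c) (x @ bs c)" using x(1) p by auto
        have "holds C (\<phi> c) (map \<sigma> (x @ bs c))"
          using holds_automorphism[OF struct s(1), of "\<phi> c" "x @ bs c"] p xt by (auto simp: tuples_def)
        moreover have "map \<sigma> (bs c) \<in> tuples (length (bs c)) (univ C)" using map_tuples[OF s(1)] p by (simp add: tuples_def)
        ultimately have "map \<sigma> (bs c) \<in> T c" using map_tuples[OF s(1) xt(1)] x(2) by (auto simp: T_def)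
        moreover have "map g (bs c) = map \<sigma> (bs c)" by (rule gm) (rule conjunct1[OF p])
        ultimately show ?thesis unfolding c(2,3) by (simp only:)
      qed
    qed
    ultimately show "\<exists>g. range g \<subseteq> univ C \<and> (\<forall>(vs, T)\<in>F. map g vs \<in> T)" by (intro exI[of _ g]) auto
  qed
  then obtain g where g0: "range g \<subseteq> univ C \<and> (\<forall>(vs, T)\<in>\<Phi>1 \<union> \<Phi>2 \<union> \<Phi>3. map g vs \<in> T)" by (elim exE)
  have g: "range g \<subseteq> univ C" "\<And>vs S. (vs, S) \<in> \<Phi>1 \<union> \<Phi>2 \<union> \<Phi>3 \<Longrightarrow> map g vs \<in> S"
  proof -
    show "range g \<subseteq> univ C" using g0 by (rule conjunct1)
    show "map g vs \<in> S" if "(vs, S) \<in> \<Phi>1 \<union> \<Phi>2 \<union> \<Phi>3" for vs S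
      using bspec[OF conjunct2[OF g0] that] by (simp only: prod.case)
  qed
  have el: "holds C \<chi> (map g vs)" if c: "\<chi> \<in> formulas_in L n" "vs \<in> tuples n V" "holds C \<chi> vs" for n \<chi> vs
  proof -
    have "(vs, {ys\<in>tuples (length vs) (univ C). holds C \<chi> ys}) \<in> \<Phi>1" using c by (auto simp: \<Phi>1_def tuples_def)
    then have "map g vs \<in> {ys\<in>tuples (length vs) (univ C). holds C \<chi> ys}" by (intro g(2) UnI1)
    then show ?thesis by simp
  qed
  have "g ` V \<subseteq> univ C" using g(1) by blast
  then have "\<exists>\<sigma>. automorphism L C \<sigma> \<and> (\<forall>a\<in>V. \<sigma> a = g a)"
    by (rule elementary_map_extends[OF V]) (rule el)
  then obtain \<sigma> where s: "automorphism L C \<sigma>" "\<And>a. a \<in> V \<Longrightarrow> \<sigma> a = g a" by blast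
  have "\<sigma> a = a" if "a \<in> A" for a
  proof -
    have "([a], {[a]}) \<in> \<Phi>2" using that by (simp add: \<Phi>2_def)
    then have "map g [a] \<in> {[a]}" by (intro g(2) UnI1 UnI2)
    then show ?thesis using s(2)[of a] that by (simp add: V_def)
  qed
  moreover have "\<not> map \<sigma> ` fst c \<subseteq> snd c" if c: "c \<in> \<C>" for c
  proof
    assume sub: "map \<sigma> ` fst c \<subseteq> snd c"
    note p = ph[OF c]
    have "(bs c, T c) \<in> \<Phi>3" using c by (simp add: \<Phi>3_def)
    then have "map g (bs c) \<in> T c" by (intro g(2) UnI2)
    moreover have "map g (bs c) = map \<sigma> (bs c)"
    proof (rule map_cong[OF refl])
      fix a assume "a \<in> set (bs c)"
      then have "a \<in> V" using c unfolding V_def by blast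
      then show "g a = \<sigma> a" by (rule s(2)[symmetric])
    qed
    ultimately have "map \<sigma> (bs c) \<in> T c" by (simp only:)
    then obtain y where y: "y \<in> tuples k (univ C)" "holds C (\<phi> c) (y @ map \<sigma> (bs c))" "y \<notin> snd c" by (auto simp: T_def)
    obtain \<tau> where t: "automorphism L C \<tau>" "\<And>x. x \<in> univ C \<Longrightarrow> \<tau> (\<sigma> x) = x" "\<And>x. x \<in> univ C \<Longrightarrow> \<sigma> (\<tau> x) = x"
      using automorphism_inv[OF struct s(1)] by blast
    have ty: "map \<tau> y \<in> tuples k (univ C)" by (rule map_tuples[OF t(1) y(1)])
    have sy: "map \<sigma> (map \<tau> y) = y" using y(1) t(3) by (auto simp: tuples_def intro!: map_idI)
    have tl: "length (map \<tau> y) = k" "set (map \<tau> y) \<subseteq> univ C" using ty unfolding tuples_def by blast+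
    have "holds C (\<phi> c) (map \<sigma> (map \<tau> y @ bs c)) \<longleftrightarrow> holds C (\<phi> c) (map \<tau> y @ bs c)"
    proof (rule holds_automorphism[OF struct s(1)])
      show "\<phi> c \<in> formulas_in L (length (map \<tau> y @ bs c))" unfolding length_append tl(1) by (rule conjunct1[OF conjunct2[OF p]])
      show "set (map \<tau> y @ bs c) \<subseteq> univ C" unfolding set_append by (intro Un_least tl(2) conjunct1[OF p])
    qed
    then have "holds C (\<phi> c) (map \<tau> y @ bs c)" unfolding map_append sy using y(2) by (rule iffD1)
    then have "map \<tau> y \<in> fst c" unfolding conjunct2[OF conjunct2[OF p]] using ty by blast
    then have "map \<sigma> (map \<tau> y) \<in> snd c" using sub by blast
    then show False using sy y(3) by simp
  qed
  ultimately have "automorphism L C \<sigma> \<and> (\<forall>a\<in>A. \<sigma> a = a) \<and> (\<forall>(D, E)\<in>\<C>. \<not> map \<sigma> ` D \<subseteq> E)"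
    using s(1) unfolding case_prod_beta by blast
  then show ?thesis by (intro exI[of _ \<sigma>])
qed

end

section \<open>The ring generated by the interpretation\<close>

context rng
begin

lemma stage_SucI:
  assumes "a \<in> stage R X n" "b \<in> stage R X n" "c \<in> stage R X n" "d \<in> stage R X n"
  shows "a \<otimes> b \<oplus> (c \<oplus> d) \<in> stage R X (Suc n)"
  using assms by (auto simp: set_add_def set_mult_def)

lemma stage_SucE:
  assumes "x \<in> stage R X (Suc n)"
  obtains a b c d where "a \<in> stage R X n" "b \<in> stage R X n" "c \<in> stage R X n" "d \<in> stage R X n"
    "x = a \<otimes> b \<oplus> (c \<oplus> d)"
  using assms by (auto simp: set_add_def set_mult_def)

lemma stage_closed:
  assumes X: "X \<subseteq> carrier R" shows "stage R X n \<subseteq> carrier R"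
proof (induction n)
  case (Suc n)
  show ?case
  proof
    fix x assume "x \<in> stage R X (Suc n)"
    then obtain a b c d where "a \<in> stage R X n" "b \<in> stage R X n" "c \<in> stage R X n" "d \<in> stage R X n"
      "x = a \<otimes> b \<oplus> (c \<oplus> d)" by (rule stage_SucE)
    then show "x \<in> carrier R" using Suc by (simp add: subset_iff rng_m_closed)
  qed
qed (use X in simp)

lemma stage_zero:
  assumes "\<zero> \<in> X" shows "\<zero> \<in> stage R X n"
proof (induction n)
  case (Suc n)
  then show ?case using stage_SucI[OF Suc Suc Suc Suc] by simp
qed (use assms in simp)

lemma stage_minus:
  assumes X: "X \<subseteq> carrier R" and sym: "(\<lambda>x. \<ominus> x) ` X = X"
  shows "x \<in> stage R X n \<Longrightarrow> \<ominus> x \<in> stage R X n"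
proof (induction n arbitrary: x)
  case 0
  then show ?case using sym by auto
next
  case (Suc n)
  obtain a b c d where a: "a \<in> stage R X n" "b \<in> stage R X n" "c \<in> stage R X n" "d \<in> stage R X n"
    "x = a \<otimes> b \<oplus> (c \<oplus> d)" using Suc.prems by (rule stage_SucE)
  have "a \<in> carrier R" "b \<in> carrier R" "c \<in> carrier R" "d \<in> carrier R"
    using a stage_closed[OF X, of n] by blast+
  then have "\<ominus> x = (\<ominus> a) \<otimes> b \<oplus> (\<ominus> c \<oplus> \<ominus> d)" by (simp add: a(5) l_minus_rng rng_m_closed minus_add)
  also have "\<dots> \<in> stage R X (Suc n)" by (rule stage_SucI[OF Suc.IH[OF a(1)] a(2) Suc.IH[OF a(3)] Suc.IH[OF a(4)]])
  finally show ?case .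
qed

lemma stage_add:
  assumes X: "X \<subseteq> carrier R" "\<zero> \<in> X" and x: "x \<in> stage R X n" "y \<in> stage R X n"
  shows "x \<oplus> y \<in> stage R X (Suc n)"
  using stage_SucI[OF stage_zero[OF X(2)] stage_zero[OF X(2)] x] stage_closed[OF X(1), of n] x
  by (simp add: subset_iff)

lemma stage_mult:
  assumes X: "X \<subseteq> carrier R" "\<zero> \<in> X" and x: "x \<in> stage R X n" "y \<in> stage R X n"
  shows "x \<otimes> y \<in> stage R X (Suc n)"
  using stage_SucI[OF x stage_zero[OF X(2)] stage_zero[OF X(2)]] stage_closed[OF X(1), of n] x
  by (simp add: subset_iff rng_m_closed)

lemma stage_Suc:
  assumes X: "X \<subseteq> carrier R" "\<zero> \<in> X" and x: "x \<in> stage R X n"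
  shows "x \<in> stage R X (Suc n)"
  using stage_add[OF X x stage_zero[OF X(2)]] stage_closed[OF X(1), of n] x by (simp add: subset_iff)

end

lemma bexpr_imp:
  assumes "bexpr L \<N> A k P" "bexpr L \<N> A k Q" shows "bexpr L \<N> A k (\<lambda>N e. P N e \<longrightarrow> Q N e)"
  by (rule bexpr_cong[OF bexpr_not[OF bexpr_conj[OF assms(1) bexpr_not[OF assms(2)]]]]) blast

lemma bexpr_all:
  fixes A :: "'a set"
  assumes "bexpr L \<N> A k P" "\<And>N. N \<in> \<N> \<Longrightarrow> A \<subseteq> univ N"
  shows "bexpr L \<N> A k (\<lambda>N e. \<forall>y\<in>tuples k (univ N). P N (e(w := y)))"
  by (rule bexpr_cong[OF bexpr_not[OF bexpr_ex[OF bexpr_not[OF assms(1)] assms(2)]]]) auto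

lemma bexpr_all_upto:
  fixes L :: "('f, 'r) lang" and P :: "('a, 'f, 'r) struct \<Rightarrow> (nat \<Rightarrow> 'a list) \<Rightarrow> bool"
  assumes "bexpr L \<N> {} k P"
  shows "bexpr L \<N> {} k (\<lambda>N e. \<forall>t. (\<forall>i. t i \<in> tuples k (univ N)) \<and> (\<forall>i\<ge>m. t i = e i) \<longrightarrow> P N t)"
  using assms
proof (induction m arbitrary: P)
  case 0
  show ?case
  proof (rule bexpr_cong[OF 0])
    fix N :: "('a, 'f, 'r) struct" and e :: "nat \<Rightarrow> 'a list" assume "\<And>w. e w \<in> tuples k (univ N)"
    moreover have "t = e" if "\<forall>i\<ge>0. t i = e i" for t using that by (simp add: fun_eq_iff)
    ultimately show "P N e \<longleftrightarrow> (\<forall>t. (\<forall>i. t i \<in> tuples k (univ N)) \<and> (\<forall>i\<ge>0. t i = e i) \<longrightarrow> P N t)" by auto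
  qed
next
  case (Suc m)
  have all: "bexpr L \<N> {} k (\<lambda>N e. \<forall>y\<in>tuples k (univ N). P N (e(m := y)))"
    by (rule bexpr_all[OF Suc.prems]) simp
  show ?case
  proof (rule bexpr_cong[OF Suc.IH[OF all]])
    fix N :: "('a, 'f, 'r) struct" and e :: "nat \<Rightarrow> 'a list" assume e: "\<And>w. e w \<in> tuples k (univ N)"
    show "(\<forall>t. (\<forall>i. t i \<in> tuples k (univ N)) \<and> (\<forall>i\<ge>m. t i = e i) \<longrightarrow> (\<forall>y\<in>tuples k (univ N). P N (t(m := y)))) \<longleftrightarrow>
      (\<forall>t. (\<forall>i. t i \<in> tuples k (univ N)) \<and> (\<forall>i\<ge>Suc m. t i = e i) \<longrightarrow> P N t)" (is "?l \<longleftrightarrow> ?r")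
    proof
      assume l: ?l
      show ?r
      proof (intro allI impI)
        fix t assume t: "(\<forall>i. t i \<in> tuples k (univ N)) \<and> (\<forall>i\<ge>Suc m. t i = e i)"
        have "(t(m := e m)) i = e i" if "i \<ge> m" for i using t that by (cases "i = m") simp_all
        moreover have "(t(m := e m)) i \<in> tuples k (univ N)" for i using t e by simp
        ultimately have "\<forall>y\<in>tuples k (univ N). P N ((t(m := e m))(m := y))" using l by blast
        then have "P N ((t(m := e m))(m := t m))" using t by blast
        then show "P N t" by simp
      qed
    next
      assume r: ?r
      show ?l
      proof (intro allI impI ballI)
        fix t y assume t: "(\<forall>i. t i \<in> tuples k (univ N)) \<and> (\<forall>i\<ge>m. t i = e i)" and y: "y \<in> tuples k (univ N)"
        have "(\<forall>i. (t(m := y)) i \<in> tuples k (univ N)) \<and> (\<forall>i\<ge>Suc m. (t(m := y)) i = e i)" using t y by simp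
        then show "P N (t(m := y))" using r by blast
      qed
    qed
  qed
qed

text \<open>Properties of finitely many variables that hold throughout \<open>M\<close> hold throughout \<open>C\<close>, by elementarity of their
universal closure.\<close>

lemma transfer_universal:
  fixes L :: "('f, 'r) lang" and M C :: "('a, 'f, 'r) struct"
  assumes el: "elementary_ext L M C" and P: "bexpr L {M, C} {} k P"
    and M: "\<And>e. (\<And>i. e i \<in> tuples k (univ M)) \<Longrightarrow> P M e"
    and fin: "\<And>e e'. (\<And>i. i < m \<Longrightarrow> e i = e' i) \<Longrightarrow> P C e \<Longrightarrow> P C e'"
    and e: "\<And>i. e i \<in> tuples k (univ C)"
  shows "P C e"
proof -
  have ne: "univ M \<noteq> {}" and MC: "univ M \<subseteq> univ C" using el by (auto simp: elementary_ext_def is_struct_def)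
  obtain u where u: "u \<in> univ M" using ne by blast
  define e0 :: "nat \<Rightarrow> 'a list" where "e0 i = replicate k u" for i
  have e0: "e0 i \<in> tuples k (univ M)" for i using u by (auto simp: e0_def tuples_def)
  have e0C: "e0 i \<in> tuples k (univ C)" for i using e0[of i] MC by (auto simp: tuples_def)
  have "\<forall>t. (\<forall>i. t i \<in> tuples k (univ M)) \<and> (\<forall>i\<ge>m. t i = e0 i) \<longrightarrow> P M t" using M by blast
  then have all: "\<forall>t. (\<forall>i. t i \<in> tuples k (univ C)) \<and> (\<forall>i\<ge>m. t i = e0 i) \<longrightarrow> P C t"
    using transfer_elementary[OF el bexpr_all_upto[OF P, of m] e0] by simp
  have "P C (\<lambda>i. if i < m then e i else e0 i)" by (rule all[rule_format]) (use e e0C in auto)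
  then show ?thesis by (rule fin[rotated]) simp
qed

lemma interpretation_eq:
  fixes L :: "('f, 'r) lang" and M C :: "('a, 'f, 'r) struct"
  assumes el: "elementary_ext L M C" and \<phi>: "\<phi> \<in> formulas_in L n" and D: "realizations M n {(\<phi>, [])} = D"
  shows "interpretation_in L M C n D = realizations C n {(\<phi>, [])}"
proof
  show "realizations C n {(\<phi>, [])} \<subseteq> interpretation_in L M C n D"
    using \<phi> D unfolding interpretation_in_def by blast
  show "interpretation_in L M C n D \<subseteq> realizations C n {(\<phi>, [])}"
  proof
    fix x assume "x \<in> interpretation_in L M C n D"
    then obtain \<psi> where \<psi>: "\<psi> \<in> formulas_in L n" "realizations M n {(\<psi>, [])} = D" "x \<in> realizations C n {(\<psi>, [])}"
      by (auto simp: interpretation_in_def)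
    have x: "x \<in> tuples n (univ C)" "holds C \<psi> x" using \<psi>(3) by (auto simp: realizations_def)
    have eqM: "realizations M n {(\<psi>, [])} = realizations M n {(\<phi>, [])}" using \<psi>(2) D by simp
    have "holds C \<psi> ((\<lambda>_. x) (0::nat)) \<longrightarrow> holds C \<phi> ((\<lambda>_. x) (0::nat))"
    proof (rule transfer_universal[OF el, where P = "\<lambda>N e. holds N \<psi> (e 0) \<longrightarrow> holds N \<phi> (e 0)" and m = 1])
      show "bexpr L {M, C} {} n (\<lambda>N e. holds N \<psi> (e 0) \<longrightarrow> holds N \<phi> (e 0))"
        by (intro bexpr_imp bexpr_holds1 \<psi>(1) \<phi>)
      fix e :: "nat \<Rightarrow> 'a list" assume "\<And>i. e i \<in> tuples n (univ M)"
      then have "e 0 \<in> tuples n (univ M)" .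
      then show "holds M \<psi> (e 0) \<longrightarrow> holds M \<phi> (e 0)" using eqM by (auto simp: realizations_def)
    qed (use x(1) in auto)
    then show "x \<in> realizations C n {(\<phi>, [])}" using x by (simp add: realizations_def)
  qed
qed

locale definable_approximate_subring = monster L \<kappa> M C A
  for L :: "('f, 'r) lang" and \<kappa> :: "'k rel" and M C :: "('a, 'f, 'r) struct" and A :: "'a set" +
  fixes k :: nat and S :: "'a list ring" and X :: "'a list set"
  assumes rng_S: "rng S" and approx: "approximate_subring S X" and zero_def: "zero_definable L M k S X"
    and carrier_def: "definable L C (univ C) k (carrier (Rbar L M C k S X))"
begin

definition form :: "nat \<Rightarrow> 'a list set \<Rightarrow> ('f, 'r) fm" where
  "form n D = (SOME \<phi>. \<phi> \<in> formulas_in L n \<and> realizations M n {(\<phi>, [])} = D)"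

lemma form:
  assumes "definable L M {} n D"
  shows "form n D \<in> formulas_in L n" "realizations M n {(form n D, [])} = D"
proof -
  obtain \<phi> bs where p: "(\<phi>, bs) \<in> formulas_over L {} n" "D = realizations M n {(\<phi>, bs)}"
    using assms by (auto simp: definable_def)
  then have "\<phi> \<in> formulas_in L n \<and> realizations M n {(\<phi>, [])} = D" by (auto simp: formulas_over_def)
  then have "form n D \<in> formulas_in L n \<and> realizations M n {(form n D, [])} = D"
    unfolding form_def by (rule someI)
  then show "form n D \<in> formulas_in L n" "realizations M n {(form n D, [])} = D" by blast+
qed

definition opS :: "bool \<Rightarrow> 'a list \<Rightarrow> 'a list \<Rightarrow> 'a list" where
  "opS j = (if j then add S else mult S)"

definition st :: "('a, 'f, 'r) struct \<Rightarrow> nat \<Rightarrow> 'a list \<Rightarrow> bool" where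
  "st N n x \<longleftrightarrow> x \<in> tuples k (univ N) \<and> holds N (form k (stage S X n)) x"

text \<open>The graph of addition (\<open>j\<close> true) or multiplication (\<open>j\<close> false) on stage \<open>n\<close>, interpreted in \<open>N\<close>.\<close>

definition gr :: "('a, 'f, 'r) struct \<Rightarrow> bool \<Rightarrow> nat \<Rightarrow> 'a list \<Rightarrow> 'a list \<Rightarrow> 'a list \<Rightarrow> bool" where
  "gr N j n x y z \<longleftrightarrow> x \<in> tuples k (univ N) \<and> y \<in> tuples k (univ N) \<and> z \<in> tuples k (univ N) \<and>
    holds N (form (3 * k) (graph_on (opS j) (stage S X n))) (x @ y @ z)"

lemma def_stage: "definable L M {} k (stage S X n)"
  and def_graph: "definable L M {} (3 * k) (graph_on (opS j) (stage S X n))"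
  using zero_def by (auto simp: zero_definable_def opS_def)

lemma X: "X \<subseteq> carrier S" "\<zero>\<^bsub>S\<^esub> \<in> X" "(\<lambda>x. \<ominus>\<^bsub>S\<^esub> x) ` X = X"
  using approx by (auto simp: approximate_subring_def)

lemma stage_tuples: "stage S X n \<subseteq> tuples k (univ M)"
  using form(2)[OF def_stage[of n]] by (auto simp: realizations_def)

lemma stage_op: "x \<in> stage S X n \<Longrightarrow> y \<in> stage S X n \<Longrightarrow> opS j x y \<in> stage S X (Suc n)"
  using rng.stage_add[OF rng_S X(1,2)] rng.stage_mult[OF rng_S X(1,2)] by (simp add: opS_def del: stage.simps)

lemma st_M: "st M n x \<longleftrightarrow> x \<in> stage S X n"
proof -
  have "x \<in> stage S X n \<longleftrightarrow> x \<in> realizations M k {(form k (stage S X n), [])}"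
    using form(2)[OF def_stage[of n]] by simp
  then show ?thesis by (simp add: st_def realizations_def)
qed

lemma gr_M: "gr M j n x y z \<longleftrightarrow> x \<in> stage S X n \<and> y \<in> stage S X n \<and> z = opS j x y"
proof -
  have "x @ y @ z \<in> graph_on (opS j) (stage S X n) \<longleftrightarrow> x \<in> stage S X n \<and> y \<in> stage S X n \<and> z = opS j x y"
    if "x \<in> tuples k (univ M)" "y \<in> tuples k (univ M)"
  proof -
    have "x = x' \<and> y = y' \<and> z = opS j x' y'" if "x' \<in> stage S X n" "y' \<in> stage S X n" "x @ y @ z = x' @ y' @ opS j x' y'" for x' y'
    proof -
      have "length x = length x'" "length y = length y'"
        using that(1,2) stage_tuples[of n] \<open>x \<in> tuples k (univ M)\<close> \<open>y \<in> tuples k (univ M)\<close> by (auto simp: tuples_def)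
      then show ?thesis using that(3) by simp
    qed
    then show ?thesis unfolding graph_on_def by blast
  qed
  moreover have "x @ y @ z \<in> graph_on (opS j) (stage S X n) \<longleftrightarrow> x @ y @ z \<in> tuples (3 * k) (univ M) \<and>
    holds M (form (3 * k) (graph_on (opS j) (stage S X n))) (x @ y @ z)"
  proof -
    have "x @ y @ z \<in> graph_on (opS j) (stage S X n) \<longleftrightarrow>
      x @ y @ z \<in> realizations M (3 * k) {(form (3 * k) (graph_on (opS j) (stage S X n)), [])}"
      using form(2)[OF def_graph[of j n]] by simp
    then show ?thesis by (simp add: realizations_def)
  qed
  moreover have "opS j x y \<in> tuples k (univ M)" if "x \<in> stage S X n" "y \<in> stage S X n"
    using stage_op[OF that] stage_tuples[of "Suc n"] by (rule subsetD[rotated])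
  moreover have "x \<in> tuples k (univ M)" if "x \<in> stage S X n" for x using stage_tuples that by (rule subsetD)
  moreover have "x @ y @ z \<in> tuples (3 * k) (univ M)" if "x \<in> tuples k (univ M)" "y \<in> tuples k (univ M)" "z \<in> tuples k (univ M)"
    using that by (auto simp: tuples_def)
  ultimately show ?thesis unfolding gr_def by metis
qed

abbreviation R :: "'a list ring" where "R \<equiv> Rbar L M C k S X"

lemma carrier_R: "x \<in> carrier R \<longleftrightarrow> (\<exists>n. st C n x)"
proof -
  have "interpretation_in L M C k (stage S X n) = realizations C k {(form k (stage S X n), [])}" for n
    by (rule interpretation_eq[OF elementary form[OF def_stage]])
  then show ?thesis by (simp add: Rbar_def st_def realizations_def)
qed

definition opR :: "bool \<Rightarrow> 'a list \<Rightarrow> 'a list \<Rightarrow> 'a list" where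
  "opR j x y = (if j then x \<oplus>\<^bsub>R\<^esub> y else x \<otimes>\<^bsub>R\<^esub> y)"

lemma opR_the:
  assumes "x \<in> tuples k (univ C)" "y \<in> tuples k (univ C)"
  shows "opR j x y = (THE z. \<exists>n. gr C j n x y z)"
proof -
  have "interpretation_in L M C (3 * k) (graph_on (opS j) (stage S X n)) =
    realizations C (3 * k) {(form (3 * k) (graph_on (opS j) (stage S X n)), [])}" for n
    by (rule interpretation_eq[OF elementary form[OF def_graph]])
  then have "x @ y @ z \<in> interpretation_in L M C (3 * k) (graph_on (opS j) (stage S X n)) \<longleftrightarrow> gr C j n x y z" for n z
    using assms by (auto simp: realizations_def gr_def tuples_def)
  moreover have "opR j x y = (THE z. \<exists>n. x @ y @ z \<in> interpretation_in L M C (3 * k) (graph_on (opS j) (stage S X n)))"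
    by (simp add: opR_def opS_def Rbar_def)
  ultimately show ?thesis by simp
qed

lemma bexpr_st: "bexpr L \<N> B k (\<lambda>N e. st N n (e w))"
  by (rule bexpr_cong[OF bexpr_holds1[OF form(1)[OF def_stage[of n]]]]) (simp add: st_def)

lemma bexpr_gr: "bexpr L \<N> B k (\<lambda>N e. gr N j n (e u) (e v) (e w))"
  by (rule bexpr_cong[OF bexpr_holds3[OF form(1)[OF def_graph[of j n]]]]) (simp add: gr_def)

lemmas bexpr_intros = bexpr_imp bexpr_conj bexpr_eq bexpr_st bexpr_gr

lemmas transfer = transfer_universal[OF elementary]

lemma gr_C:
  assumes g: "gr C j n x y z" shows "st C n x" "st C n y" "st C (Suc n) z" "gr C j (Suc n) x y z"
proof -
  let ?P = "\<lambda>N (e :: nat \<Rightarrow> 'a list). gr N j n (e 0) (e 1) (e 2) \<longrightarrow>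
    st N n (e 0) \<and> st N n (e 1) \<and> st N (Suc n) (e 2) \<and> gr N j (Suc n) (e 0) (e 1) (e 2)"
  have "?P C ((\<lambda>_. z)(0 := x, 1 := y))"
  proof (rule transfer[where P = ?P and m = 3])
    show "bexpr L {M, C} {} k ?P" by (intro bexpr_intros)
    show "?P M e" for e unfolding st_M gr_M
      using stage_op rng.stage_Suc[OF rng_S X(1,2)] by (simp del: stage.simps)
    show "?P C e'" if "\<And>i. i < 3 \<Longrightarrow> e i = e' i" "?P C e" for e e' using that(2) by (simp add: that(1))
    show "((\<lambda>_. z)(0 := x, 1 := y)) i \<in> tuples k (univ C)" for i using g by (simp add: gr_def)
  qed
  then have "?P C ((\<lambda>_. z)(0 := x, 1 := y))" .
  then show "st C n x" "st C n y" "st C (Suc n) z" "gr C j (Suc n) x y z" using g by auto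
qed

lemma gr_C_unique:
  assumes g: "gr C j n x y z" "gr C j n x y z'" shows "z = z'"
proof -
  let ?P = "\<lambda>N (e :: nat \<Rightarrow> 'a list). gr N j n (e 0) (e 1) (e 2) \<and> gr N j n (e 0) (e 1) (e 3) \<longrightarrow> e 2 = e 3"
  have "?P C ((\<lambda>_. z')(0 := x, 1 := y, 2 := z))"
  proof (rule transfer[where P = ?P and m = 4])
    show "bexpr L {M, C} {} k ?P" by (intro bexpr_intros)
    show "?P M e" for e unfolding gr_M by simp
    show "?P C e'" if "\<And>i. i < 4 \<Longrightarrow> e i = e' i" "?P C e" for e e' using that(2) by (simp add: that(1))
    show "((\<lambda>_. z')(0 := x, 1 := y, 2 := z)) i \<in> tuples k (univ C)" for i using g by (simp add: gr_def)
  qed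
  then show ?thesis using g by simp
qed

lemma gr_C_exists:
  assumes s: "st C n x" "st C n y" shows "\<exists>z. gr C j n x y z"
proof -
  let ?P = "\<lambda>N (e :: nat \<Rightarrow> 'a list). st N n (e 0) \<and> st N n (e 1) \<longrightarrow> (\<exists>z\<in>tuples k (univ N). gr N j n (e 0) (e 1) z)"
  have "?P C ((\<lambda>_. y)(0 := x))"
  proof (rule transfer[where P = ?P and m = 2])
    have "bexpr L {M, C} {} k (\<lambda>N e. \<exists>z\<in>tuples k (univ N). gr N j n (e 0) (e 1) z)"
      by (rule bexpr_cong[OF bexpr_ex[OF bexpr_gr[of _ _ j n 0 1 2], where w = 2]]) simp_all
    then show "bexpr L {M, C} {} k ?P" by (intro bexpr_intros)
    show "?P M e" for e unfolding st_M gr_M using stage_op[of _ n] stage_tuples[of "Suc n"] by blast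
    show "?P C e'" if "\<And>i. i < 2 \<Longrightarrow> e i = e' i" "?P C e" for e e' using that(2) by (simp add: that(1))
    show "((\<lambda>_. y)(0 := x)) i \<in> tuples k (univ C)" for i using s by (simp add: st_def)
  qed
  then show ?thesis using s by auto
qed

text \<open>The zero is described as an idempotent for addition, so that no constant is needed.\<close>

lemma gr_C_inverse:
  assumes s: "st C n x" shows "\<exists>y u. gr C True n y x u \<and> gr C True n u u u"
proof -
  interpret S: rng S by (rule rng_S)
  let ?P = "\<lambda>N (e :: nat \<Rightarrow> 'a list). st N n (e 0) \<longrightarrow>
    (\<exists>y\<in>tuples k (univ N). \<exists>u\<in>tuples k (univ N). gr N True n y (e 0) u \<and> gr N True n u u u)"
  have "?P C (\<lambda>_. x)"
  proof (rule transfer[where P = ?P and m = 1])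
    have "bexpr L {M, C} {} k (\<lambda>N e. \<exists>u\<in>tuples k (univ N). gr N True n (e 1) (e 0) u \<and> gr N True n u u u)"
      by (rule bexpr_cong[OF bexpr_ex[OF bexpr_conj[OF bexpr_gr[of _ _ True n 1 0 2] bexpr_gr[of _ _ True n 2 2 2]], where w = 2]]) simp_all
    from bexpr_ex[OF this, where w = 1]
    have "bexpr L {M, C} {} k (\<lambda>N e. \<exists>y\<in>tuples k (univ N). \<exists>u\<in>tuples k (univ N). gr N True n y (e 0) u \<and> gr N True n u u u)"
      by simp
    then show "bexpr L {M, C} {} k ?P" by (intro bexpr_intros)
    show "?P M e" for e
    proof
      assume "st M n (e 0)"
      then have x: "e 0 \<in> stage S X n" by (simp add: st_M)
      have 1: "\<ominus>\<^bsub>S\<^esub> e 0 \<in> stage S X n" "\<zero>\<^bsub>S\<^esub> \<in> stage S X n"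
        using S.stage_minus[OF X(1,3) x] S.stage_zero[OF X(2)] by auto
      have xc: "e 0 \<in> carrier S" using x S.stage_closed[OF X(1)] by blast
      have "gr M True n (\<ominus>\<^bsub>S\<^esub> e 0) (e 0) \<zero>\<^bsub>S\<^esub> \<and> gr M True n \<zero>\<^bsub>S\<^esub> \<zero>\<^bsub>S\<^esub> \<zero>\<^bsub>S\<^esub>"
        unfolding gr_M using x 1 xc by (simp add: opS_def S.l_neg)
      then show "\<exists>y\<in>tuples k (univ M). \<exists>u\<in>tuples k (univ M). gr M True n y (e 0) u \<and> gr M True n u u u"
        using 1 stage_tuples[of n] by blast
    qed
    show "?P C e'" if "\<And>i. i < 1 \<Longrightarrow> e i = e' i" "?P C e" for e e' using that(2) by (simp add: that(1))
    show "x \<in> tuples k (univ C)" using s by (simp add: st_def)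
  qed
  then show ?thesis using s by auto
qed

lemma gr_C_assoc:
  assumes g: "gr C j n x y u" "gr C j n u z v" "gr C j n y z w" "gr C j n x w t" shows "v = t"
proof -
  interpret S: rng S by (rule rng_S)
  let ?P = "\<lambda>N (e :: nat \<Rightarrow> 'a list). gr N j n (e 0) (e 1) (e 3) \<and> gr N j n (e 3) (e 2) (e 4) \<and>
    gr N j n (e 1) (e 2) (e 5) \<and> gr N j n (e 0) (e 5) (e 6) \<longrightarrow> e 4 = e 6"
  have "?P C ((\<lambda>_. t)(0 := x, 1 := y, 2 := z, 3 := u, 4 := v, 5 := w))"
  proof (rule transfer[where P = ?P and m = 7])
    show "bexpr L {M, C} {} k ?P" by (intro bexpr_intros)
    show "?P M e" for e unfolding gr_M
      by (auto simp: opS_def intro: S.a_assoc S.rng_m_assoc subsetD[OF S.stage_closed[OF X(1), of n]])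
    show "?P C e'" if "\<And>i. i < 7 \<Longrightarrow> e i = e' i" "?P C e" for e e' using that(2) by (simp add: that(1))
    show "((\<lambda>_. t)(0 := x, 1 := y, 2 := z, 3 := u, 4 := v, 5 := w)) i \<in> tuples k (univ C)" for i using g by (simp add: gr_def)
  qed
  then show ?thesis using g by simp
qed

lemma gr_C_comm:
  assumes g: "gr C True n x y u" "gr C True n y x v" shows "u = v"
proof -
  interpret S: rng S by (rule rng_S)
  let ?P = "\<lambda>N (e :: nat \<Rightarrow> 'a list). gr N True n (e 0) (e 1) (e 2) \<and> gr N True n (e 1) (e 0) (e 3) \<longrightarrow> e 2 = e 3"
  have "?P C ((\<lambda>_. v)(0 := x, 1 := y, 2 := u))"
  proof (rule transfer[where P = ?P and m = 4])
    show "bexpr L {M, C} {} k ?P" by (intro bexpr_intros)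
    show "?P M e" for e unfolding gr_M using S.stage_closed[OF X(1), of n]
      by (auto simp: opS_def intro: S.a_comm)
    show "?P C e'" if "\<And>i. i < 4 \<Longrightarrow> e i = e' i" "?P C e" for e e' using that(2) by (simp add: that(1))
    show "((\<lambda>_. v)(0 := x, 1 := y, 2 := u)) i \<in> tuples k (univ C)" for i using g by (simp add: gr_def)
  qed
  then show ?thesis using g by simp
qed

lemma gr_C_zero:
  assumes g: "gr C True n z z z" "gr C True n z x u" shows "u = x"
proof -
  interpret S: rng S by (rule rng_S)
  let ?P = "\<lambda>N (e :: nat \<Rightarrow> 'a list). gr N True n (e 0) (e 0) (e 0) \<and> gr N True n (e 0) (e 1) (e 2) \<longrightarrow> e 2 = e 1"
  have "?P C ((\<lambda>_. u)(0 := z, 1 := x))"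
  proof (rule transfer[where P = ?P and m = 3])
    show "bexpr L {M, C} {} k ?P" by (intro bexpr_intros)
    show "?P M e" for e
    proof
      assume "gr M True n (e 0) (e 0) (e 0) \<and> gr M True n (e 0) (e 1) (e 2)"
      then have h: "e 0 \<in> carrier S" "e 1 \<in> carrier S" "e 0 = e 0 \<oplus>\<^bsub>S\<^esub> e 0" "e 2 = e 0 \<oplus>\<^bsub>S\<^esub> e 1"
        using S.stage_closed[OF X(1), of n] by (auto simp: gr_M opS_def)
      have "e 0 = \<zero>\<^bsub>S\<^esub>" using h(1,3) S.add.l_cancel_one'[of "e 0" "e 0"] by simp
      then show "e 2 = e 1" using h by simp
    qed
    show "?P C e'" if "\<And>i. i < 3 \<Longrightarrow> e i = e' i" "?P C e" for e e' using that(2) by (simp add: that(1))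
    show "((\<lambda>_. u)(0 := z, 1 := x)) i \<in> tuples k (univ C)" for i using g by (simp add: gr_def)
  qed
  then show ?thesis using g by simp
qed

lemma gr_C_distr:
  assumes g: "gr C True n x y s"
  shows "gr C False n s z p \<Longrightarrow> gr C False n x z q \<Longrightarrow> gr C False n y z r \<Longrightarrow> gr C True n q r t \<Longrightarrow> p = t"
    and "gr C False n z s p \<Longrightarrow> gr C False n z x q \<Longrightarrow> gr C False n z y r \<Longrightarrow> gr C True n q r t \<Longrightarrow> p = t"
proof -
  interpret S: rng S by (rule rng_S)
  let ?e = "(\<lambda>_. t)(0 := x, 1 := y, 2 := z, 3 := s, 4 := p, 5 := q, 6 := r)"
  let ?P = "\<lambda>N (e :: nat \<Rightarrow> 'a list). gr N True n (e 0) (e 1) (e 3) \<and> gr N False n (e 3) (e 2) (e 4) \<and>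
    gr N False n (e 0) (e 2) (e 5) \<and> gr N False n (e 1) (e 2) (e 6) \<and> gr N True n (e 5) (e 6) (e 7) \<longrightarrow> e 4 = e 7"
  let ?Q = "\<lambda>N (e :: nat \<Rightarrow> 'a list). gr N True n (e 0) (e 1) (e 3) \<and> gr N False n (e 2) (e 3) (e 4) \<and>
    gr N False n (e 2) (e 0) (e 5) \<and> gr N False n (e 2) (e 1) (e 6) \<and> gr N True n (e 5) (e 6) (e 7) \<longrightarrow> e 4 = e 7"
  show "p = t" if h: "gr C False n s z p" "gr C False n x z q" "gr C False n y z r" "gr C True n q r t"
  proof -
    have "?P C ?e"
    proof (rule transfer[where P = ?P and m = 8])
      show "bexpr L {M, C} {} k ?P" by (intro bexpr_intros)
      show "?P M e" for e unfolding gr_M using S.stage_closed[OF X(1), of n]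
        by (auto simp: opS_def intro: S.rng_l_distr)
      show "?P C e'" if "\<And>i. i < 8 \<Longrightarrow> e i = e' i" "?P C e" for e e' using that(2) by (simp add: that(1))
      show "?e i \<in> tuples k (univ C)" for i using g h by (simp add: gr_def)
    qed
    then show ?thesis using g h by simp
  qed
  show "p = t" if h: "gr C False n z s p" "gr C False n z x q" "gr C False n z y r" "gr C True n q r t"
  proof -
    have "?Q C ?e"
    proof (rule transfer[where P = ?Q and m = 8])
      show "bexpr L {M, C} {} k ?Q" by (intro bexpr_intros)
      show "?Q M e" for e unfolding gr_M using S.stage_closed[OF X(1), of n]
        by (auto simp: opS_def intro: S.rng_r_distr)
      show "?Q C e'" if "\<And>i. i < 8 \<Longrightarrow> e i = e' i" "?Q C e" for e e' using that(2) by (simp add: that(1))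
      show "?e i \<in> tuples k (univ C)" for i using g h by (simp add: gr_def)
    qed
    then show ?thesis using g h by simp
  qed
qed

lemma st_C_mono: "st C n x \<Longrightarrow> n \<le> m \<Longrightarrow> st C m x"
proof (induction m)
  case (Suc m)
  show ?case
  proof (cases "n = Suc m")
    case False
    then have s: "st C m x" using Suc by simp
    then obtain z where "gr C True m x x z" using gr_C_exists by blast
    then have "gr C True (Suc m) x x z" by (rule gr_C(4))
    then show ?thesis by (rule gr_C(1))
  qed (use Suc in simp)
qed simp

lemma gr_C_mono: "gr C j n x y z \<Longrightarrow> n \<le> m \<Longrightarrow> gr C j m x y z"
proof (induction m)
  case (Suc m)
  show ?case
  proof (cases "n = Suc m")
    case False
    then have "gr C j m x y z" using Suc by simp
    then show ?thesis by (rule gr_C(4))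
  qed (use Suc in simp)
qed simp

lemma gr_opR: assumes s: "st C n x" "st C n y" shows "gr C j n x y (opR j x y)"
proof -
  obtain z where z: "gr C j n x y z" using gr_C_exists[OF s] by blast
  have t: "x \<in> tuples k (univ C)" "y \<in> tuples k (univ C)" using s by (auto simp: st_def)
  have "(THE z. \<exists>n. gr C j n x y z) = z"
  proof (rule the_equality)
    fix z' assume "\<exists>n. gr C j n x y z'"
    then obtain m where "gr C j m x y z'" by blast
    then have "gr C j (max n m) x y z'" "gr C j (max n m) x y z" using z by (auto intro: gr_C_mono)
    then show "z' = z" by (rule gr_C_unique)
  qed (use z in blast)
  then show ?thesis using z opR_the[OF t] by simp
qed

lemma opR_eventually:
  assumes "x \<in> carrier R" "y \<in> carrier R"
  shows "\<forall>\<^sub>F n in sequentially. gr C j n x y (opR j x y)"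
proof -
  obtain n m where s: "st C n x" "st C m y" using assms carrier_R by blast
  have "gr C j i x y (opR j x y)" if "i \<ge> max n m" for i
    by (rule gr_opR) (use s that in \<open>auto intro: st_C_mono\<close>)
  then show ?thesis by (rule eventually_sequentiallyI)
qed

lemma opR_closed: assumes "x \<in> carrier R" "y \<in> carrier R" shows "opR j x y \<in> carrier R"
proof -
  obtain n where "gr C j n x y (opR j x y)"
    using eventually_happens'[OF _ opR_eventually[OF assms]] by auto
  then have "st C (Suc n) (opR j x y)" by (rule gr_C(3))
  then show ?thesis using carrier_R by blast
qed

lemma zero_R: "\<zero>\<^bsub>R\<^esub> = \<zero>\<^bsub>S\<^esub>" by (simp add: Rbar_def)

lemma gr_zero: "gr C True n \<zero>\<^bsub>R\<^esub> \<zero>\<^bsub>R\<^esub> \<zero>\<^bsub>R\<^esub>"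
proof -
  interpret S: rng S by (rule rng_S)
  have z: "\<zero>\<^bsub>S\<^esub> \<in> stage S X n" by (rule S.stage_zero[OF X(2)])
  have "gr M True n \<zero>\<^bsub>S\<^esub> \<zero>\<^bsub>S\<^esub> \<zero>\<^bsub>S\<^esub>" unfolding gr_M using z by (simp add: opS_def)
  moreover have "gr M True n \<zero>\<^bsub>S\<^esub> \<zero>\<^bsub>S\<^esub> \<zero>\<^bsub>S\<^esub> \<longleftrightarrow> gr C True n \<zero>\<^bsub>S\<^esub> \<zero>\<^bsub>S\<^esub> \<zero>\<^bsub>S\<^esub>"
    by (rule transfer_elementary[OF elementary bexpr_gr[of _ _ True n 0 0 0], where e = "\<lambda>_. \<zero>\<^bsub>S\<^esub>"])
      (use z stage_tuples[of n] in blast)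
  ultimately show ?thesis by (simp add: zero_R)
qed

lemma st_zero: "st C n \<zero>\<^bsub>R\<^esub>" by (rule gr_C(1)[OF gr_zero])

lemma zero_R_closed: "\<zero>\<^bsub>R\<^esub> \<in> carrier R" using st_zero carrier_R by blast

lemma opR_assoc:
  assumes "x \<in> carrier R" "y \<in> carrier R" "z \<in> carrier R"
  shows "opR j (opR j x y) z = opR j x (opR j y z)"
proof -
  have "\<forall>\<^sub>F n in sequentially. opR j (opR j x y) z = opR j x (opR j y z)"
    using opR_eventually[OF assms(1,2), of j] opR_eventually[OF opR_closed[OF assms(1,2), of j] assms(3), of j]
      opR_eventually[OF assms(2,3), of j] opR_eventually[OF assms(1) opR_closed[OF assms(2,3), of j], of j]
    by eventually_elim (rule gr_C_assoc)
  then show ?thesis by simp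
qed

lemma opR_comm:
  assumes "x \<in> carrier R" "y \<in> carrier R" shows "opR True x y = opR True y x"
proof -
  have "\<forall>\<^sub>F n in sequentially. opR True x y = opR True y x"
    using opR_eventually[OF assms, of True] opR_eventually[OF assms(2,1), of True]
    by eventually_elim (rule gr_C_comm)
  then show ?thesis by simp
qed

lemma opR_zero: assumes "x \<in> carrier R" shows "opR True \<zero>\<^bsub>R\<^esub> x = x"
proof -
  have "\<forall>\<^sub>F n in sequentially. opR True \<zero>\<^bsub>R\<^esub> x = x"
    using opR_eventually[OF zero_R_closed assms, of True]
    by eventually_elim (rule gr_C_zero[OF gr_zero])
  then show ?thesis by simp
qed

lemma opR_inverse: assumes x: "x \<in> carrier R" shows "\<exists>y\<in>carrier R. opR True y x = \<zero>\<^bsub>R\<^esub>"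
proof -
  obtain n where "st C n x" using x carrier_R by blast
  then obtain y u where g: "gr C True n y x u" "gr C True n u u u" using gr_C_inverse by blast
  have s: "st C n y" "st C n x" "st C n u" using gr_C(1,2)[OF g(1)] gr_C(1)[OF g(2)] by auto
  have "u = opR True y x" by (rule gr_C_unique[OF g(1) gr_opR[OF s(1,2)]])
  moreover have "u = \<zero>\<^bsub>R\<^esub>"
  proof -
    have "opR True u \<zero>\<^bsub>R\<^esub> = \<zero>\<^bsub>R\<^esub>" by (rule gr_C_zero[OF g(2) gr_opR[OF s(3) st_zero]])
    moreover have "opR True \<zero>\<^bsub>R\<^esub> u = u" by (rule gr_C_zero[OF gr_zero gr_opR[OF st_zero s(3)]])
    moreover have "opR True u \<zero>\<^bsub>R\<^esub> = opR True \<zero>\<^bsub>R\<^esub> u"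
      by (rule gr_C_comm[OF gr_opR[OF s(3) st_zero] gr_opR[OF st_zero s(3)]])
    ultimately show ?thesis by simp
  qed
  ultimately show ?thesis using s(1) carrier_R by blast
qed

lemma opR_distr:
  assumes "x \<in> carrier R" "y \<in> carrier R" "z \<in> carrier R"
  shows "opR False (opR True x y) z = opR True (opR False x z) (opR False y z)"
    "opR False z (opR True x y) = opR True (opR False z x) (opR False z y)"
proof -
  note ev = opR_eventually and cl = opR_closed
  have "\<forall>\<^sub>F n in sequentially. opR False (opR True x y) z = opR True (opR False x z) (opR False y z)"
    using ev[OF assms(1,2), of True] ev[OF cl[OF assms(1,2), of True] assms(3), of False]
      ev[OF assms(1,3), of False] ev[OF assms(2,3), of False]
      ev[OF cl[OF assms(1,3), of False] cl[OF assms(2,3), of False], of True]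
    by eventually_elim (rule gr_C_distr(1))
  then show "opR False (opR True x y) z = opR True (opR False x z) (opR False y z)" by simp
  have "\<forall>\<^sub>F n in sequentially. opR False z (opR True x y) = opR True (opR False z x) (opR False z y)"
    using ev[OF assms(1,2), of True] ev[OF assms(3) cl[OF assms(1,2), of True], of False]
      ev[OF assms(3,1), of False] ev[OF assms(3,2), of False]
      ev[OF cl[OF assms(3,1), of False] cl[OF assms(3,2), of False], of True]
    by eventually_elim (rule gr_C_distr(2))
  then show "opR False z (opR True x y) = opR True (opR False z x) (opR False z y)" by simp
qed

lemma add_opR: "x \<oplus>\<^bsub>R\<^esub> y = opR True x y" and mult_opR: "x \<otimes>\<^bsub>R\<^esub> y = opR False x y"
  by (simp_all add: opR_def)

lemma rng_R: "rng R"
proof (rule rng.intro)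
  show "abelian_group R"
  proof (rule abelian_groupI, unfold add_opR)
    fix x assume "x \<in> carrier R"
    then show "\<exists>y\<in>carrier R. opR True y x = \<zero>\<^bsub>R\<^esub>" by (rule opR_inverse)
  next
    fix x y assume a: "x \<in> carrier R" "y \<in> carrier R"
    show "opR True x y \<in> carrier R" by (rule opR_closed[OF a])
    show "opR True x y = opR True y x" by (rule opR_comm[OF a])
  next
    fix x y z assume a: "x \<in> carrier R" "y \<in> carrier R" "z \<in> carrier R"
    show "opR True (opR True x y) z = opR True x (opR True y z)" by (rule opR_assoc[OF a])
  next
    fix x assume "x \<in> carrier R"
    then show "opR True \<zero>\<^bsub>R\<^esub> x = x" by (rule opR_zero)
  qed (rule zero_R_closed)
  show "rng_axioms R"
  proof (rule rng_axioms.intro, unfold add_opR mult_opR)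
    fix x y assume "x \<in> carrier R" "y \<in> carrier R"
    then show "opR False x y \<in> carrier R" by (rule opR_closed)
  next
    fix x y z assume a: "x \<in> carrier R" "y \<in> carrier R" "z \<in> carrier R"
    show "opR False (opR False x y) z = opR False x (opR False y z)" by (rule opR_assoc[OF a])
    show "opR False (opR True x y) z = opR True (opR False x z) (opR False y z)"
      "opR False z (opR True x y) = opR True (opR False z x) (opR False z y)" by (rule opR_distr[OF a])+
  qed
qed

lemma bexpr_carrier_params: "bexpr L {C} (univ C) k (\<lambda>N e. e w \<in> carrier R)"
  by (rule bexpr_definable[OF carrier_def])

lemma carrier_tuples: "carrier R \<subseteq> tuples k (univ C)"
  by (rule definable_sub[OF carrier_def])

text \<open>Otherwise the definable sets \<open>R - X\<^sub>n\<close> are nonempty and decreasing, and saturation gives a common element.\<close>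

lemma carrier_stage: "\<exists>m. \<forall>x. x \<in> carrier R \<longleftrightarrow> st C m x"
proof (rule ccontr)
  assume no: "\<nexists>m. \<forall>x. x \<in> carrier R \<longleftrightarrow> st C m x"
  have "\<exists>x\<in>tuples k (univ C). \<forall>n\<in>UNIV. x \<in> {x\<in>carrier R. \<not> st C n x}"
  proof (rule saturated_family[OF small_nat])
    fix n :: nat
    have e: "bexpr L {C} (univ C) k (\<lambda>N e. e 0 \<in> {x\<in>carrier R. \<not> st C n x})"
    proof (rule bexpr_cong[OF bexpr_conj[OF bexpr_carrier_params[of 0] bexpr_not[OF bexpr_st[of _ _ n 0]]]])
      fix N :: "('a, 'f, 'r) struct" and e :: "nat \<Rightarrow> 'a list" assume "N \<in> {C}"
      then have N: "N = C" by simp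
      show "e 0 \<in> carrier R \<and> \<not> st N n (e 0) \<longleftrightarrow> e 0 \<in> {x\<in>carrier R. \<not> st C n x}" unfolding N by simp
    qed
    have "{x\<in>carrier R. \<not> st C n x} \<subseteq> carrier R" by (rule Collect_restrict)
    then have "{x\<in>carrier R. \<not> st C n x} \<subseteq> tuples k (univ C)" using carrier_tuples by (rule subset_trans)
    then show "definable L C (univ C) k {x\<in>carrier R. \<not> st C n x}"
      by (rule definable_bexpr[OF e _ subset_refl univ_ne])
  next
    fix J :: "nat set" assume J: "finite J" "J \<subseteq> UNIV"
    define b where "b = Max (insert 0 J)"
    have b: "i \<le> b" if "i \<in> J" for i unfolding b_def using J(1) that by (intro Max_ge) simp_all
    have "\<exists>x. \<not> (x \<in> carrier R \<longleftrightarrow> st C b x)" using no by simp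
    then obtain x where "\<not> (x \<in> carrier R \<longleftrightarrow> st C b x)" by (elim exE)
    moreover have "st C b x \<Longrightarrow> x \<in> carrier R" unfolding carrier_R by (rule exI)
    ultimately have x: "x \<in> carrier R" "\<not> st C b x" by argo+
    have "\<not> st C i x" if "i \<in> J" for i
    proof
      assume "st C i x"
      then have "st C b x" using b[OF that] by (rule st_C_mono)
      with x(2) show False by (rule notE)
    qed
    then have "\<forall>i\<in>J. x \<in> {x\<in>carrier R. \<not> st C i x}" using x(1) by simp
    then show "\<exists>x\<in>tuples k (univ C). \<forall>i\<in>J. x \<in> {x\<in>carrier R. \<not> st C i x}"
      by (rule bexI) (rule subsetD[OF carrier_tuples x(1)])
  qed
  then obtain x where x: "\<forall>n\<in>UNIV. x \<in> {x\<in>carrier R. \<not> st C n x}" by (elim bexE)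
  have "x \<in> carrier R" "\<not> st C n x" for n using bspec[OF x UNIV_I, of n] by simp_all
  then show False unfolding carrier_R by simp
qed

end

section \<open>Passage to the abstract setting\<close>

lemma two_sided_ideal_iff:
  "two_sided_ideal I R \<longleftrightarrow> additive_subgroup I R \<and>
    (\<forall>r\<in>carrier R. \<forall>x\<in>I. r \<otimes>\<^bsub>R\<^esub> x \<in> I) \<and> (\<forall>r\<in>carrier R. \<forall>x\<in>I. x \<otimes>\<^bsub>R\<^esub> r \<in> I)"
  unfolding two_sided_ideal_def set_mult_def by blast

lemma set_add_set_mult:
  "G <+>\<^bsub>R\<^esub> (K <#>\<^bsub>R\<^esub> G) = {h \<oplus>\<^bsub>R\<^esub> r \<otimes>\<^bsub>R\<^esub> h' | h h' r. h \<in> G \<and> h' \<in> G \<and> r \<in> K}"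
  unfolding set_add_def' set_mult_def by blast

context definable_approximate_subring
begin

definition level :: nat where "level = (SOME m. \<forall>x. x \<in> carrier R \<longleftrightarrow> st C m x)"

lemma level: "x \<in> carrier R \<longleftrightarrow> st C level x"
proof -
  have "\<forall>x. x \<in> carrier R \<longleftrightarrow> st C level x" unfolding level_def by (rule someI_ex[OF carrier_stage])
  then show ?thesis by (rule spec)
qed

lemma bexpr_carrier: "bexpr L {C} B k (\<lambda>N e. e w \<in> carrier R)"
proof (rule bexpr_cong[OF bexpr_st[of _ _ level w]])
  fix N :: "('a, 'f, 'r) struct" and e :: "nat \<Rightarrow> 'a list" assume "N \<in> {C}"
  then have N: "N = C" by simp
  show "st N level (e w) \<longleftrightarrow> e w \<in> carrier R" unfolding N by (rule level[symmetric])
qed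

lemma gr_level:
  assumes "x \<in> carrier R" "y \<in> carrier R" shows "gr C j level x y z \<longleftrightarrow> opR j x y = z"
proof -
  have g: "gr C j level x y (opR j x y)" by (rule gr_opR[OF assms[unfolded level]])
  show ?thesis
  proof
    assume "gr C j level x y z"
    with g show "opR j x y = z" by (rule gr_C_unique)
  next
    assume "opR j x y = z"
    with g show "gr C j level x y z" by (rule subst[rotated])
  qed
qed

text \<open>The predicate \<open>P\<close> is evaluated only at tuples in the ring, so quantifiers over the ring can be relativized.\<close>

definition foR :: "'a set \<Rightarrow> ((nat \<Rightarrow> 'a list) \<Rightarrow> bool) \<Rightarrow> bool" where
  "foR B Q \<longleftrightarrow> (\<exists>P. bexpr L {C} B k P \<and> (\<forall>e. (\<forall>i. e i \<in> carrier R) \<longrightarrow> (P C e \<longleftrightarrow> Q e)))"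

lemma foRI:
  assumes "bexpr L {C} B k P" "\<And>e. (\<And>i. e i \<in> carrier R) \<Longrightarrow> P C e \<longleftrightarrow> Q e" shows "foR B Q"
  unfolding foR_def
proof (intro exI[of _ P] conjI allI impI)
  fix e :: "nat \<Rightarrow> 'a list" assume "\<forall>i. e i \<in> carrier R"
  then show "P C e \<longleftrightarrow> Q e" by (intro assms(2)) (rule spec)
qed (rule assms(1))

lemma foR_opR: "foR B (\<lambda>e. opR j (e u) (e v) = e w)"
  by (rule foRI[OF bexpr_gr[of _ _ j level u v w]]) (rule gr_level)

lemma definability_foR:
  assumes B: "B \<subseteq> univ C" shows "definability R (foR B)"
proof (rule definability.intro[OF rng_R], rule definability_axioms.intro)
  fix P Q :: "(nat \<Rightarrow> 'a list) \<Rightarrow> bool"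
  assume P: "foR B P" and eq: "\<And>e. (\<And>i. e i \<in> carrier R) \<Longrightarrow> P e \<longleftrightarrow> Q e"
  obtain P' where P'0: "bexpr L {C} B k P'" "\<forall>e. (\<forall>i. e i \<in> carrier R) \<longrightarrow> (P' C e \<longleftrightarrow> P e)"
    using P unfolding foR_def by (elim exE conjE)
  have P': "bexpr L {C} B k P'" "\<And>e. (\<And>i. e i \<in> carrier R) \<Longrightarrow> P' C e \<longleftrightarrow> P e"
    by (rule P'0(1)) (use P'0(2) in simp)
  show "foR B Q"
  proof (rule foRI[OF P'(1)])
    fix e :: "nat \<Rightarrow> 'a list" assume e: "\<And>i. e i \<in> carrier R"
    show "P' C e \<longleftrightarrow> Q e" using P'(2)[OF e] eq[OF e] by simp
  qed
next
  fix P :: "(nat \<Rightarrow> 'a list) \<Rightarrow> bool" assume P: "foR B P"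
  obtain P' where P'0: "bexpr L {C} B k P'" "\<forall>e. (\<forall>i. e i \<in> carrier R) \<longrightarrow> (P' C e \<longleftrightarrow> P e)"
    using P unfolding foR_def by (elim exE conjE)
  have P': "bexpr L {C} B k P'" "\<And>e. (\<And>i. e i \<in> carrier R) \<Longrightarrow> P' C e \<longleftrightarrow> P e"
    by (rule P'0(1)) (use P'0(2) in simp)
  show "foR B (\<lambda>e. \<not> P e)"
  proof (rule foRI[OF bexpr_not[OF P'(1)]])
    fix e :: "nat \<Rightarrow> 'a list" assume e: "\<And>i. e i \<in> carrier R"
    show "(\<not> P' C e) \<longleftrightarrow> (\<not> P e)" using P'(2)[OF e] by simp
  qed
  show "foR B (\<lambda>e. P (\<lambda>i. e (h i)))" for h :: "nat \<Rightarrow> nat"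
  proof (rule foRI[OF bexpr_subst[OF P'(1), of h]])
    fix e :: "nat \<Rightarrow> 'a list" assume e: "\<And>i. e i \<in> carrier R"
    show "P' C (\<lambda>i. e (h i)) \<longleftrightarrow> P (\<lambda>i. e (h i))" by (rule P'(2)) (rule e)
  qed
  show "foR B (\<lambda>e. \<exists>y\<in>carrier R. P (case_nat y e))"
  proof -
    have 1: "bexpr L {C} B k (\<lambda>N e. \<exists>y\<in>tuples k (univ N). (e(0 := y)) 0 \<in> carrier R \<and> P' N (e(0 := y)))"
      by (rule bexpr_ex[OF bexpr_conj[OF bexpr_carrier[of B 0] P'(1)], where w = 0]) (use B in simp)
    show ?thesis
    proof (rule foRI[OF bexpr_subst[OF 1, of "\<lambda>i. i - 1"]])
      fix e :: "nat \<Rightarrow> 'a list" assume e: "\<And>i. e i \<in> carrier R"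
      have c: "(\<lambda>i. e (i - 1))(0 := y) = case_nat y e" for y by (auto simp: fun_eq_iff split: nat.split)
      have "P' C (case_nat y e) \<longleftrightarrow> P (case_nat y e)" if "y \<in> carrier R" for y
        by (rule P'(2)) (use e that in \<open>simp split: nat.split\<close>)
      moreover have "y \<in> tuples k (univ C)" if "y \<in> carrier R" for y using carrier_tuples that by (rule subsetD)
      ultimately show "(\<exists>y\<in>tuples k (univ C). ((\<lambda>i. e (i - 1))(0 := y)) 0 \<in> carrier R \<and> P' C ((\<lambda>i. e (i - 1))(0 := y))) \<longleftrightarrow>
        (\<exists>y\<in>carrier R. P (case_nat y e))" unfolding c by auto
    qed
  qed
next
  fix P Q :: "(nat \<Rightarrow> 'a list) \<Rightarrow> bool" assume P: "foR B P" and Q: "foR B Q"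
  obtain P' where P'0: "bexpr L {C} B k P'" "\<forall>e. (\<forall>i. e i \<in> carrier R) \<longrightarrow> (P' C e \<longleftrightarrow> P e)"
    using P unfolding foR_def by (elim exE conjE)
  have P': "bexpr L {C} B k P'" "\<And>e. (\<And>i. e i \<in> carrier R) \<Longrightarrow> P' C e \<longleftrightarrow> P e"
    by (rule P'0(1)) (use P'0(2) in simp)
  obtain Q' where Q'0: "bexpr L {C} B k Q'" "\<forall>e. (\<forall>i. e i \<in> carrier R) \<longrightarrow> (Q' C e \<longleftrightarrow> Q e)"
    using Q unfolding foR_def by (elim exE conjE)
  have Q': "bexpr L {C} B k Q'" "\<And>e. (\<And>i. e i \<in> carrier R) \<Longrightarrow> Q' C e \<longleftrightarrow> Q e"
    by (rule Q'0(1)) (use Q'0(2) in simp)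
  show "foR B (\<lambda>e. P e \<and> Q e)"
  proof (rule foRI[OF bexpr_conj[OF P'(1) Q'(1)]])
    fix e :: "nat \<Rightarrow> 'a list" assume e: "\<And>i. e i \<in> carrier R"
    show "(P' C e \<and> Q' C e) \<longleftrightarrow> (P e \<and> Q e)" using P'(2)[OF e] Q'(2)[OF e] by simp
  qed
next
  show "foR B (\<lambda>e. e i = e j)" for i j :: nat by (rule foRI[OF bexpr_eq[of _ _ _ _ i j]]) (rule refl)
  show "foR B (\<lambda>e. e i \<oplus>\<^bsub>R\<^esub> e j = e l)" "foR B (\<lambda>e. e i \<otimes>\<^bsub>R\<^esub> e j = e l)" for i j l :: nat
    unfolding add_opR mult_opR by (rule foR_opR)+
qed

lemma dset_foR:
  assumes B: "B \<subseteq> univ C"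
  shows "definability.dset R (foR B) D \<longleftrightarrow> D \<subseteq> carrier R \<and> definable L C B k D"
  unfolding definability.dset_def[OF definability_foR[OF B]]
proof (intro conj_cong refl iffI)
  assume D: "D \<subseteq> carrier R" and fo: "foR B (\<lambda>e. e 0 \<in> D)"
  obtain P where P0: "bexpr L {C} B k P" "\<forall>e. (\<forall>i. e i \<in> carrier R) \<longrightarrow> (P C e \<longleftrightarrow> e 0 \<in> D)"
    using fo unfolding foR_def by (elim exE conjE)
  have P: "bexpr L {C} B k P" "\<And>e. (\<And>i. e i \<in> carrier R) \<Longrightarrow> P C e \<longleftrightarrow> e 0 \<in> D"
    by (rule P0(1)) (use P0(2) in simp)
  have "bexpr L {C} B k (\<lambda>N e. e 0 \<in> D)"
  proof (rule bexpr_cong[OF bexpr_conj[OF bexpr_carrier[of B 0] bexpr_subst[OF P(1), of "\<lambda>_. 0"]]])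
    fix N :: "('a, 'f, 'r) struct" and e :: "nat \<Rightarrow> 'a list" assume "N \<in> {C}"
    then have N: "N = C" by simp
    have "P C (\<lambda>_. e 0) \<longleftrightarrow> e 0 \<in> D" if "e 0 \<in> carrier R" by (rule P(2)) (rule that)
    then show "e 0 \<in> carrier R \<and> P N (\<lambda>_. e 0) \<longleftrightarrow> e 0 \<in> D" unfolding N using D by blast
  qed
  then show "definable L C B k D"
    by (rule definable_bexpr[OF _ subset_trans[OF D carrier_tuples] B univ_ne])
next
  assume "definable L C B k D"
  from bexpr_definable[OF this, of 0] show "foR B (\<lambda>e. e 0 \<in> D)" by (rule foRI) (rule refl)
qed

text \<open>The action of an automorphism on the ring, extended by the identity to a bijection of the whole type.\<close>

definition ext :: "('a \<Rightarrow> 'a) \<Rightarrow> 'a list \<Rightarrow> 'a list" where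
  "ext \<sigma> x = (if x \<in> carrier R then map \<sigma> x else x)"

definition Gal :: "('a \<Rightarrow> 'a) set" where
  "Gal = {\<sigma>. automorphism L C \<sigma> \<and> (\<forall>a\<in>A. \<sigma> a = a)}"

lemma carrier_A: "definable L C A k (carrier R)"
  by (rule definable_bexpr[OF bexpr_carrier carrier_tuples A_univ univ_ne])

lemma GalD: "\<sigma> \<in> Gal \<Longrightarrow> automorphism L C \<sigma>" "\<sigma> \<in> Gal \<Longrightarrow> a \<in> A \<Longrightarrow> \<sigma> a = a"
  by (simp_all add: Gal_def)

lemma Gal_definable: assumes s: "\<sigma> \<in> Gal" and D: "definable L C A k D" shows "map \<sigma> ` D = D"
  by (rule definable_image(2)[OF struct GalD(1)[OF s] A_univ D]) (rule GalD(2)[OF s])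

lemma Gal_carrier: assumes "\<sigma> \<in> Gal" shows "map \<sigma> ` carrier R = carrier R"
  by (rule Gal_definable[OF assms carrier_A])

lemma Gal_closed: assumes "\<sigma> \<in> Gal" "x \<in> carrier R" shows "map \<sigma> x \<in> carrier R"
  using imageI[OF assms(2), of "map \<sigma>"] unfolding Gal_carrier[OF assms(1)] .

lemma ext_image: assumes "D \<subseteq> carrier R" shows "ext \<sigma> ` D = map \<sigma> ` D"
proof (rule image_cong[OF refl])
  fix x assume "x \<in> D"
  then have "x \<in> carrier R" using assms by (rule subsetD[rotated])
  then show "ext \<sigma> x = map \<sigma> x" by (simp add: ext_def)
qed

lemma ext_comp: assumes "\<sigma> \<in> Gal" "\<tau> \<in> Gal" shows "ext \<sigma> \<circ> ext \<tau> = ext (\<sigma> \<circ> \<tau>)"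
  by (rule HOL.ext) (simp add: ext_def Gal_closed[OF assms(2)])

lemma Gal_comp: "\<sigma> \<in> Gal \<Longrightarrow> \<tau> \<in> Gal \<Longrightarrow> \<sigma> \<circ> \<tau> \<in> Gal"
  by (simp add: Gal_def automorphism_comp)

lemma Gal_inverse:
  assumes s: "\<sigma> \<in> Gal" obtains \<tau> where "\<tau> \<in> Gal" "ext \<tau> \<circ> ext \<sigma> = id" "ext \<sigma> \<circ> ext \<tau> = id"
proof -
  obtain \<tau> where t: "automorphism L C \<tau>" "\<And>x. x \<in> univ C \<Longrightarrow> \<tau> (\<sigma> x) = x" "\<And>x. x \<in> univ C \<Longrightarrow> \<sigma> (\<tau> x) = x"
    using automorphism_inv[OF struct GalD(1)[OF s]] by metis
  have "\<tau> a = a" if "a \<in> A" for a using t(2)[OF subsetD[OF A_univ that]] GalD(2)[OF s that] by simp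
  then have tG: "\<tau> \<in> Gal" using t(1) by (simp add: Gal_def)
  have u: "set x \<subseteq> univ C" if "x \<in> carrier R" for x using subsetD[OF carrier_tuples that] by (simp add: tuples_def)
  have 1: "ext (\<tau> \<circ> \<sigma>) x = id x" "ext (\<sigma> \<circ> \<tau>) x = id x" for x
  proof -
    have "\<tau> (\<sigma> a) = a" "\<sigma> (\<tau> a) = a" if "x \<in> carrier R" "a \<in> set x" for a
      using t(2,3)[OF subsetD[OF u[OF that(1)] that(2)]] by blast+
    then show "ext (\<tau> \<circ> \<sigma>) x = id x" "ext (\<sigma> \<circ> \<tau>) x = id x" by (auto simp: ext_def intro!: map_idI)
  qed
  show ?thesis by (rule that[OF tG]) (simp_all only: ext_comp[OF tG s] ext_comp[OF s tG] 1 fun_eq_iff simp_thms)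
qed

lemma Gal_opR:
  assumes s: "\<sigma> \<in> Gal" and x: "x \<in> carrier R" "y \<in> carrier R"
  shows "map \<sigma> (opR j x y) = opR j (map \<sigma> x) (map \<sigma> y)"
proof -
  let ?f = "form (3 * k) (graph_on (opS j) (stage S X level))" and ?z = "opR j x y"
  have g: "gr C j level x y ?z" using gr_level[OF x] by simp
  then have l: "x \<in> tuples k (univ C)" "y \<in> tuples k (univ C)" "?z \<in> tuples k (univ C)" "holds C ?f (x @ y @ ?z)"
    unfolding gr_def by blast+
  have l': "length x = k" "length y = k" "length ?z = k" "set x \<subseteq> univ C" "set y \<subseteq> univ C" "set ?z \<subseteq> univ C"
    using l(1-3) by (simp_all add: tuples_def)
  have len: "length (x @ y @ ?z) = 3 * k" using l' by simp
  have "holds C ?f (map \<sigma> (x @ y @ ?z)) \<longleftrightarrow> holds C ?f (x @ y @ ?z)"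
  proof (rule holds_automorphism[OF struct GalD(1)[OF s]])
    show "?f \<in> formulas_in L (length (x @ y @ ?z))" unfolding len by (rule form(1)[OF def_graph])
    show "set (x @ y @ ?z) \<subseteq> univ C" using l' by simp
  qed
  then have "holds C ?f (map \<sigma> x @ map \<sigma> y @ map \<sigma> ?z)" using l(4) by simp
  then have "gr C j level (map \<sigma> x) (map \<sigma> y) (map \<sigma> ?z)"
    unfolding gr_def using map_tuples[OF GalD(1)[OF s]] l(1-3) by blast
  then show ?thesis using gr_level[OF Gal_closed[OF s x(1)] Gal_closed[OF s x(2)]] by simp
qed

lemma definable_ring_R: "definable_ring R (foR (univ C)) (foR A) \<kappa> (ext ` Gal)"
proof (rule definable_ring.intro[OF definability_foR[OF subset_refl] definability_foR[OF A_univ]],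
    rule definable_ring_axioms.intro, unfold dset_foR[OF subset_refl] dset_foR[OF A_univ])
  show "strong_limit \<kappa>" by (rule strong_limit)
  show "|UNIV :: nat set| <o \<kappa>" by (rule small_nat)
  show "foR (univ C) P" if foA: "foR A P" for P
  proof -
    obtain P' where P'0: "bexpr L {C} A k P'" "\<forall>e. (\<forall>i. e i \<in> carrier R) \<longrightarrow> (P' C e \<longleftrightarrow> P e)"
    using foA unfolding foR_def by (elim exE conjE)
  have P': "bexpr L {C} A k P'" "\<And>e. (\<And>i. e i \<in> carrier R) \<Longrightarrow> P' C e \<longleftrightarrow> P e"
    by (rule P'0(1)) (use P'0(2) in simp)
    show ?thesis by (rule foRI[OF bexpr_mono[OF P'(1) A_univ subset_refl]]) (rule P'(2))
  qed
  show "foR (univ C) (\<lambda>e. e i = x)" if "x \<in> carrier R" for x and i :: nat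
    by (rule foRI[OF bexpr_const[OF subsetD[OF carrier_tuples that], of _ _ i]]) (rule refl)
  show "|{D. D \<subseteq> carrier R \<and> definable L C A k D}| <o \<kappa>"
    by (rule small_subset[OF few_definable[OF small_A, of k]]) blast
  show "id \<in> ext ` Gal"
  proof (rule image_eqI)
    show "id = ext id" by (rule HOL.ext) (simp add: ext_def)
    show "id \<in> Gal" by (simp add: Gal_def automorphism_id)
  qed
next
  fix \<S> :: "'a list set set"
  assume small: "|\<S>| <o \<kappa>" and D: "\<And>S. S \<in> \<S> \<Longrightarrow> S \<subseteq> carrier R \<and> definable L C (univ C) k S"
    and fin: "\<And>F. finite F \<Longrightarrow> F \<subseteq> \<S> \<Longrightarrow> carrier R \<inter> \<Inter>F \<noteq> {}"
  show "carrier R \<inter> \<Inter>\<S> \<noteq> {}"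
  proof (cases "\<S> = {}")
    case True
    then show ?thesis using fin[of "{}"] by simp
  next
    case False
    then obtain S0 where S0: "S0 \<in> \<S>" by blast
    have "\<exists>x\<in>tuples k (univ C). \<forall>S\<in>\<S>. x \<in> S"
    proof (rule saturated_family[OF small])
      show "definable L C (univ C) k S" if "S \<in> \<S>" for S using D[OF that] by (rule conjunct2)
      fix J assume "finite J" "J \<subseteq> \<S>"
      from fin[OF this] obtain x where x: "x \<in> carrier R" "\<forall>S\<in>J. x \<in> S" by blast
      show "\<exists>x\<in>tuples k (univ C). \<forall>S\<in>J. x \<in> S" using x(2) subsetD[OF carrier_tuples x(1)] by (rule bexI)
    qed
    then obtain x where x: "\<forall>S\<in>\<S>. x \<in> S" by (elim bexE)
    have "x \<in> carrier R" using D[OF S0] x S0 by blast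
    then show ?thesis using x by blast
  qed
next
  fix \<sigma> assume "\<sigma> \<in> ext ` Gal"
  then obtain s where s: "\<sigma> = ext s" "s \<in> Gal" by (rule imageE)
  obtain t where t: "t \<in> Gal" "ext t \<circ> ext s = id" "ext s \<circ> ext t = id" using Gal_inverse[OF s(2)] .
  show "bij \<sigma>" unfolding s(1) by (rule o_bij[OF t(2,3)])
  have "inv_into UNIV \<sigma> = ext t" unfolding s(1) by (rule inv_unique_comp[OF t(3,2)])
  then show "inv_into UNIV \<sigma> \<in> ext ` Gal" using t(1) by simp
  show "\<sigma> ` carrier R = carrier R" unfolding s(1) ext_image[OF subset_refl] by (rule Gal_carrier[OF s(2)])
  have op: "\<sigma> (opR j x y) = opR j (\<sigma> x) (\<sigma> y)" if "x \<in> carrier R" "y \<in> carrier R" for j x y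
    using Gal_opR[OF s(2) that] opR_closed[OF that] that by (simp add: s(1) ext_def)
  show "\<sigma> (x \<oplus>\<^bsub>R\<^esub> y) = \<sigma> x \<oplus>\<^bsub>R\<^esub> \<sigma> y" "\<sigma> (x \<otimes>\<^bsub>R\<^esub> y) = \<sigma> x \<otimes>\<^bsub>R\<^esub> \<sigma> y"
    if "x \<in> carrier R" "y \<in> carrier R" for x y unfolding add_opR mult_opR by (rule op[OF that])+
  show "\<sigma> ` D \<subseteq> carrier R \<and> definable L C (univ C) k (\<sigma> ` D)"
    if D: "D \<subseteq> carrier R \<and> definable L C (univ C) k D" for D
  proof
    have i: "\<sigma> ` D = map s ` D" unfolding s(1) by (rule ext_image[OF conjunct1[OF D]])
    show "\<sigma> ` D \<subseteq> carrier R" unfolding i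
      by (rule subset_trans[OF image_mono[OF conjunct1[OF D]]]) (simp only: Gal_carrier[OF s(2)] subset_refl)
    show "definable L C (univ C) k (\<sigma> ` D)" unfolding i
      using definable_image(1)[OF struct GalD(1)[OF s(2)] subset_refl conjunct2[OF D]]
      unfolding automorphism_univ[OF GalD(1)[OF s(2)]] .
  qed
  show "\<sigma> ` D = D" if D: "D \<subseteq> carrier R \<and> definable L C A k D" for D
    unfolding s(1) ext_image[OF conjunct1[OF D]] by (rule Gal_definable[OF s(2) conjunct2[OF D]])
next
  fix \<sigma> \<tau> assume "\<sigma> \<in> ext ` Gal" "\<tau> \<in> ext ` Gal"
  then obtain s t where s: "\<sigma> = ext s" "s \<in> Gal" "\<tau> = ext t" "t \<in> Gal" by (elim imageE)
  show "\<sigma> \<circ> \<tau> \<in> ext ` Gal" unfolding s(1,3) ext_comp[OF s(2,4)] by (rule imageI[OF Gal_comp[OF s(2,4)]])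
next
  fix x y assume x: "x \<in> carrier R" and y: "y \<in> carrier R"
    and type: "\<And>D. D \<subseteq> carrier R \<and> definable L C A k D \<Longrightarrow> x \<in> D \<longleftrightarrow> y \<in> D"
  have "x \<in> D \<longleftrightarrow> y \<in> D" if D: "definable L C A k D" for D
  proof -
    have "bexpr L {C} A k (\<lambda>N e. e 0 \<in> carrier R \<inter> D)"
      by (rule bexpr_cong[OF bexpr_conj[OF bexpr_carrier[of A 0] bexpr_definable[OF D, of 0]]]) (rule Int_iff[symmetric])
    then have "definable L C A k (carrier R \<inter> D)"
      by (rule definable_bexpr[OF _ subset_trans[OF Int_lower1 carrier_tuples] A_univ univ_ne])
    then show ?thesis using type[of "carrier R \<inter> D"] x y by simp
  qed
  then obtain s where s: "automorphism L C s" "\<And>a. a \<in> A \<Longrightarrow> s a = a" "map s x = y"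
    using automorphism_of_type[OF subsetD[OF carrier_tuples x] subsetD[OF carrier_tuples y]] by metis
  show "\<exists>\<sigma>\<in>ext ` Gal. \<sigma> x = y"
  proof (rule bexI)
    show "ext s x = y" using x s(3) by (simp add: ext_def)
    show "ext s \<in> ext ` Gal" using s(1,2) by (intro imageI) (simp add: Gal_def)
  qed
next
  fix \<C> :: "('a list set \<times> 'a list set) set"
  assume small: "|\<C>| <o \<kappa>"
    and D: "\<And>D E. (D, E) \<in> \<C> \<Longrightarrow> (D \<subseteq> carrier R \<and> definable L C (univ C) k D) \<and> E \<subseteq> carrier R \<and> definable L C (univ C) k E"
    and fin: "\<And>F. finite F \<Longrightarrow> F \<subseteq> \<C> \<Longrightarrow> \<exists>\<sigma>\<in>ext ` Gal. \<forall>(D, E)\<in>F. \<not> \<sigma> ` D \<subseteq> E"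
  have im: "ext s ` D = map s ` D" if "(D, E) \<in> \<C>" for s D E
    by (rule ext_image) (rule conjunct1[OF conjunct1[OF D[OF that]]])
  have "\<exists>\<sigma>. automorphism L C \<sigma> \<and> (\<forall>a\<in>A. \<sigma> a = a) \<and> (\<forall>(D, E)\<in>\<C>. \<not> map \<sigma> ` D \<subseteq> E)"
  proof (rule automorphism_saturation[OF small])
    show "definable L C (univ C) k D \<and> definable L C (univ C) k E" if "(D, E) \<in> \<C>" for D E
      using D[OF that] by (elim conjE, intro conjI)
    fix F assume F: "finite F" "F \<subseteq> \<C>"
    from fin[OF F] obtain s where s: "s \<in> Gal" "\<forall>(D, E)\<in>F. \<not> ext s ` D \<subseteq> E" by (elim bexE imageE) simp
    have "\<not> map s ` D \<subseteq> E" if "(D, E) \<in> F" for D E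
      using bspec[OF s(2) that] im[OF subsetD[OF F(2) that], of s] by simp
    then have "\<forall>(D, E)\<in>F. \<not> map s ` D \<subseteq> E" by (intro ballI) (simp only: split_paired_all prod.case not_False_eq_True)
    then show "\<exists>\<sigma>. automorphism L C \<sigma> \<and> (\<forall>a\<in>A. \<sigma> a = a) \<and> (\<forall>(D, E)\<in>F. \<not> map \<sigma> ` D \<subseteq> E)"
      using s(1) by (intro exI[of _ s]) (simp add: Gal_def)
  qed
  then obtain s where s: "automorphism L C s" "\<forall>a\<in>A. s a = a" "\<forall>(D, E)\<in>\<C>. \<not> map s ` D \<subseteq> E" by (elim exE conjE)
  have "\<not> ext s ` D \<subseteq> E" if "(D, E) \<in> \<C>" for D E using bspec[OF s(3) that] im[OF that, of s] by simp
  then have a: "\<forall>(D, E)\<in>\<C>. \<not> ext s ` D \<subseteq> E" by (intro ballI) (simp only: split_paired_all prod.case not_False_eq_True)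
  have "ext s \<in> ext ` Gal" using s(1,2) by (intro imageI) (simp add: Gal_def)
  with a show "\<exists>\<sigma>\<in>ext ` Gal. \<forall>(D, E)\<in>\<C>. \<not> \<sigma> ` D \<subseteq> E" by (rule bexI)
qed

lemma type_definable_iff:
  assumes H: "H \<subseteq> carrier R"
  shows "type_definable L C A k H \<longleftrightarrow>
    (\<exists>\<S>. (\<forall>S\<in>\<S>. S \<subseteq> carrier R \<and> definable L C A k S) \<and> H = carrier R \<inter> \<Inter>\<S>)" (is "?l \<longleftrightarrow> ?r")
proof
  have real: "x \<in> realizations C k p \<longleftrightarrow> (\<forall>\<theta>\<in>p. x \<in> realizations C k {\<theta>})" if "x \<in> carrier R" for x p
    using subsetD[OF carrier_tuples that] by (simp add: realizations_def)
  {
    assume ?l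
    then obtain p where p: "p \<subseteq> formulas_over L A k" "H = realizations C k p" by (auto simp: type_definable_def)
    define \<S> where "\<S> = (\<lambda>\<theta>. carrier R \<inter> realizations C k {\<theta>}) ` p"
    have "definable L C A k (carrier R \<inter> realizations C k {\<theta>})" if "\<theta> \<in> p" for \<theta>
    proof -
      have D: "definable L C A k (realizations C k {\<theta>})" unfolding definable_def
        by (intro bexI[of _ \<theta>] refl subsetD[OF p(1) that])
      have "bexpr L {C} A k (\<lambda>N e. e 0 \<in> carrier R \<inter> realizations C k {\<theta>})"
        by (rule bexpr_cong[OF bexpr_conj[OF bexpr_carrier[of A 0] bexpr_definable[OF D, of 0]]]) (rule Int_iff[symmetric])
      then show ?thesis
        by (rule definable_bexpr[OF _ subset_trans[OF Int_lower1 carrier_tuples] A_univ univ_ne])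
    qed
    then have d: "\<forall>S\<in>\<S>. S \<subseteq> carrier R \<and> definable L C A k S" unfolding \<S>_def by simp
    have mem: "x \<in> H \<longleftrightarrow> x \<in> carrier R \<inter> \<Inter>\<S>" for x
    proof (cases "x \<in> carrier R")
      case True
      have "x \<in> H \<longleftrightarrow> (\<forall>\<theta>\<in>p. x \<in> realizations C k {\<theta>})" unfolding p(2) by (rule real[OF True])
      moreover have "x \<in> carrier R \<inter> \<Inter>\<S> \<longleftrightarrow> (\<forall>\<theta>\<in>p. x \<in> realizations C k {\<theta>})"
        using True unfolding \<S>_def by simp
      ultimately show ?thesis by (simp only:)
    next
      case False
      have "x \<notin> H"
      proof
        assume "x \<in> H"
        with H have "x \<in> carrier R" by (rule subsetD)
        with False show False by (rule notE)
      qed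
      with False show ?thesis by simp
    qed
    have e: "H = carrier R \<inter> \<Inter>\<S>"
      by (rule equalityI, rule subsetI, erule iffD1[OF mem], rule subsetI, erule iffD2[OF mem])
    show ?r by (rule exI[of _ \<S>], rule conjI[OF d e])
  }
  {
    assume ?r
    then obtain \<S> where S: "\<forall>S\<in>\<S>. S \<subseteq> carrier R \<and> definable L C A k S" "H = carrier R \<inter> \<Inter>\<S>" by (elim exE conjE)
    define p where "p = {\<theta>\<in>formulas_over L A k. realizations C k {\<theta>} \<in> insert (carrier R) \<S>}"
    have ex: "\<exists>\<theta>\<in>p. realizations C k {\<theta>} = T" if "T \<in> insert (carrier R) \<S>" for T
    proof -
      have "definable L C A k T"
      proof (rule insertE[OF that])
        assume "T = carrier R"
        then show ?thesis using carrier_A by (simp only:)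
      next
        assume "T \<in> \<S>"
        with S(1) have "T \<subseteq> carrier R \<and> definable L C A k T" by (rule bspec)
        then show ?thesis by (rule conjunct2)
      qed
      then obtain \<theta> where t: "\<theta> \<in> formulas_over L A k" "T = realizations C k {\<theta>}" unfolding definable_def by (elim bexE)
      have "\<theta> \<in> p" using t that unfolding p_def by simp
      then show ?thesis using t(2) by (intro bexI[of _ \<theta>]) simp_all
    qed
    have sub: "realizations C k p \<subseteq> realizations C k {\<theta>}" if "\<theta> \<in> p" for \<theta> using that by (auto simp: realizations_def)
    have a: "realizations C k p \<subseteq> T" if T: "T \<in> insert (carrier R) \<S>" for T
    proof -
      obtain \<theta> where t: "\<theta> \<in> p" "realizations C k {\<theta>} = T" using ex[OF T] by (elim bexE)
      show ?thesis using sub[OF t(1)] unfolding t(2) .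
    qed
    have le: "realizations C k p \<subseteq> H" unfolding S(2)
    proof (intro Int_greatest Inter_greatest)
      show "realizations C k p \<subseteq> carrier R" by (rule a[OF insertI1])
      show "realizations C k p \<subseteq> T" if "T \<in> \<S>" for T by (rule a[OF insertI2[OF that]])
    qed
    have ge: "H \<subseteq> realizations C k p"
    proof
      fix x assume x: "x \<in> H"
      have xR: "x \<in> carrier R" by (rule subsetD[OF H x])
      have "x \<in> realizations C k {\<theta>}" if "\<theta> \<in> p" for \<theta>
      proof -
        have "realizations C k {\<theta>} \<in> insert (carrier R) \<S>" using that unfolding p_def mem_Collect_eq by (rule conjunct2)
        then show ?thesis
        proof (rule insertE)
          assume "realizations C k {\<theta>} = carrier R"
          then show ?thesis using xR by (simp only:)
        next
          assume "realizations C k {\<theta>} \<in> \<S>"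
          then show ?thesis by (rule InterD[OF IntD2[OF x[unfolded S(2)]]])
        qed
      qed
      then have "\<forall>\<theta>\<in>p. x \<in> realizations C k {\<theta>}" by (rule ballI)
      then show "x \<in> realizations C k p" by (rule iffD2[OF real[OF xR]])
    qed
    have "H = realizations C k p" by (rule equalityI[OF ge le])
    moreover have "p \<subseteq> formulas_over L A k" unfolding p_def by (rule Collect_restrict)
    ultimately show ?l unfolding type_definable_def by (intro exI[of _ p] conjI)
  }
qed

lemma invariant_iff:
  assumes H: "H \<subseteq> carrier R" shows "invariant L C A k H \<longleftrightarrow> (\<forall>\<sigma>\<in>ext ` Gal. \<sigma> ` H = H)"
proof -
  have "H \<subseteq> tuples k (univ C)" using H carrier_tuples by (rule subset_trans)
  then show ?thesis by (simp add: invariant_def ext_image[OF H] Gal_def)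
qed

lemma components:
  "\<exists>G I J. is_add_00 L \<kappa> C k R A G \<and> is_ring_000 L \<kappa> C k R A I \<and> is_ring_00 L \<kappa> C k R A J \<and>
    G <+>\<^bsub>R\<^esub> (carrier R <#>\<^bsub>R\<^esub> G) = I \<and> I = J"
proof -
  interpret D: definable_ring R "foR (univ C)" "foR A" \<kappa> "ext ` Gal" by (rule definable_ring_R)
  have add: "additive_subgroup H R \<longleftrightarrow> D.subgrp H" for H by (rule D.subgrp_eq_additive_subgroup[symmetric])
  have td: "type_definable L C A k H \<longleftrightarrow> D.tdefA H" if "D.subgrp H" for H
    unfolding D.tdefA_def dset_foR[OF A_univ] by (rule type_definable_iff[OF D.subgrp_sub[OF that]])
  have inv: "invariant L C A k H \<longleftrightarrow> (\<forall>\<sigma>\<in>ext ` Gal. \<sigma> ` H = H)" if "D.subgrp H" for H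
    by (rule invariant_iff[OF D.subgrp_sub[OF that]])
  have bd: "bounded_index \<kappa> R H \<longleftrightarrow> D.bounded H" if "D.subgrp H" for H
    unfolding bounded_index_def D.bounded_def D.a_rcosets_eq[OF that] by (rule refl)
  have J: "two_sided_ideal D.J00 R"
    unfolding two_sided_ideal_iff add using D.J00_ideal(1,5,6) by simp
  have Jinv: "\<sigma> ` D.J00 = D.J00" if "\<sigma> \<in> ext ` Gal" for \<sigma>
    by (rule D.tdefA_invariant) (fact that D.J00_ideal(2))+
  have least: "D.J00 \<subseteq> I" if I: "two_sided_ideal I R" "invariant L C A k I" "bounded_index \<kappa> R I" for I
  proof (rule D.J00_least)
    show s: "D.subgrp I" using I(1) unfolding two_sided_ideal_iff add by (rule conjunct1)
    show "D.bounded I" using I(3) unfolding bd[OF s] .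
    have iv: "\<forall>\<sigma>\<in>ext ` Gal. \<sigma> ` I = I" using I(2) unfolding inv[OF s] .
    show "\<sigma> ` I \<subseteq> I" if "\<sigma> \<in> ext ` Gal" for \<sigma> using bspec[OF iv that] by simp
    show "r \<otimes>\<^bsub>R\<^esub> x \<in> I" if "r \<in> carrier R" "x \<in> I" for r x using I(1) that unfolding two_sided_ideal_iff by simp
  qed
  have least': "D.J00 \<subseteq> I" if I: "two_sided_ideal I R" "type_definable L C A k I" "bounded_index \<kappa> R I" for I
  proof (rule least[OF I(1) _ I(3)])
    have s: "D.subgrp I" using I(1) unfolding two_sided_ideal_iff add by (rule conjunct1)
    have "D.tdefA I" using I(2) unfolding td[OF s] .
    then have "\<sigma> ` I = I" if "\<sigma> \<in> ext ` Gal" for \<sigma> by (intro D.tdefA_invariant that)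
    then show "invariant L C A k I" unfolding inv[OF s] by (rule ballI)
  qed
  have "is_add_00 L \<kappa> C k R A D.G00"
    unfolding is_add_00_def smallest_def
  proof (intro conjI allI impI)
    show "additive_subgroup D.G00 R" unfolding add by (rule D.G00_subgrp)
    show "type_definable L C A k D.G00" unfolding td[OF D.G00_subgrp] by (rule D.G00_tdefA)
    show "bounded_index \<kappa> R D.G00" unfolding bd[OF D.G00_subgrp] by (rule D.G00_bounded)
    fix K assume K: "additive_subgroup K R \<and> type_definable L C A k K \<and> bounded_index \<kappa> R K"
    then have s: "D.subgrp K" unfolding add by (rule conjunct1)
    show "D.G00 \<subseteq> K" by (rule D.G00_subset) (use K td[OF s] bd[OF s] s in simp_all)
  qed
  moreover have "is_ring_000 L \<kappa> C k R A D.J00"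
    unfolding is_ring_000_def smallest_def
  proof (intro conjI allI impI J)
    show "invariant L C A k D.J00" unfolding inv[OF D.J00_ideal(1)] by (rule ballI) (rule Jinv)
    show "bounded_index \<kappa> R D.J00" unfolding bd[OF D.J00_ideal(1)] by (rule D.J00_ideal(3))
    fix K assume "two_sided_ideal K R \<and> invariant L C A k K \<and> bounded_index \<kappa> R K"
    then show "D.J00 \<subseteq> K" by (elim conjE) (rule least)
  qed
  moreover have "is_ring_00 L \<kappa> C k R A D.J00"
    unfolding is_ring_00_def smallest_def
  proof (intro conjI allI impI J)
    show "type_definable L C A k D.J00" unfolding td[OF D.J00_ideal(1)] by (rule D.J00_ideal(2))
    show "bounded_index \<kappa> R D.J00" unfolding bd[OF D.J00_ideal(1)] by (rule D.J00_ideal(3))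
    fix K assume "two_sided_ideal K R \<and> type_definable L C A k K \<and> bounded_index \<kappa> R K"
    then show "D.J00 \<subseteq> K" by (elim conjE) (rule least')
  qed
  moreover have "D.G00 <+>\<^bsub>R\<^esub> (carrier R <#>\<^bsub>R\<^esub> D.G00) = D.J00"
    unfolding D.J00_def by (rule set_add_set_mult)
  ultimately have c: "is_add_00 L \<kappa> C k R A D.G00 \<and> is_ring_000 L \<kappa> C k R A D.J00 \<and> is_ring_00 L \<kappa> C k R A D.J00 \<and>
    D.G00 <+>\<^bsub>R\<^esub> (carrier R <#>\<^bsub>R\<^esub> D.G00) = D.J00 \<and> D.J00 = D.J00" by (intro conjI refl)
  show ?thesis
    by (rule exI[of _ D.G00], rule exI[of _ D.J00], rule exI[of _ D.J00]) (rule c)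
qed

end

theorem corollary4p10:
  fixes L :: "('f, 'r) lang"
    and \<kappa> :: "'k rel"
    and M C :: "('a, 'f, 'r) struct"
    and k :: nat
    and S :: "'a list ring"
    and X :: "'a list set"
    and A :: "'a set"
  defines "R \<equiv> Rbar L M C k S X"
  assumes "monster_model L \<kappa> M C"
    and "rng S"
    and "approximate_subring S X"
    and "zero_definable L M k S X"
    and "definable L C (univ C) k (carrier R)"
    and "A \<subseteq> univ C" and "|A| <o \<kappa>"
  shows "\<exists>G I J. is_add_00 L \<kappa> C k R A G \<and> is_ring_000 L \<kappa> C k R A I \<and> is_ring_00 L \<kappa> C k R A J \<and>
    G <+>\<^bsub>R\<^esub> (carrier R <#>\<^bsub>R\<^esub> G) = I \<and> I = J"
proof -
  have m: "monster L \<kappa> M C A" by (rule monster.intro) fact+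
  have c: "definable L C (univ C) k (carrier (Rbar L M C k S X))"
    using \<open>definable L C (univ C) k (carrier R)\<close> unfolding R_def .
  have "definable_approximate_subring L \<kappa> M C A k S X"
    by (rule definable_approximate_subring.intro[OF m], rule definable_approximate_subring_axioms.intro) (fact c | fact)+
  then show ?thesis unfolding R_def by (rule definable_approximate_subring.components)
qed

end
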